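(* Let $(\Gamma^{\rm r},\Gamma^{\rm c})$ be an aperiodic pair of Belavin--Drinfeld triples for $SL_n$, let $h(U)=H^{\rm r}(U)UH^{\rm c}(U)$ be the rational map $SL_n\to SL_n$ defined in the context, and let $f_{ij}^h(U)=f_{ij}\circ h(U)$. Let $i\ne j$, and let $(k_1,1),\dots,(k_s,1)$ and $(1,m_1),\dots,(1,m_t)$ be all the exit points subordinate to $(i,j)$. Then $$f_{ij}^h(U)=F_{ij}(U)\prod_{p=1}^sF_{k_p,1}(U)\prod_{q=1}^tF_{1,m_q}(U),$$ where $F_{ij}(U)$ is the trailing minor of $U$ whose upper left corner contains the entry $u_{ij}$.
   Context: Notation. $[a,b]$ is the set of integers from $a$ to $b$; $A_I^J$ is the submatrix of $A$ with row set $I$ and column set $J$. Simple roots of $SL_n$ are identified with $[1,n-1]$. The trailing minor $F_{ij}(A)$ is $\det A_{[i,n]}^{[j,j+n-i]}$ for $i\ge j$ and $\det A_{[i,i+n-j]}^{[j,n]}$ for $i\le j$. BD triples. A Belavin--Drinfeld (BD) triple $\Gamma=(\Gamma_1,\Gamma_2,\gamma)$ consists of $\Gamma_1,\Gamma_2\subset[1,n-1]$ and a bijection $\gamma:\Gamma_1\to\Gamma_2$ that is an isometry ($|i-j|=1$ iff $|\gamma(i)-\gamma(j)|=1$) and nilpotent (for every $i\in\Gamma_1$ there is $m$ with $\gamma^j(i)\in\Gamma_1$ for $j\in[0,m-1]$, $\gamma^m(i)\notin\Gamma_1$). On each connected component (maximal interval) of $\Gamma_1$, $\gamma$ either preserves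 the orientation ($\gamma(i+1)=\gamma(i)+1$; one-element components are of this kind) or reverses it ($\gamma(i+1)=\gamma(i)-1$). Superscripts r and c mark data of $\Gamma^{\rm r}$ and $\Gamma^{\rm c}$. Runs. The X-runs of $\Gamma$ are the intervals partitioning $[1,n]$ such that $i,i+1$ lie in the same X-run iff $i\in\Gamma_1$; the X$^\dag$-run dual to an X-run $[a,b]$ is $[n-b+1,n-a+1]$. Y-runs and Y$^\dag$-runs are defined in the same way with $\Gamma_2$ instead of $\Gamma_1$. Rows are partitioned into runs using $\Gamma^{\rm r}$, columns using $\Gamma^{\rm c}$. BD graph. The directed graph $G_{\Gamma^{\rm r},\Gamma^{\rm c}}$ has as vertices two copies (upper and lower) of $[1,n-1]$; inclined edges: from upper $i$ to lower $\gamma^{\rm r}(i)$ for $i\in\Gamma_1^{\rm r}$, and from lower $\gamma^{\rm c}(i)$ to upper $i$ for $i\in\Gamma_1^{\rm c}$; horizontal edges $i\to n-i$ in each part for all $i$ (both directions; a single loop if $i=n/2$). A directed path is alternating if horizontal and inclined edges alternate; an alternating path with coinciding endpoints and an even number of edges is an alternating cycle. The set of edges decomposes into a disjoint union of maximal alternating paths and alternating cycles; the pair is aperiodic if there are no alternating cycles. Blocks. For an $n\times n$ matrix $A$, $A^\dag$ is the matrix whose $(i,j)$ entry is the determinant of $A$ with row $n+1-i$ and column $n+1-j$ deleted (the cofactor matrix conjugated by $w_0\mathbf J$, $\mathbf J=\mathrm{diag}((-1)^i)$, $w_0$ the longest permutation matrix). Let $X,Y$ be two $n\times n$ matrices of indeterminates.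 For a horizontal edge $i\to n-i$ in the upper part: its X-block is the smallest submatrix $X_{[\alpha,n]}^{[1,\beta]}$ whose row and column sets are unions of X-runs and which contains the entries $(n-i+1,1)$ (exit point) and $(n,i)$ (entrance point); its X$^\dag$-block is the smallest submatrix $(X^\dag)_{[\alpha',n]}^{[1,\beta']}$ whose row and column sets are unions of X$^\dag$-runs and which contains $(i+1,1)$ (exit point) and $(n,n-i)$ (entrance point). For a horizontal edge $i\to n-i$ in the lower part: its Y-block is the smallest submatrix $Y_{[1,\bar\alpha]}^{[\bar\beta,n]}$ built of Y-runs containing $(1,n-i+1)$ (exit) and $(i,n)$ (entrance); its Y$^\dag$-block is the smallest submatrix $(Y^\dag)_{[1,\bar\alpha']}^{[\bar\beta',n]}$ built of Y$^\dag$-runs containing $(1,i+1)$ (exit) and $(n-i,n)$ (entrance). The X- and X$^\dag$-blocks (Y- and Y$^\dag$-blocks) of one edge are called dual to each other; X-, Y-blocks are primal. Gluing. Let $e_1,\dots,e_b$ be the consecutive horizontal edges of a maximal alternating path. It defines two matrices, each containing one of the two dual blocks of every $e_l$: one matrix starts with the primal block of $e_1$, the other with its dual. Given the block $B_l$ of $e_l$ in a matrix, the block $B_{l+1}$ of $e_{l+1}$ is of the same kind (primal/dual) as $B_l$ if $\gamma^{\rm r}$ (when $e_l$ is in the upper part) or $\gamma^{\rm c}$ (when $e_l$ is in the lower part) preserves the orientation of the component of $\Gamma_1$ corresponding to the inclined edge between $e_l$ and $e_{l+1}$, and of the other kind if it reverses it. If $e_l$ is in the upper part, $B_{l+1}$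 is placed immediately to the left of $B_l$, the rows of its lowest run being aligned in order with the rows of the uppermost run of $B_l$. If $e_l$ is in the lower part, $B_{l+1}$ is placed immediately above $B_l$, the columns of its rightmost run being aligned in order with the columns of the leftmost run of $B_l$. All other entries are $0$. The results are square matrices whose main diagonal passes through the entrance and exit points of all blocks; $B_1$ is in the lower right corner. Functions. For $i>j$ let $e(i,j)$ be the edge $(n-i+j)\to(i-j)$ in the upper part and $X(i,j)$ its X-block; for $i<j$ let $e(i,j)$ be the edge $(n+i-j)\to(j-i)$ in the lower part and $Y(i,j)$ its Y-block. $\mathcal L(i,j)$ denotes that one of the two matrices of the maximal alternating path through $e(i,j)$ which contains the primal block of $e(i,j)$. The entry $x_{ij}$ (if $i>j$) or $y_{ij}$ (if $i<j$) of this block lies on the main diagonal of $\mathcal L(i,j)$; let $\mathtt f_{ij}(X,Y)$ be the principal trailing minor of $\mathcal L(i,j)$ (extending to the lower right corner) with this entry in its upper left corner, and $f_{ij}(Z)=\mathtt f_{ij}(Z,Z)$. Subordinate exit points. An exit point $(k,1)$ of an X-block (or $(1,m)$ of a Y-block) is subordinate to $(i,j)$ if either it or the exit point of the dual X$^\dag$-block (Y$^\dag$-block) belongs to the main diagonal of $\mathcal L(i,j)$ and lies below or to the right of the block $X(i,j)$ (or $Y(i,j)$). Equivalently, these are the exit points of the primal blocks of the horizontal edges preceding $e(i,j)$ in its maximal alternating path. The map $h$. $\mathcal N_\pm$, $\mathcal B_\pm$: unipotent and Borel upper/lower triangular subgroups of $SL_n$. For $J\subset[1,n-1]$, $\mathcal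 G^J$ is the subgroup generated by $\exp(te_{\pm i})$, $i\in J$ ($e_i=E_{i,i+1}$, $e_{-i}=E_{i+1,i}$), $\mathcal N_\pm^J=\mathcal N_\pm\cap\mathcal G^J$, $\mathcal B_\pm^J=\mathcal B_\pm\cap\mathcal G^J$. $\boldsymbol\gamma:\mathcal N_+\to\mathcal N_+$ is the group homomorphism whose differential sends $e_i\mapsto e_{\gamma(i)}$ for $i\in\Gamma_1$, $e_i\mapsto0$ otherwise; $\boldsymbol\gamma^*:\mathcal N_-\to\mathcal N_-$ has differential $e_{-\gamma(i)}\mapsto e_{-i}$ for $i\in\Gamma_1$ and $e_{-j}\mapsto0$ for $j\notin\Gamma_2$. For generic $U\in SL_n$ write $U=U_-U_0U_+$ (Gauss decomposition). Write $U_-$ uniquely as $\prod_l\exp(t_le_{-i_l})$ along a reduced word of the longest permutation that starts with a reduced word of the longest element of the parabolic subgroup $W_{\Gamma_1^{\rm r}}$, and let $V^{\rm r}\in\mathcal N_-^{\Gamma_1^{\rm r}}$ be the product over this initial subword; write $U_+$ as $\prod_l\exp(t_le_{i_l})$ along a reduced word ending with a reduced word of the longest element of $W_{\Gamma_2^{\rm c}}$, and let $V^{\rm c}\in\mathcal N_+^{\Gamma_2^{\rm c}}$ be the product over this final subword. Choose $W^{\rm r}\in\mathcal G^{\Gamma_1^{\rm r}}$, $W^{\rm c}\in\mathcal G^{\Gamma_2^{\rm c}}$ with $W^{\rm r}\mathcal B_-^{\Gamma_1^{\rm r}}(W^{\rm r})^{-1}=\mathcal B_+^{\Gamma_1^{\rm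 r}}$, $W^{\rm c}\mathcal B_+^{\Gamma_2^{\rm c}}(W^{\rm c})^{-1}=\mathcal B_-^{\Gamma_2^{\rm c}}$; let $\bar V^{\rm r}$ be the $\mathcal N_+$-factor of $V^{\rm r}W^{\rm r}\in\mathcal N_+\mathcal B_-$ and $\bar V^{\rm c}$ the $\mathcal N_-$-factor of $W^{\rm c}V^{\rm c}\in\mathcal B_+\mathcal N_-$. Put $H^{\rm r}(U)=\cdots(\boldsymbol\gamma^{\rm r})^2(\bar V^{\rm r})\boldsymbol\gamma^{\rm r}(\bar V^{\rm r})$, $H^{\rm c}(U)=(\boldsymbol\gamma^{\rm c})^*(\bar V^{\rm c})((\boldsymbol\gamma^{\rm c})^* )^2(\bar V^{\rm c})\cdots$ (finite products), $h(U)=H^{\rm r}(U)UH^{\rm c}(U)$.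
   Formalization: The choice of W^c must also satisfy that conjugation by W^c sends B_- of G^{Γ_2^c} to B_+ (W^c represents the longest Weyl element); with the stated condition alone the N_- -factor of W^cV^c, hence h, depends on the choice and the identity can fail. *)

theory Defs
  imports
    Complex_Main
    "HOL-Algebra.Generated_Groups"
    "HOL-Combinatorics.Transposition"
    "Jordan_Normal_Form.Determinant"
    "Jordan_Normal_Form.DL_Submatrix"
begin

text \<open>
  Rows, columns and simple roots are numbered from 1, as in the mathematical text; the entry in
  row \<open>r\<close> and column \<open>c\<close> of a matrix \<open>A\<close> is therefore \<open>A $$ (r - 1, c - 1)\<close>. The ground field is
  the field of complex numbers.
\<close>

section \<open>Belavin--Drinfeld triples and runs\<close>

record bd_triple =
  Gam1 :: "nat set"
  Gam2 :: "nat set"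
  gam :: "nat \<Rightarrow> nat"

definition is_bd_triple :: "nat \<Rightarrow> bd_triple \<Rightarrow> bool" where
  "is_bd_triple n \<Gamma> \<longleftrightarrow>
     Gam1 \<Gamma> \<subseteq> {1..<n} \<and> Gam2 \<Gamma> \<subseteq> {1..<n} \<and> bij_betw (gam \<Gamma>) (Gam1 \<Gamma>) (Gam2 \<Gamma>) \<and>
     (\<forall>i\<in>Gam1 \<Gamma>. \<forall>j\<in>Gam1 \<Gamma>.
        \<bar>int i - int j\<bar> = 1 \<longleftrightarrow> \<bar>int (gam \<Gamma> i) - int (gam \<Gamma> j)\<bar> = 1) \<and>
     (\<forall>i\<in>Gam1 \<Gamma>. \<exists>m. (\<forall>j<m. (gam \<Gamma> ^^ j) i \<in> Gam1 \<Gamma>) \<and> (gam \<Gamma> ^^ m) i \<notin> Gam1 \<Gamma>)"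

definition component :: "nat set \<Rightarrow> nat \<Rightarrow> nat set" where
  "component S u = {v. {min u v..max u v} \<subseteq> S}"

text \<open>By the isometry condition, \<open>\<gamma>\<close> reverses the orientation of the component of \<open>u\<close> if and only
  if it does not preserve it.\<close>

definition preserves_orientation :: "bd_triple \<Rightarrow> nat \<Rightarrow> bool" where
  "preserves_orientation \<Gamma> u \<longleftrightarrow>
     (\<forall>v. v \<in> component (Gam1 \<Gamma>) u \<and> Suc v \<in> component (Gam1 \<Gamma>) u
        \<longrightarrow> gam \<Gamma> (Suc v) = gam \<Gamma> v + 1)"

text \<open>The run containing \<open>k\<close>, for the partition of \<open>[1,n]\<close> in which \<open>i\<close> and \<open>i+1\<close> belong to the same
  run iff \<open>i \<in> S\<close>; and the \<open>\<dagger>\<close>-run containing \<open>k\<close>, i.e. the dual of the run containing \<open>n+1-k\<close>.\<close>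

definition run :: "nat \<Rightarrow> nat set \<Rightarrow> nat \<Rightarrow> nat set" where
  "run n S k = {l \<in> {1..n}. {min k l..<max k l} \<subseteq> S}"

definition dual_run :: "nat \<Rightarrow> nat set \<Rightarrow> nat \<Rightarrow> nat set" where
  "dual_run n S k = (\<lambda>l. n + 1 - l) ` run n S (n + 1 - k)"

section \<open>The BD graph\<close>

datatype part = Upper | Lower

type_synonym vertex = "part \<times> nat"
type_synonym edge = "vertex \<times> vertex"

definition horizontal_edges :: "nat \<Rightarrow> edge set" where
  "horizontal_edges n = {((p, i), (p, n - i)) | p i. i \<in> {1..<n}}"

definition inclined_edges :: "bd_triple \<Rightarrow> bd_triple \<Rightarrow> edge set" where
  "inclined_edges \<Gamma>r \<Gamma>c =
     {((Upper, i), (Lower, gam \<Gamma>r i)) | i. i \<in> Gam1 \<Gamma>r} \<union>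
     {((Lower, gam \<Gamma>c i), (Upper, i)) | i. i \<in> Gam1 \<Gamma>c}"

definition alternating_path :: "nat \<Rightarrow> bd_triple \<Rightarrow> bd_triple \<Rightarrow> edge list \<Rightarrow> bool" where
  "alternating_path n \<Gamma>r \<Gamma>c es \<longleftrightarrow>
     es \<noteq> [] \<and> set es \<subseteq> horizontal_edges n \<union> inclined_edges \<Gamma>r \<Gamma>c \<and>
     successively
       (\<lambda>e e'. snd e = fst e' \<and> (e \<in> horizontal_edges n \<longleftrightarrow> e' \<notin> horizontal_edges n)) es"

definition alternating_cycle :: "nat \<Rightarrow> bd_triple \<Rightarrow> bd_triple \<Rightarrow> edge list \<Rightarrow> bool" where
  "alternating_cycle n \<Gamma>r \<Gamma>c es \<longleftrightarrow>
     alternating_path n \<Gamma>r \<Gamma>c es \<and> even (length es) \<and> fst (hd es) = snd (last es)"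

definition aperiodic :: "nat \<Rightarrow> bd_triple \<Rightarrow> bd_triple \<Rightarrow> bool" where
  "aperiodic n \<Gamma>r \<Gamma>c \<longleftrightarrow> \<not> (\<exists>es. alternating_cycle n \<Gamma>r \<Gamma>c es)"

definition maximal_alternating_path :: "nat \<Rightarrow> bd_triple \<Rightarrow> bd_triple \<Rightarrow> edge list \<Rightarrow> bool" where
  "maximal_alternating_path n \<Gamma>r \<Gamma>c es \<longleftrightarrow>
     alternating_path n \<Gamma>r \<Gamma>c es \<and>
     (\<forall>e. \<not> alternating_path n \<Gamma>r \<Gamma>c (e # es)) \<and>
     (\<forall>e. \<not> alternating_path n \<Gamma>r \<Gamma>c (es @ [e]))"

text \<open>A horizontal edge is determined by its tail, so \<open>(p, i)\<close> also stands for the edge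
  \<open>i \<rightarrow> n - i\<close> in part \<open>p\<close>. The following is the list \<open>e\<^sub>1, \<dots>, e\<^sub>b\<close> of the consecutive horizontal edges
  of the maximal alternating path through such an edge; it is meaningful for aperiodic pairs.\<close>

definition path_edges :: "nat \<Rightarrow> bd_triple \<Rightarrow> bd_triple \<Rightarrow> vertex \<Rightarrow> vertex list" where
  "path_edges n \<Gamma>r \<Gamma>c v =
     map fst (filter (\<lambda>e. e \<in> horizontal_edges n)
       (THE es. maximal_alternating_path n \<Gamma>r \<Gamma>c es \<and> (v, (fst v, n - snd v)) \<in> set es))"

section \<open>Blocks\<close>

definition dagger :: "complex mat \<Rightarrow> complex mat" where
  "dagger A = mat (dim_row A) (dim_col A)
     (\<lambda>(a, b). det (mat_delete A (dim_row A - 1 - a) (dim_col A - 1 - b)))"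

text \<open>A block is given by a part \<open>p\<close> (\<open>Upper\<close>: X, \<open>Lower\<close>: Y), a flag \<open>d\<close> (\<open>True\<close> for the dual
  block, built from \<open>X\<^sup>\<dagger>\<close> or \<open>Y\<^sup>\<dagger>\<close>) and the tail \<open>i\<close> of its horizontal edge. Runs of rows are those of
  \<open>\<Gamma>\<^sup>r\<close>, runs of columns are those of \<open>\<Gamma>\<^sup>c\<close>; \<open>run_of\<close> is used for both.\<close>

definition run_of :: "nat \<Rightarrow> bd_triple \<Rightarrow> part \<Rightarrow> bool \<Rightarrow> nat \<Rightarrow> nat set" where
  "run_of n \<Gamma> p d k =
     (let S = (case p of Upper \<Rightarrow> Gam1 \<Gamma> | Lower \<Rightarrow> Gam2 \<Gamma>)
      in if d then dual_run n S k else run n S k)"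

fun exit_point :: "nat \<Rightarrow> part \<Rightarrow> bool \<Rightarrow> nat \<Rightarrow> nat \<times> nat" where
  "exit_point n Upper False i = (n - i + 1, 1)"
| "exit_point n Upper True i = (i + 1, 1)"
| "exit_point n Lower False i = (1, n - i + 1)"
| "exit_point n Lower True i = (1, i + 1)"

fun entrance_point :: "nat \<Rightarrow> part \<Rightarrow> bool \<Rightarrow> nat \<Rightarrow> nat \<times> nat" where
  "entrance_point n Upper False i = (n, i)"
| "entrance_point n Upper True i = (n, n - i)"
| "entrance_point n Lower False i = (i, n)"
| "entrance_point n Lower True i = (n - i, n)"

text \<open>The smallest union of runs of the form \<open>[\<alpha>,n]\<close> (resp. \<open>[1,\<beta>]\<close>) containing \<open>k\<close> starts (resp.
  ends) where the run of \<open>k\<close> does.\<close>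

fun block_rows :: "nat \<Rightarrow> bd_triple \<Rightarrow> part \<Rightarrow> bool \<Rightarrow> nat \<Rightarrow> nat set" where
  "block_rows n \<Gamma>r Upper d i = {Min (run_of n \<Gamma>r Upper d (fst (exit_point n Upper d i)))..n}"
| "block_rows n \<Gamma>r Lower d i = {1..Max (run_of n \<Gamma>r Lower d (fst (entrance_point n Lower d i)))}"

fun block_cols :: "nat \<Rightarrow> bd_triple \<Rightarrow> part \<Rightarrow> bool \<Rightarrow> nat \<Rightarrow> nat set" where
  "block_cols n \<Gamma>c Upper d i = {1..Max (run_of n \<Gamma>c Upper d (snd (entrance_point n Upper d i)))}"
| "block_cols n \<Gamma>c Lower d i = {Min (run_of n \<Gamma>c Lower d (snd (exit_point n Lower d i)))..n}"

definition source_mat :: "part \<Rightarrow> bool \<Rightarrow> complex mat \<Rightarrow> complex mat \<Rightarrow> complex mat" where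
  "source_mat p d X Y =
     (let Z = (case p of Upper \<Rightarrow> X | Lower \<Rightarrow> Y) in if d then dagger Z else Z)"

section \<open>Gluing\<close>

text \<open>In this section \<open>hs\<close> is the list of horizontal edges of a maximal alternating path, indexed
  from 0, and \<open>d\<close> tells whether the first block is the dual one. \<open>reverses_after\<close> refers to the
  inclined edge between \<open>hs ! l\<close> and \<open>hs ! Suc l\<close>, which is \<open>n - i \<rightarrow> \<gamma>\<^sup>r(n - i)\<close> if \<open>hs ! l = (Upper, i)\<close>
  and \<open>\<gamma>\<^sup>c(u) \<rightarrow> u\<close> if \<open>hs ! l\<close> is in the lower part and \<open>hs ! Suc l = (Upper, u)\<close>.\<close>

definition reverses_after :: "nat \<Rightarrow> bd_triple \<Rightarrow> bd_triple \<Rightarrow> vertex list \<Rightarrow> nat \<Rightarrow> bool" where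
  "reverses_after n \<Gamma>r \<Gamma>c hs l =
     (case fst (hs ! l) of
        Upper \<Rightarrow> \<not> preserves_orientation \<Gamma>r (n - snd (hs ! l))
      | Lower \<Rightarrow> \<not> preserves_orientation \<Gamma>c (snd (hs ! Suc l)))"

primrec dual_at :: "nat \<Rightarrow> bd_triple \<Rightarrow> bd_triple \<Rightarrow> vertex list \<Rightarrow> bool \<Rightarrow> nat \<Rightarrow> bool" where
  "dual_at n \<Gamma>r \<Gamma>c hs d 0 = d"
| "dual_at n \<Gamma>r \<Gamma>c hs d (Suc l) =
     (if reverses_after n \<Gamma>r \<Gamma>c hs l then \<not> dual_at n \<Gamma>r \<Gamma>c hs d l else dual_at n \<Gamma>r \<Gamma>c hs d l)"

definition rows_at :: "nat \<Rightarrow> bd_triple \<Rightarrow> bd_triple \<Rightarrow> vertex list \<Rightarrow> bool \<Rightarrow> nat \<Rightarrow> nat set" where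
  "rows_at n \<Gamma>r \<Gamma>c hs d l =
     block_rows n \<Gamma>r (fst (hs ! l)) (dual_at n \<Gamma>r \<Gamma>c hs d l) (snd (hs ! l))"

definition cols_at :: "nat \<Rightarrow> bd_triple \<Rightarrow> bd_triple \<Rightarrow> vertex list \<Rightarrow> bool \<Rightarrow> nat \<Rightarrow> nat set" where
  "cols_at n \<Gamma>r \<Gamma>c hs d l =
     block_cols n \<Gamma>c (fst (hs ! l)) (dual_at n \<Gamma>r \<Gamma>c hs d l) (snd (hs ! l))"

text \<open>Blocks are first placed on an integer grid on which rows grow downwards, columns grow to the
  right, and the lower right corner of \<open>B\<^sub>1\<close> is the cell \<open>(0, 0)\<close>. If \<open>offset \<dots> l = (\<rho>, \<sigma>)\<close>, the
  entry in row \<open>r\<close> and column \<open>c\<close> of the matrix \<open>X\<close>, \<open>X\<^sup>\<dagger>\<close>, \<open>Y\<close> or \<open>Y\<^sup>\<dagger>\<close> from which block \<open>l\<close> is cut out goes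
  to the cell \<open>(\<rho> + r, \<sigma> + c)\<close>. Runs to be aligned have equal length, so aligning them in order
  amounts to aligning their first elements.\<close>

primrec offset :: "nat \<Rightarrow> bd_triple \<Rightarrow> bd_triple \<Rightarrow> vertex list \<Rightarrow> bool \<Rightarrow> nat \<Rightarrow> int \<times> int" where
  "offset n \<Gamma>r \<Gamma>c hs d 0 =
     (- int (Max (rows_at n \<Gamma>r \<Gamma>c hs d 0)), - int (Max (cols_at n \<Gamma>r \<Gamma>c hs d 0)))"
| "offset n \<Gamma>r \<Gamma>c hs d (Suc l) =
     (let \<rho> = fst (offset n \<Gamma>r \<Gamma>c hs d l);
          \<sigma> = snd (offset n \<Gamma>r \<Gamma>c hs d l);
          R = rows_at n \<Gamma>r \<Gamma>c hs d l;
          C = cols_at n \<Gamma>r \<Gamma>c hs d l;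
          R' = rows_at n \<Gamma>r \<Gamma>c hs d (Suc l);
          C' = cols_at n \<Gamma>r \<Gamma>c hs d (Suc l);
          p' = fst (hs ! Suc l);
          d' = dual_at n \<Gamma>r \<Gamma>c hs d (Suc l)
      in case fst (hs ! l) of
           Upper \<Rightarrow> (\<rho> + int (Min R) - int (Min (run_of n \<Gamma>r p' d' (Max R'))),
                     \<sigma> + int (Min C) - 1 - int (Max C'))
         | Lower \<Rightarrow> (\<rho> + int (Min R) - 1 - int (Max R'),
                     \<sigma> + int (Min C) - int (Min (run_of n \<Gamma>c p' d' (Max C')))))"

text \<open>The footprints of different blocks are disjoint, so the sum below has at most one nonzero
  term.\<close>

definition cell ::
  "nat \<Rightarrow> bd_triple \<Rightarrow> bd_triple \<Rightarrow> vertex list \<Rightarrow> bool \<Rightarrow> complex mat \<Rightarrow> complex mat \<Rightarrow>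
   int \<Rightarrow> int \<Rightarrow> complex" where
  "cell n \<Gamma>r \<Gamma>c hs d X Y a b =
     (\<Sum>l<length hs.
        let r = a - fst (offset n \<Gamma>r \<Gamma>c hs d l);
            c = b - snd (offset n \<Gamma>r \<Gamma>c hs d l)
        in if r \<in> int ` rows_at n \<Gamma>r \<Gamma>c hs d l \<and> c \<in> int ` cols_at n \<Gamma>r \<Gamma>c hs d l
           then source_mat (fst (hs ! l)) (dual_at n \<Gamma>r \<Gamma>c hs d l) X Y $$ (nat r - 1, nat c - 1)
           else 0)"

definition glued_dim :: "nat \<Rightarrow> bd_triple \<Rightarrow> bd_triple \<Rightarrow> vertex list \<Rightarrow> bool \<Rightarrow> nat" where
  "glued_dim n \<Gamma>r \<Gamma>c hs d =
     (let b = length hs - 1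
      in nat (1 - (fst (offset n \<Gamma>r \<Gamma>c hs d b) + int (Min (rows_at n \<Gamma>r \<Gamma>c hs d b)))))"

definition glued_mat ::
  "nat \<Rightarrow> bd_triple \<Rightarrow> bd_triple \<Rightarrow> vertex list \<Rightarrow> bool \<Rightarrow> complex mat \<Rightarrow> complex mat \<Rightarrow> complex mat"
  where
  "glued_mat n \<Gamma>r \<Gamma>c hs d X Y =
     (let N = glued_dim n \<Gamma>r \<Gamma>c hs d
      in mat N N (\<lambda>(a, b). cell n \<Gamma>r \<Gamma>c hs d X Y (int a + 1 - int N) (int b + 1 - int N)))"

section \<open>The functions \<open>f\<^sub>i\<^sub>j\<close> and subordinate exit points\<close>

definition e_ij :: "nat \<Rightarrow> nat \<Rightarrow> nat \<Rightarrow> vertex" where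
  "e_ij n i j = (if i > j then (Upper, n + j - i) else (Lower, n + i - j))"

definition hs_ij :: "nat \<Rightarrow> bd_triple \<Rightarrow> bd_triple \<Rightarrow> nat \<Rightarrow> nat \<Rightarrow> vertex list" where
  "hs_ij n \<Gamma>r \<Gamma>c i j = path_edges n \<Gamma>r \<Gamma>c (e_ij n i j)"

definition pos_ij :: "nat \<Rightarrow> bd_triple \<Rightarrow> bd_triple \<Rightarrow> nat \<Rightarrow> nat \<Rightarrow> nat" where
  "pos_ij n \<Gamma>r \<Gamma>c i j =
     (THE l. l < length (hs_ij n \<Gamma>r \<Gamma>c i j) \<and> hs_ij n \<Gamma>r \<Gamma>c i j ! l = e_ij n i j)"

text \<open>The type of the first block for which the block of \<open>e(i,j)\<close> is the primal one.\<close>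

definition start_ij :: "nat \<Rightarrow> bd_triple \<Rightarrow> bd_triple \<Rightarrow> nat \<Rightarrow> nat \<Rightarrow> bool" where
  "start_ij n \<Gamma>r \<Gamma>c i j =
     (THE d. \<not> dual_at n \<Gamma>r \<Gamma>c (hs_ij n \<Gamma>r \<Gamma>c i j) d (pos_ij n \<Gamma>r \<Gamma>c i j))"

definition L_mat ::
  "nat \<Rightarrow> bd_triple \<Rightarrow> bd_triple \<Rightarrow> nat \<Rightarrow> nat \<Rightarrow> complex mat \<Rightarrow> complex mat \<Rightarrow> complex mat" where
  "L_mat n \<Gamma>r \<Gamma>c i j X Y =
     glued_mat n \<Gamma>r \<Gamma>c (hs_ij n \<Gamma>r \<Gamma>c i j) (start_ij n \<Gamma>r \<Gamma>c i j) X Y"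

definition f_XY ::
  "nat \<Rightarrow> bd_triple \<Rightarrow> bd_triple \<Rightarrow> nat \<Rightarrow> nat \<Rightarrow> complex mat \<Rightarrow> complex mat \<Rightarrow> complex" where
  "f_XY n \<Gamma>r \<Gamma>c i j X Y =
     (let L = L_mat n \<Gamma>r \<Gamma>c i j X Y;
          N = dim_row L;
          \<rho> = fst (offset n \<Gamma>r \<Gamma>c (hs_ij n \<Gamma>r \<Gamma>c i j) (start_ij n \<Gamma>r \<Gamma>c i j)
                    (pos_ij n \<Gamma>r \<Gamma>c i j));
          q = nat (\<rho> + int i + int N - 1)
      in det (submatrix L {q..<N} {q..<N}))"

definition f_ij :: "nat \<Rightarrow> bd_triple \<Rightarrow> bd_triple \<Rightarrow> nat \<Rightarrow> nat \<Rightarrow> complex mat \<Rightarrow> complex" where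
  "f_ij n \<Gamma>r \<Gamma>c i j Z = f_XY n \<Gamma>r \<Gamma>c i j Z Z"

text \<open>\<open>subordinate_edge \<dots> l\<close>: the exit point of the block of the \<open>l\<close>-th horizontal edge in \<open>\<L>(i,j)\<close> (be
  it the primal or the dual block) is on the main diagonal and below or to the right of the block
  \<open>X(i,j)\<close> or \<open>Y(i,j)\<close>. The subordinate exit point itself is in either case that of the primal block.\<close>

definition subordinate_edge :: "nat \<Rightarrow> bd_triple \<Rightarrow> bd_triple \<Rightarrow> nat \<Rightarrow> nat \<Rightarrow> nat \<Rightarrow> bool" where
  "subordinate_edge n \<Gamma>r \<Gamma>c i j l \<longleftrightarrow>
     (let hs = hs_ij n \<Gamma>r \<Gamma>c i j;
          d = start_ij n \<Gamma>r \<Gamma>c i j;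
          k = pos_ij n \<Gamma>r \<Gamma>c i j;
          x = exit_point n (fst (hs ! l)) (dual_at n \<Gamma>r \<Gamma>c hs d l) (snd (hs ! l));
          a = fst (offset n \<Gamma>r \<Gamma>c hs d l) + int (fst x);
          b = snd (offset n \<Gamma>r \<Gamma>c hs d l) + int (snd x)
      in l < length hs \<and> a = b \<and>
         (a > fst (offset n \<Gamma>r \<Gamma>c hs d k) + int (Max (rows_at n \<Gamma>r \<Gamma>c hs d k)) \<or>
          b > snd (offset n \<Gamma>r \<Gamma>c hs d k) + int (Max (cols_at n \<Gamma>r \<Gamma>c hs d k))))"

definition subordinate_X :: "nat \<Rightarrow> bd_triple \<Rightarrow> bd_triple \<Rightarrow> nat \<Rightarrow> nat \<Rightarrow> nat set" where
  "subordinate_X n \<Gamma>r \<Gamma>c i j =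
     {k. \<exists>l u. subordinate_edge n \<Gamma>r \<Gamma>c i j l \<and> hs_ij n \<Gamma>r \<Gamma>c i j ! l = (Upper, u) \<and>
               (k, 1) = exit_point n Upper False u}"

definition subordinate_Y :: "nat \<Rightarrow> bd_triple \<Rightarrow> bd_triple \<Rightarrow> nat \<Rightarrow> nat \<Rightarrow> nat set" where
  "subordinate_Y n \<Gamma>r \<Gamma>c i j =
     {m. \<exists>l u. subordinate_edge n \<Gamma>r \<Gamma>c i j l \<and> hs_ij n \<Gamma>r \<Gamma>c i j ! l = (Lower, u) \<and>
               (1, m) = exit_point n Lower False u}"

text \<open>\<open>submatrix\<close> counts rows and columns from 0.\<close>

definition trailing_minor :: "nat \<Rightarrow> nat \<Rightarrow> nat \<Rightarrow> complex mat \<Rightarrow> complex" where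
  "trailing_minor n i j A =
     (if i \<ge> j then det (submatrix A {i - 1..<n} {j - 1..<j + n - i})
      else det (submatrix A {i - 1..<i + n - j} {j - 1..<n}))"

section \<open>Subgroups of \<open>SL\<^sub>n\<close>\<close>

definition SL :: "nat \<Rightarrow> complex mat monoid" where
  "SL n = \<lparr>carrier = {A \<in> carrier_mat n n. det A = 1}, monoid.mult = (*), monoid.one = 1\<^sub>m n\<rparr>"

definition B_plus :: "nat \<Rightarrow> complex mat set" where
  "B_plus n = {A \<in> carrier (SL n). upper_triangular A}"

definition B_minus :: "nat \<Rightarrow> complex mat set" where
  "B_minus n = {A \<in> carrier (SL n). upper_triangular (transpose_mat A)}"

definition N_plus :: "nat \<Rightarrow> complex mat set" where
  "N_plus n = {A \<in> B_plus n. \<forall>a<n. A $$ (a, a) = 1}"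

definition N_minus :: "nat \<Rightarrow> complex mat set" where
  "N_minus n = {A \<in> B_minus n. \<forall>a<n. A $$ (a, a) = 1}"

definition e_plus :: "nat \<Rightarrow> nat \<Rightarrow> complex mat" where
  "e_plus n i = mat n n (\<lambda>(a, b). if a = i - 1 \<and> b = i then 1 else 0)"

definition e_minus :: "nat \<Rightarrow> nat \<Rightarrow> complex mat" where
  "e_minus n i = transpose_mat (e_plus n i)"

text \<open>The exponential series terminates after the linear term, since \<open>e\<^sub>i\<close> and \<open>e\<^sub>-\<^sub>i\<close> have square 0.\<close>

definition exp_plus :: "nat \<Rightarrow> nat \<Rightarrow> complex \<Rightarrow> complex mat" where
  "exp_plus n i t = 1\<^sub>m n + t \<cdot>\<^sub>m e_plus n i"

definition exp_minus :: "nat \<Rightarrow> nat \<Rightarrow> complex \<Rightarrow> complex mat" where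
  "exp_minus n i t = 1\<^sub>m n + t \<cdot>\<^sub>m e_minus n i"

definition G_sub :: "nat \<Rightarrow> nat set \<Rightarrow> complex mat set" where
  "G_sub n J = generate (SL n)
     ({exp_plus n i t | i t. i \<in> J} \<union> {exp_minus n i t | i t. i \<in> J})"

section \<open>The homomorphisms \<open>\<gamma>\<close> and \<open>\<gamma>\<^sup>*\<close>\<close>

definition has_deriv_at_0 :: "nat \<Rightarrow> (complex \<Rightarrow> complex mat) \<Rightarrow> complex mat \<Rightarrow> bool" where
  "has_deriv_at_0 n g D \<longleftrightarrow>
     (\<forall>a<n. \<forall>b<n. ((\<lambda>t. g t $$ (a, b)) has_field_derivative D $$ (a, b)) (at 0))"

text \<open>The differential of \<open>\<phi>\<close> at the identity sends \<open>e\<close> to the derivative of \<open>t \<mapsto> \<phi>(exp(t e))\<close> at 0.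
  As \<open>N\<^sub>+\<close> is generated by the one-parameter subgroups \<open>exp(t e\<^sub>i)\<close>, the predicates below determine
  \<open>\<phi>\<close> uniquely on \<open>N\<^sub>+\<close> (resp. \<open>N\<^sub>-\<close>).\<close>

definition is_bold_gamma :: "nat \<Rightarrow> bd_triple \<Rightarrow> (complex mat \<Rightarrow> complex mat) \<Rightarrow> bool" where
  "is_bold_gamma n \<Gamma> \<phi> \<longleftrightarrow>
     \<phi> \<in> hom ((SL n)\<lparr>carrier := N_plus n\<rparr>) ((SL n)\<lparr>carrier := N_plus n\<rparr>) \<and>
     (\<forall>i\<in>Gam1 \<Gamma>. has_deriv_at_0 n (\<lambda>t. \<phi> (exp_plus n i t)) (e_plus n (gam \<Gamma> i))) \<and>
     (\<forall>i\<in>{1..<n} - Gam1 \<Gamma>. has_deriv_at_0 n (\<lambda>t. \<phi> (exp_plus n i t)) (0\<^sub>m n n))"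

definition is_bold_gamma_star :: "nat \<Rightarrow> bd_triple \<Rightarrow> (complex mat \<Rightarrow> complex mat) \<Rightarrow> bool" where
  "is_bold_gamma_star n \<Gamma> \<phi> \<longleftrightarrow>
     \<phi> \<in> hom ((SL n)\<lparr>carrier := N_minus n\<rparr>) ((SL n)\<lparr>carrier := N_minus n\<rparr>) \<and>
     (\<forall>i\<in>Gam1 \<Gamma>. has_deriv_at_0 n (\<lambda>t. \<phi> (exp_minus n (gam \<Gamma> i) t)) (e_minus n i)) \<and>
     (\<forall>j\<in>{1..<n} - Gam2 \<Gamma>. has_deriv_at_0 n (\<lambda>t. \<phi> (exp_minus n j t)) (0\<^sub>m n n))"

section \<open>Reduced words and factorization of unipotent matrices\<close>

definition word_perm :: "nat list \<Rightarrow> nat \<Rightarrow> nat" where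
  "word_perm w = foldr (\<lambda>i \<pi>. Transposition.transpose i (Suc i) \<circ> \<pi>) w id"

definition reduced_word :: "nat \<Rightarrow> nat list \<Rightarrow> bool" where
  "reduced_word n w \<longleftrightarrow> set w \<subseteq> {1..<n} \<and>
     (\<forall>w'. set w' \<subseteq> {1..<n} \<and> word_perm w' = word_perm w \<longrightarrow> length w \<le> length w')"

text \<open>\<open>w\<close> is a reduced word of the longest element of the parabolic subgroup \<open>W\<^sub>J\<close>; for \<open>J = [1,n-1]\<close>
  this is the longest permutation.\<close>

definition longest_word :: "nat \<Rightarrow> nat set \<Rightarrow> nat list \<Rightarrow> bool" where
  "longest_word n J w \<longleftrightarrow> reduced_word n w \<and> set w \<subseteq> J \<and>
     (\<forall>w'. reduced_word n w' \<and> set w' \<subseteq> J \<longrightarrow> length w' \<le> length w)"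

definition prod_plus :: "nat \<Rightarrow> nat list \<Rightarrow> complex list \<Rightarrow> complex mat" where
  "prod_plus n w ts = foldr (\<lambda>(i, t) A. exp_plus n i t * A) (zip w ts) (1\<^sub>m n)"

definition prod_minus :: "nat \<Rightarrow> nat list \<Rightarrow> complex list \<Rightarrow> complex mat" where
  "prod_minus n w ts = foldr (\<lambda>(i, t) A. exp_minus n i t * A) (zip w ts) (1\<^sub>m n)"

definition gauss ::
  "nat \<Rightarrow> complex mat \<Rightarrow> complex mat \<Rightarrow> complex mat \<Rightarrow> complex mat \<Rightarrow> bool" where
  "gauss n U Um U0 Up \<longleftrightarrow>
     Um \<in> N_minus n \<and> U0 \<in> carrier (SL n) \<and> diagonal_mat U0 \<and> Up \<in> N_plus n \<and> U = Um * U0 * Up"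

definition V_row :: "nat \<Rightarrow> nat set \<Rightarrow> complex mat \<Rightarrow> complex mat \<Rightarrow> bool" where
  "V_row n J Um V \<longleftrightarrow>
     (\<exists>w1 w2 t1 t2. longest_word n {1..<n} (w1 @ w2) \<and> longest_word n J w1 \<and>
        length t1 = length w1 \<and> length t2 = length w2 \<and>
        Um = prod_minus n (w1 @ w2) (t1 @ t2) \<and> V = prod_minus n w1 t1)"

definition V_col :: "nat \<Rightarrow> nat set \<Rightarrow> complex mat \<Rightarrow> complex mat \<Rightarrow> bool" where
  "V_col n J Up V \<longleftrightarrow>
     (\<exists>w1 w2 t1 t2. longest_word n {1..<n} (w1 @ w2) \<and> longest_word n J w2 \<and>
        length t1 = length w1 \<and> length t2 = length w2 \<and>
        Up = prod_plus n (w1 @ w2) (t1 @ t2) \<and> V = prod_plus n w2 t2)"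

definition conjugates :: "nat \<Rightarrow> complex mat \<Rightarrow> complex mat set \<Rightarrow> complex mat set \<Rightarrow> bool" where
  "conjugates n W S T \<longleftrightarrow> (\<lambda>A. W * A * inv\<^bsub>SL n\<^esub> W) ` S = T"

definition Vbar_row :: "nat \<Rightarrow> nat set \<Rightarrow> complex mat \<Rightarrow> complex mat \<Rightarrow> bool" where
  "Vbar_row n J V Vb \<longleftrightarrow>
     (\<exists>W\<in>G_sub n J. conjugates n W (B_minus n \<inter> G_sub n J) (B_plus n \<inter> G_sub n J) \<and>
        Vb \<in> N_plus n \<and> (\<exists>b\<in>B_minus n. V * W = Vb * b))"

text \<open>The matrices \<open>W\<close> with \<open>W B\<^sub>+\<^sup>J W\<^sup>-\<^sup>1 = B\<^sub>-\<^sup>J\<close> form a left coset of \<open>B\<^sub>+\<^sup>J\<close>, along which the \<open>N\<^sub>-\<close>-factor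
  of \<open>W V\<close> is not constant. It is independent of the choice of \<open>W\<close> once \<open>W B\<^sub>-\<^sup>J W\<^sup>-\<^sup>1 = B\<^sub>+\<^sup>J\<close> is required as
  well, i.e. once \<open>W\<close> represents the longest element of the Weyl group of \<open>G\<^sup>J\<close>.\<close>

definition Vbar_col :: "nat \<Rightarrow> nat set \<Rightarrow> complex mat \<Rightarrow> complex mat \<Rightarrow> bool" where
  "Vbar_col n J V Vb \<longleftrightarrow>
     (\<exists>W\<in>G_sub n J. conjugates n W (B_plus n \<inter> G_sub n J) (B_minus n \<inter> G_sub n J) \<and>
        conjugates n W (B_minus n \<inter> G_sub n J) (B_plus n \<inter> G_sub n J) \<and>
        Vb \<in> N_minus n \<and> (\<exists>b\<in>B_plus n. W * V = b * Vb))"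

section \<open>The map \<open>h\<close>\<close>

primrec row_prod ::
  "nat \<Rightarrow> (complex mat \<Rightarrow> complex mat) \<Rightarrow> complex mat \<Rightarrow> nat \<Rightarrow> complex mat" where
  "row_prod n \<phi> V 0 = 1\<^sub>m n"
| "row_prod n \<phi> V (Suc m) = (\<phi> ^^ Suc m) V * row_prod n \<phi> V m"

primrec col_prod ::
  "nat \<Rightarrow> (complex mat \<Rightarrow> complex mat) \<Rightarrow> complex mat \<Rightarrow> nat \<Rightarrow> complex mat" where
  "col_prod n \<phi> V 0 = 1\<^sub>m n"
| "col_prod n \<phi> V (Suc m) = col_prod n \<phi> V m * (\<phi> ^^ Suc m) V"

text \<open>\<open>H\<^sup>r\<close>, \<open>H\<^sup>c\<close> and \<open>h\<close> are rational maps; they are rendered as relations: \<open>h_value n \<Gamma>\<^sup>r \<Gamma>\<^sup>c U Z\<close>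
  says that the construction of \<open>h\<close> can be carried out at \<open>U\<close> and has the outcome \<open>Z\<close>. Because of
  nilpotency the factors with exponent \<open>\<ge> n - 1\<close> are trivial, so the products are taken up to \<open>n\<close>.\<close>

definition H_row_value :: "nat \<Rightarrow> bd_triple \<Rightarrow> complex mat \<Rightarrow> complex mat \<Rightarrow> bool" where
  "H_row_value n \<Gamma> U H \<longleftrightarrow>
     (\<exists>\<phi> Um U0 Up V Vb. is_bold_gamma n \<Gamma> \<phi> \<and> gauss n U Um U0 Up \<and>
        V_row n (Gam1 \<Gamma>) Um V \<and> Vbar_row n (Gam1 \<Gamma>) V Vb \<and> H = row_prod n \<phi> Vb n)"

definition H_col_value :: "nat \<Rightarrow> bd_triple \<Rightarrow> complex mat \<Rightarrow> complex mat \<Rightarrow> bool" where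
  "H_col_value n \<Gamma> U H \<longleftrightarrow>
     (\<exists>\<phi> Um U0 Up V Vb. is_bold_gamma_star n \<Gamma> \<phi> \<and> gauss n U Um U0 Up \<and>
        V_col n (Gam2 \<Gamma>) Up V \<and> Vbar_col n (Gam2 \<Gamma>) V Vb \<and> H = col_prod n \<phi> Vb n)"

definition h_value ::
  "nat \<Rightarrow> bd_triple \<Rightarrow> bd_triple \<Rightarrow> complex mat \<Rightarrow> complex mat \<Rightarrow> bool" where
  "h_value n \<Gamma>r \<Gamma>c U Z \<longleftrightarrow>
     (\<exists>Hr Hc. H_row_value n \<Gamma>r U Hr \<and> H_col_value n \<Gamma>c U Hc \<and> Z = Hr * U * Hc)"

end

(* Write U = N M with N unipotent upper triangular and M vanishing above the antidiagonal. For U with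
   generic parameters N can be taken to be V^r-bar times a factor invisible to gamma^r, so that
   Z = h(U) factors as G M K with G = H^r N and H^r the image of G under gamma^r; symmetrically
   Z = H^r M' G' with K the image of G' under gamma^c transposed. Because gamma identifies the runs
   along which consecutive blocks are glued, the unipotent factors combine into unitriangular row and
   column operations on the whole glued matrix. They replace its blocks by those of M and M' without
   changing trailing minors, and the antitriangular shape makes the resulting staircase split into a
   product of minors ending at the exit points; the dual blocks are treated by Jacobi's complementary
   minor identity. The remaining U are limits of generic ones along a one-parameter family on which
   H^r and H^c are constant. *)
theory Submission
  imports Defs
begin


section \<open>Triangular and antitriangular matrices and the twisted inverse
  \<open>dagger\<close>\<close>

section \<open>Matrices\<close>

text \<open>\<open>Z\<close> has two factorizations, \<open>G * M * H'\<^sup>T\<close> and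
  \<open>H * M' * G'\<^sup>T\<close>, and neither serves all blocks: those of the upper part use the
  first, those of the lower part the second. Two neighbours that share rows then carry the row
  factors \<open>G\<close> and \<open>H\<close>, which agree on these rows because \<open>H\<close>
  is the image of \<open>G\<close>; shared columns carry \<open>G'\<close> and \<open>H'\<close>
  likewise. On a component reversed by gamma the agreement is a reflection. The map
  \<open>dagger\<close>, inverse transposition twisted by w_0 and signs, is multiplicative on SL_n
  and sends exp(t e_i) to exp(t e_(n-i)), so passing to the dual block restores a translation. The
  relation \<open>h_value\<close> admits vanishing parameters, for which \<open>U\<close> may leave
  the cell N_+ w_0 B_+ and \<open>M\<close> need not exist. In approximating \<open>U\<close>, the
  initial parameters for Gamma_1 and the final ones for Gamma_2 must stay, since they determine H^r
  and H^c; only the others are shifted, on both sides of a fixed diagonal factor. Inclined edges of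
  Gamma^c run from gamma(i) to i, so after transposition the columns are treated as rows for the
  inverse triple.\<close>

lemma mult_entry:
  "A \<in> carrier_mat n n \<Longrightarrow> B \<in> carrier_mat n n \<Longrightarrow> a < n \<Longrightarrow> b < n \<Longrightarrow>
   (A * B) $$ (a, b) = (\<Sum>k<n. A $$ (a, k) * B $$ (k, b))"
  by (simp add: scalar_prod_def lessThan_atLeast0)

lemma mult_carrier_square [simp]:
  "A \<in> carrier_mat n n \<Longrightarrow> B \<in> carrier_mat n n \<Longrightarrow> A * B \<in> carrier_mat n n"
  by (rule mult_carrier_mat)

lemma mult_assoc_square:
  "A \<in> carrier_mat n n \<Longrightarrow> B \<in> carrier_mat n n \<Longrightarrow> C \<in> carrier_mat n n \<Longrightarrow> A * B * C = A * (B * C)"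
  by (rule assoc_mult_mat)

lemma det_one_inverse:
  assumes "A \<in> carrier_mat n n" "det A = (1::complex)"
  obtains B where "B \<in> carrier_mat n n" "A * B = 1\<^sub>m n" "B * A = 1\<^sub>m n" "det B = 1"
proof -
  have 1: "adj_mat A \<in> carrier_mat n n" "A * adj_mat A = 1\<^sub>m n"
    using adj_mat[OF assms(1)] assms(2) by auto
  moreover have "det A * det (adj_mat A) = 1"
    using det_mult[OF assms(1) 1(1)] 1(2) by simp
  ultimately show ?thesis using that assms mat_mult_left_right_inverse by auto
qed

lemma inverse_unique:
  assumes "(A::complex mat) \<in> carrier_mat n n" "B \<in> carrier_mat n n" "C \<in> carrier_mat n n"
    "A * B = 1\<^sub>m n" "A * C = 1\<^sub>m n"
  shows "B = C"
proof -
  have "B * A = 1\<^sub>m n" by (rule mat_mult_left_right_inverse[OF assms(1,2,4)])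
  then have "C = B * A * C" using assms(3) by simp
  also have "\<dots> = B" using assms by (simp add: assoc_mult_mat[of _ n n _ n _ n])
  finally show ?thesis by simp
qed

lemma sum_single:
  "a < n \<Longrightarrow> (\<And>k. k < n \<Longrightarrow> k \<noteq> a \<Longrightarrow> f k = 0) \<Longrightarrow> (\<Sum>k<n. f k) = f a"
  for f :: "nat \<Rightarrow> 'a::comm_monoid_add"
  by (subst sum.mono_neutral_right[of _ "{a}"]) auto

lemma sum_rev_lessThan: "(\<Sum>k<n. f k) = (\<Sum>k<n. f (n - Suc k))" for f :: "nat \<Rightarrow> complex"
  by (rule sum.nat_diff_reindex[symmetric])

lemma dagger_carrier [simp]: "A \<in> carrier_mat n n \<Longrightarrow> dagger A \<in> carrier_mat n n"
  by (auto simp: dagger_def)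

text \<open>For determinant 1 the adjugate is the inverse; the two index reversals turn the cofactor
  sign into (-1)^(a+b).\<close>

lemma dagger_entry:
  assumes "A \<in> carrier_mat n n" "det A = 1" "B \<in> carrier_mat n n" "A * B = 1\<^sub>m n" "a < n" "b < n"
  shows "dagger A $$ (a, b) = (-1) ^ (a + b) * B $$ (n - 1 - b, n - 1 - a)"
proof -
  have "B = adj_mat A"
    by (rule inverse_unique[OF assms(1,3) _ assms(4)])
      (use adj_mat[OF assms(1)] assms(2) in \<open>auto intro!: eq_matI\<close>)
  then have "B $$ (n - 1 - b, n - 1 - a) =
      (-1) ^ ((n - 1 - a) + (n - 1 - b)) * dagger A $$ (a, b)"
    using assms(1,5,6) by (auto simp: adj_mat_def cofactor_def dagger_def)
  moreover have "(-1::complex) ^ (a + b) * (-1) ^ ((n - 1 - a) + (n - 1 - b)) = 1"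
  proof -
    have "a + b + ((n - 1 - a) + (n - 1 - b)) = 2 * (n - 1)" using assms by auto
    then show ?thesis by (metis power_add power_minus1_even)
  qed
  ultimately show ?thesis by (simp add: mult.assoc[symmetric])
qed

text \<open>Inverse transposition and conjugation are both multiplicative, and the alternating signs
  telescope over the summation index. Because of this, row and column operations on a primal block
  have counterparts on the dual one.\<close>

lemma dagger_mult:
  assumes A: "A \<in> carrier_mat n n" "det A = 1" and B: "B \<in> carrier_mat n n" "det B = 1"
  shows "dagger (A * B) = dagger A * dagger B"
proof -
  obtain A' where A': "A' \<in> carrier_mat n n" "A * A' = 1\<^sub>m n" by (rule det_one_inverse[OF A])
  obtain B' where B': "B' \<in> carrier_mat n n" "B * B' = 1\<^sub>m n" by (rule det_one_inverse[OF B])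
  have "A * B * (B' * A') = A * (B * (B' * A'))" 
    using A B A' B' by (simp add: assoc_mult_mat[of _ n n _ n _ n])
  also have "B * (B' * A') = A'" 
    using A B A' B' by (simp add: assoc_mult_mat[symmetric, of _ n n _ n _ n])
  finally have AB': "A * B * (B' * A') = 1\<^sub>m n" using A' by simp
  have AB: "A * B \<in> carrier_mat n n" "det (A * B) = 1" using A B by (auto simp: det_mult)
  show ?thesis
  proof (rule eq_matI)
    fix a b assume "a < dim_row (dagger A * dagger B)" "b < dim_col (dagger A * dagger B)"
    then have ab: "a < n" "b < n" using A B by (auto simp: dagger_def)
    have "dagger (A * B) $$ (a, b) = (-1) ^ (a + b) * (\<Sum>k<n. B' $$ (n - 1 - b, k) * A' $$ (k, n - 1 - a))"
      using dagger_entry[OF AB _ AB' ab] A' B' ab by (simp add: mult_entry[of _ n] del: index_mult_mat)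
    also have "\<dots> = (\<Sum>k<n. (-1) ^ (a + b) * (B' $$ (n - 1 - b, n - Suc k) * A' $$ (n - Suc k, n - 1 - a)))"
      by (subst sum_rev_lessThan) (simp add: sum_distrib_left)
    also have "\<dots> = (\<Sum>k<n. dagger A $$ (a, k) * dagger B $$ (k, b))"
    proof (rule sum.cong)
      fix k assume "k \<in> {..<n}"
      then have k: "k < n" by simp
      have "(-1::complex) ^ (a + b) = (-1) ^ (a + k) * (-1) ^ (k + b)"
      proof -
        have "(-1::complex) ^ (a + k) * (-1) ^ (k + b) = (-1) ^ (a + b + 2 * k)"
          by (simp add: power_add[symmetric] mult_2_right ac_simps)
        then show ?thesis by (simp add: power_add)
      qed
      then show "(-1) ^ (a + b) * (B' $$ (n - 1 - b, n - Suc k) * A' $$ (n - Suc k, n - 1 - a)) =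
          dagger A $$ (a, k) * dagger B $$ (k, b)"
        using dagger_entry[OF A A' ab(1) k] dagger_entry[OF B B' k ab(2)] by (simp add: ac_simps)
    qed simp
    also have "\<dots> = (dagger A * dagger B) $$ (a, b)"
      using A B ab by (simp add: mult_entry[of _ n] del: index_mult_mat)
    finally show "dagger (A * B) $$ (a, b) = (dagger A * dagger B) $$ (a, b)" .
  qed (use A B in \<open>auto simp: dagger_def\<close>)
qed

lemma dagger_transpose:
  assumes A: "A \<in> carrier_mat n n"
  shows "dagger A\<^sup>T = (dagger A)\<^sup>T"
proof (rule eq_matI)
  fix a b assume "a < dim_row (dagger A)\<^sup>T" "b < dim_col (dagger A)\<^sup>T"
  then have ab: "a < n" "b < n" using A by (auto simp: dagger_def)
  have "mat_delete A\<^sup>T (n - 1 - a) (n - 1 - b) = (mat_delete A (n - 1 - b) (n - 1 - a))\<^sup>T"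
    using A ab by (auto simp: mat_delete_def)
  then have "det (mat_delete A\<^sup>T (n - 1 - a) (n - 1 - b)) = det (mat_delete A (n - 1 - b) (n - 1 - a))"
    using det_transpose[of "mat_delete A (n - 1 - b) (n - 1 - a)" "n - 1"] A
    by (metis carrier_matD carrier_matI mat_delete_dim)
  then show "dagger A\<^sup>T $$ (a, b) = (dagger A)\<^sup>T $$ (a, b)"
    using A ab by (auto simp: dagger_def)
qed (use A in \<open>auto simp: dagger_def\<close>)

lemma dagger_one: "dagger (1\<^sub>m n) = 1\<^sub>m n"
proof (rule eq_matI)
  fix a b assume "a < dim_row (1\<^sub>m n :: complex mat)" "b < dim_col (1\<^sub>m n :: complex mat)"
  then show "dagger (1\<^sub>m n) $$ (a, b) = (1\<^sub>m n) $$ (a, b)"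
    using dagger_entry[of "1\<^sub>m n" n "1\<^sub>m n" a b] by (auto simp: mult_2[symmetric])
qed (auto simp: dagger_def)

text \<open>The matrix from which a primal or, for \<open>d\<close>, a dual block is cut; treating
  both alike lets each statement about blocks be proved once.\<close>

definition src :: "bool \<Rightarrow> complex mat \<Rightarrow> complex mat" where
  "src d A = (if d then dagger A else A)"

lemma src_carrier [simp]: "A \<in> carrier_mat n n \<Longrightarrow> src d A \<in> carrier_mat n n"
  by (simp add: src_def)

lemma src_mult:
  "A \<in> carrier_mat n n \<Longrightarrow> det A = 1 \<Longrightarrow> B \<in> carrier_mat n n \<Longrightarrow> det B = 1 \<Longrightarrow>
   src d (A * B) = src d A * src d B"
  by (simp add: src_def dagger_mult)

lemma src_transpose: "A \<in> carrier_mat n n \<Longrightarrow> src d A\<^sup>T = (src d A)\<^sup>T"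
  by (simp add: src_def dagger_transpose)

lemma src_one: "src d (1\<^sub>m n) = 1\<^sub>m n"
  by (simp add: src_def dagger_one)

section \<open>Unipotent matrices\<close>

lemma det_upper:
  assumes "A \<in> carrier_mat n n" "\<And>a b. a < n \<Longrightarrow> b < a \<Longrightarrow> A $$ (a, b) = (0::complex)"
  shows "det A = (\<Prod>a<n. A $$ (a, a))"
  using det_upper_triangular[of A n] assms
  by (auto simp: upper_triangular_def prod_list_diag_prod lessThan_atLeast0)

lemma N_plus_iff:
  "A \<in> N_plus n \<longleftrightarrow> A \<in> carrier_mat n n \<and> (\<forall>a<n. \<forall>b<a. A $$ (a, b) = 0) \<and> (\<forall>a<n. A $$ (a, a) = 1)"
  (is "?L \<longleftrightarrow> ?R")
proof
  assume ?R
  moreover from this have "det A = 1" using det_upper[of A n] by simp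
  ultimately show ?L by (auto simp: N_plus_def B_plus_def SL_def upper_triangular_def)
qed (auto simp: N_plus_def B_plus_def SL_def upper_triangular_def)

lemma N_plusD:
  assumes "A \<in> N_plus n"
  shows "A \<in> carrier_mat n n" "det A = 1"
    "\<And>a b. a < n \<Longrightarrow> b < a \<Longrightarrow> A $$ (a, b) = 0" "\<And>a. a < n \<Longrightarrow> A $$ (a, a) = 1"
  using assms by (auto simp: N_plus_def B_plus_def SL_def upper_triangular_def)

lemma N_minus_transpose: "A\<^sup>T \<in> N_plus n \<longleftrightarrow> A \<in> N_minus n"
  by (auto simp: N_plus_def B_plus_def N_minus_def B_minus_def SL_def det_transpose
      carrier_matI[of A "dim_row A" "dim_col A"])

lemma N_plus_one: "1\<^sub>m n \<in> N_plus n"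
  by (auto simp: N_plus_iff)

lemma N_plus_mult:
  assumes "A \<in> N_plus n" "B \<in> N_plus n"
  shows "A * B \<in> N_plus n"
  unfolding N_plus_iff
proof (intro conjI allI impI)
  note A = N_plusD[OF assms(1)] and B = N_plusD[OF assms(2)]
  show "A * B \<in> carrier_mat n n" using A B by simp
  fix a assume a: "a < n"
  have "A $$ (a, k) * B $$ (k, a) = 0" if "k < n" "k \<noteq> a" for k
    using A(3)[OF a, of k] B(3)[of k a] that a by (cases k a rule: linorder_cases) auto
  then have "(A * B) $$ (a, a) = A $$ (a, a) * B $$ (a, a)"
    unfolding mult_entry[OF A(1) B(1) a a] using a by (intro sum_single) auto
  then show "(A * B) $$ (a, a) = 1" using a A B by simp
  fix b assume b: "b < a"
  have "(A * B) $$ (a, b) = (\<Sum>k<n. 0)"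
    unfolding mult_entry[OF A(1) B(1) a order.strict_trans[OF b a]]
    by (rule sum.cong, simp, case_tac "x < a") (use A B a b in auto)
  then show "(A * B) $$ (a, b) = 0" by simp
qed

lemma upper_inverse:
  assumes A: "A \<in> carrier_mat n n" "\<And>a b. a < n \<Longrightarrow> b < a \<Longrightarrow> A $$ (a, b) = (0::complex)"
    and B: "B \<in> carrier_mat n n" "A * B = 1\<^sub>m n"
  shows "\<And>a b. a < n \<Longrightarrow> b < a \<Longrightarrow> B $$ (a, b) = 0" "\<And>a. a < n \<Longrightarrow> A $$ (a, a) * B $$ (a, a) = 1"
proof -
  have "det A * det B = 1" using det_mult[OF A(1) B(1)] B by simp
  then have "det A \<noteq> 0" by auto
  then have nz: "A $$ (a, a) \<noteq> 0" if "a < n" for a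
    using det_upper[OF A] that by (auto simp: prod_zero_iff)
  have *: "B $$ (a, b) = 0" if "a < n" "b < a" for a b using that
  proof (induction "n - a" arbitrary: a rule: less_induct)
    case less
    then have b: "b < n" by simp
    have "0 = (\<Sum>k<n. A $$ (a, k) * B $$ (k, b))"
      using mult_entry[OF A(1) B(1) less(2) b] B less by simp
    also have "\<dots> = (\<Sum>k<n. if k = a then A $$ (a, a) * B $$ (a, b) else 0)"
    proof (rule sum.cong)
      fix k assume "k \<in> {..<n}"
      then show "A $$ (a, k) * B $$ (k, b) = (if k = a then A $$ (a, a) * B $$ (a, b) else 0)"
        using A(2)[of a k] less(1)[of k] less(2,3) by (cases k a rule: linorder_cases) auto
    qed simp
    finally show ?case using nz[OF less(2)] less(2) by simp
  qed
  then show "\<And>a b. a < n \<Longrightarrow> b < a \<Longrightarrow> B $$ (a, b) = 0" .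
  show "A $$ (a, a) * B $$ (a, a) = 1" if a: "a < n" for a
  proof -
    have "1 = (\<Sum>k<n. A $$ (a, k) * B $$ (k, a))"
      using mult_entry[OF A(1) B(1) a a] B a by simp
    also have "\<dots> = (\<Sum>k<n. if k = a then A $$ (a, a) * B $$ (a, a) else 0)"
    proof (rule sum.cong)
      fix k assume "k \<in> {..<n}"
      then show "A $$ (a, k) * B $$ (k, a) = (if k = a then A $$ (a, a) * B $$ (a, a) else 0)"
        using A(2)[OF a, of k] *[of k a] by (cases k a rule: linorder_cases) auto
    qed simp
    finally show ?thesis using a by simp
  qed
qed

lemma N_plus_inverse:
  assumes "A \<in> N_plus n" "B \<in> carrier_mat n n" "A * B = 1\<^sub>m n"
  shows "B \<in> N_plus n"
  using upper_inverse[OF N_plusD(1)[OF assms(1)] N_plusD(3)[OF assms(1)] assms(2,3)] assms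
  by (auto simp: N_plus_iff)

lemma N_plus_obtain_inverse:
  assumes "A \<in> N_plus n"
  obtains B where "B \<in> N_plus n" "A * B = 1\<^sub>m n" "B * A = 1\<^sub>m n"
  using det_one_inverse[of A n] N_plusD[OF assms] N_plus_inverse[OF assms] by metis

lemma N_plus_src:
  assumes "A \<in> N_plus n"
  shows "src d A \<in> N_plus n"
proof (cases d)
  case True
  obtain B where B: "B \<in> N_plus n" "A * B = 1\<^sub>m n" by (rule N_plus_obtain_inverse[OF assms])
  have "dagger A $$ (a, b) = (-1) ^ (a + b) * B $$ (n - 1 - b, n - 1 - a)" if "a < n" "b < n" for a b
    using dagger_entry[OF N_plusD(1,2)[OF assms] N_plusD(1)[OF B(1)] B(2)] that by simp
  then show ?thesis
    using True N_plusD[OF assms] N_plusD[OF B(1)]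
    by (auto simp: N_plus_iff src_def mult_2[symmetric])
qed (use assms in \<open>simp add: src_def\<close>)

section \<open>Anti-triangular matrices\<close>

text \<open>The invertible ones form w_0 B_+ = B_- w_0, hence the stability under lower triangular
  factors on the left and upper triangular ones on the right.\<close>

definition antilower :: "nat \<Rightarrow> complex mat \<Rightarrow> bool" where
  "antilower n A \<longleftrightarrow> A \<in> carrier_mat n n \<and> (\<forall>a<n. \<forall>b<n. a + b + 1 < n \<longrightarrow> A $$ (a, b) = 0)"

lemma antilower_transpose: "antilower n A \<Longrightarrow> antilower n A\<^sup>T"
  by (auto simp: antilower_def)

text \<open>Reversing the rows of \<open>A\<close> and the columns of its inverse \<open>B\<close>
  gives mutually inverse matrices. The first is upper triangular, so the second is too, and
  \<open>dagger_entry\<close> translates its zeros back.\<close>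

lemma antilower_src:
  assumes "antilower n A" "det A = 1"
  shows "antilower n (src d A)"
proof (cases d)
  case True
  have A: "A \<in> carrier_mat n n" and A0: "\<And>a b. a < n \<Longrightarrow> b < n \<Longrightarrow> a + b + 1 < n \<Longrightarrow> A $$ (a, b) = 0"
    using assms by (auto simp: antilower_def)
  obtain B where B: "B \<in> carrier_mat n n" "A * B = 1\<^sub>m n" by (rule det_one_inverse[OF A assms(2)])
  define A1 where "A1 = mat n n (\<lambda>(a, b). A $$ (n - 1 - a, b))"
  define B1 where "B1 = mat n n (\<lambda>(a, b). B $$ (a, n - 1 - b))"
  have c: "A1 \<in> carrier_mat n n" "B1 \<in> carrier_mat n n" by (auto simp: A1_def B1_def)
  have "A1 * B1 = 1\<^sub>m n"
  proof (rule eq_matI)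
    fix a b assume "a < dim_row (1\<^sub>m n :: complex mat)" "b < dim_col (1\<^sub>m n :: complex mat)"
    then have ab: "a < n" "b < n" by auto
    have "(A1 * B1) $$ (a, b) = (\<Sum>k<n. A $$ (n - 1 - a, k) * B $$ (k, n - 1 - b))"
      unfolding mult_entry[OF c ab] using ab by (auto simp: A1_def B1_def)
    also have "\<dots> = (A * B) $$ (n - 1 - a, n - 1 - b)"
      using ab by (simp add: mult_entry[OF A B(1)] del: index_mult_mat)
    also have "\<dots> = (1\<^sub>m n) $$ (a, b)" using ab B(2) by auto
    finally show "(A1 * B1) $$ (a, b) = (1\<^sub>m n) $$ (a, b)" .
  qed (use c in auto)
  moreover have "A1 $$ (a, b) = 0" if "a < n" "b < a" for a b
    using that A0[of "n - 1 - a" b] by (auto simp: A1_def)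
  ultimately have "B1 $$ (a, b) = 0" if "a < n" "b < a" for a b
    using upper_inverse(1)[OF c(1) _ c(2)] that by blast
  then have "B $$ (p, q) = 0" if "p < n" "q < n" "n - 1 - q < p" for p q
    using that by (force simp: B1_def)
  then show ?thesis
    using dagger_entry[OF A assms(2) B] A True by (auto simp: antilower_def src_def)
qed (use assms in \<open>simp add: src_def\<close>)

section \<open>Bruhat cells, Levi parts and the factorization of a generic matrix\<close>

section \<open>Reduced words\<close>

lemma word_perm_Nil [simp]: "word_perm [] = id"
  and word_perm_Cons: "word_perm (i # w) = Transposition.transpose i (Suc i) \<circ> word_perm w"
  by (simp_all add: word_perm_def)

lemma word_perm_append: "word_perm (u @ v) = word_perm u \<circ> word_perm v"
  by (induction u) (simp_all add: word_perm_Cons comp_assoc)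

lemma word_perm_rev: "word_perm w \<circ> word_perm (rev w) = id" "word_perm (rev w) \<circ> word_perm w = id"
proof -
  have *: "word_perm w (word_perm (rev w) x) = x" for w x
    by (induction w arbitrary: x) (simp_all add: word_perm_Cons word_perm_append)
  show "word_perm w \<circ> word_perm (rev w) = id" "word_perm (rev w) \<circ> word_perm w = id"
    using *[of w] *[of "rev w"] by (auto simp: fun_eq_iff)
qed

lemma word_perm_rev_apply [simp]:
  "word_perm w (word_perm (rev w) x) = x" "word_perm (rev w) (word_perm w x) = x"
  using word_perm_rev[of w] by (metis comp_apply id_apply)+

lemma word_perm_rev_eqI:
  assumes "word_perm u = word_perm v"
  shows "word_perm (rev u) = word_perm (rev v)"
proof
  fix x
  have "word_perm u (word_perm (rev v) x) = x" using assms by simp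
  then show "word_perm (rev u) x = word_perm (rev v) x"
    by (metis word_perm_rev_apply(2))
qed

lemma word_perm_permutes: "set w \<subseteq> {1..<n} \<Longrightarrow> word_perm w permutes {1..n}"
proof (induction w)
  case (Cons i w)
  then have "Transposition.transpose i (Suc i) permutes {1..n}"
    by (intro permutes_swap_id) auto
  then show ?case unfolding word_perm_Cons using Cons by (intro permutes_compose) auto
qed (simp add: permutes_id)

lemma word_perm_bounds:
  "set w \<subseteq> {1..<n} \<Longrightarrow> 1 \<le> x \<Longrightarrow> x \<le> n \<Longrightarrow> 1 \<le> word_perm w x \<and> word_perm w x \<le> n"
  using permutes_in_image[OF word_perm_permutes, of w n x] by auto

definition inversions :: "nat \<Rightarrow> (nat \<Rightarrow> nat) \<Rightarrow> (nat \<times> nat) set" where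
  "inversions n p = {(a, b). 1 \<le> a \<and> a < b \<and> b \<le> n \<and> p a > p b}"

lemma finite_inversions [simp]: "finite (inversions n p)"
  by (rule finite_subset[of _ "{1..n} \<times> {1..n}"]) (auto simp: inversions_def)

lemma inversions_id [simp]: "inversions n id = {}" "inversions n (\<lambda>a. a) = {}"
  by (auto simp: inversions_def)

text \<open>Exchanging the adjacent positions i and i+1 moves every other pair without reversing its
  order, so only the pair (i, i+1) changes its status.\<close>

lemma card_inversions_ascent:
  assumes "1 \<le> i" "i < n" "p i < p (Suc i)"
  shows "card (inversions n (p \<circ> Transposition.transpose i (Suc i))) = Suc (card (inversions n p))"
proof -
  define s where "s = Transposition.transpose i (Suc i)"
  have s [simp]: "s (s x) = x" for x by (simp add: s_def)
  have lt: "s a < s b" if "a < b" "(a, b) \<noteq> (i, Suc i)" for a b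
    using that by (auto simp: s_def Transposition.transpose_def)
  have rng: "1 \<le> s a \<and> s a \<le> n" if "1 \<le> a" "a \<le> n" for a
    using that assms by (auto simp: s_def Transposition.transpose_def)
  have "inversions n (p \<circ> s) = insert (i, Suc i) (map_prod s s ` inversions n p)" (is "?L = ?R")
  proof (intro equalityI subsetI)
    fix x assume x: "x \<in> ?L"
    then obtain a b where ab: "x = (a, b)" "1 \<le> a" "a < b" "b \<le> n" "p (s a) > p (s b)"
      by (auto simp: inversions_def)
    show "x \<in> ?R"
    proof (cases "x = (i, Suc i)")
      case False
      then have "(s a, s b) \<in> inversions n p" 
        using ab lt[of a b] rng[of a] rng[of b] by (auto simp: inversions_def)
      then have "map_prod s s (s a, s b) \<in> map_prod s s ` inversions n p" by (rule imageI)
      then show ?thesis using ab by simp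
    qed simp
  next
    fix x assume "x \<in> ?R"
    then consider "x = (i, Suc i)" | a b where "x = (s a, s b)" "(a, b) \<in> inversions n p" by auto
    then show "x \<in> ?L"
    proof cases
      case 1
      then show ?thesis using assms by (auto simp: inversions_def s_def)
    next
      case 2
      then have "(a, b) \<noteq> (i, Suc i)" using assms by (auto simp: inversions_def)
      then show ?thesis using 2 lt[of a b] rng[of a] rng[of b] by (auto simp: inversions_def)
    qed
  qed
  moreover have "(i, Suc i) \<notin> map_prod s s ` inversions n p"
  proof
    assume "(i, Suc i) \<in> map_prod s s ` inversions n p"
    then obtain a b where ab: "i = s a" "Suc i = s b" "(a, b) \<in> inversions n p" by auto
    have "a = Suc i" using arg_cong[OF ab(1), of s] unfolding s by (simp add: s_def)
    moreover have "b = i" using arg_cong[OF ab(2), of s] unfolding s by (simp add: s_def)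
    ultimately show False using ab(3) by (simp add: inversions_def)
  qed
  moreover have "inj s" by (metis s injI)
  then have "inj (map_prod s s)" by (simp add: prod.inj_map)
  then have "card (map_prod s s ` inversions n p) = card (inversions n p)"
    by (intro card_image) (rule inj_on_subset, auto)
  ultimately show ?thesis by (simp add: s_def)
qed

lemma card_inversions_descent:
  assumes "1 \<le> i" "i < n" "p (Suc i) < p i"
  shows "card (inversions n p) = Suc (card (inversions n (p \<circ> Transposition.transpose i (Suc i))))"
  using card_inversions_ascent[of i n "p \<circ> Transposition.transpose i (Suc i)"] assms
  by (simp add: comp_assoc)

text \<open>Inversions are counted for the inverse permutation \<open>word_perm (rev w)\<close>: a
  letter in front of \<open>w\<close> multiplies it on the right, which swaps adjacent positions and
  changes the count by one.\<close>

lemma card_inversions_le_length: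
  "set w \<subseteq> {1..<n} \<Longrightarrow> card (inversions n (word_perm (rev w))) \<le> length w"
proof (induction w)
  case Nil
  show ?case by simp
next
  case (Cons i w)
  have "inj (word_perm (rev w))" using word_perm_permutes[of "rev w" n] Cons.prems
    by (auto simp: permutes_inj)
  then have "word_perm (rev w) i \<noteq> word_perm (rev w) (Suc i)" by (simp add: inj_eq)
  moreover have "word_perm (rev (i # w)) = word_perm (rev w) \<circ> Transposition.transpose i (Suc i)"
    by (simp add: word_perm_append word_perm_Cons)
  moreover have "card (inversions n (word_perm (rev w))) \<le> length w" "1 \<le> i" "i < n"
    using Cons by auto
  ultimately show ?case
    using card_inversions_ascent[of i n "word_perm (rev w)"]
      card_inversions_descent[of i n "word_perm (rev w)"]
    by (cases "word_perm (rev w) i < word_perm (rev w) (Suc i)") (metis Suc_le_mono length_Cons, 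
      metis Suc_leD le_SucI length_Cons linorder_neqE_nat)
qed

lemma ascending_permutation:
  assumes p: "p permutes {1..n}" and asc: "\<And>i. 1 \<le> i \<Longrightarrow> i < n \<Longrightarrow> p i < p (Suc i)"
  shows "p = id"
proof
  have rng: "1 \<le> p i \<and> p i \<le> n" if "1 \<le> i" "i \<le> n" for i
    using permutes_in_image[OF p, of i] that by auto
  have ge: "1 \<le> i \<Longrightarrow> i \<le> n \<Longrightarrow> i \<le> p i" for i
  proof (induction i)
    case (Suc i)
    then show ?case using asc[of i] rng[of 1] by (cases "i = 0") force+
  qed simp
  have le: "k < n \<Longrightarrow> p (n - k) \<le> n - k" for k
  proof (induction k)
    case (Suc k)
    have "Suc (n - Suc k) = n - k" using Suc by simp
    then have "p (n - Suc k) < p (n - k)" using Suc.prems asc[of "n - Suc k"] by simp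
    then show ?case using Suc.IH Suc.prems by linarith
  qed (use rng in auto)
  fix x
  show "p x = id x"
  proof (cases "x \<in> {1..n}")
    case True
    then show ?thesis using ge[of x] le[of "n - x"] by simp
  next
    case False
    then show ?thesis using p by (simp add: permutes_not_in)
  qed
qed

text \<open>Bubble sort: as long as a descent exists, one adjacent transposition removes exactly one
  inversion.\<close>

lemma word_of_permutation:
  "p permutes {1..n} \<Longrightarrow>
   \<exists>w. set w \<subseteq> {1..<n} \<and> word_perm (rev w) = p \<and> length w = card (inversions n p)"
proof (induction "card (inversions n p)" arbitrary: p rule: less_induct)
  case less
  show ?case
  proof (cases "\<exists>i. 1 \<le> i \<and> i < n \<and> p (Suc i) < p i")
    case True
    then obtain i where i: "1 \<le> i" "i < n" "p (Suc i) < p i" by auto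
    have "p \<circ> Transposition.transpose i (Suc i) permutes {1..n}"
      using less.prems i by (intro permutes_compose permutes_swap_id) auto
    from less.hyps[OF _ this] card_inversions_descent[OF i] obtain w where w: "set w \<subseteq> {1..<n}"
      "word_perm (rev w) = p \<circ> Transposition.transpose i (Suc i)" "Suc (length w) = card (inversions n p)"
      by auto
    then have "word_perm (rev (i # w)) = p"
      by (simp add: word_perm_append word_perm_Cons comp_assoc)
    then show ?thesis using w i by (intro exI[of _ "i # w"]) auto
  next
    case False
    have "inj p" using less.prems by (simp add: permutes_inj)
    then have "p i \<noteq> p (Suc i)" for i by (simp add: inj_eq)
    then have "p = id"
      using False by (intro ascending_permutation[OF less.prems]) (meson linorder_neqE_nat)
    then show ?thesis by (intro exI[of _ "[]"]) auto
  qed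
qed

lemma reduced_word_iff:
  "reduced_word n w \<longleftrightarrow> set w \<subseteq> {1..<n} \<and> length w = card (inversions n (word_perm (rev w)))"
proof
  assume r: "reduced_word n w"
  then have s: "set w \<subseteq> {1..<n}" by (simp add: reduced_word_def)
  obtain w' where w': "set w' \<subseteq> {1..<n}" "word_perm (rev w') = word_perm (rev w)"
    "length w' = card (inversions n (word_perm (rev w)))"
    using word_of_permutation[OF word_perm_permutes[of "rev w" n]] s by auto
  have "word_perm w' = word_perm w"
    using word_perm_rev_eqI[OF w'(2)] by simp
  then show "set w \<subseteq> {1..<n} \<and> length w = card (inversions n (word_perm (rev w)))"
    using r w' card_inversions_le_length[OF s] s by (auto simp: reduced_word_def intro: le_antisym)
next
  assume w: "set w \<subseteq> {1..<n} \<and> length w = card (inversions n (word_perm (rev w)))"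
  have "length w \<le> length w'" if "set w' \<subseteq> {1..<n}" "word_perm w' = word_perm w" for w'
  proof -
    have "word_perm (rev w') = word_perm (rev w)"
      by (rule word_perm_rev_eqI[OF that(2)])
    then show ?thesis using w card_inversions_le_length[OF that(1)] by simp
  qed
  then show "reduced_word n w" using w by (simp add: reduced_word_def)
qed

lemma reduced_word_rev: "reduced_word n w \<Longrightarrow> reduced_word n (rev w)"
  unfolding reduced_word_def
proof (intro conjI allI impI)
  assume r: "set w \<subseteq> {1..<n} \<and> (\<forall>w'. set w' \<subseteq> {1..<n} \<and> word_perm w' = word_perm w \<longrightarrow> length w \<le> length w')"
  then show "set (rev w) \<subseteq> {1..<n}" by simp
  fix v assume v: "set v \<subseteq> {1..<n} \<and> word_perm v = word_perm (rev w)"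
  then have "word_perm (rev v) = word_perm w"
    using word_perm_rev_eqI[of v "rev w"] by simp
  then show "length (rev w) \<le> length v" using r[THEN conjunct2, rule_format, of "rev v"] v by simp
qed

lemma longest_word_rev: "longest_word n J w \<Longrightarrow> longest_word n J (rev w)"
  by (auto simp: longest_word_def reduced_word_rev)

lemma reduced_word_Cons:
  assumes "reduced_word n (i # w)"
  shows "reduced_word n w" "word_perm (rev w) i < word_perm (rev w) (Suc i)"
proof -
  have s: "set w \<subseteq> {1..<n}" "1 \<le> i" "i < n"
    and l: "Suc (length w) = card (inversions n (word_perm (rev w) \<circ> Transposition.transpose i (Suc i)))"
    using assms by (auto simp: reduced_word_iff word_perm_append word_perm_Cons)
  have "inj (word_perm (rev w))" using word_perm_permutes[of "rev w" n] s
    by (auto simp: permutes_inj)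
  then have ne: "word_perm (rev w) i \<noteq> word_perm (rev w) (Suc i)" by (simp add: inj_eq)
  show 1: "word_perm (rev w) i < word_perm (rev w) (Suc i)"
  proof (rule ccontr)
    assume "\<not> ?thesis"
    then have "word_perm (rev w) (Suc i) < word_perm (rev w) i" using ne by simp
    from card_inversions_descent[OF s(2,3), of "word_perm (rev w)", OF this] l
      card_inversions_le_length[OF s(1)]
    show False by linarith
  qed
  show "reduced_word n w" 
    unfolding reduced_word_iff using card_inversions_ascent[OF s(2,3), of "word_perm (rev w)", OF 1] l s(1) by linarith
qed

lemma reduced_word_suffix: "reduced_word n (u @ v) \<Longrightarrow> reduced_word n v"
  by (induction u) (auto dest: reduced_word_Cons)

text \<open>Without the descent, \<open>i # w\<close> would again be reduced with letters in
  \<open>J\<close>, contradicting maximal length.\<close>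

lemma longest_word_descent:
  assumes "longest_word n J w" "J \<subseteq> {1..<n}" "i \<in> J"
  shows "word_perm (rev w) (Suc i) < word_perm (rev w) i"
proof (rule ccontr)
  assume "\<not> ?thesis"
  have w: "reduced_word n w" "set w \<subseteq> J" using assms by (auto simp: longest_word_def)
  then have "inj (word_perm (rev w))" using word_perm_permutes[of "rev w" n]
    by (auto simp: permutes_inj reduced_word_def)
  then have "word_perm (rev w) i \<noteq> word_perm (rev w) (Suc i)" by (simp add: inj_eq)
  with \<open>\<not> ?thesis\<close> have "word_perm (rev w) i < word_perm (rev w) (Suc i)" by simp
  from card_inversions_ascent[OF _ _ this, of n] assms(2,3) w(1)
  have "card (inversions n (word_perm (rev (i # w)))) = length (i # w)"
    by (auto simp: word_perm_append word_perm_Cons reduced_word_iff simp del: comp_apply)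
  then have "reduced_word n (i # w)"
    using w assms(2,3) by (auto simp: reduced_word_iff)
  moreover have "set (i # w) \<subseteq> J" using assms(3) w by simp
  ultimately have "length (i # w) \<le> length w" using assms(1) unfolding longest_word_def by blast
  then show False by simp
qed

lemma word_perm_interval:
  assumes "set w \<subseteq> J" "hi \<notin> J" "lo - 1 \<notin> J" "1 \<le> lo" "lo \<le> x" "x \<le> hi"
  shows "lo \<le> word_perm w x \<and> word_perm w x \<le> hi"
  using assms(1)
proof (induction w)
  case (Cons i w)
  have "i \<noteq> hi" "i \<noteq> lo - 1" using Cons assms by auto
  then show ?case using Cons assms
    by (auto simp: word_perm_Cons Transposition.transpose_def)
qed (use assms in auto)

text \<open>Letters from \<open>J\<close> keep the run invariant and every step inside it is a
  descent; a strictly decreasing self-map of an interval is squeezed from both ends into the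
  reversal, which is its own inverse.\<close>

lemma longest_word_reversal:
  assumes w: "longest_word n J w" and J: "J \<subseteq> {1..<n}" and i: "{lo..<hi} \<subseteq> J" "hi \<notin> J" "lo - 1 \<notin> J" "1 \<le> lo"
    and x: "lo \<le> x" "x \<le> hi"
  shows "word_perm w x = lo + hi - x"
proof -
  define p where "p = word_perm (rev w)"
  have s: "set (rev w) \<subseteq> J" using w by (auto simp: longest_word_def)
  have rng: "lo \<le> p x \<and> p x \<le> hi" if "lo \<le> x" "x \<le> hi" for x
    unfolding p_def using word_perm_interval[OF s i(2-4)] that by simp
  have desc: "p (Suc x) < p x" if "lo \<le> x" "x < hi" for x
    unfolding p_def using longest_word_descent[OF w J, of x] that i by auto
  have up: "lo + k \<le> hi \<Longrightarrow> p (lo + k) + k \<le> hi" for k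
  proof (induction k)
    case (Suc k)
    then show ?case using desc[of "lo + k"] by simp
  qed (use rng[of lo] x in simp)
  have down: "lo + k \<le> hi \<Longrightarrow> lo + k \<le> p (hi - k)" for k
  proof (induction k)
    case (Suc k)
    have "Suc (hi - Suc k) = hi - k" using Suc by simp
    moreover have "lo \<le> hi - Suc k" "hi - Suc k < hi" "lo + k \<le> hi" using Suc.prems by auto
    ultimately show ?case using Suc.IH desc[of "hi - Suc k"] by simp
  qed (use rng[of hi] x in simp)
  have p: "p x = lo + hi - x" if "lo \<le> x" "x \<le> hi" for x
  proof -
    have "p x + (x - lo) \<le> hi" using up[of "x - lo"] that by simp
    moreover have "lo + (hi - x) \<le> p x" using down[of "hi - x"] that by simp
    ultimately show ?thesis using that by linarith
  qed
  have "word_perm w (p (lo + hi - x)) = lo + hi - x" by (simp add: p_def)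
  then show ?thesis using p[of "lo + hi - x"] x by simp
qed

section \<open>Elementary unipotent matrices\<close>

lemma exp_carrier [simp]: "exp_plus n i t \<in> carrier_mat n n" "exp_minus n i t \<in> carrier_mat n n"
  by (auto simp: exp_plus_def exp_minus_def e_plus_def e_minus_def)

lemma exp_dim [simp]:
  "dim_row (exp_plus n i t) = n" "dim_col (exp_plus n i t) = n"
  "dim_row (exp_minus n i t) = n" "dim_col (exp_minus n i t) = n"
  using carrier_matD[OF exp_carrier(1)] carrier_matD[OF exp_carrier(2)] by blast+

lemma exp_plus_entry:
  "a < n \<Longrightarrow> b < n \<Longrightarrow>
   exp_plus n i t $$ (a, b) = (if a = b then 1 else 0) + (if a = i - 1 \<and> b = i then t else 0)"
  by (auto simp: exp_plus_def e_plus_def)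

lemma exp_minus_entry:
  "a < n \<Longrightarrow> b < n \<Longrightarrow>
   exp_minus n i t $$ (a, b) = (if a = b then 1 else 0) + (if a = i \<and> b = i - 1 then t else 0)"
  by (auto simp: exp_minus_def e_minus_def e_plus_def)

lemma exp_plus_transpose: "(exp_plus n i t)\<^sup>T = exp_minus n i t"
  and exp_minus_transpose: "(exp_minus n i t)\<^sup>T = exp_plus n i t"
  by (auto simp: exp_plus_entry exp_minus_entry intro!: eq_matI)

lemma exp_plus_times:
  assumes "A \<in> carrier_mat n n" "i < n" "a < n" "b < n"
  shows "(exp_plus n i t * A) $$ (a, b) = A $$ (a, b) + (if a = i - 1 then t * A $$ (i, b) else 0)"
proof -
  have "(exp_plus n i t * A) $$ (a, b) =
      (\<Sum>k<n. (if k = a then A $$ (a, b) else 0) + (if k = i then if a = i - 1 then t * A $$ (i, b) else 0 else 0))"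
    unfolding mult_entry[OF exp_carrier(1) assms(1,3,4)]
    by (rule sum.cong) (use assms in \<open>auto simp: exp_plus_entry algebra_simps\<close>)
  also have "\<dots> = A $$ (a, b) + (if a = i - 1 then t * A $$ (i, b) else 0)"
    using assms unfolding sum.distrib by (subst (1 2) sum.delta) auto
  finally show ?thesis .
qed

lemma exp_minus_times:
  assumes "A \<in> carrier_mat n n" "i < n" "a < n" "b < n"
  shows "(exp_minus n i t * A) $$ (a, b) = A $$ (a, b) + (if a = i then t * A $$ (i - 1, b) else 0)"
proof -
  have "(exp_minus n i t * A) $$ (a, b) =
      (\<Sum>k<n. (if k = a then A $$ (a, b) else 0) + (if k = i - 1 then if a = i then t * A $$ (i - 1, b) else 0 else 0))"
    unfolding mult_entry[OF exp_carrier(2) assms(1,3,4)]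
    by (rule sum.cong) (use assms in \<open>auto simp: exp_minus_entry algebra_simps\<close>)
  also have "\<dots> = A $$ (a, b) + (if a = i then t * A $$ (i - 1, b) else 0)"
    using assms unfolding sum.distrib by (subst (1 2) sum.delta) auto
  finally show ?thesis .
qed

lemma times_exp_plus:
  assumes "A \<in> carrier_mat n n" "i < n" "a < n" "b < n"
  shows "(A * exp_plus n i t) $$ (a, b) = A $$ (a, b) + (if b = i then t * A $$ (a, i - 1) else 0)"
proof -
  have "(A * exp_plus n i t) $$ (a, b) = (exp_minus n i t * A\<^sup>T) $$ (b, a)"
    using assms transpose_mult[OF assms(1) exp_carrier(1), of i t]
    by (metis carrier_matD exp_dim(2) exp_plus_transpose index_mult_mat(2,3) index_transpose_mat(1))
  then show ?thesis using exp_minus_times[of "A\<^sup>T" n i b a t] assms by simp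
qed

lemma times_exp_minus:
  assumes "A \<in> carrier_mat n n" "i < n" "a < n" "b < n"
  shows "(A * exp_minus n i t) $$ (a, b) = A $$ (a, b) + (if b = i - 1 then t * A $$ (a, i) else 0)"
proof -
  have "(A * exp_minus n i t) $$ (a, b) = (exp_plus n i t * A\<^sup>T) $$ (b, a)"
    using assms transpose_mult[OF assms(1) exp_carrier(2), of i t]
    by (metis carrier_matD exp_dim(4) exp_minus_transpose index_mult_mat(2,3) index_transpose_mat(1))
  then show ?thesis using exp_plus_times[of "A\<^sup>T" n i b a t] assms by simp
qed

lemma exp_plus_add: "1 \<le> i \<Longrightarrow> i < n \<Longrightarrow> exp_plus n i s * exp_plus n i t = exp_plus n i (s + t)"
  by (rule eq_matI) (auto simp: exp_plus_times[OF exp_carrier(1)] exp_plus_entry simp del: index_mult_mat(1))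

lemma exp_plus_0: "exp_plus n i 0 = 1\<^sub>m n" "exp_minus n i 0 = 1\<^sub>m n"
  by (auto simp: exp_plus_def e_plus_def exp_minus_def e_minus_def)

lemma exp_minus_add: "1 \<le> i \<Longrightarrow> i < n \<Longrightarrow> exp_minus n i s * exp_minus n i t = exp_minus n i (s + t)"
  by (rule eq_matI) (auto simp: exp_minus_times[OF exp_carrier(2)] exp_minus_entry simp del: index_mult_mat(1))

lemma exp_plus_N_plus: "1 \<le> i \<Longrightarrow> exp_plus n i t \<in> N_plus n"
  by (auto simp: N_plus_iff exp_plus_entry)

lemma exp_minus_N_minus: "1 \<le> i \<Longrightarrow> exp_minus n i t \<in> N_minus n"
  using exp_plus_N_plus[of i n t] by (simp flip: N_minus_transpose add: exp_minus_transpose)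

section \<open>Bruhat factorization of products along reduced words\<close>

lemma prod_minus_Nil: "prod_minus n [] ts = 1\<^sub>m n"
  and prod_minus_Cons: "prod_minus n (i # w) (t # ts) = exp_minus n i t * prod_minus n w ts"
  by (simp_all add: prod_minus_def)

lemma prod_minus_carrier [simp]: "prod_minus n w ts \<in> carrier_mat n n"
proof (induction w arbitrary: ts)
  case (Cons i w)
  show ?case
  proof (cases ts)
    case Nil
    then show ?thesis by (simp add: prod_minus_def)
  next
    case (Cons t ts')
    then show ?thesis using \<open>\<And>ts. prod_minus n w ts \<in> carrier_mat n n\<close>
      by (simp only: prod_minus_Cons) (rule mult_carrier_mat[OF exp_carrier(2)])
  qed
qed (simp add: prod_minus_Nil)

text \<open>One step of the induction: with \<open>x = N\<^sub>i\<^sub>,\<^sub>i\<^sub>+\<^sub>1\<close>, the matrix \<open>exp(t e\<^sub>-\<^sub>i) exp(x e\<^sub>i)\<close> normalizes the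
  unipotent matrices with vanishing entry \<open>(i, i+1)\<close>, and \<open>t \<noteq> 0\<close> places it in \<open>B\<^sub>+ s\<^sub>i B\<^sub>+\<close>.\<close>

lemma prod_minus_factor:
  assumes "reduced_word n w" "length ts = length w" "\<forall>t\<in>set ts. t \<noteq> 0"
  shows "\<exists>N L. N \<in> N_plus n \<and> L \<in> carrier_mat n n \<and>
    (\<forall>c<n. \<forall>b<c. L $$ (word_perm w (Suc c) - 1, b) = 0) \<and> prod_minus n w ts = N * L"
  using assms
proof (induction w arbitrary: ts)
  case Nil
  then show ?case 
    by (intro exI[of _ "1\<^sub>m n"]) (auto simp: prod_minus_Nil N_plus_one)
next
  case (Cons i w)
  then obtain t ts' where ts: "ts = t # ts'" "t \<noteq> 0" "length ts' = length w" "\<forall>t\<in>set ts'. t \<noteq> 0"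
    by (cases ts) auto
  note red = reduced_word_Cons[OF Cons.prems(1)]
  have i: "1 \<le> i" "i < n" "set w \<subseteq> {1..<n}" using Cons.prems by (auto simp: reduced_word_def)
  obtain N L where N: "N \<in> N_plus n" and L: "L \<in> carrier_mat n n"
    and L0: "\<And>c b. c < n \<Longrightarrow> b < c \<Longrightarrow> L $$ (word_perm w (Suc c) - 1, b) = 0"
    and NL: "prod_minus n w ts' = N * L"
    using Cons.IH[OF red(1) ts(3,4)] by auto
  note Nc = N_plusD[OF N]
  define x where "x = N $$ (i - 1, i)"
  define E where "E = exp_minus n i t"
  define E' where "E' = exp_minus n i (- t)"
  define N1 where "N1 = N * exp_plus n i (- x)"
  define N2 where "N2 = E * N1 * E'"
  define XL where "XL = exp_plus n i x * L"
  \<comment> \<open>\<open>exp_plus n i (- (1 / t)) * exp_minus n i t\<close> has the 2x2 block with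
    rows (0, -1/t) and (t, 1), an upper triangular block with its rows exchanged. This represents
    s_i and requires \<open>t \<noteq> 0\<close>.\<close>
  define L' where "L' = exp_plus n i (- (1 / t)) * (E * XL)"
  have N1: "N1 \<in> N_plus n" unfolding N1_def by (intro N_plus_mult N exp_plus_N_plus i)
  note N1c = N_plusD[OF N1]
  \<comment> \<open>A nonzero entry here would, after conjugation by \<open>exp_minus n i t\<close>,
    disturb the diagonal and leave an entry just below it.\<close>
  have x0: "N1 $$ (i - 1, i) = 0"
    using i Nc by (simp add: N1_def times_exp_plus[OF Nc(1)] x_def del: index_mult_mat(1))
  have Ec: "E \<in> carrier_mat n n" "E' \<in> carrier_mat n n" by (auto simp: E_def E'_def)
  have EN1: "E * N1 \<in> carrier_mat n n" using Ec N1c by simp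
  have N2e: "N2 $$ (a, b) = N1 $$ (a, b) + (if a = i then t * N1 $$ (i - 1, b) else 0)
      - (if b = i - 1 then t * (N1 $$ (a, i) + (if a = i then t * N1 $$ (i - 1, i) else 0)) else 0)"
    if "a < n" "b < n" for a b
    unfolding N2_def E'_def times_exp_minus[OF EN1 i(2) that]
    unfolding E_def exp_minus_times[OF N1c(1) i(2) that] exp_minus_times[OF N1c(1) i(2) that(1) i(2)]
    by simp
  have N2: "N2 \<in> N_plus n"
    unfolding N_plus_iff
  proof (intro conjI allI impI)
    show "N2 \<in> carrier_mat n n" unfolding N2_def using EN1 Ec by simp
    fix a assume a: "a < n"
    show "N2 $$ (a, a) = 1"
    proof -
      have "i \<noteq> i - 1" using i by simp
      then show ?thesis using N2e[OF a a] x0 N1c(4)[OF a] by (cases "a = i") auto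
    qed
    fix b assume b: "b < a"
    have bn: "b < n" using a b by simp
    consider "b \<noteq> i - 1" "a = i" | "b \<noteq> i - 1" "a \<noteq> i" | "b = i - 1" "a = i" | "b = i - 1" "i < a"
      using b i by linarith
    then show "N2 $$ (a, b) = 0"
    proof cases
      case 1
      then show ?thesis using N2e[OF a bn] N1c(3)[OF a b] N1c(3)[of "i - 1" b] b i by auto
    next
      case 2
      then show ?thesis using N2e[OF a bn] N1c(3)[OF a b] by simp
    next
      case 3
      then show ?thesis using N2e[OF a bn] N1c(3)[OF a b] N1c(4)[of "i - 1"] N1c(4)[of i] x0 i by simp
    next
      case 4
      then show ?thesis using N2e[OF a bn] N1c(3)[OF a b] N1c(3)[of a i] a by simp
    qed
  qed
  have XL: "XL \<in> carrier_mat n n" unfolding XL_def using L by simp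
  have EXL: "E * XL \<in> carrier_mat n n" using Ec XL by simp
  have XLe: "XL $$ (a, b) = L $$ (a, b) + (if a = i - 1 then x * L $$ (i, b) else 0)"
    if "a < n" "b < n" for a b
    unfolding XL_def by (rule exp_plus_times[OF L i(2) that])
  have EXLe: "(E * XL) $$ (a, b) = XL $$ (a, b) + (if a = i then t * XL $$ (i - 1, b) else 0)"
    if "a < n" "b < n" for a b
    unfolding E_def by (rule exp_minus_times[OF XL i(2) that])
  have L'e0: "L' $$ (a, b) = (E * XL) $$ (a, b) + (if a = i - 1 then - (1 / t) * (E * XL) $$ (i, b) else 0)"
    if "a < n" "b < n" for a b
    unfolding L'_def by (rule exp_plus_times[OF EXL i(2) that])
  have L'e: "L' $$ (a, b) = (if a = i - 1 then - (1 / t) * L $$ (i, b)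
      else if a = i then L $$ (i, b) + t * (L $$ (i - 1, b) + x * L $$ (i, b)) else L $$ (a, b))"
    if ab: "a < n" "b < n" for a b
  proof -
    have "i - 1 < n" "i \<noteq> i - 1" using i by auto
    then show ?thesis
      using L'e0[OF ab] EXLe[OF ab] EXLe[OF i(2) ab(2)] XLe[OF ab] XLe[OF i(2) ab(2)]
        XLe[OF \<open>i - 1 < n\<close> ab(2)] ts(2)
      by (cases "a = i - 1") (simp_all del: index_mult_mat(1), simp_all add: add_divide_distrib)
  qed
  have "prod_minus n (i # w) ts = (N2 * exp_plus n i (1 / t)) * L'"
  proof -
    note as = mult_assoc_square[of _ n]
    have "(N2 * exp_plus n i (1 / t)) * L' = N2 * (exp_plus n i (1 / t) * exp_plus n i (- (1 / t))) * (E * XL)"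
      unfolding L'_def using N_plusD(1)[OF N2] EXL by (simp add: as)
    also have "\<dots> = N2 * (E * XL)"
      using N_plusD(1)[OF N2] i by (simp add: exp_plus_add exp_plus_0)
    also have "\<dots> = E * N1 * (E' * E) * XL"
      unfolding N2_def using N1c Ec XL by (simp add: as)
    also have "\<dots> = E * N1 * XL"
      unfolding E_def E'_def using N1c Ec i by (simp add: exp_minus_add exp_plus_0)
    also have "\<dots> = E * (N * (exp_plus n i (- x) * exp_plus n i x) * L)"
      unfolding N1_def XL_def using Nc Ec L by (simp add: as)
    also have "\<dots> = E * (N * L)"
      using Nc L i by (simp add: exp_plus_add exp_plus_0)
    finally show ?thesis by (simp add: ts prod_minus_Cons NL E_def)
  qed
  moreover have "N2 * exp_plus n i (1 / t) \<in> N_plus n"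
    by (intro N_plus_mult N2 exp_plus_N_plus i)
  moreover have "L' $$ (word_perm (i # w) (Suc c) - 1, b) = 0" if c: "c < n" "b < c" for c b
  proof -
    \<comment> \<open>\<open>p\<close> and \<open>p'\<close> index the rows of \<open>L\<close> in
      positions i and i+1. Reducedness of \<open>i # w\<close> gives \<open>p < p'\<close>: the
      second row starts with more zeros, so any combination of the two still has the zeros of the
      first, and the row moved up to position i keeps the longer string.\<close>
    define p where "p = word_perm (rev w) i"
    define p' where "p' = word_perm (rev w) (Suc i)"
    have pp: "word_perm w p = i" "word_perm w p' = Suc i" "p < p'" 
      using red(2) by (simp_all add: p_def p'_def)
    have pb: "1 \<le> p" "p' \<le> n" using word_perm_bounds[of "rev w" n i] word_perm_bounds[of "rev w" n "Suc i"] i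
      by (auto simp: p_def p'_def)
    have b: "b < n" using c by simp
    consider "Suc c = p" | "Suc c = p'" | "Suc c \<noteq> p" "Suc c \<noteq> p'" by blast
    then show ?thesis
    proof cases
      case 1
      then have "word_perm (i # w) (Suc c) = Suc i" using pp by (simp add: word_perm_Cons)
      moreover have "L $$ (i, b) = 0" "L $$ (i - 1, b) = 0"
        using L0[of "p' - 1" b] L0[of "p - 1" b] pp pb 1 c by auto
      ultimately show ?thesis using L'e[of i b] i b by auto
    next
      case 2
      then have "word_perm (i # w) (Suc c) = i" using pp by (simp add: word_perm_Cons)
      moreover have "L $$ (i, b) = 0"
        using L0[of "p' - 1" b] pp pb 2 c by auto
      ultimately show ?thesis using L'e[of "i - 1" b] i b by auto
    next
      case 3
      have ne: "word_perm w (Suc c) \<noteq> i" "word_perm w (Suc c) \<noteq> Suc i"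
        using 3 word_perm_rev_apply(2)[of w "Suc c"] unfolding p_def p'_def by (auto simp del: word_perm_rev_apply)
      then have "word_perm (i # w) (Suc c) = word_perm w (Suc c)" by (simp add: word_perm_Cons)
      moreover have "1 \<le> word_perm w (Suc c)" "word_perm w (Suc c) \<le> n"
        using word_perm_bounds[of w n "Suc c"] i c by auto
      ultimately show ?thesis using L'e[of "word_perm w (Suc c) - 1" b] b ne L0[OF c] by auto
    qed
  qed
  moreover have "L' \<in> carrier_mat n n" unfolding L'_def using EXL by simp
  ultimately show ?case by blast
qed

section \<open>Block diagonal matrices\<close>

definition linked :: "nat set \<Rightarrow> nat \<Rightarrow> nat \<Rightarrow> bool" where
  "linked J a b \<longleftrightarrow> {min a b..<max a b} \<subseteq> J"

lemma linked_refl [simp]: "linked J a a"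
  by (simp add: linked_def)

lemma linked_sym: "linked J a b \<longleftrightarrow> linked J b a"
  by (simp add: linked_def min.commute max.commute)

lemma linked_trans: "linked J a b \<Longrightarrow> linked J b c \<Longrightarrow> linked J a c"
proof -
  have "{min a c..<max a c} \<subseteq> {min a b..<max a b} \<union> {min b c..<max b c}" by auto
  then show "linked J a b \<Longrightarrow> linked J b c \<Longrightarrow> linked J a c" unfolding linked_def by blast
qed

lemma linked_between: "linked J a c \<Longrightarrow> a \<le> b \<Longrightarrow> b \<le> c \<Longrightarrow> linked J a b"
  by (auto simp: linked_def min_def max_def subset_iff)

lemma linked_less: "a < b \<Longrightarrow> linked J a b \<Longrightarrow> a \<in> J"
  by (auto simp: linked_def)

lemma linked_Suc: "linked J a (Suc a) \<longleftrightarrow> a \<in> J"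
  by (auto simp: linked_def)

lemma run_eq_linked: "run n J k = {l \<in> {1..n}. linked J k l}"
  by (auto simp: run_def linked_def)

lemma run_bounds:
  assumes "J \<subseteq> {1..<n}" "1 \<le> x" "x \<le> n"
  obtains lo hi where "lo \<le> x" "x \<le> hi" "1 \<le> lo" "hi \<le> n" "{lo..<hi} \<subseteq> J" "hi \<notin> J" "lo - 1 \<notin> J"
    "\<And>y. linked J x y \<longleftrightarrow> lo \<le> y \<and> y \<le> hi"
proof -
  define hi where "hi = (LEAST y. x \<le> y \<and> y \<notin> J)"
  define lo where "lo = (LEAST y. {y..<x} \<subseteq> J)"
  have n: "x \<le> n \<and> n \<notin> J" using assms by auto
  have hi: "x \<le> hi" "hi \<notin> J" "hi \<le> n"
    unfolding hi_def using LeastI[of "\<lambda>y. x \<le> y \<and> y \<notin> J", OF n] Least_le[of "\<lambda>y. x \<le> y \<and> y \<notin> J", OF n] by auto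
  have hi2: "{x..<hi} \<subseteq> J"
  proof
    fix z assume z: "z \<in> {x..<hi}"
    then have "\<not> (x \<le> z \<and> z \<notin> J)" unfolding hi_def by (intro not_less_Least) simp
    then show "z \<in> J" using z by simp
  qed
  have lo: "{lo..<x} \<subseteq> J" "lo \<le> x"
    unfolding lo_def using LeastI[of "\<lambda>y. {y..<x} \<subseteq> J" x] Least_le[of "\<lambda>y. {y..<x} \<subseteq> J" x] by auto
  have lo1: "1 \<le> lo"
  proof (rule ccontr)
    assume "\<not> 1 \<le> lo"
    then have "0 \<in> J" using lo assms(2) by auto
    then show False using assms(1) by auto
  qed
  have lo2: "lo - 1 \<notin> J"
  proof
    assume "lo - 1 \<in> J"
    have "{lo - 1..<x} \<subseteq> J"
    proof
      fix z assume "z \<in> {lo - 1..<x}"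
      then have "z = lo - 1 \<or> z \<in> {lo..<x}" using lo1 by auto
      then show "z \<in> J" using \<open>lo - 1 \<in> J\<close> lo(1) by blast
    qed
    then have "lo \<le> lo - 1" unfolding lo_def by (rule Least_le)
    then show False using lo1 by simp
  qed
  have "linked J x y \<longleftrightarrow> lo \<le> y \<and> y \<le> hi" for y
  proof
    assume l: "linked J x y"
    have "lo \<le> y"
    proof (rule ccontr)
      assume "\<not> lo \<le> y"
      then have "lo - 1 \<in> {min x y..<max x y}" using lo by auto
      then show False using l lo2 unfolding linked_def by blast
    qed
    moreover have "y \<le> hi"
    proof (rule ccontr)
      assume "\<not> y \<le> hi"
      then have "hi \<in> {min x y..<max x y}" using hi by auto
      then show False using l hi(2) unfolding linked_def by blast
    qed
    ultimately show "lo \<le> y \<and> y \<le> hi" by simp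
  next
    assume y: "lo \<le> y \<and> y \<le> hi"
    show "linked J x y" unfolding linked_def
    proof
      fix z assume "z \<in> {min x y..<max x y}"
      then have "z \<in> {lo..<x} \<or> z \<in> {x..<hi}" using y hi lo by auto
      then show "z \<in> J" using lo(1) hi2 by auto
    qed
  qed
  moreover have "{lo..<hi} \<subseteq> J"
  proof
    fix z assume "z \<in> {lo..<hi}"
    then have "z \<in> {lo..<x} \<or> z \<in> {x..<hi}" by auto
    then show "z \<in> J" using lo(1) hi2 by auto
  qed
  ultimately show thesis using that hi lo lo1 lo2 by blast
qed

text \<open>The Levi part belonging to \<open>J\<close>. Matrix indices start at 0 and runs at 1,
  hence \<open>Suc\<close>.\<close>

definition blockdiag :: "nat \<Rightarrow> nat set \<Rightarrow> complex mat \<Rightarrow> bool" where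
  "blockdiag n J A \<longleftrightarrow> A \<in> carrier_mat n n \<and>
     (\<forall>a<n. \<forall>b<n. \<not> linked J (Suc a) (Suc b) \<longrightarrow> A $$ (a, b) = 0)"

definition trunc :: "nat \<Rightarrow> nat set \<Rightarrow> complex mat \<Rightarrow> complex mat" where
  "trunc n J A = mat n n (\<lambda>(a, b). if linked J (Suc a) (Suc b) then A $$ (a, b) else 0)"

lemma blockdiagD:
  assumes "blockdiag n J A"
  shows "A \<in> carrier_mat n n" "\<And>a b. a < n \<Longrightarrow> b < n \<Longrightarrow> \<not> linked J (Suc a) (Suc b) \<Longrightarrow> A $$ (a, b) = 0"
  using assms by (auto simp: blockdiag_def)

lemma trunc_blockdiag: "blockdiag n J (trunc n J A)"
  by (auto simp: blockdiag_def trunc_def)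

lemma trunc_carrier [simp]: "trunc n J A \<in> carrier_mat n n"
  by (simp add: trunc_def)

lemma trunc_id: "blockdiag n J A \<Longrightarrow> trunc n J A = A"
  by (rule eq_matI) (auto simp: blockdiag_def trunc_def)

lemma blockdiag_iff: "blockdiag n J A \<longleftrightarrow> trunc n J A = A"
  using trunc_id trunc_blockdiag by metis

text \<open>Being linked is an equivalence relation, so a nonzero entry of \<open>A\<close> never
  moves a row to another run. The projection to the Levi part thus commutes with Levi
  factors.\<close>

lemma trunc_mult_left:
  assumes A: "blockdiag n J A" and B: "B \<in> carrier_mat n n"
  shows "trunc n J (A * B) = A * trunc n J B"
proof (rule eq_matI)
  note Ac = blockdiagD[OF A]
  fix a b assume "a < dim_row (A * trunc n J B)" "b < dim_col (A * trunc n J B)"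
  then have ab: "a < n" "b < n" using Ac by (auto simp: trunc_def)
  have "A $$ (a, k) * trunc n J B $$ (k, b) =
      (if linked J (Suc a) (Suc b) then A $$ (a, k) * B $$ (k, b) else 0)" if k: "k < n" for k
  proof (cases "linked J (Suc a) (Suc k)")
    case True
    then have "linked J (Suc k) (Suc b) = linked J (Suc a) (Suc b)"
      by (meson linked_trans linked_sym)
    then show ?thesis using k ab by (simp add: trunc_def)
  qed (use Ac(2)[OF ab(1) k] in simp)
  then show "trunc n J (A * B) $$ (a, b) = (A * trunc n J B) $$ (a, b)"
    unfolding mult_entry[OF Ac(1) trunc_carrier ab]
    using ab by (simp add: trunc_def mult_entry[OF Ac(1) B ab] del: index_mult_mat(1))
qed (use blockdiagD(1)[OF A] in \<open>auto simp: trunc_def\<close>)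

lemma trunc_transpose: "A \<in> carrier_mat n n \<Longrightarrow> trunc n J A\<^sup>T = (trunc n J A)\<^sup>T"
  by (rule eq_matI) (auto simp: trunc_def linked_sym)

lemma blockdiag_transpose: "blockdiag n J A \<Longrightarrow> blockdiag n J A\<^sup>T"
  by (auto simp: blockdiag_def linked_sym)

lemma trunc_mult_right:
  assumes A: "A \<in> carrier_mat n n" and B: "blockdiag n J B"
  shows "trunc n J (A * B) = trunc n J A * B"
proof -
  note Bc = blockdiagD(1)[OF B]
  have "(trunc n J (A * B))\<^sup>T = (trunc n J A * B)\<^sup>T"
    using trunc_mult_left[OF blockdiag_transpose[OF B], of "A\<^sup>T"] A Bc
    by (simp add: trunc_transpose[symmetric] transpose_mult[of _ n n _ n])
  then show ?thesis by (metis transpose_transpose)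
qed

lemma blockdiag_mult: "blockdiag n J A \<Longrightarrow> blockdiag n J B \<Longrightarrow> blockdiag n J (A * B)"
  by (simp add: blockdiag_iff[of n J "A * B"] trunc_mult_left trunc_id blockdiagD(1))

lemma trunc_one: "trunc n J (1\<^sub>m n) = 1\<^sub>m n"
  by (rule eq_matI) (auto simp: trunc_def)

lemma blockdiag_inverse:
  assumes "blockdiag n J A" "B \<in> carrier_mat n n" "A * B = 1\<^sub>m n"
  shows "blockdiag n J B"
proof -
  have "A * trunc n J B = 1\<^sub>m n"
    using trunc_mult_left[OF assms(1,2)] assms(3) by (simp add: trunc_one)
  from inverse_unique[OF blockdiagD(1)[OF assms(1)] trunc_carrier assms(2) this assms(3)]
  show ?thesis by (simp add: blockdiag_iff)
qed

text \<open>The unipotent radical of the standard parabolic subgroup with Levi part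
  \<open>J\<close>.\<close>

definition radical :: "nat \<Rightarrow> nat set \<Rightarrow> complex mat \<Rightarrow> bool" where
  "radical n J A \<longleftrightarrow> A \<in> carrier_mat n n \<and> trunc n J A = 1\<^sub>m n \<and>
     (\<forall>a<n. \<forall>b<a. \<not> linked J (Suc a) (Suc b) \<longrightarrow> A $$ (a, b) = 0)"

lemma radical_entry:
  assumes "radical n J A" "a < n" "b < n" "linked J (Suc a) (Suc b)"
  shows "A $$ (a, b) = (if a = b then 1 else 0)"
proof -
  have "A $$ (a, b) = trunc n J A $$ (a, b)" using assms by (simp add: trunc_def)
  then show ?thesis using assms by (simp add: radical_def)
qed

lemma radical_N_plus:
  assumes "radical n J A"
  shows "A \<in> N_plus n"
  unfolding N_plus_iff
proof (intro conjI allI impI)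
  show "A \<in> carrier_mat n n" using assms by (simp add: radical_def)
  fix a assume a: "a < n"
  then show "A $$ (a, a) = 1" using radical_entry[OF assms, of a a] by simp
  fix b assume b: "b < a"
  show "A $$ (a, b) = 0"
  proof (cases "linked J (Suc a) (Suc b)")
    case True
    then show ?thesis using radical_entry[OF assms, of a b] a b by simp
  next
    case False
    then show ?thesis using assms a b by (simp add: radical_def)
  qed
qed

text \<open>The Levi part normalizes the unipotent radical. For the zeros below the diagonal: if
  \<open>a\<close> is linked to \<open>k\<close> and \<open>b\<close> to \<open>l\<close>, while
  \<open>b < a\<close> lie in different runs, then \<open>l < k\<close> because runs are disjoint
  intervals.\<close>

lemma radical_conj:
  assumes B: "blockdiag n J B" "B' \<in> carrier_mat n n" "B * B' = 1\<^sub>m n" and R: "radical n J R"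
  shows "radical n J (B * R * B')"
proof -
  note Bc = blockdiagD[OF B(1)]
  have B': "blockdiag n J B'" by (rule blockdiag_inverse[OF B])
  have Rc: "R \<in> carrier_mat n n" using R by (simp add: radical_def)
  have BR: "B * R \<in> carrier_mat n n" using Bc Rc by simp
  have "trunc n J (B * R * B') = B * trunc n J R * B'"
    using trunc_mult_right[OF BR B'] trunc_mult_left[OF B(1) Rc] by simp
  also have "\<dots> = 1\<^sub>m n" using R B Bc by (simp add: radical_def)
  finally have "trunc n J (B * R * B') = 1\<^sub>m n" .
  moreover have "(B * R * B') $$ (a, b) = 0" if a: "a < n" "b < a" and nl: "\<not> linked J (Suc a) (Suc b)" for a b
  proof -
    have b: "b < n" using a by simp
    have "(B * R) $$ (a, l) * B' $$ (l, b) = 0" if l: "l < n" for l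
    proof (cases "linked J (Suc l) (Suc b)")
      case lb: True
      have "B $$ (a, k) * R $$ (k, l) = 0" if k: "k < n" for k
      proof (cases "linked J (Suc a) (Suc k)")
        case ak: True
        have kl: "\<not> linked J (Suc k) (Suc l)" using lb ak nl by (meson linked_trans)
        have "l < k"
        proof (rule ccontr)
          assume "\<not> l < k"
          then have "k \<le> l" by simp
          then consider "k \<le> b" | "b < k" "a \<le> l" | "b < k" "l < a" by linarith
          then show False
          proof cases
            case 1
            then have "linked J (Suc k) (Suc b)" using linked_between[of J "Suc k" "Suc a" "Suc b"] ak a
              by (simp add: linked_sym)
            then show False using ak nl by (meson linked_trans)
          next
            case 2
            then have "linked J (Suc b) (Suc a)" using linked_between[of J "Suc b" "Suc l" "Suc a"] lb a
              by (simp add: linked_sym)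
            then show False using nl by (simp add: linked_sym)
          next
            case 3
            then have "linked J (Suc b) (Suc k)" 
              using linked_between[of J "Suc b" "Suc l" "Suc k"] lb \<open>k \<le> l\<close> by (simp add: linked_sym)
            then show False using ak nl by (meson linked_trans linked_sym)
          qed
        qed
        then show ?thesis using R k l kl by (simp add: radical_def)
      qed (use Bc(2)[OF a(1) k] in simp)
      then have "(B * R) $$ (a, l) = 0"
        unfolding mult_entry[OF Bc(1) Rc a(1) l] by (intro sum.neutral) simp
      then show ?thesis by simp
    qed (use blockdiagD(2)[OF B' l b] in simp)
    then show ?thesis unfolding mult_entry[OF BR B(2) a(1) b] by (intro sum.neutral) simp
  qed
  ultimately show ?thesis using BR B(2) by (simp add: radical_def)
qed

lemma antilower_lower_mult:
  assumes D: "D \<in> carrier_mat n n" "\<And>a b. b < n \<Longrightarrow> a < b \<Longrightarrow> D $$ (a, b) = 0" and M: "antilower n M"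
  shows "antilower n (D * M)"
proof -
  have Mc: "M \<in> carrier_mat n n" using M by (simp add: antilower_def)
  have "(D * M) $$ (a, b) = 0" if "a < n" "b < n" "a + b + 1 < n" for a b
    unfolding mult_entry[OF D(1) Mc that(1,2)]
  proof (rule sum.neutral, intro ballI)
    fix k assume "k \<in> {..<n}"
    then show "D $$ (a, k) * M $$ (k, b) = 0"
      using that D(2)[of k a] M by (cases "a < k") (auto simp: antilower_def)
  qed
  then show ?thesis using D Mc by (simp add: antilower_def)
qed

lemma antilower_mult_upper:
  assumes M: "antilower n M" and B: "B \<in> carrier_mat n n" "\<And>a b. a < n \<Longrightarrow> b < a \<Longrightarrow> B $$ (a, b) = 0"
  shows "antilower n (M * B)"
proof -
  have Mc: "M \<in> carrier_mat n n" using M by (simp add: antilower_def)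
  have "antilower n (B\<^sup>T * M\<^sup>T)"
    using antilower_lower_mult[of "B\<^sup>T" n "M\<^sup>T"] B antilower_transpose[OF M] by auto
  from antilower_transpose[OF this] show ?thesis
    using Mc B by (simp add: transpose_mult[of _ n n _ n])
qed

lemma lower_inverse:
  assumes A: "A \<in> carrier_mat n n" "\<And>a b. b < n \<Longrightarrow> a < b \<Longrightarrow> A $$ (a, b) = (0::complex)"
    and B: "B \<in> carrier_mat n n" "A * B = 1\<^sub>m n"
    and ab: "b < n" "a < b"
  shows "B $$ (a, b) = 0"
proof -
  have "A\<^sup>T * B\<^sup>T = (B * A)\<^sup>T" using A B by (simp add: transpose_mult[of _ n n _ n])
  also have "\<dots> = 1\<^sub>m n" using mat_mult_left_right_inverse[OF A(1) B] by simp
  finally have "A\<^sup>T * B\<^sup>T = 1\<^sub>m n" .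
  from upper_inverse(1)[OF _ _ _ this, of b a] A B ab show ?thesis by auto
qed

section \<open>The group \<open>SL\<^sub>n\<close> and the subgroups \<open>G\<^sup>J\<close>\<close>

lemma SL_carrier_iff: "A \<in> carrier (SL n) \<longleftrightarrow> A \<in> carrier_mat n n \<and> det A = 1"
  by (simp add: SL_def)

lemma SL_group: "group (SL n)"
proof (rule groupI)
  fix A assume "A \<in> carrier (SL n)"
  then have A: "A \<in> carrier_mat n n" "det A = 1" by (auto simp: SL_def)
  obtain B where "B \<in> carrier_mat n n" "A * B = 1\<^sub>m n" "B * A = 1\<^sub>m n" "det B = 1"
    by (rule det_one_inverse[OF A])
  then show "\<exists>B\<in>carrier (SL n). B \<otimes>\<^bsub>SL n\<^esub> A = \<one>\<^bsub>SL n\<^esub>" by (auto simp: SL_def)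
qed (auto simp: SL_def det_mult mult_assoc_square)

lemma SL_inv:
  assumes "A \<in> carrier (SL n)"
  shows "inv\<^bsub>SL n\<^esub> A \<in> carrier_mat n n" "A * inv\<^bsub>SL n\<^esub> A = 1\<^sub>m n" "inv\<^bsub>SL n\<^esub> A * A = 1\<^sub>m n"
  using group.inv_closed[OF SL_group assms] group.r_inv[OF SL_group assms] group.l_inv[OF SL_group assms]
  by (auto simp: SL_def)

lemma exp_blockdiag:
  assumes "i \<in> J" "1 \<le> i"
  shows "blockdiag n J (exp_plus n i t)" "blockdiag n J (exp_minus n i t)"
proof -
  have l: "linked J i (Suc i)" "linked J (Suc i) i" using assms by (auto simp: linked_Suc linked_sym[of J "Suc i"])
  show "blockdiag n J (exp_plus n i t)" using l assms
    by (auto simp: blockdiag_def exp_plus_entry)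
  show "blockdiag n J (exp_minus n i t)" using l assms
    by (auto simp: blockdiag_def exp_minus_entry)
qed

lemma exp_SL: "1 \<le> i \<Longrightarrow> exp_plus n i t \<in> carrier (SL n)" "1 \<le> i \<Longrightarrow> exp_minus n i t \<in> carrier (SL n)"
  using exp_plus_N_plus[of i n t] exp_minus_N_minus[of i n t]
  by (auto simp: N_plus_def B_plus_def N_minus_def B_minus_def)

lemma G_sub_blockdiag:
  assumes J: "J \<subseteq> {1..<n}" and A: "A \<in> G_sub n J"
  shows "A \<in> carrier (SL n)" "blockdiag n J A"
proof -
  have "A \<in> carrier (SL n) \<and> blockdiag n J A"
    using A unfolding G_sub_def
  proof (induction rule: generate.induct)
    case one
    then show ?case by (auto simp: SL_def blockdiag_def)
  next
    case (incl h)
    then show ?case using J exp_SL exp_blockdiag by auto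
  next
    case (inv h)
    then have h: "h \<in> carrier (SL n)" "blockdiag n J h" using J exp_SL exp_blockdiag by auto
    then show ?case
      using group.inv_closed[OF SL_group h(1)] blockdiag_inverse[OF h(2) SL_inv(1,2)[OF h(1)]] by simp
  next
    case (eng h1 h2)
    then show ?case using group.is_monoid[OF SL_group] blockdiag_mult[of n J h1 h2]
      by (auto simp: SL_def det_mult)
  qed
  then show "A \<in> carrier (SL n)" "blockdiag n J A" by auto
qed

lemma prod_minus_blockdiag:
  assumes "set w \<subseteq> J" "J \<subseteq> {1..<n}"
  shows "blockdiag n J (prod_minus n w ts)"
  using assms(1)
proof (induction w arbitrary: ts)
  case Nil
  then show ?case by (auto simp: prod_minus_Nil blockdiag_def)
next
  case (Cons i w)
  show ?case
  proof (cases ts)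
    case Nil
    then show ?thesis by (auto simp: prod_minus_def blockdiag_def)
  next
    case (Cons t ts')
    have "1 \<le> i" "i \<in> J" using Cons.prems assms(2) by auto
    then show ?thesis using Cons Cons.IH Cons.prems
      by (auto simp: prod_minus_Cons intro!: blockdiag_mult exp_blockdiag)
  qed
qed

text \<open>Conjugation by \<open>W\<close> maps the flag fixed by \<open>B\<^sub>-\<^sup>J\<close> to the one fixed by \<open>B\<^sub>+\<^sup>J\<close>; hence the columns of
  \<open>W\<close> are, up to the reversal \<open>q\<close> of the runs, upper triangular.\<close>

lemma conjugating_matrix_triangular:
  assumes J: "J \<subseteq> {1..<n}" and W: "W \<in> G_sub n J"
    and c: "conjugates n W (B_minus n \<inter> G_sub n J) (B_plus n \<inter> G_sub n J)"
    and q: "\<And>a. a < n \<Longrightarrow> linked J (Suc a) (Suc (q a))" "\<And>a. a < n \<Longrightarrow> q a < n"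
      "\<And>a b. a < b \<Longrightarrow> b < n \<Longrightarrow> linked J (Suc a) (Suc b) \<Longrightarrow> q b < q a"
    and ab: "b < n" "a < n" "q b < a"
  shows "W $$ (a, b) = 0"
proof -
  note Wb = G_sub_blockdiag[OF J W]
  note Wc = blockdiagD[OF Wb(2)]
  have ex: "\<exists>N. N \<in> carrier_mat n n \<and> (\<forall>a b. b < n \<longrightarrow> a < b \<longrightarrow> N $$ (a, b) = 0) \<and> exp_plus n i 1 * W = W * N"
    if i: "i \<in> J" for i
  proof -
    have i1: "1 \<le> i" using i J by auto
    have "exp_plus n i 1 \<in> B_plus n \<inter> G_sub n J"
      using i i1 exp_plus_N_plus[of i n 1] unfolding G_sub_def N_plus_def by (auto intro!: generate.incl)
    then obtain A where A: "A \<in> B_minus n" "exp_plus n i 1 = W * A * inv\<^bsub>SL n\<^esub> W"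
      using c unfolding conjugates_def by (metis (no_types, lifting) IntD1 imageE)
    have Ac: "A \<in> carrier_mat n n" "\<forall>a b. b < n \<longrightarrow> a < b \<longrightarrow> A $$ (a, b) = 0"
      using A by (auto simp: B_minus_def SL_def upper_triangular_def)
    have "exp_plus n i 1 * W = W * A"
      unfolding A(2) using SL_inv[OF Wb(1)] Ac Wc by (simp add: mult_assoc_square[of _ n])
    then show ?thesis using Ac by blast
  qed
  show ?thesis using ab
  proof (induction "n - b" arbitrary: a b rule: less_induct)
    case less
    show ?case
    proof (cases "linked J (Suc a) (Suc b)")
      case lab: True
      have qa: "linked J (Suc (q b)) (Suc a)"
        using lab q(1)[OF less.prems(1)] by (meson linked_trans linked_sym)
      have qa': "linked J (Suc (q b)) a"
        by (rule linked_between[OF qa]) (use less.prems in auto)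
      then have aJ: "a \<in> J" using qa unfolding linked_Suc[symmetric] by (meson linked_trans linked_sym)
      obtain N where N: "N \<in> carrier_mat n n" "\<And>a b. b < n \<Longrightarrow> a < b \<Longrightarrow> N $$ (a, b) = 0"
        "exp_plus n a 1 * W = W * N"
        using ex[OF aJ] by blast
      \<comment> \<open>Columns after \<open>b\<close> in the same run vanish from row
        \<open>q b\<close> on, by the induction from the last column backwards; hence in these rows
        column \<open>b\<close> of \<open>W * N\<close> is a multiple of that of
        \<open>W\<close>.\<close>
      have step: "(exp_plus n a 1 * W) $$ (a', b) = W $$ (a', b) * N $$ (b, b)" 
        if a': "a' < n" "q b \<le> a'" "linked J (Suc a') (Suc b)" for a'
      proof -
        have "W $$ (a', k) * N $$ (k, b) = 0" if k: "k < n" "k \<noteq> b" for k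
        proof (cases "k < b")
          case False
          then have bk: "b < k" using k by simp
          show ?thesis
          proof (cases "linked J (Suc a') (Suc k)")
            case True
            then have "linked J (Suc b) (Suc k)" using a'(3) by (meson linked_trans linked_sym)
            then have "q k < q b" using q(3) bk k by simp
            then have "W $$ (a', k) = 0" using less.hyps[of k a'] bk k a' by simp
            then show ?thesis by simp
          qed (use Wc(2)[OF a'(1) k(1)] in simp)
        qed (use N(2)[OF less.prems(1)] in simp)
        then show ?thesis
          unfolding N(3) mult_entry[OF Wc(1) N(1) a'(1) less.prems(1)]
          by (intro sum_single less.prems(1)) auto
      qed
      have a1: "1 \<le> a" using less.prems by simp
      have 1: "W $$ (a, b) = W $$ (a, b) * N $$ (b, b)"
        using step[of a] less.prems lab a1 by (cases a) (simp_all add: exp_plus_times[OF Wc(1)] del: index_mult_mat(1))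
      have 2: "W $$ (a - 1, b) + W $$ (a, b) = W $$ (a - 1, b) * N $$ (b, b)"
      proof -
        have "linked J a (Suc b)" using qa' q(1)[OF less.prems(1)] by (meson linked_trans linked_sym)
        then show ?thesis
          using step[of "a - 1"] less.prems a1 by (simp add: exp_plus_times[OF Wc(1)] del: index_mult_mat(1))
      qed
      \<comment> \<open>Left multiplication by \<open>exp_plus n a 1\<close> adds row
        \<open>a\<close> to row \<open>a - 1\<close>. Row \<open>a\<close> forces the factor
        \<open>N $$ (b, b)\<close> to be 1 if its entry is nonzero, and then row
        \<open>a - 1\<close> forces that entry to be 0.\<close>
      show ?thesis
      proof (rule ccontr)
        assume "W $$ (a, b) \<noteq> 0"
        then have "N $$ (b, b) = 1" using 1 by simp
        then show False using 2 \<open>W $$ (a, b) \<noteq> 0\<close> by simp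
      qed
    qed (use Wc(2) less.prems in auto)
  qed
qed

definition swap_mat :: "nat \<Rightarrow> (nat \<Rightarrow> nat) \<Rightarrow> complex mat" where
  "swap_mat n q = mat n n (\<lambda>(a, b). if b = q a then 1 else 0)"

lemma swap_mat_carrier [simp]: "swap_mat n q \<in> carrier_mat n n"
  by (simp add: swap_mat_def)

lemma swap_mat_times:
  assumes "A \<in> carrier_mat n n" "a < n" "b < n" "q a < n"
  shows "(swap_mat n q * A) $$ (a, b) = A $$ (q a, b)"
  unfolding mult_entry[OF swap_mat_carrier assms(1-3)]
  by (subst sum_single[OF assms(4)]) (use assms in \<open>auto simp: swap_mat_def\<close>)

lemma times_swap_mat:
  assumes "A \<in> carrier_mat n n" "a < n" "b < n" "\<And>a. a < n \<Longrightarrow> q a < n" "\<And>a. a < n \<Longrightarrow> q (q a) = a"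
  shows "(A * swap_mat n q) $$ (a, b) = A $$ (a, q b)"
  unfolding mult_entry[OF assms(1) swap_mat_carrier assms(2,3)]
proof (subst sum_single[OF assms(4)[OF assms(3)]])
  fix k assume "k < n" "k \<noteq> q b"
  then have "b \<noteq> q k" using assms(5)[of k] by auto
  then show "A $$ (a, k) * swap_mat n q $$ (k, b) = 0"
    using \<open>k < n\<close> assms by (simp add: swap_mat_def)
qed (use assms in \<open>auto simp: swap_mat_def\<close>)

text \<open>If \<open>U\<^sub>- = V V'\<close>, then \<open>V'\<close> lies in the Bruhat cell of \<open>w\<^sub>J w\<^sub>0\<close>, so that the \<open>N\<^sub>+\<close>-factor of
  \<open>U \<in> N\<^sub>+ w\<^sub>0 B\<^sub>+\<close> has Levi part \<open>Vb\<close>.\<close>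

theorem Vbar_row_factor:
  assumes J: "J \<subseteq> {1..<n}" and Vb: "Vbar_row n J V Vb"
    and w: "longest_word n {1..<n} (w1 @ w2)" "longest_word n J w1"
    and t: "length t2 = length w2" "\<forall>t\<in>set t2. t \<noteq> 0"
    and V: "V = prod_minus n w1 t1"
    and B0: "B0 \<in> carrier_mat n n" "\<And>a b. a < n \<Longrightarrow> b < a \<Longrightarrow> B0 $$ (a, b) = 0"
  shows "\<exists>R M. radical n J R \<and> antilower n M \<and> V * prod_minus n w2 t2 * B0 = Vb * R * M"
proof -
  define q where "q a = word_perm w1 (Suc a) - 1" for a
  have rev: "\<exists>lo hi. 1 \<le> lo \<and> hi \<le> n \<and> (\<forall>y. linked J x y \<longleftrightarrow> lo \<le> y \<and> y \<le> hi) \<and>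
      (\<forall>y. lo \<le> y \<longrightarrow> y \<le> hi \<longrightarrow> word_perm w1 y = lo + hi - y)" if x: "1 \<le> x" "x \<le> n" for x
  proof -
    obtain lo hi where lh: "lo \<le> x" "x \<le> hi" "1 \<le> lo" "hi \<le> n" "{lo..<hi} \<subseteq> J" "hi \<notin> J" "lo - 1 \<notin> J"
      "\<And>y. linked J x y \<longleftrightarrow> lo \<le> y \<and> y \<le> hi"
      using run_bounds[OF J x] by blast
    moreover have "word_perm w1 y = lo + hi - y" if "lo \<le> y" "y \<le> hi" for y
      by (rule longest_word_reversal[OF w(2) J lh(5,6,7,3) that])
    ultimately show ?thesis by blast
  qed
  have q: "linked J (Suc a) (Suc (q a)) \<and> q a < n \<and> q (q a) = a \<and> word_perm w1 (Suc a) = Suc (q a) \<and>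
      (\<forall>b<a. linked J (Suc b) (Suc a) \<longrightarrow> q a < q b)" if a: "a < n" for a
  proof -
    obtain lo hi where lh: "1 \<le> lo" "hi \<le> n" "\<And>y. linked J (Suc a) y \<longleftrightarrow> lo \<le> y \<and> y \<le> hi"
      and p: "\<And>y. lo \<le> y \<Longrightarrow> y \<le> hi \<Longrightarrow> word_perm w1 y = lo + hi - y"
      using rev[of "Suc a"] a by auto
    have la: "lo \<le> Suc a" "Suc a \<le> hi" using lh(3)[of "Suc a"] by auto
    have qe: "Suc (q b) = lo + hi - Suc b" if "lo \<le> Suc b" "Suc b \<le> hi" for b
      using p[OF that] that lh(1) by (simp add: q_def)
    have q1: "lo \<le> Suc (q a)" "Suc (q a) \<le> hi" using qe[OF la] la by auto
    show ?thesis
    proof (intro conjI allI impI)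
      show "linked J (Suc a) (Suc (q a))" using lh(3) q1 by simp
      show "q a < n" using q1 lh(2) by simp
      show "q (q a) = a" using qe[OF q1] qe[OF la] la by simp
      show "word_perm w1 (Suc a) = Suc (q a)" using p[OF la] qe[OF la] by simp
      fix b assume b: "b < a" "linked J (Suc b) (Suc a)"
      then have "lo \<le> Suc b" "Suc b \<le> hi" using lh(3)[of "Suc b"] by (auto simp: linked_sym)
      then show "q a < q b" using qe[of b] qe[OF la] b la by simp
    qed
  qed
  define Q where "Q = swap_mat n q"
  have Qc: "Q \<in> carrier_mat n n" by (simp add: Q_def)
  have QA: "(Q * A) $$ (a, b) = A $$ (q a, b)" if "A \<in> carrier_mat n n" "a < n" "b < n" for A a b
    unfolding Q_def using swap_mat_times that q by blast
  have AQ: "(A * Q) $$ (a, b) = A $$ (a, q b)" if "A \<in> carrier_mat n n" "a < n" "b < n" for A a b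
    unfolding Q_def using times_swap_mat that q by blast
  have QQ: "Q * Q = 1\<^sub>m n"
  proof (rule eq_matI)
    fix a b assume "a < dim_row (1\<^sub>m n :: complex mat)" "b < dim_col (1\<^sub>m n :: complex mat)"
    then have ab: "a < n" "b < n" by auto
    have "(Q * Q) $$ (a, b) = Q $$ (q a, b)" by (rule QA[OF Qc ab])
    also have "\<dots> = (1\<^sub>m n) $$ (a, b)" using q ab by (auto simp: Q_def swap_mat_def)
    finally show "(Q * Q) $$ (a, b) = (1\<^sub>m n) $$ (a, b)" .
  qed (use Qc in auto)
  obtain W b where W: "W \<in> G_sub n J" "conjugates n W (B_minus n \<inter> G_sub n J) (B_plus n \<inter> G_sub n J)"
    and VbN: "Vb \<in> N_plus n" and b: "b \<in> B_minus n" "V * W = Vb * b"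
    using Vb unfolding Vbar_row_def by blast
  note Wb = G_sub_blockdiag[OF J W(1)]
  note Wc = blockdiagD[OF Wb(2)]
  define W' where "W' = inv\<^bsub>SL n\<^esub> W"
  have W': "W' \<in> carrier_mat n n" "W * W' = 1\<^sub>m n" "W' * W = 1\<^sub>m n"
    using SL_inv[OF Wb(1)] by (auto simp: W'_def)
  have W'b: "blockdiag n J W'" by (rule blockdiag_inverse[OF Wb(2) W'(1,2)])
  have Vbd: "blockdiag n J V" unfolding V
    by (rule prod_minus_blockdiag[OF _ J]) (use w(2) in \<open>simp add: longest_word_def\<close>)
  note Vc = blockdiagD[OF Vbd]
  note Vbc = N_plusD[OF VbN]
  have bc: "b \<in> carrier_mat n n" "det b = 1" "\<And>x y. y < n \<Longrightarrow> x < y \<Longrightarrow> b $$ (x, y) = 0"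
    using b(1) by (auto simp: B_minus_def SL_def upper_triangular_def)
  \<comment> \<open>\<open>b\<close> is only given as lower triangular, but
    \<open>Vb * b = V * W\<close> is block diagonal; back substitution through the unitriangular
    \<open>Vb\<close>, from the last row upwards, kills the entries of \<open>b\<close> between
    different runs.\<close>
  have bbd: "blockdiag n J b"
  proof -
    have A: "blockdiag n J (Vb * b)" using blockdiag_mult[OF Vbd Wb(2)] b(2) by simp
    have "b $$ (x, y) = 0" if "x < n" "y < n" "\<not> linked J (Suc x) (Suc y)" for x y
    proof (cases "x < y")
      case False
      then have "y < x" using that by (cases "x = y") auto
      then show ?thesis using that
      proof (induction "n - x" arbitrary: x rule: less_induct)
        case less
        have "Vb $$ (x, k) * b $$ (k, y) = 0" if k: "k < n" "k \<noteq> x" for k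
        proof (cases "k < x")
          case False
          then have xk: "x < k" using k by simp
          have "\<not> linked J (Suc k) (Suc y)"
            using linked_between[of J "Suc y" "Suc k" "Suc x"] less.prems xk by (auto simp: linked_sym)
          then have "b $$ (k, y) = 0" using less.hyps[of k] less.prems xk k by simp
          then show ?thesis by simp
        qed (use Vbc(3)[OF less.prems(2)] in simp)
        then have "(Vb * b) $$ (x, y) = Vb $$ (x, x) * b $$ (x, y)"
          unfolding mult_entry[OF Vbc(1) bc(1) less.prems(2,3)] by (intro sum_single less.prems(2)) auto
        then show ?case using blockdiagD(2)[OF A less.prems(2,3,4)] Vbc(4)[OF less.prems(2)] by simp
      qed
    qed (use bc(3) that in auto)
    then show ?thesis using bc by (simp add: blockdiag_def)
  qed
  obtain b' where b': "b' \<in> carrier_mat n n" "b * b' = 1\<^sub>m n" "b' * b = 1\<^sub>m n"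
    using det_one_inverse[OF bc(1,2)] by metis
  have red: "reduced_word n w2" "reduced_word n (w1 @ w2)"
    using w(1) reduced_word_suffix[of n w1 w2] by (auto simp: longest_word_def)
  obtain N L where N: "N \<in> N_plus n" and L: "L \<in> carrier_mat n n"
    and L0: "\<And>c b. c < n \<Longrightarrow> b < c \<Longrightarrow> L $$ (word_perm w2 (Suc c) - 1, b) = 0"
    and NL: "prod_minus n w2 t2 = N * L"
    using prod_minus_factor[OF red(1) t] by blast
  note Nc = N_plusD[OF N]
  \<comment> \<open>Levi decomposition \<open>N = N1 * N2\<close>: the radical factor
    \<open>N1\<close> will move left to \<open>Vb\<close>, and the Levi factor \<open>N2\<close>
    will be absorbed into the antitriangular matrix.\<close>
  define N2 where "N2 = trunc n J N"
  have N2b: "blockdiag n J N2" by (simp add: N2_def trunc_blockdiag)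
  note N2c = blockdiagD[OF N2b]
  have N2N: "N2 \<in> N_plus n" using Nc by (auto simp: N_plus_iff N2_def trunc_def)
  obtain N2' where N2': "N2' \<in> N_plus n" "N2 * N2' = 1\<^sub>m n" "N2' * N2 = 1\<^sub>m n"
    by (rule N_plus_obtain_inverse[OF N2N])
  note N2'c = N_plusD[OF N2'(1)]
  have N2'b: "blockdiag n J N2'" by (rule blockdiag_inverse[OF N2b N2'c(1) N2'(2)])
  define N1 where "N1 = N * N2'"
  have N1: "radical n J N1"
    using trunc_mult_right[OF Nc(1) N2'b] N_plusD[OF N_plus_mult[OF N N2'(1)]] N2'(2)
    by (auto simp: radical_def N1_def N2_def)
  have N1c: "N1 \<in> carrier_mat n n" using N1 by (simp add: radical_def)
  have NN: "N = N1 * N2" unfolding N1_def using Nc N2'c N2c N2'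
    by (simp add: mult_assoc_square[of _ n])
  \<comment> \<open>As \<open>w1 @ w2\<close> represents w_0, row \<open>a\<close> of
    \<open>Q * L\<close> is the row of \<open>L\<close> that starts with n-1-a zeros.\<close>
  have QLa: "antilower n (Q * L)"
    unfolding antilower_def
  proof (intro conjI allI impI)
    fix a y assume a: "a < n" "y < n" "a + y + 1 < n"
    have "word_perm (w1 @ w2) (n - a) = 1 + n - (n - a)"
      by (rule longest_word_reversal[OF w(1) order_refl]) (use a in auto)
    then have "word_perm w1 (word_perm w2 (n - a)) = Suc a" using a by (simp add: word_perm_append)
    also have "\<dots> = word_perm w1 (Suc (q a))" using q[of a] q[of "q a"] a by auto
    finally have "word_perm (rev w1) (word_perm w1 (word_perm w2 (n - a))) = word_perm (rev w1) (word_perm w1 (Suc (q a)))"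
      by (rule arg_cong)
    then have "word_perm w2 (n - a) = Suc (q a)" by simp
    then have "L $$ (q a, y) = 0" using L0[of "n - 1 - a" y] a by (simp add: Suc_diff_Suc)
    then show "(Q * L) $$ (a, y) = 0" using QA[OF L a(1,2)] by simp
  qed (use Qc L in simp)
  define M1 where "M1 = Q * N2 * Q * (Q * L) * B0"
  have M1: "antilower n M1"
    unfolding M1_def
  proof (rule antilower_mult_upper[OF antilower_lower_mult[OF _ _ QLa] B0])
    show "Q * N2 * Q \<in> carrier_mat n n" using Qc N2c by simp
    fix x y assume xy: "y < n" "x < y"
    then have x: "x < n" by simp
    \<comment> \<open>Reversing every run makes the upper triangular Levi factor lower triangular,
      which preserves antitriangularity when applied on the left.\<close>
    have "(Q * N2 * Q) $$ (x, y) = N2 $$ (q x, q y)"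
      using AQ[of "Q * N2" x y] QA[of N2 x "q y"] q[of y] xy x Qc N2c by simp
    also have "\<dots> = 0"
    proof (cases "linked J (Suc x) (Suc y)")
      case True
      then have "q y < q x" using q[of y] xy by blast
      then show ?thesis using N_plusD(3)[OF N2N, of "q x" "q y"] q[OF x] by blast
    next
      case False
      then have "\<not> linked J (Suc (q x)) (Suc (q y))"
        using q[OF x] q[OF xy(1)] by (meson linked_trans linked_sym)
      then show ?thesis using N2c(2) q[OF x] q[OF xy(1)] by blast
    qed
    finally show "(Q * N2 * Q) $$ (x, y) = 0" .
  qed
  have M1c: "M1 \<in> carrier_mat n n" using M1 by (simp add: antilower_def)
  have QM1: "N2 * L * B0 = Q * M1"
  proof -
    have "Q * M1 = (Q * Q) * (N2 * ((Q * Q) * (L * B0)))"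
      unfolding M1_def using Qc N2c L B0 by (simp add: mult_assoc_square[of _ n])
    then show ?thesis using QQ Qc N2c L B0 by (simp add: mult_assoc_square[of _ n])
  qed
  \<comment> \<open>\<open>Q * W\<close> is lower triangular by
    \<open>conjugating_matrix_triangular\<close>, and \<open>c\<close> is its inverse. Writing
    \<open>Q\<close> as \<open>W * c\<close> creates the product \<open>V * W\<close>, which is
    \<open>Vb * b\<close>.\<close>
  define c where "c = W' * Q"
  have cc: "c \<in> carrier_mat n n" using W' Qc by (simp add: c_def)
  have QW: "(Q * W) $$ (x, y) = 0" if "y < n" "x < y" for x y
  proof -
    have x: "x < n" using that by simp
    have "W $$ (q x, y) = 0"
    proof (cases "linked J (Suc x) (Suc y)")
      case True
      then have lt: "q y < q x" using q[OF that(1)] that by blast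
      show ?thesis
        by (rule conjugating_matrix_triangular[OF J W, of q]) (use q that x lt in blast)+
    next
      case False
      then have "\<not> linked J (Suc (q x)) (Suc y)"
        using q[OF x] by (meson linked_trans linked_sym)
      then show ?thesis using Wc(2) q[OF x] that by blast
    qed
    then show ?thesis using QA[OF Wc(1) x that(1)] by simp
  qed
  have "(Q * W) * c = 1\<^sub>m n"
  proof -
    have "(Q * W) * c = Q * ((W * W') * Q)" unfolding c_def using Qc Wc(1) W'(1) by (simp add: mult_assoc_square[of _ n])
    then show ?thesis using W' Qc QQ by simp
  qed
  then have c0: "c $$ (x, y) = 0" if "y < n" "x < y" for x y
    using lower_inverse[of "Q * W" n c y x] QW that Qc Wc cc by simp
  have Wc1: "W * c = Q"
  proof -
    have "W * c = (W * W') * Q" unfolding c_def using Qc Wc(1) W'(1) by (simp add: mult_assoc_square[of _ n])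
    then show ?thesis using W' Qc by simp
  qed
  define R1 where "R1 = W' * N1 * W"
  have R1: "radical n J R1" unfolding R1_def
    by (rule radical_conj[OF W'b Wc(1) W'(3) N1])
  have R1c: "R1 \<in> carrier_mat n n" using R1 by (simp add: radical_def)
  define R where "R = b * R1 * b'"
  have R: "radical n J R" unfolding R_def
    by (rule radical_conj[OF bbd b'(1,2) R1])
  have Rc: "R \<in> carrier_mat n n" using R by (simp add: radical_def)
  define M where "M = b * (c * M1)"
  have M: "antilower n M" unfolding M_def
    by (intro antilower_lower_mult M1 bc cc c0)
  have "V * prod_minus n w2 t2 * B0 = V * N1 * (N2 * L * B0)"
    unfolding NL NN using Vc N1c N2c L B0 by (simp add: mult_assoc_square[of _ n])
  also have "\<dots> = V * N1 * (W * c * M1)" unfolding QM1 Wc1 ..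
  also have "\<dots> = V * (W * W') * N1 * W * c * M1"
    using Vc N1c Wc W' cc M1c by (simp add: mult_assoc_square[of _ n])
  also have "\<dots> = (V * W) * R1 * c * M1"
    unfolding R1_def using Vc N1c Wc W'(1) cc M1c by (simp add: mult_assoc_square[of _ n])
  also have "\<dots> = Vb * b * R1 * (b' * b) * c * M1"
    unfolding b(2) b'(3) using Vbc bc R1c b'(1) cc M1c by (simp add: mult_assoc_square[of _ n])
  also have "\<dots> = Vb * R * M"
    unfolding R_def M_def using Vbc bc R1c b'(1) cc M1c by (simp add: mult_assoc_square[of _ n])
  finally show ?thesis using R M by blast
qed

section \<open>The homomorphism of a Belavin-Drinfeld triple and its action on runs\<close>

section \<open>The homomorphism \<open>\<gamma>\<close> on one-parameter subgroups\<close>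

lemma bold_gamma_hom:
  assumes "is_bold_gamma n \<Gamma> \<phi>"
  shows "\<And>A. A \<in> N_plus n \<Longrightarrow> \<phi> A \<in> N_plus n"
    "\<And>A B. A \<in> N_plus n \<Longrightarrow> B \<in> N_plus n \<Longrightarrow> \<phi> (A * B) = \<phi> A * \<phi> B"
  using assms by (auto simp: is_bold_gamma_def hom_def SL_def)

text \<open>Restriction to the segment from 0 to z reduces this to real functions, taken separately
  for real and imaginary parts.\<close>

lemma complex_zero_derivative_constant:
  fixes f :: "complex \<Rightarrow> complex"
  assumes "\<And>z. (f has_field_derivative 0) (at z)"
  shows "f z = f 0"
proof -
  have d: "((\<lambda>s::real. f (complex_of_real s * z)) has_derivative (\<lambda>_. 0)) (at s)" for s
  proof -
    have "((\<lambda>s::real. complex_of_real s * z) has_derivative (\<lambda>x. complex_of_real x * z)) (at s)"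
      by (intro derivative_eq_intros) auto
    from has_derivative_compose[OF this] assms[of "complex_of_real s * z"] show ?thesis
      by (fastforce simp: has_field_derivative_def)
  qed
  have "((\<lambda>s. Re (f (complex_of_real s * z))) has_real_derivative 0) (at s)"
    "((\<lambda>s. Im (f (complex_of_real s * z))) has_real_derivative 0) (at s)" for s
    using has_derivative_Re[OF d[of s]] has_derivative_Im[OF d[of s]]
    by (simp_all add: has_field_derivative_def flip: lambda_zero)
  then have "Re (f (complex_of_real 1 * z)) = Re (f (complex_of_real 0 * z))"
    "Im (f (complex_of_real 1 * z)) = Im (f (complex_of_real 0 * z))"
    using DERIV_isconst_all[of "\<lambda>s. Re (f (complex_of_real s * z))" 1 0]
      DERIV_isconst_all[of "\<lambda>s. Im (f (complex_of_real s * z))" 1 0] by auto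
  then show ?thesis by (simp add: complex_eq_iff)
qed

text \<open>The homomorphism law carries the derivative at 0 to \<open>g t * D\<close> at every
  \<open>t\<close>. Since \<open>D * D\<close> is 0, the product of \<open>g t\<close> with 1 - t D
  has derivative 0 and stays at 1.\<close>

lemma one_parameter_subgroup:
  assumes D: "D \<in> carrier_mat n n" "D * D = 0\<^sub>m n n"
    and g: "\<And>t. g t \<in> N_plus n" "\<And>s t. g (s + t) = g s * g t"
    and deriv: "has_deriv_at_0 n g D"
  shows "g t = 1\<^sub>m n + t \<cdot>\<^sub>m D"
proof -
  note gc = N_plusD(1)[OF g(1)]
  have g0: "g 0 = 1\<^sub>m n"
  proof -
    obtain B where B: "B \<in> N_plus n" "g 0 * B = 1\<^sub>m n" by (rule N_plus_obtain_inverse[OF g(1)])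
    have "g 0 = g 0 * (g 0 * B)" using B gc[of 0] by simp
    also have "\<dots> = g (0 + 0) * B" unfolding g(2) using gc[of 0] N_plusD(1)[OF B(1)] by (simp add: mult_assoc_square[of _ n])
    finally show ?thesis using B by simp
  qed
  have gd: "((\<lambda>t. g t $$ (a, b)) has_field_derivative (g t * D) $$ (a, b)) (at t)" if ab: "a < n" "b < n" for a b t
  proof -
    have "((\<lambda>h. \<Sum>k<n. g t $$ (a, k) * g h $$ (k, b)) has_field_derivative (\<Sum>k<n. g t $$ (a, k) * D $$ (k, b))) (at 0)"
      using deriv ab by (intro DERIV_sum DERIV_cmult) (auto simp: has_deriv_at_0_def)
    moreover have "(\<lambda>h. \<Sum>k<n. g t $$ (a, k) * g h $$ (k, b)) = (\<lambda>h. g (h + t) $$ (a, b))"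
      using mult_entry[OF gc gc ab, of t] g(2)[of t] by (simp add: add.commute del: index_mult_mat(1))
    ultimately show ?thesis
      using DERIV_shift[of "\<lambda>t. g t $$ (a, b)" "(g t * D) $$ (a, b)" 0 t]
      by (simp add: mult_entry[OF gc D(1) ab] del: index_mult_mat(1))
  qed
  define m where "m t = g t * (1\<^sub>m n + (- t) \<cdot>\<^sub>m D)" for t
  have me: "m t $$ (a, b) = g t $$ (a, b) - t * (\<Sum>k<n. g t $$ (a, k) * D $$ (k, b))" if ab: "a < n" "b < n" for a b t
  proof -
    have "m t = g t + (- t) \<cdot>\<^sub>m (g t * D)"
      unfolding m_def using gc[of t] D by (simp add: mult_add_distrib_mat[of _ n n _ n] mult_smult_distrib[of _ n n _ n])
    then show ?thesis using ab gc[of t] D by (simp add: mult_entry[OF gc D(1) ab] del: index_mult_mat(1))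
  qed
  have md: "((\<lambda>t. m t $$ (a, b)) has_field_derivative 0) (at t)" if ab: "a < n" "b < n" for a b t
  proof -
    have "((\<lambda>t. g t $$ (a, b) - t * (\<Sum>k<n. g t $$ (a, k) * D $$ (k, b))) has_field_derivative
        (g t * D) $$ (a, b) - (1 * (\<Sum>k<n. g t $$ (a, k) * D $$ (k, b)) + (\<Sum>k<n. (g t * D) $$ (a, k) * D $$ (k, b)) * t)) (at t)"
      using ab by (intro DERIV_diff DERIV_mult DERIV_ident DERIV_sum DERIV_cmult_right gd) auto
    moreover have "(\<Sum>k<n. (g t * D) $$ (a, k) * D $$ (k, b)) = 0"
    proof -
      have "g t * D * D = 0\<^sub>m n n" using gc[of t] D by (simp add: mult_assoc_square[of _ n])
      then show ?thesis
        using mult_entry[OF mult_carrier_square[OF gc D(1)] D(1) ab, of t] ab by simp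
    qed
    ultimately show ?thesis using ab by (simp add: me mult_entry[OF gc D(1) ab] del: index_mult_mat(1))
  qed
  have "m t = 1\<^sub>m n"
  proof (rule eq_matI)
    fix a b assume "a < dim_row (1\<^sub>m n :: complex mat)" "b < dim_col (1\<^sub>m n :: complex mat)"
    then have ab: "a < n" "b < n" by auto
    have "m t $$ (a, b) = m 0 $$ (a, b)"
      by (rule complex_zero_derivative_constant) (rule md[OF ab])
    also have "\<dots> = 1\<^sub>m n $$ (a, b)" using ab by (simp add: me g0)
    finally show "m t $$ (a, b) = 1\<^sub>m n $$ (a, b)" .
  qed (use gc[of t] D in \<open>auto simp: m_def\<close>)
  moreover have "(1\<^sub>m n + (- t) \<cdot>\<^sub>m D) * (1\<^sub>m n + t \<cdot>\<^sub>m D) = 1\<^sub>m n"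
  proof -
    have "(1\<^sub>m n + (- t) \<cdot>\<^sub>m D) * (1\<^sub>m n + t \<cdot>\<^sub>m D) = (1\<^sub>m n + t \<cdot>\<^sub>m D) + (- t) \<cdot>\<^sub>m (D * (1\<^sub>m n + t \<cdot>\<^sub>m D))"
      using D by (simp add: add_mult_distrib_mat[of _ n n _ _ n] mult_smult_assoc_mat[of _ n n _ n])
    also have "D * (1\<^sub>m n + t \<cdot>\<^sub>m D) = D"
      using D by (simp add: mult_add_distrib_mat[of _ n n _ n] mult_smult_distrib[of _ n n _ n])
    also have "(1\<^sub>m n + t \<cdot>\<^sub>m D) + (- t) \<cdot>\<^sub>m D = 1\<^sub>m n"
      by (rule eq_matI) (use D in auto)
    finally show ?thesis .
  qed
  ultimately have "g t * (1\<^sub>m n + (- t) \<cdot>\<^sub>m D) * (1\<^sub>m n + t \<cdot>\<^sub>m D) = 1\<^sub>m n + t \<cdot>\<^sub>m D"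
    using D by (simp add: m_def)
  then show ?thesis
    using \<open>(1\<^sub>m n + (- t) \<cdot>\<^sub>m D) * (1\<^sub>m n + t \<cdot>\<^sub>m D) = 1\<^sub>m n\<close> gc[of t] D by (simp add: mult_assoc_square[of _ n])
qed

lemma e_plus_square:
  assumes "1 \<le> i" "i < n"
  shows "e_plus n i \<in> carrier_mat n n" "e_plus n i * e_plus n i = 0\<^sub>m n n"
proof -
  show c: "e_plus n i \<in> carrier_mat n n" by (simp add: e_plus_def)
  have "(e_plus n i * e_plus n i) $$ (a, b) = 0" if "a < n" "b < n" for a b
    unfolding mult_entry[OF c c that] by (rule sum.neutral) (use assms that in \<open>auto simp: e_plus_def\<close>)
  then show "e_plus n i * e_plus n i = 0\<^sub>m n n" using c by (intro eq_matI) auto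
qed

lemma bold_gamma_exp:
  assumes \<Gamma>: "is_bd_triple n \<Gamma>" and \<phi>: "is_bold_gamma n \<Gamma> \<phi>" and i: "1 \<le> i" "i < n"
  shows "\<phi> (exp_plus n i t) = (if i \<in> Gam1 \<Gamma> then exp_plus n (gam \<Gamma> i) t else 1\<^sub>m n)"
proof -
  note h = bold_gamma_hom[OF \<phi>]
  have N: "exp_plus n i t \<in> N_plus n" for t by (rule exp_plus_N_plus[OF i(1)])
  have g: "\<phi> (exp_plus n i t) \<in> N_plus n" "\<phi> (exp_plus n i (s + t)) = \<phi> (exp_plus n i s) * \<phi> (exp_plus n i t)" for s t
    using h N by (simp_all flip: exp_plus_add[OF i])
  show ?thesis
  proof (cases "i \<in> Gam1 \<Gamma>")
    case True
    then have "gam \<Gamma> i \<in> Gam2 \<Gamma>" using \<Gamma> by (auto simp: is_bd_triple_def bij_betw_def)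
    then have gi: "1 \<le> gam \<Gamma> i" "gam \<Gamma> i < n" using \<Gamma> by (auto simp: is_bd_triple_def)
    have "has_deriv_at_0 n (\<lambda>t. \<phi> (exp_plus n i t)) (e_plus n (gam \<Gamma> i))"
      using True \<phi> by (simp add: is_bold_gamma_def)
    from one_parameter_subgroup[OF e_plus_square[OF gi] g this]
    show ?thesis using True by (simp add: exp_plus_def)
  next
    case False
    have "has_deriv_at_0 n (\<lambda>t. \<phi> (exp_plus n i t)) (0\<^sub>m n n)"
      using False i \<phi> by (simp add: is_bold_gamma_def)
    from one_parameter_subgroup[OF _ _ g this]
    show ?thesis using False by (auto intro!: eq_matI)
  qed
qed

section \<open>Generation of \<open>N\<^sub>+\<close>\<close>

definition elemat :: "nat \<Rightarrow> nat \<Rightarrow> nat \<Rightarrow> complex \<Rightarrow> complex mat" where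
  "elemat n a b t = mat n n (\<lambda>(x, y). (if x = y then 1 else 0) + (if x = a \<and> y = b then t else 0))"

lemma elemat_carrier [simp]: "elemat n a b t \<in> carrier_mat n n"
  by (simp add: elemat_def)

lemma elemat_times:
  assumes "A \<in> carrier_mat n n" "b < n" "x < n" "y < n"
  shows "(elemat n a b t * A) $$ (x, y) = A $$ (x, y) + (if x = a then t * A $$ (b, y) else 0)"
proof -
  have "(elemat n a b t * A) $$ (x, y) =
      (\<Sum>k<n. (if k = x then A $$ (x, y) else 0) + (if k = b then if x = a then t * A $$ (b, y) else 0 else 0))"
    unfolding mult_entry[OF elemat_carrier assms(1,3,4)]
    by (rule sum.cong) (use assms in \<open>auto simp: elemat_def algebra_simps\<close>)
  also have "\<dots> = A $$ (x, y) + (if x = a then t * A $$ (b, y) else 0)"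
    using assms unfolding sum.distrib by (subst (1 2) sum.delta) auto
  finally show ?thesis .
qed

lemma elemat_commutator:
  assumes "a < b" "b < c" "c < n"
  shows "elemat n a c t = elemat n a b t * (elemat n b c 1 * (elemat n a b (- t) * elemat n b c (- 1)))"
proof (rule eq_matI)
  let ?X = "elemat n a b (- t) * elemat n b c (- 1)"
  have c: "elemat n b c 1 * ?X \<in> carrier_mat n n" "?X \<in> carrier_mat n n" by simp_all
  have bn: "b < n" using assms by simp
  fix x y assume "x < dim_row (elemat n a b t * (elemat n b c 1 * ?X))" "y < dim_col (elemat n a b t * (elemat n b c 1 * ?X))"
  then have xy: "x < n" "y < n" by (auto simp: elemat_def)
  have X: "?X $$ (x, y) = elemat n b c (- 1) $$ (x, y) + (if x = a then (- t) * elemat n b c (- 1) $$ (b, y) else 0)"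
    if "x < n" for x
    by (rule elemat_times[OF elemat_carrier bn that xy(2)])
  have Y: "(elemat n b c 1 * ?X) $$ (x, y) = ?X $$ (x, y) + (if x = b then 1 * ?X $$ (c, y) else 0)" if "x < n" for x
    by (rule elemat_times[OF c(2) assms(3) that xy(2)])
  show "elemat n a c t $$ (x, y) = (elemat n a b t * (elemat n b c 1 * ?X)) $$ (x, y)"
    unfolding elemat_times[OF c(1) bn xy] Y[OF xy(1)] Y[OF bn] X[OF xy(1)] X[OF bn] X[OF assms(3)]
    using assms xy by (auto simp: elemat_def)
qed (auto simp: elemat_def)

text \<open>N_+ is generated by its simple root subgroups. The set \<open>S\<close> of left
  multipliers preserving \<open>P\<close> is closed under products; commutators give the other root
  subgroups, their products single columns, and these assemble \<open>A\<close> column by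
  column.\<close>

lemma N_plus_induct [consumes 1, case_names one step]:
  assumes A: "A \<in> N_plus n" and one: "P (1\<^sub>m n)"
    and step: "\<And>i t A. 1 \<le> i \<Longrightarrow> i < n \<Longrightarrow> A \<in> N_plus n \<Longrightarrow> P A \<Longrightarrow> P (exp_plus n i t * A)"
  shows "P A"
proof -
  define S where "S = {A \<in> N_plus n. \<forall>B\<in>N_plus n. P B \<longrightarrow> P (A * B)}"
  have S1: "1\<^sub>m n \<in> S" by (auto simp: S_def N_plus_one dest: N_plusD(1))
  have Sm: "A * B \<in> S" if "A \<in> S" "B \<in> S" for A B
  proof -
    have AB: "A \<in> N_plus n" "B \<in> N_plus n" using that by (auto simp: S_def)
    have "P (A * B * C)" if "C \<in> N_plus n" "P C" for C
      using \<open>A \<in> S\<close> \<open>B \<in> S\<close> that N_plus_mult[OF AB(2) that(1)] mult_assoc_square[of A n B C]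
        N_plusD(1)[OF AB(1)] N_plusD(1)[OF AB(2)] N_plusD(1)[OF that(1)]
      by (simp add: S_def)
    then show ?thesis using N_plus_mult[OF AB] by (simp add: S_def)
  qed
  have el: "b < n \<Longrightarrow> a < b \<Longrightarrow> elemat n a b t \<in> S" for a b t
  proof (induction "b - a" arbitrary: a t rule: less_induct)
    case less
    show ?case
    proof (cases "Suc a = b")
      case True
      have "elemat n a b t = exp_plus n b t"
        using True less.prems by (intro eq_matI) (auto simp: elemat_def exp_plus_entry)
      then show ?thesis using step[of b] less.prems exp_plus_N_plus[of b n t] by (auto simp: S_def)
    next
      case False
      then have lt: "Suc a < b" using less.prems by simp
      have "elemat n a (Suc a) s \<in> S" for s
      proof -
        have "elemat n a (Suc a) s = exp_plus n (Suc a) s"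
          using lt less.prems by (intro eq_matI) (auto simp: elemat_def exp_plus_entry)
        then show ?thesis using step[of "Suc a"] lt less.prems exp_plus_N_plus[of "Suc a" n s] by (auto simp: S_def)
      qed
      moreover have "elemat n (Suc a) b s \<in> S" for s using less.hyps[of "Suc a"] lt less.prems by auto
      ultimately show ?thesis
        unfolding elemat_commutator[OF lessI lt less.prems(1)] by (intro Sm)
    qed
  qed
  define col where "col q v k = mat n n (\<lambda>(x, y). (if x = y then 1 else 0) + (if y = q \<and> x < k then v x else 0))"
    for q k :: nat and v :: "nat \<Rightarrow> complex"
  have col: "q < n \<Longrightarrow> k \<le> q \<Longrightarrow> col q v k \<in> S" for q v k
  proof (induction k)
    case 0
    have "col q v 0 = 1\<^sub>m n" by (auto simp: col_def)
    then show ?case using S1 by simp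
  next
    case (Suc k)
    have c: "col q v k \<in> carrier_mat n n" by (simp add: col_def)
    have "col q v (Suc k) = elemat n k q (v k) * col q v k"
    proof (rule eq_matI)
      fix x y assume "x < dim_row (elemat n k q (v k) * col q v k)" "y < dim_col (elemat n k q (v k) * col q v k)"
      then have xy: "x < n" "y < n" using c by (auto simp: elemat_def)
      show "col q v (Suc k) $$ (x, y) = (elemat n k q (v k) * col q v k) $$ (x, y)"
        unfolding elemat_times[OF c Suc.prems(1) xy] using Suc.prems xy by (auto simp: col_def)
    qed (auto simp: col_def elemat_def)
    then show ?case using Suc el[of q k] Sm by auto
  qed
  note Ac = N_plusD[OF A]
  define Ap where "Ap p = mat n n (\<lambda>(x, y). if y < p then A $$ (x, y) else if x = y then 1 else 0)" for p :: nat
  have Apc: "Ap p \<in> carrier_mat n n" for p by (simp add: Ap_def)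
  have "p \<le> n \<Longrightarrow> Ap p \<in> S" for p
  proof (induction p)
    case 0
    have "Ap 0 = 1\<^sub>m n" by (auto simp: Ap_def)
    then show ?case using S1 by simp
  next
    case (Suc p)
    then have p: "p < n" by simp
    let ?c = "col p (\<lambda>x. A $$ (x, p)) p"
    have c: "?c \<in> carrier_mat n n" by (simp add: col_def)
    have "Ap (Suc p) = ?c * Ap p"
    proof (rule eq_matI)
      fix x y assume "x < dim_row (?c * Ap p)" "y < dim_col (?c * Ap p)"
      then have xy: "x < n" "y < n" using c Apc[of p] by auto
      have "(?c * Ap p) $$ (x, y) =
          (\<Sum>k<n. (if k = x then Ap p $$ (x, y) else 0) + (if k = p then if x < p then A $$ (x, p) * Ap p $$ (p, y) else 0 else 0))"
        unfolding mult_entry[OF c Apc xy]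
        by (rule sum.cong) (use xy in \<open>auto simp: col_def algebra_simps\<close>)
      also have "\<dots> = Ap p $$ (x, y) + (if x < p then A $$ (x, p) * Ap p $$ (p, y) else 0)"
        using xy p unfolding sum.distrib by (subst (1 2) sum.delta) auto
      also have "\<dots> = Ap (Suc p) $$ (x, y)"
      proof (cases "y = p")
        case True
        then show ?thesis using xy p Ac(3)[of x p] Ac(4)[of p] 
          by (cases x p rule: linorder_cases) (auto simp: Ap_def)
      next
        case False
        then show ?thesis using xy p Ac(3)[of p y] by (auto simp: Ap_def)
      qed
      finally show "Ap (Suc p) $$ (x, y) = (?c * Ap p) $$ (x, y)" ..
    qed (auto simp: Ap_def col_def)
    then show ?case using Suc Sm col[OF p order_refl] by auto
  qed
  then have "Ap n \<in> S" by simp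
  moreover have "Ap n = A" using Ac by (intro eq_matI) (auto simp: Ap_def)
  ultimately show ?thesis using one N_plus_one Ac(1) by (auto simp: S_def)
qed

section \<open>Belavin--Drinfeld triples\<close>

lemma bd_tripleD:
  assumes "is_bd_triple n \<Gamma>"
  shows "Gam1 \<Gamma> \<subseteq> {1..<n}" "Gam2 \<Gamma> \<subseteq> {1..<n}" "bij_betw (gam \<Gamma>) (Gam1 \<Gamma>) (Gam2 \<Gamma>)"
    "\<And>i. i \<in> Gam1 \<Gamma> \<Longrightarrow> gam \<Gamma> i \<in> Gam2 \<Gamma>"
    "\<And>i j. i \<in> Gam1 \<Gamma> \<Longrightarrow> j \<in> Gam1 \<Gamma> \<Longrightarrow> gam \<Gamma> i = gam \<Gamma> j \<Longrightarrow> i = j"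
    "\<And>i j. i \<in> Gam1 \<Gamma> \<Longrightarrow> j \<in> Gam1 \<Gamma> \<Longrightarrow>
      \<bar>int i - int j\<bar> = 1 \<longleftrightarrow> \<bar>int (gam \<Gamma> i) - int (gam \<Gamma> j)\<bar> = 1"
    "\<And>i. i \<in> Gam1 \<Gamma> \<Longrightarrow> \<exists>m. (gam \<Gamma> ^^ m) i \<notin> Gam1 \<Gamma>"
  using assms by (auto simp: is_bd_triple_def bij_betw_def dest: inj_onD)

text \<open>The columns are glued along the inverse of gamma^c; with this triple they obey the rules
  of the rows.\<close>

definition inv_triple :: "bd_triple \<Rightarrow> bd_triple" where
  "inv_triple \<Gamma> = \<lparr>Gam1 = Gam2 \<Gamma>, Gam2 = Gam1 \<Gamma>, gam = the_inv_into (Gam1 \<Gamma>) (gam \<Gamma>)\<rparr>"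

lemma inv_triple_simps [simp]: "Gam1 (inv_triple \<Gamma>) = Gam2 \<Gamma>" "Gam2 (inv_triple \<Gamma>) = Gam1 \<Gamma>"
  by (simp_all add: inv_triple_def)

lemma inv_triple_gam:
  assumes "is_bd_triple n \<Gamma>"
  shows "i \<in> Gam1 \<Gamma> \<Longrightarrow> gam (inv_triple \<Gamma>) (gam \<Gamma> i) = i"
    "j \<in> Gam2 \<Gamma> \<Longrightarrow> gam (inv_triple \<Gamma>) j \<in> Gam1 \<Gamma>"
    "j \<in> Gam2 \<Gamma> \<Longrightarrow> gam \<Gamma> (gam (inv_triple \<Gamma>) j) = j"
  using bd_tripleD(3)[OF assms]
  by (auto simp: inv_triple_def bij_betw_def the_inv_into_f_f f_the_inv_into_f intro: the_inv_into_into)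

lemma periodic_stays:
  assumes "(f ^^ p) x = x" "0 < p" "\<And>j. j < p \<Longrightarrow> (f ^^ j) x \<in> S"
  shows "(f ^^ m) x \<in> S"
  using funpow_mod_eq[OF assms(1), of m] assms(2) assms(3)[of "m mod p"] by simp

lemma funpow_repeat:
  fixes f :: "nat \<Rightarrow> nat"
  assumes "S \<subseteq> {1..<n}" "\<And>j. j < n \<Longrightarrow> (f ^^ j) x \<in> S" "0 < n"
  obtains a b where "a < b" "b < n" "(f ^^ a) x = (f ^^ b) x"
proof -
  have "\<not> inj_on (\<lambda>j. (f ^^ j) x) {..<n}"
  proof
    assume "inj_on (\<lambda>j. (f ^^ j) x) {..<n}"
    then have "card {..<n} \<le> card {1..<n}"
      using assms by (intro card_inj_on_le[of "\<lambda>j. (f ^^ j) x"]) auto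
    then show False using assms(3) by simp
  qed
  then obtain a b where ab: "a < n" "b < n" "a \<noteq> b" "(f ^^ a) x = (f ^^ b) x"
    by (auto simp: inj_on_def)
  show thesis
  proof (cases "a < b")
    case True
    then show ?thesis using that ab by blast
  next
    case False
    then show ?thesis using that[of b a] ab by simp
  qed
qed

text \<open>An orbit that stays in Gamma_1 for \<open>n\<close> steps repeats a value and hence
  never leaves. This bounds the exponents in H^r uniformly.\<close>

lemma bd_triple_leaves:
  assumes \<Gamma>: "is_bd_triple n \<Gamma>" and i: "i \<in> Gam1 \<Gamma>"
  shows "\<exists>j<n. (gam \<Gamma> ^^ j) i \<notin> Gam1 \<Gamma>"
proof (rule ccontr)
  note D = bd_tripleD[OF \<Gamma>]
  assume "\<not> ?thesis"
  then have s: "j < n \<Longrightarrow> (gam \<Gamma> ^^ j) i \<in> Gam1 \<Gamma>" for j by blast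
  have n: "0 < n" using i D(1) by auto
  obtain a b where ab: "a < b" "b < n" "(gam \<Gamma> ^^ a) i = (gam \<Gamma> ^^ b) i"
    using funpow_repeat[OF D(1) s n] by blast
  define x where "x = (gam \<Gamma> ^^ a) i"
  have fx: "(gam \<Gamma> ^^ j) x = (gam \<Gamma> ^^ (j + a)) i" for j by (simp add: x_def funpow_add)
  have "(gam \<Gamma> ^^ m) x \<in> Gam1 \<Gamma>" for m
    by (rule periodic_stays[where p = "b - a"]) (use ab s in \<open>auto simp: fx, simp add: x_def\<close>)
  moreover have "x \<in> Gam1 \<Gamma>" using s[of a] ab by (simp add: x_def)
  ultimately show False using D(7) by blast
qed

text \<open>For nilpotency: a backward orbit that never leaves Gamma_2 repeats a value by
  finiteness, and read forwards it is a periodic orbit of gamma inside Gamma_1.\<close>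

lemma inv_triple_bd:
  assumes \<Gamma>: "is_bd_triple n \<Gamma>"
  shows "is_bd_triple n (inv_triple \<Gamma>)"
proof -
  note D = bd_tripleD[OF \<Gamma>] and I = inv_triple_gam[OF \<Gamma>]
  let ?g = "gam (inv_triple \<Gamma>)"
  have "bij_betw ?g (Gam2 \<Gamma>) (Gam1 \<Gamma>)"
    using bij_betw_the_inv_into[OF D(3)] by (simp add: inv_triple_def)
  moreover have "\<bar>int i - int j\<bar> = 1 \<longleftrightarrow> \<bar>int (?g i) - int (?g j)\<bar> = 1" if "i \<in> Gam2 \<Gamma>" "j \<in> Gam2 \<Gamma>" for i j
    using D(6)[OF I(2)[OF that(1)] I(2)[OF that(2)]] I(3) that by simp
  moreover have "\<exists>m. (\<forall>j<m. (?g ^^ j) i \<in> Gam2 \<Gamma>) \<and> (?g ^^ m) i \<notin> Gam2 \<Gamma>" if i: "i \<in> Gam2 \<Gamma>" for i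
  proof -
    have "\<exists>m. (?g ^^ m) i \<notin> Gam2 \<Gamma>"
    proof (rule ccontr)
      assume "\<nexists>m. (?g ^^ m) i \<notin> Gam2 \<Gamma>"
      then have s: "(?g ^^ m) i \<in> Gam2 \<Gamma>" for m by blast
      have n: "0 < n" using i D(2) by auto
      obtain a b where ab: "a < b" "b < n" "(?g ^^ a) i = (?g ^^ b) i"
        using funpow_repeat[OF D(2) s n] by blast
      have bk: "j \<le> m \<Longrightarrow> (gam \<Gamma> ^^ j) ((?g ^^ m) i) = (?g ^^ (m - j)) i" for j m
      proof (induction j)
        case (Suc j)
        have "m - j = Suc (m - Suc j)" using Suc.prems by simp
        then show ?case using Suc I(3)[OF s] by simp
      qed simp
      define x where "x = (?g ^^ b) i"
      have g1: "(?g ^^ Suc m) i \<in> Gam1 \<Gamma>" for m using I(2)[OF s[of m]] by simp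
      have "(gam \<Gamma> ^^ m) x \<in> Gam1 \<Gamma>" for m
      proof (rule periodic_stays[where p = "b - a"])
        show "(gam \<Gamma> ^^ (b - a)) x = x" using bk[of "b - a" b] ab by (simp add: x_def)
        show "0 < b - a" using ab by simp
        fix j assume "j < b - a"
        then have "b - j = Suc (b - j - 1)" "j \<le> b" by auto
        then show "(gam \<Gamma> ^^ j) x \<in> Gam1 \<Gamma>" using bk[of j b] g1[of "b - j - 1"] by (simp add: x_def)
      qed
      moreover from this[of 0] have "x \<in> Gam1 \<Gamma>" by simp
      ultimately show False using D(7) by blast
    qed
    then have l: "(?g ^^ (LEAST m. (?g ^^ m) i \<notin> Gam2 \<Gamma>)) i \<notin> Gam2 \<Gamma>" by (rule LeastI_ex)
    show ?thesis
      by (rule exI[of _ "LEAST m. (?g ^^ m) i \<notin> Gam2 \<Gamma>"]) (use l not_less_Least in blast)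
  qed
  ultimately show ?thesis using D(1,2) unfolding is_bd_triple_def by simp
qed

lemma component_mono:
  assumes "v \<in> component S u" "w \<in> component S u" "min v w \<le> z" "z \<le> max v w"
  shows "z \<in> component S u" "z \<in> S"
proof -
  have "{min u z..max u z} \<subseteq> {min u v..max u v} \<union> {min u w..max u w}" using assms(3,4) by auto
  then show "z \<in> component S u" using assms(1,2) unfolding component_def by blast
  then show "z \<in> S" by (auto simp: component_def)
qed

lemma component_subset: "v \<in> component S u \<Longrightarrow> v \<in> S"
  by (auto simp: component_def)

lemma component_self: "u \<in> S \<Longrightarrow> u \<in> component S u"
  by (simp add: component_def)

definition orient :: "bd_triple \<Rightarrow> nat \<Rightarrow> int" where
  "orient \<Gamma> u = (if preserves_orientation \<Gamma> u then 1 else - 1)"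

text \<open>Consecutive roots go to neighbours by isometry, and injectivity forbids turning
  back.\<close>

lemma gam_step_constant:
  assumes \<Gamma>: "is_bd_triple n \<Gamma>"
    and "v \<in> component (Gam1 \<Gamma>) u" "Suc v \<in> component (Gam1 \<Gamma>) u"
    and "w \<in> component (Gam1 \<Gamma>) u" "Suc w \<in> component (Gam1 \<Gamma>) u"
  shows "int (gam \<Gamma> (Suc v)) - int (gam \<Gamma> v) = int (gam \<Gamma> (Suc w)) - int (gam \<Gamma> w)"
proof -
  note D = bd_tripleD[OF \<Gamma>]
  let ?C = "component (Gam1 \<Gamma>) u"
  have up: "int (gam \<Gamma> (Suc (v + k))) - int (gam \<Gamma> (v + k)) = int (gam \<Gamma> (Suc v)) - int (gam \<Gamma> v)"
    if "v \<in> ?C" "Suc v \<in> ?C" "Suc (v + k) \<in> ?C" for v k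
    using that(3)
  proof (induction k)
    case (Suc k)
    have c: "v + k \<in> Gam1 \<Gamma>" "Suc (v + k) \<in> Gam1 \<Gamma>" "Suc (Suc (v + k)) \<in> Gam1 \<Gamma>" "Suc (v + k) \<in> ?C"
      using component_mono[OF that(1) Suc.prems] by auto
    have "\<bar>int (gam \<Gamma> (v + k)) - int (gam \<Gamma> (Suc (v + k)))\<bar> = 1"
      using D(6)[OF c(1,2)] by simp
    moreover have "\<bar>int (gam \<Gamma> (Suc (v + k))) - int (gam \<Gamma> (Suc (Suc (v + k))))\<bar> = 1"
      using D(6)[OF c(2,3)] by simp
    moreover have "gam \<Gamma> (v + k) \<noteq> gam \<Gamma> (Suc (Suc (v + k)))" using D(5)[OF c(1,3)] by auto
    ultimately have "int (gam \<Gamma> (Suc (Suc (v + k)))) - int (gam \<Gamma> (Suc (v + k))) =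
        int (gam \<Gamma> (Suc (v + k))) - int (gam \<Gamma> (v + k))" by linarith
    then show ?case using Suc.IH[OF c(4)] by simp
  qed simp
  show ?thesis
  proof (cases "v \<le> w")
    case True
    then show ?thesis using up[of v "w - v"] assms by simp
  next
    case False
    then show ?thesis using up[of w "v - w"] assms by simp
  qed
qed

lemma gam_step:
  assumes \<Gamma>: "is_bd_triple n \<Gamma>"
    and v: "v \<in> component (Gam1 \<Gamma>) u" "Suc v \<in> component (Gam1 \<Gamma>) u"
  shows "int (gam \<Gamma> (Suc v)) - int (gam \<Gamma> v) = orient \<Gamma> u"
proof (cases "preserves_orientation \<Gamma> u")
  case True
  then show ?thesis using v by (simp add: orient_def preserves_orientation_def)
next
  case False
  then obtain w where w: "w \<in> component (Gam1 \<Gamma>) u" "Suc w \<in> component (Gam1 \<Gamma>) u" "gam \<Gamma> (Suc w) \<noteq> gam \<Gamma> w + 1"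
    by (auto simp: preserves_orientation_def)
  have "\<bar>int w - int (Suc w)\<bar> = 1" by simp
  then have "\<bar>int (gam \<Gamma> w) - int (gam \<Gamma> (Suc w))\<bar> = 1"
    using bd_tripleD(6)[OF \<Gamma>, of w "Suc w"] component_mono(2)[OF w(1,2)] by simp
  then have "int (gam \<Gamma> (Suc w)) - int (gam \<Gamma> w) = - 1" using w(3) by linarith
  then show ?thesis using gam_step_constant[OF \<Gamma> v w(1,2)] False by (simp add: orient_def)
qed

lemma gam_affine:
  assumes \<Gamma>: "is_bd_triple n \<Gamma>" and u: "u \<in> Gam1 \<Gamma>" and j: "j \<in> component (Gam1 \<Gamma>) u"
  shows "int (gam \<Gamma> j) - int (gam \<Gamma> u) = orient \<Gamma> u * (int j - int u)"
proof -
  let ?C = "component (Gam1 \<Gamma>) u"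
  have up: "int (gam \<Gamma> (v + k)) - int (gam \<Gamma> v) = orient \<Gamma> u * int k"
    if "v \<in> ?C" "v + k \<in> ?C" for v k using that(2)
  proof (induction k)
    case (Suc k)
    have c: "v + k \<in> ?C" using component_mono[OF that(1) Suc.prems] by auto
    show ?case using Suc.IH[OF c] gam_step[OF \<Gamma> c] Suc.prems by (simp add: algebra_simps)
  qed simp
  note us = component_self[OF u]
  show ?thesis
  proof (cases "u \<le> j")
    case True
    then show ?thesis using up[of u "j - u"] us j by (simp add: of_nat_diff)
  next
    case False
    then have "int (gam \<Gamma> u) - int (gam \<Gamma> j) = orient \<Gamma> u * (int u - int j)"
      using up[of j "u - j"] us j by (simp add: of_nat_diff)
    then show ?thesis by (simp add: algebra_simps)
  qed
qed

lemma orient_values: "orient \<Gamma> u = 1 \<or> orient \<Gamma> u = - 1"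
  by (simp add: orient_def)

lemma gam_component:
  assumes \<Gamma>: "is_bd_triple n \<Gamma>" and u: "u \<in> Gam1 \<Gamma>" and j: "j \<in> component (Gam1 \<Gamma>) u"
  shows "gam \<Gamma> j \<in> component (Gam2 \<Gamma>) (gam \<Gamma> u)"
  unfolding component_def
proof (intro CollectI subsetI)
  fix z assume z: "z \<in> {min (gam \<Gamma> u) (gam \<Gamma> j)..max (gam \<Gamma> u) (gam \<Gamma> j)}"
  define y where "y = int u + orient \<Gamma> u * (int z - int (gam \<Gamma> u))"
  have y: "min (int u) (int j) \<le> y" "y \<le> max (int u) (int j)"
    using gam_affine[OF \<Gamma> u j] z orient_values[of \<Gamma> u] unfolding y_def by auto
  then have y0: "0 \<le> y" by linarith
  then obtain k where k: "y = int k" using nonneg_int_cases by blast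
  then have "min u j \<le> k" "k \<le> max u j" using y by auto
  note kc = component_mono[OF component_self[OF u] j this]
  have "int (gam \<Gamma> k) - int (gam \<Gamma> u) = orient \<Gamma> u * (int k - int u)" by (rule gam_affine[OF \<Gamma> u kc(1)])
  then have "gam \<Gamma> k = z" using orient_values[of \<Gamma> u] k unfolding y_def by auto
  then show "z \<in> Gam2 \<Gamma>" using bd_tripleD(4)[OF \<Gamma> kc(2)] by simp
qed

lemma inv_triple_orient:
  assumes \<Gamma>: "is_bd_triple n \<Gamma>" and u: "u \<in> Gam1 \<Gamma>"
  shows "orient (inv_triple \<Gamma>) (gam \<Gamma> u) = orient \<Gamma> u"
proof -
  note \<Gamma>' = inv_triple_bd[OF \<Gamma>] and I = inv_triple_gam[OF \<Gamma>]
  have u': "gam \<Gamma> u \<in> Gam1 (inv_triple \<Gamma>)" using bd_tripleD(4)[OF \<Gamma> u] by simp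
  have "preserves_orientation (inv_triple \<Gamma>) (gam \<Gamma> u) \<longleftrightarrow> preserves_orientation \<Gamma> u"
  proof
    assume p: "preserves_orientation \<Gamma> u"
    show "preserves_orientation (inv_triple \<Gamma>) (gam \<Gamma> u)"
      unfolding preserves_orientation_def
    proof (intro allI impI)
      fix v assume v: "v \<in> component (Gam1 (inv_triple \<Gamma>)) (gam \<Gamma> u) \<and> Suc v \<in> component (Gam1 (inv_triple \<Gamma>)) (gam \<Gamma> u)"
      let ?g = "gam (inv_triple \<Gamma>)"
      have c: "?g v \<in> component (Gam1 \<Gamma>) u" "?g (Suc v) \<in> component (Gam1 \<Gamma>) u"
        using gam_component[OF \<Gamma>' u'] v I(1)[OF u] by auto
      have m: "v \<in> Gam2 \<Gamma>" "Suc v \<in> Gam2 \<Gamma>" using v by (auto dest: component_subset)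
      have "\<bar>int (?g v) - int (?g (Suc v))\<bar> = 1"
        using bd_tripleD(6)[OF \<Gamma>', of v "Suc v"] m by simp
      moreover have "int (?g v) \<noteq> int (?g (Suc v)) + 1"
      proof
        assume that: "int (?g v) = int (?g (Suc v)) + 1"
        have e: "?g v = Suc (?g (Suc v))" using that by simp
        then have "gam \<Gamma> (?g v) = gam \<Gamma> (?g (Suc v)) + 1"
          using p c unfolding preserves_orientation_def by simp
        then show False using I(3) m by simp
      qed
      ultimately show "?g (Suc v) = ?g v + 1" by linarith
    qed
  next
    assume p: "preserves_orientation (inv_triple \<Gamma>) (gam \<Gamma> u)"
    show "preserves_orientation \<Gamma> u"
      unfolding preserves_orientation_def
    proof (intro allI impI)
      fix v assume v: "v \<in> component (Gam1 \<Gamma>) u \<and> Suc v \<in> component (Gam1 \<Gamma>) u"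
      have c: "gam \<Gamma> v \<in> component (Gam2 \<Gamma>) (gam \<Gamma> u)" "gam \<Gamma> (Suc v) \<in> component (Gam2 \<Gamma>) (gam \<Gamma> u)"
        using gam_component[OF \<Gamma> u] v by auto
      have m: "v \<in> Gam1 \<Gamma>" "Suc v \<in> Gam1 \<Gamma>" using v by (auto dest: component_subset)
      have "\<bar>int (gam \<Gamma> v) - int (gam \<Gamma> (Suc v))\<bar> = 1"
        using bd_tripleD(6)[OF \<Gamma>, of v "Suc v"] m by simp
      moreover have "int (gam \<Gamma> v) \<noteq> int (gam \<Gamma> (Suc v)) + 1"
      proof
        assume that: "int (gam \<Gamma> v) = int (gam \<Gamma> (Suc v)) + 1"
        have e: "gam \<Gamma> v = Suc (gam \<Gamma> (Suc v))" using that by simp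
        then have "gam (inv_triple \<Gamma>) (gam \<Gamma> v) = gam (inv_triple \<Gamma>) (gam \<Gamma> (Suc v)) + 1"
          using p c unfolding preserves_orientation_def by simp
        then show False using I(1) m by simp
      qed
      ultimately show "gam \<Gamma> (Suc v) = gam \<Gamma> v + 1" by linarith
    qed
  qed
  then show ?thesis by (simp add: orient_def)
qed

section \<open>Dual indices\<close>

text \<open>The place of the simple root \<open>i\<close> in a primal or dual block;
  \<open>dagger\<close> exchanges i and n-i (see \<open>dagger_exp_plus\<close>). With
  \<open>fl\<close>, dual runs become ordinary runs of the reflected set.\<close>

definition fi :: "nat \<Rightarrow> bool \<Rightarrow> nat \<Rightarrow> nat" where
  "fi n d i = (if d then n - i else i)"

definition fl :: "nat \<Rightarrow> bool \<Rightarrow> nat set \<Rightarrow> nat set" where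
  "fl n d J = fi n d ` J"

lemma fi_range: "1 \<le> i \<Longrightarrow> i < n \<Longrightarrow> 1 \<le> fi n d i \<and> fi n d i < n"
  by (auto simp: fi_def)

lemma fi_fi [simp]: "i \<le> n \<Longrightarrow> fi n d (fi n d i) = i"
  by (simp add: fi_def)

lemma fl_subset: "J \<subseteq> {1..<n} \<Longrightarrow> fl n d J \<subseteq> {1..<n}"
  using fi_range[of _ n d] unfolding fl_def by (fastforce simp: subset_iff)

lemma fi_in_fl: "J \<subseteq> {1..<n} \<Longrightarrow> i \<le> n \<Longrightarrow> i \<in> fl n d J \<longleftrightarrow> fi n d i \<in> J"
proof
  assume "J \<subseteq> {1..<n}" "i \<in> fl n d J"
  then show "fi n d i \<in> J" by (auto simp: fl_def)
next
  assume "i \<le> n" "fi n d i \<in> J"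
  then show "i \<in> fl n d J" unfolding fl_def by (metis fi_fi imageI)
qed

lemma dual_run_eq:
  assumes J: "J \<subseteq> {1..<n}" and k: "1 \<le> k" "k \<le> n"
  shows "dual_run n J k = run n (fl n True J) k"
proof -
  have m: "z \<in> fl n True J \<longleftrightarrow> n - z \<in> J" if "z \<le> n" for z
    using fi_in_fl[OF J that, of True] by (simp add: fi_def)
  have *: "{min k l..<max k l} \<subseteq> fl n True J \<longleftrightarrow> {min (n+1-k) (n+1-l)..<max (n+1-k) (n+1-l)} \<subseteq> J"
    (is "?A \<subseteq> ?F \<longleftrightarrow> ?B \<subseteq> J") if l: "1 \<le> l" "l \<le> n" for l
  proof
    assume a: "?A \<subseteq> ?F"
    show "?B \<subseteq> J"
    proof
      fix z assume z: "z \<in> ?B"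
      then have "n - z \<in> ?A" "z \<le> n" using k l by (auto simp: min_def max_def split: if_splits)
      then show "z \<in> J" using a m[of "n - z"] by auto
    qed
  next
    assume a: "?B \<subseteq> J"
    show "?A \<subseteq> ?F"
    proof
      fix z assume z: "z \<in> ?A"
      then have "n - z \<in> ?B" "z \<le> n" using k l by (auto simp: min_def max_def split: if_splits)
      then show "z \<in> ?F" using a m[of z] by auto
    qed
  qed
  show ?thesis
  proof (rule Set.set_eqI)
    fix l
    show "l \<in> dual_run n J k \<longleftrightarrow> l \<in> run n (fl n True J) k"
    proof
      assume "l \<in> dual_run n J k"
      then obtain l' where "l' \<in> run n J (n + 1 - k)" "l = n + 1 - l'" by (auto simp: dual_run_def)
      moreover from this have "1 \<le> l" "l \<le> n" "n + 1 - l = l'" by (auto simp: run_def)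
      ultimately show "l \<in> run n (fl n True J) k" using *[of l] by (simp add: run_def)
    next
      assume "l \<in> run n (fl n True J) k"
      then have l: "1 \<le> l" "l \<le> n" "n + 1 - l \<in> run n J (n + 1 - k)" using *[of l] by (auto simp: run_def)
      then have "l = n + 1 - (n + 1 - l)" by simp
      then show "l \<in> dual_run n J k" unfolding dual_run_def using l(3) by blast
    qed
  qed
qed

lemma linked_fl:
  assumes J: "J \<subseteq> {1..<n}" and l: "1 \<le> k" "k \<le> n" "1 \<le> l" "l \<le> n"
  shows "linked (fl n True J) k l \<longleftrightarrow> linked J (n + 1 - k) (n + 1 - l)"
proof -
  have "l \<in> run n (fl n True J) k \<longleftrightarrow> n + 1 - l \<in> run n J (n + 1 - k)"
    unfolding dual_run_eq[OF J l(1,2), symmetric] dual_run_def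
  proof
    assume "l \<in> (\<lambda>l. n + 1 - l) ` run n J (n + 1 - k)"
    then obtain l' where "l' \<in> run n J (n + 1 - k)" "l = n + 1 - l'" by auto
    then show "n + 1 - l \<in> run n J (n + 1 - k)" by (auto simp: run_def)
  next
    assume "n + 1 - l \<in> run n J (n + 1 - k)"
    moreover have "l = n + 1 - (n + 1 - l)" using l by simp
    ultimately show "l \<in> (\<lambda>l. n + 1 - l) ` run n J (n + 1 - k)" by blast
  qed
  then show ?thesis using l by (auto simp: run_eq_linked)
qed

lemma run_of_eq:
  assumes "is_bd_triple n \<Gamma>" "1 \<le> k" "k \<le> n"
  shows "run_of n \<Gamma> p d k = run n (fl n d (case p of Upper \<Rightarrow> Gam1 \<Gamma> | Lower \<Rightarrow> Gam2 \<Gamma>)) k"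
proof -
  have "fl n False J = J" for J by (auto simp: fl_def fi_def)
  then show ?thesis
    using dual_run_eq[OF _ assms(2,3)] bd_tripleD(1,2)[OF assms(1)]
    by (cases p; cases d) (auto simp: run_of_def Let_def)
qed

text \<open>gamma has slope 1 or -1 on a component. Changing between primal and dual exactly in the
  second case makes the slope 1 throughout, which is why gluing is always a translation.\<close>

lemma gam_affine_fi:
  assumes \<Gamma>: "is_bd_triple n \<Gamma>" and u: "u \<in> Gam1 \<Gamma>" and j: "j \<in> component (Gam1 \<Gamma>) u"
    and d': "d' = (d \<noteq> (\<not> preserves_orientation \<Gamma> u))"
  shows "int (fi n d' (gam \<Gamma> j)) - int (fi n d' (gam \<Gamma> u)) = int (fi n d j) - int (fi n d u)"
proof -
  note D = bd_tripleD[OF \<Gamma>]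
  have jG: "j \<in> Gam1 \<Gamma>" using component_mono(2)[OF j j, of j] by simp
  have "u < n" "j < n" "gam \<Gamma> u < n" "gam \<Gamma> j < n" using D(1,2) D(4)[OF u] D(4)[OF jG] u jG by auto
  then show ?thesis using gam_affine[OF \<Gamma> u j] d'
    by (cases "preserves_orientation \<Gamma> u"; cases d) (auto simp: orient_def fi_def of_nat_diff)
qed

lemma linked_fi_component:
  assumes J: "J \<subseteq> {1..<n}" and u: "u \<in> J" and x: "linked (fl n d J) (fi n d u) x" "x \<in> fl n d J"
  shows "fi n d x \<in> component J u"
  unfolding component_def
proof (intro CollectI subsetI)
  have xr: "x < n" "1 \<le> x" "u < n" "1 \<le> u" using fl_subset[OF J, of d] x(2) u J by auto
  fix z assume z: "z \<in> {min u (fi n d x)..max u (fi n d x)}"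
  then have zn: "z < n" using xr by (auto simp: fi_def split: if_splits)
  have c: "fi n d u \<in> fl n d J" using u by (simp add: fl_def)
  have "fi n d z \<in> fl n d J"
  proof (cases "fi n d z = max (fi n d u) x")
    case True
    then show ?thesis using c x(2) by (simp add: max_def split: if_splits)
  next
    case False
    then have "fi n d z \<in> {min (fi n d u) x..<max (fi n d u) x}"
      using z zn xr by (cases d) (auto simp: fi_def min_def max_def split: if_splits)
    then show ?thesis using x(1) unfolding linked_def by blast
  qed
  moreover have "fi n d z \<le> n" using zn by (simp add: fi_def)
  ultimately show "z \<in> J" using fi_in_fl[OF J, of "fi n d z" d] zn by simp
qed

text \<open>Every link of the run is translated by \<open>gam_affine_fi\<close>. The translation is
  encoded by an equation between sums because it may go in either direction.\<close>

lemma linked_transport: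
  assumes \<Gamma>: "is_bd_triple n \<Gamma>" and u: "u \<in> Gam1 \<Gamma>"
    and d': "d' = (d \<noteq> (\<not> preserves_orientation \<Gamma> u))"
    and x: "linked (fl n d (Gam1 \<Gamma>)) (fi n d u) x"
  shows "\<exists>x'. x + fi n d' (gam \<Gamma> u) = x' + fi n d u \<and> linked (fl n d' (Gam2 \<Gamma>)) (fi n d' (gam \<Gamma> u)) x'"
proof -
  note D = bd_tripleD[OF \<Gamma>]
  let ?c = "fi n d u" and ?v = "fi n d' (gam \<Gamma> u)"
  have pt: "\<exists>z'. z + ?v = z' + ?c \<and> z' \<in> fl n d' (Gam2 \<Gamma>)" if z: "z \<in> {min ?c x..<max ?c x}" for z
  proof -
    have zJ: "z \<in> fl n d (Gam1 \<Gamma>)" using x z unfolding linked_def by blast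
    have zn: "z < n" using fl_subset[OF D(1), of d] zJ by auto
    have "linked (fl n d (Gam1 \<Gamma>)) ?c z"
    proof -
      have "{min ?c z..<max ?c z} \<subseteq> {min ?c x..<max ?c x}" using z by auto
      then show ?thesis using x unfolding linked_def by blast
    qed
    note c = linked_fi_component[OF D(1) u this zJ]
    note a = gam_affine_fi[OF \<Gamma> u c d']
    have "fi n d z \<in> Gam1 \<Gamma>" using component_mono(2)[OF c c, of "fi n d z"] by simp
    then have "fi n d' (gam \<Gamma> (fi n d z)) \<in> fl n d' (Gam2 \<Gamma>)" using D(4) by (auto simp: fl_def)
    moreover have "z + ?v = fi n d' (gam \<Gamma> (fi n d z)) + ?c" using a zn by simp
    ultimately show ?thesis by blast
  qed
  have "?c \<le> x + ?v"
  proof (cases "x < ?c")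
    case True
    then show ?thesis using pt[of x] by auto
  qed simp
  then obtain x' where x': "x + ?v = x' + ?c" by (metis le_add_diff_inverse2)
  have "{min ?v x'..<max ?v x'} \<subseteq> fl n d' (Gam2 \<Gamma>)"
  proof
    fix z' assume z': "z' \<in> {min ?v x'..<max ?v x'}"
    have "?v \<le> z' + ?c"
    proof (cases "x' < ?v")
      case True
      then show ?thesis using x' z' by auto
    qed (use z' in auto)
    then obtain z where z: "z + ?v = z' + ?c" by (metis le_add_diff_inverse2)
    then have "z \<in> {min ?c x..<max ?c x}" using z' x' by (auto simp: min_def max_def split: if_splits)
    from pt[OF this] z show "z' \<in> fl n d' (Gam2 \<Gamma>)" by auto
  qed
  then show ?thesis using x' unfolding linked_def by blast
qed

section \<open>Transport of runs by \<open>\<gamma>\<close>\<close>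

lemma N_plus_mult_entry:
  assumes "A \<in> N_plus n" "B \<in> N_plus n" "a < n" "b < n"
  shows "(A * B) $$ (a, b) = (\<Sum>k\<in>{a..b}. A $$ (a, k) * B $$ (k, b))"
proof -
  note A = N_plusD[OF assms(1)] and B = N_plusD[OF assms(2)]
  have "(\<Sum>k\<in>{a..b}. A $$ (a, k) * B $$ (k, b)) = (\<Sum>k<n. A $$ (a, k) * B $$ (k, b))"
  proof (rule sum.mono_neutral_left)
    show "\<forall>k\<in>{..<n} - {a..b}. A $$ (a, k) * B $$ (k, b) = 0"
    proof
      fix k assume k: "k \<in> {..<n} - {a..b}"
      then have "k < a \<or> b < k" by auto
      then show "A $$ (a, k) * B $$ (k, b) = 0" using A(3)[of a k] B(3)[of k b] assms(3) k by auto
    qed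
  qed (use assms in auto)
  then show ?thesis using mult_entry[OF A(1) B(1) assms(3,4)] by simp
qed

lemma dagger_exp_plus:
  assumes i: "1 \<le> i" "i < n"
  shows "dagger (exp_plus n i t) = exp_plus n (n - i) t"
proof (rule eq_matI)
  note E = N_plusD[OF exp_plus_N_plus[OF i(1), of n t]]
  have inv: "exp_plus n i t * exp_plus n i (- t) = 1\<^sub>m n" using i by (simp add: exp_plus_add exp_plus_0)
  fix a b assume "a < dim_row (exp_plus n (n - i) t)" "b < dim_col (exp_plus n (n - i) t)"
  then have ab: "a < n" "b < n" by auto
  have "dagger (exp_plus n i t) $$ (a, b) = (-1) ^ (a + b) * exp_plus n i (- t) $$ (n - 1 - b, n - 1 - a)"
    by (rule dagger_entry[OF E(1,2) exp_carrier(1) inv ab])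
  also have "exp_plus n i (- t) $$ (n - 1 - b, n - 1 - a) =
      (if a = b then 1 else 0) + (if a = n - i - 1 \<and> b = n - i then - t else 0)"
  proof -
    have "n - 1 - b = n - 1 - a \<longleftrightarrow> a = b" using ab by auto
    moreover have "n - 1 - b = i - 1 \<and> n - 1 - a = i \<longleftrightarrow> a = n - i - 1 \<and> b = n - i" using ab i by auto
    ultimately show ?thesis using ab by (simp add: exp_plus_entry)
  qed
  also have "(-1) ^ (a + b) * \<dots> = exp_plus n (n - i) t $$ (a, b)"
  proof (cases "a = n - i - 1 \<and> b = n - i")
    case True
    then have "a + b = Suc (2 * a)" "a \<noteq> b" using i by auto
    then have "(-1 :: complex) ^ (a + b) = - 1" by simp
    then show ?thesis using True ab \<open>a \<noteq> b\<close> by (simp add: exp_plus_entry)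
  next
    case False
    then show ?thesis using ab by (auto simp: exp_plus_entry mult_2[symmetric])
  qed
  finally show "dagger (exp_plus n i t) $$ (a, b) = exp_plus n (n - i) t $$ (a, b)" .
qed (simp_all add: dagger_def)

lemma src_exp_plus:
  "1 \<le> i \<Longrightarrow> i < n \<Longrightarrow> src d (exp_plus n i t) = exp_plus n (fi n d i) t"
  by (simp add: src_def fi_def dagger_exp_plus)

lemma linked_fi_src:
  assumes J: "J \<subseteq> {1..<n}" and A: "A \<in> carrier_mat n n" "det A = 1" and B: "B \<in> carrier_mat n n" "A * B = 1\<^sub>m n"
    and ab: "a < n" "b < n"
  shows "linked (fl n True J) (Suc a) (Suc b) \<longleftrightarrow> linked J (Suc (n - 1 - a)) (Suc (n - 1 - b))"
  using linked_fl[OF J, of "Suc a" "Suc b"] ab by (simp add: Suc_diff_Suc)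

lemma blockdiag_src:
  assumes J: "J \<subseteq> {1..<n}" and A: "blockdiag n J A" "det A = 1"
  shows "blockdiag n (fl n d J) (src d A)"
proof (cases d)
  case True
  note Ac = blockdiagD[OF A(1)]
  obtain B where B: "B \<in> carrier_mat n n" "A * B = 1\<^sub>m n" by (rule det_one_inverse[OF Ac(1) A(2)])
  note Bb = blockdiagD(2)[OF blockdiag_inverse[OF A(1) B]]
  have "dagger A $$ (a, b) = 0" if "a < n" "b < n" "\<not> linked (fl n True J) (Suc a) (Suc b)" for a b
  proof -
    have "\<not> linked J (Suc (n - 1 - b)) (Suc (n - 1 - a))"
      using that linked_fi_src[OF J Ac(1) A(2) B that(1,2)] by (simp add: linked_sym)
    then show ?thesis using dagger_entry[OF Ac(1) A(2) B that(1,2)] Bb that by simp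
  qed
  then show ?thesis using True Ac(1) by (simp add: src_def blockdiag_def)
next
  case False
  have "fl n False J = J" by (auto simp: fl_def fi_def)
  then show ?thesis using A False by (simp add: src_def)
qed

lemma radical_src_entry:
  assumes J: "J \<subseteq> {1..<n}" and R: "radical n J R" and ab: "a < n" "b < n" "linked (fl n d J) (Suc a) (Suc b)"
  shows "src d R $$ (a, b) = (if a = b then 1 else 0)"
proof (cases d)
  case True
  note RN = radical_N_plus[OF R] 
  note Rc = N_plusD[OF RN]
  obtain B where B: "B \<in> N_plus n" "R * B = 1\<^sub>m n" by (rule N_plus_obtain_inverse[OF RN])
  have Be: "B $$ (x, y) = (if x = y then 1 else 0)" if xy: "x < n" "y < n" "linked J (Suc x) (Suc y)" for x y
  proof (cases "x \<le> y")
    case True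
    have "(if x = y then 1 else 0) = (\<Sum>k\<in>{x..y}. R $$ (x, k) * B $$ (k, y))"
      using N_plus_mult_entry[OF RN B(1) xy(1,2)] B(2) xy by simp
    also have "\<dots> = (\<Sum>k\<in>{x..y}. if k = x then B $$ (x, y) else 0)"
    proof (rule sum.cong)
      fix k assume k: "k \<in> {x..y}"
      then have "linked J (Suc x) (Suc k)" using linked_between[OF xy(3), of "Suc k"] by simp
      then show "R $$ (x, k) * B $$ (k, y) = (if k = x then B $$ (x, y) else 0)"
        using radical_entry[OF R xy(1), of k] k xy by auto
    qed simp
    also have "\<dots> = B $$ (x, y)" using True by simp
    finally show ?thesis by simp
  next
    case False
    then show ?thesis using N_plusD(3)[OF B(1) xy(1), of y] by simp
  qed
  have "linked J (Suc (n - 1 - b)) (Suc (n - 1 - a))"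
    using ab True linked_fi_src[OF J Rc(1,2) N_plusD(1)[OF B(1)] B(2) ab(1,2)] by (simp add: linked_sym)
  then have "B $$ (n - 1 - b, n - 1 - a) = (if a = b then 1 else 0)" using Be ab by auto
  then show ?thesis using dagger_entry[OF Rc(1,2) N_plusD(1)[OF B(1)] B(2) ab(1,2)] True
    by (auto simp: src_def mult_2[symmetric])
next
  case False
  have "fl n False J = J" by (auto simp: fl_def fi_def)
  then show ?thesis using radical_entry[OF R ab(1,2)] ab(3) False by (simp add: src_def)
qed

lemma src_mult_N_plus: "A \<in> N_plus n \<Longrightarrow> B \<in> N_plus n \<Longrightarrow> src d (A * B) = src d A * src d B"
  by (rule src_mult) (auto dest: N_plusD)

text \<open>The diagonal block of \<open>src d A\<close> along a run of Gamma_1 through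
  \<open>u\<close> reappears in \<open>src d' B\<close> along the run through gamma(u). Positions
  are 1-based and are matched by additive equations, as the translation may be negative.\<close>

definition transported :: "nat \<Rightarrow> bd_triple \<Rightarrow> complex mat \<Rightarrow> complex mat \<Rightarrow> bool" where
  "transported n \<Gamma> A B \<longleftrightarrow> (\<forall>u\<in>Gam1 \<Gamma>. \<forall>d d' x y x' y'.
     d' = (d \<noteq> (\<not> preserves_orientation \<Gamma> u)) \<longrightarrow> 1 \<le> x \<longrightarrow> x \<le> n \<longrightarrow> 1 \<le> y \<longrightarrow> y \<le> n \<longrightarrow>
     linked (fl n d (Gam1 \<Gamma>)) (fi n d u) x \<longrightarrow> linked (fl n d (Gam1 \<Gamma>)) (fi n d u) y \<longrightarrow>
     x + fi n d' (gam \<Gamma> u) = x' + fi n d u \<longrightarrow> y + fi n d' (gam \<Gamma> u) = y' + fi n d u \<longrightarrow>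
     src d A $$ (x - 1, y - 1) = src d' B $$ (x' - 1, y' - 1))"

lemma transport_range:
  assumes \<Gamma>: "is_bd_triple n \<Gamma>" and u: "u \<in> Gam1 \<Gamma>"
    and d': "d' = (d \<noteq> (\<not> preserves_orientation \<Gamma> u))"
    and x: "linked (fl n d (Gam1 \<Gamma>)) (fi n d u) x" "x + fi n d' (gam \<Gamma> u) = x' + fi n d u"
  shows "1 \<le> x' \<and> x' \<le> n"
proof -
  note D = bd_tripleD[OF \<Gamma>]
  obtain x'' where "x + fi n d' (gam \<Gamma> u) = x'' + fi n d u" and l: "linked (fl n d' (Gam2 \<Gamma>)) (fi n d' (gam \<Gamma> u)) x''"
    using linked_transport[OF \<Gamma> u d' x(1)] by blast
  then have "x'' = x'" using x(2) by simp
  then have l: "linked (fl n d' (Gam2 \<Gamma>)) (fi n d' (gam \<Gamma> u)) x'" using l by simp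
  have v: "1 \<le> fi n d' (gam \<Gamma> u)" "fi n d' (gam \<Gamma> u) < n"
    using fi_range[of "gam \<Gamma> u" n d'] D(4)[OF u] D(2) by auto
  have s: "fl n d' (Gam2 \<Gamma>) \<subseteq> {1..<n}" by (rule fl_subset[OF D(2)])
  have "1 \<le> x'"
  proof (rule ccontr)
    assume "\<not> 1 \<le> x'"
    then have "0 \<in> {min (fi n d' (gam \<Gamma> u)) x'..<max (fi n d' (gam \<Gamma> u)) x'}" using v by auto
    then have "0 \<in> fl n d' (Gam2 \<Gamma>)" using l unfolding linked_def by blast
    then show False using s by auto
  qed
  moreover have "x' \<le> n"
  proof (rule ccontr)
    assume "\<not> x' \<le> n"
    then have "n \<in> {min (fi n d' (gam \<Gamma> u)) x'..<max (fi n d' (gam \<Gamma> u)) x'}" using v by auto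
    then have "n \<in> fl n d' (Gam2 \<Gamma>)" using l unfolding linked_def by blast
    then show False using s by auto
  qed
  ultimately show ?thesis by simp
qed

text \<open>For upper triangular factors the entry (x, y) of the product involves only indices
  between x and y, and these stay in the run.\<close>

lemma transported_mult:
  assumes \<Gamma>: "is_bd_triple n \<Gamma>" and A: "A1 \<in> N_plus n" "A2 \<in> N_plus n" and B: "B1 \<in> N_plus n" "B2 \<in> N_plus n"
    and t: "transported n \<Gamma> A1 B1" "transported n \<Gamma> A2 B2"
  shows "transported n \<Gamma> (A1 * A2) (B1 * B2)"
  unfolding transported_def
proof (intro ballI allI impI)
  fix u d d' x y x' y'
  assume u: "u \<in> Gam1 \<Gamma>" and d': "d' = (d \<noteq> (\<not> preserves_orientation \<Gamma> u))"
    and r: "1 \<le> x" "x \<le> n" "1 \<le> y" "y \<le> n"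
    and l: "linked (fl n d (Gam1 \<Gamma>)) (fi n d u) x" "linked (fl n d (Gam1 \<Gamma>)) (fi n d u) y"
    and e: "x + fi n d' (gam \<Gamma> u) = x' + fi n d u" "y + fi n d' (gam \<Gamma> u) = y' + fi n d u"
  note x'r = transport_range[OF \<Gamma> u d' l(1) e(1)] and y'r = transport_range[OF \<Gamma> u d' l(2) e(2)]
  have "src d (A1 * A2) $$ (x - 1, y - 1) = (src d A1 * src d A2) $$ (x - 1, y - 1)"
    using src_mult_N_plus[OF A] by simp
  also have "\<dots> = (\<Sum>k\<in>{x - 1..y - 1}. src d A1 $$ (x - 1, k) * src d A2 $$ (k, y - 1))"
    by (rule N_plus_mult_entry) (use A N_plus_src r in auto)
  also have "\<dots> = (\<Sum>k\<in>{x' - 1..y' - 1}. src d' B1 $$ (x' - 1, k) * src d' B2 $$ (k, y' - 1))"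
  proof (rule sum.reindex_bij_witness[of _ "\<lambda>k. k + x - x'" "\<lambda>k. k + x' - x"])
    fix k assume k: "k \<in> {x - 1..y - 1}"
    show "k + x' - x + x - x' = k" using k r x'r by auto
    show "k + x' - x \<in> {x' - 1..y' - 1}" using k r x'r e by auto
    have lk: "linked (fl n d (Gam1 \<Gamma>)) (fi n d u) (Suc k)"
    proof -
      have "linked (fl n d (Gam1 \<Gamma>)) x y" using l by (meson linked_trans linked_sym)
      then have "linked (fl n d (Gam1 \<Gamma>)) x (Suc k)" by (rule linked_between) (use k r in auto)
      then show ?thesis using l(1) by (meson linked_trans)
    qed
    have ek: "Suc k + fi n d' (gam \<Gamma> u) = Suc (k + x' - x) + fi n d u" using k r x'r e by auto
    have kn: "Suc k \<le> n" using k r by auto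
    have "src d A1 $$ (x - 1, Suc k - 1) = src d' B1 $$ (x' - 1, Suc (k + x' - x) - 1)"
      using t(1)[unfolded transported_def, rule_format, OF u d' r(1,2) _ kn l(1) lk e(1) ek] by simp
    moreover have "src d A2 $$ (Suc k - 1, y - 1) = src d' B2 $$ (Suc (k + x' - x) - 1, y' - 1)"
      using t(2)[unfolded transported_def, rule_format, OF u d' _ kn r(3,4) lk l(2) ek e(2)] by simp
    ultimately show "src d' B1 $$ (x' - 1, k + x' - x) * src d' B2 $$ (k + x' - x, y' - 1) =
        src d A1 $$ (x - 1, k) * src d A2 $$ (k, y - 1)" by simp
  next
    fix k assume k: "k \<in> {x' - 1..y' - 1}"
    show "k + x - x' + x' - x = k" using k r x'r by auto
    have "y + x' = y' + x" using e by linarith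
    then show "k + x - x' \<in> {x - 1..y - 1}" using k r x'r y'r by auto
  qed
  also have "\<dots> = (src d' B1 * src d' B2) $$ (x' - 1, y' - 1)"
    by (rule N_plus_mult_entry[symmetric]) (use B N_plus_src x'r y'r in auto)
  also have "\<dots> = src d' (B1 * B2) $$ (x' - 1, y' - 1)"
    using src_mult_N_plus[OF B] by simp
  finally show "src d (A1 * A2) $$ (x - 1, y - 1) = src d' (B1 * B2) $$ (x' - 1, y' - 1)" .
qed

lemma transported_one:
  assumes \<Gamma>: "is_bd_triple n \<Gamma>"
  shows "transported n \<Gamma> (1\<^sub>m n) (1\<^sub>m n)"
  unfolding transported_def
proof (intro ballI allI impI)
  fix u d d' x y x' y'
  assume u: "u \<in> Gam1 \<Gamma>" and d': "d' = (d \<noteq> (\<not> preserves_orientation \<Gamma> u))"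
    and r: "1 \<le> x" "x \<le> n" "1 \<le> y" "y \<le> n"
    and l: "linked (fl n d (Gam1 \<Gamma>)) (fi n d u) x" "linked (fl n d (Gam1 \<Gamma>)) (fi n d u) y"
    and e: "x + fi n d' (gam \<Gamma> u) = x' + fi n d u" "y + fi n d' (gam \<Gamma> u) = y' + fi n d u"
  note x'r = transport_range[OF \<Gamma> u d' l(1) e(1)] and y'r = transport_range[OF \<Gamma> u d' l(2) e(2)]
  have idx: "x - 1 < n" "y - 1 < n" "x' - 1 < n" "y' - 1 < n" using r x'r y'r by auto
  have "x - 1 = y - 1 \<longleftrightarrow> x' - 1 = y' - 1" using r x'r y'r e by auto
  then show "src d (1\<^sub>m n) $$ (x - 1, y - 1) = src d' (1\<^sub>m n) $$ (x' - 1, y' - 1)"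
    using idx by (simp add: src_one)
qed

lemma transported_exp:
  assumes \<Gamma>: "is_bd_triple n \<Gamma>" and i: "1 \<le> i" "i < n"
  shows "transported n \<Gamma> (exp_plus n i t) (if i \<in> Gam1 \<Gamma> then exp_plus n (gam \<Gamma> i) t else 1\<^sub>m n)"
  unfolding transported_def
proof (intro ballI allI impI)
  note D = bd_tripleD[OF \<Gamma>]
  fix u d d' x y x' y'
  let ?c = "fi n d u" and ?v = "fi n d' (gam \<Gamma> u)" and ?J = "fl n d (Gam1 \<Gamma>)"
  assume u: "u \<in> Gam1 \<Gamma>" and d': "d' = (d \<noteq> (\<not> preserves_orientation \<Gamma> u))"
    and r: "1 \<le> x" "x \<le> n" "1 \<le> y" "y \<le> n"
    and l: "linked ?J ?c x" "linked ?J ?c y"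
    and e: "x + ?v = x' + ?c" "y + ?v = y' + ?c"
  note x'r = transport_range[OF \<Gamma> u d' l(1) e(1)] and y'r = transport_range[OF \<Gamma> u d' l(2) e(2)]
  have idx: "x - 1 < n" "y - 1 < n" "x' - 1 < n" "y' - 1 < n" using r x'r y'r by auto
  have eq: "x - 1 = y - 1 \<longleftrightarrow> x' - 1 = y' - 1" using r x'r y'r e by auto
  have ui: "fi n d i \<ge> 1" "fi n d i < n" using fi_range[OF i, of d] by auto
  have lhs: "src d (exp_plus n i t) $$ (x - 1, y - 1) =
      (if x - 1 = y - 1 then 1 else 0) + (if x = fi n d i \<and> y = Suc x then t else 0)"
  proof -
    have "(x - 1 = fi n d i - 1 \<and> y - 1 = fi n d i) \<longleftrightarrow> (x = fi n d i \<and> y = Suc x)" using r ui by auto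
    then show ?thesis using i idx by (simp add: src_exp_plus exp_plus_entry)
  qed
  have comp: "fi n d x \<in> component (Gam1 \<Gamma>) u" if "y = Suc x"
  proof (rule linked_fi_component[OF D(1) u l(1)])
    have "linked ?J x (Suc x)" using l that by (meson linked_trans linked_sym)
    then show "x \<in> ?J" by (simp add: linked_Suc)
  qed
  show "src d (exp_plus n i t) $$ (x - 1, y - 1) =
      src d' (if i \<in> Gam1 \<Gamma> then exp_plus n (gam \<Gamma> i) t else 1\<^sub>m n) $$ (x' - 1, y' - 1)"
  proof (cases "i \<in> Gam1 \<Gamma>")
    case True
    then have gi: "1 \<le> gam \<Gamma> i" "gam \<Gamma> i < n" using D(4)[OF True] D(2) by auto
    note gfi = fi_range[OF gi, of d']
    have "(x' - 1 = fi n d' (gam \<Gamma> i) - 1 \<and> y' - 1 = fi n d' (gam \<Gamma> i)) \<longleftrightarrow> (x' = fi n d' (gam \<Gamma> i) \<and> y' = Suc x')"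
      using x'r y'r gfi by auto
    moreover have "y' = Suc x' \<longleftrightarrow> y = Suc x" using e by auto
    moreover have "x' = fi n d' (gam \<Gamma> i) \<longleftrightarrow> x = fi n d i" if y: "y = Suc x"
    proof -
      have xn: "x < n" using y r by simp
      have j: "fi n d x \<in> Gam1 \<Gamma>" by (rule component_subset[OF comp[OF y]])
      have "int (fi n d' (gam \<Gamma> (fi n d x))) - int ?v = int x - int ?c"
        using gam_affine_fi[OF \<Gamma> u comp[OF y] d'] xn by simp
      then have x': "x' = fi n d' (gam \<Gamma> (fi n d x))" using e(1) by linarith
      have "x' = fi n d' (gam \<Gamma> i) \<longleftrightarrow> gam \<Gamma> (fi n d x) = gam \<Gamma> i"
      proof
        assume a: "x' = fi n d' (gam \<Gamma> i)"
        have "gam \<Gamma> (fi n d x) < n" using D(4)[OF j] D(2) by auto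
        then have "fi n d' x' = gam \<Gamma> (fi n d x)" unfolding x' by simp
        moreover have "fi n d' x' = gam \<Gamma> i" unfolding a using gi by simp
        ultimately show "gam \<Gamma> (fi n d x) = gam \<Gamma> i" by simp
      qed (simp add: x')
      also have "\<dots> \<longleftrightarrow> fi n d x = i" using D(5)[OF j True] by auto
      also have "\<dots> \<longleftrightarrow> x = fi n d i" using xn i by (auto simp: fi_def)
      finally show ?thesis .
    qed
    ultimately show ?thesis
      unfolding lhs using True eq idx by (auto simp: src_exp_plus[OF gi] exp_plus_entry simp del: One_nat_def)
  next
    case False
    have "\<not> (x = fi n d i \<and> y = Suc x)"
    proof
      assume a: "x = fi n d i \<and> y = Suc x"
      then have "fi n d x = i" using i by simp
      then show False using component_subset[OF comp] a False by auto
    qed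
    then show ?thesis unfolding lhs using False idx eq by (auto simp: src_one simp del: One_nat_def)
  qed
qed

lemma bold_gamma_one:
  assumes "is_bold_gamma n \<Gamma> \<phi>"
  shows "\<phi> (1\<^sub>m n) = 1\<^sub>m n"
proof -
  note h = bold_gamma_hom[OF assms]
  have "\<phi> (1\<^sub>m n) = \<phi> (1\<^sub>m n) * \<phi> (1\<^sub>m n)" using h(2)[OF N_plus_one N_plus_one] by simp
  moreover obtain B where B: "B \<in> N_plus n" "\<phi> (1\<^sub>m n) * B = 1\<^sub>m n"
    using N_plus_obtain_inverse[OF h(1)[OF N_plus_one]] by blast
  moreover have c: "\<phi> (1\<^sub>m n) \<in> carrier_mat n n" "B \<in> carrier_mat n n"
    using N_plusD(1)[OF h(1)[OF N_plus_one]] N_plusD(1)[OF B(1)] by auto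
  ultimately show ?thesis by (metis mult_assoc_square right_mult_one_mat)
qed

theorem bold_gamma_transported:
  assumes \<Gamma>: "is_bd_triple n \<Gamma>" and \<phi>: "is_bold_gamma n \<Gamma> \<phi>" and A: "A \<in> N_plus n"
  shows "transported n \<Gamma> A (\<phi> A)" "blockdiag n (Gam2 \<Gamma>) (\<phi> A)"
proof -
  note D = bd_tripleD[OF \<Gamma>] and h = bold_gamma_hom[OF \<phi>]
  have "transported n \<Gamma> A (\<phi> A) \<and> blockdiag n (Gam2 \<Gamma>) (\<phi> A)" using A
  proof (induction rule: N_plus_induct)
    case one
    then show ?case using transported_one[OF \<Gamma>] bold_gamma_one[OF \<phi>] by (auto simp: blockdiag_def)
  next
    case (step i t A)
    note E = exp_plus_N_plus[OF step(1), of n t]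
    note e = bold_gamma_exp[OF \<Gamma> \<phi> step(1,2), of t]
    have "transported n \<Gamma> (exp_plus n i t * A) (\<phi> (exp_plus n i t) * \<phi> A)"
      by (rule transported_mult[OF \<Gamma> E step(3) h(1)[OF E] h(1)[OF step(3)]])
        (use transported_exp[OF \<Gamma> step(1,2), of t] e step in auto)
    moreover have "blockdiag n (Gam2 \<Gamma>) (\<phi> (exp_plus n i t))"
    proof (cases "i \<in> Gam1 \<Gamma>")
      case True
      then have "gam \<Gamma> i \<in> Gam2 \<Gamma>" "1 \<le> gam \<Gamma> i" using D(4)[OF True] D(2) by auto
      then show ?thesis using e True exp_blockdiag(1) by simp
    qed (use e in \<open>auto simp: blockdiag_def\<close>)
    ultimately show ?case using h(2)[OF E step(3)] step blockdiag_mult by auto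
  qed
  then show "transported n \<Gamma> A (\<phi> A)" "blockdiag n (Gam2 \<Gamma>) (\<phi> A)" by auto
qed

lemma bold_gamma_pow:
  assumes "is_bold_gamma n \<Gamma> \<phi>"
  shows "A \<in> N_plus n \<Longrightarrow> (\<phi> ^^ m) A \<in> N_plus n" "(\<phi> ^^ m) (1\<^sub>m n) = 1\<^sub>m n"
    "A \<in> N_plus n \<Longrightarrow> B \<in> N_plus n \<Longrightarrow> (\<phi> ^^ m) (A * B) = (\<phi> ^^ m) A * (\<phi> ^^ m) B"
proof -
  note h = bold_gamma_hom[OF assms]
  show *: "A \<in> N_plus n \<Longrightarrow> (\<phi> ^^ m) A \<in> N_plus n" for A by (induction m) (auto intro: h)
  show "(\<phi> ^^ m) (1\<^sub>m n) = 1\<^sub>m n" by (induction m) (auto simp: bold_gamma_one[OF assms])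
  have "A \<in> N_plus n \<Longrightarrow> B \<in> N_plus n \<Longrightarrow> (\<phi> ^^ m) (A * B) = (\<phi> ^^ m) A * (\<phi> ^^ m) B \<and> (\<phi> ^^ m) A \<in> N_plus n \<and> (\<phi> ^^ m) B \<in> N_plus n"
    by (induction m) (auto simp: h)
  then show "A \<in> N_plus n \<Longrightarrow> B \<in> N_plus n \<Longrightarrow> (\<phi> ^^ m) (A * B) = (\<phi> ^^ m) A * (\<phi> ^^ m) B" by blast
qed

text \<open>On a generator exp(t e_i) the iterates follow the orbit of i under gamma until it leaves
  Gamma_1, which happens in fewer than \<open>n\<close> steps.\<close>

lemma bold_gamma_nilpotent:
  assumes \<Gamma>: "is_bd_triple n \<Gamma>" and \<phi>: "is_bold_gamma n \<Gamma> \<phi>" and A: "A \<in> N_plus n"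
  shows "(\<phi> ^^ n) A = 1\<^sub>m n"
  using A
proof (induction rule: N_plus_induct)
  case one
  then show ?case by (rule bold_gamma_pow(2)[OF \<phi>])
next
  case (step i t A)
  note D = bd_tripleD[OF \<Gamma>]
  have *: "(\<phi> ^^ m) (exp_plus n i t) = 1\<^sub>m n \<or>
      (\<forall>j<m. (gam \<Gamma> ^^ j) i \<in> Gam1 \<Gamma>) \<and> (\<phi> ^^ m) (exp_plus n i t) = exp_plus n ((gam \<Gamma> ^^ m) i) t" for m
  proof (induction m)
    case (Suc m)
    then consider "(\<phi> ^^ m) (exp_plus n i t) = 1\<^sub>m n" |
      "\<forall>j<m. (gam \<Gamma> ^^ j) i \<in> Gam1 \<Gamma>" "(\<phi> ^^ m) (exp_plus n i t) = exp_plus n ((gam \<Gamma> ^^ m) i) t" by blast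
    then show ?case
    proof cases
      case 1
      then show ?thesis by (simp add: bold_gamma_one[OF \<phi>])
    next
      case 2
      have "(gam \<Gamma> ^^ m) i \<in> {1..<n}"
      proof (cases m)
        case (Suc k)
        then have "gam \<Gamma> ((gam \<Gamma> ^^ k) i) \<in> Gam2 \<Gamma>" using 2(1) D(4) by blast
        then show ?thesis using D(2) Suc by auto
      qed (use step in auto)
      then have g: "1 \<le> (gam \<Gamma> ^^ m) i" "(gam \<Gamma> ^^ m) i < n" by auto
      show ?thesis
      proof (cases "(gam \<Gamma> ^^ m) i \<in> Gam1 \<Gamma>")
        case True
        then have "\<forall>j<Suc m. (gam \<Gamma> ^^ j) i \<in> Gam1 \<Gamma>" using 2(1) less_Suc_eq by auto
        then show ?thesis using bold_gamma_exp[OF \<Gamma> \<phi> g, of t] 2(2) True by simp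
      next
        case False
        then show ?thesis using bold_gamma_exp[OF \<Gamma> \<phi> g, of t] 2(2) by simp
      qed
    qed
  qed simp
  have "(\<phi> ^^ n) (exp_plus n i t) = 1\<^sub>m n"
  proof (rule ccontr)
    assume "\<not> ?thesis"
    then have s: "\<forall>j<n. (gam \<Gamma> ^^ j) i \<in> Gam1 \<Gamma>" using *[of n] by blast
    then have "i \<in> Gam1 \<Gamma>" using step(2) by (metis funpow_0 gr_implies_not0 neq0_conv)
    then show False using bd_triple_leaves[OF \<Gamma>] s by blast
  qed
  then show ?case
    using bold_gamma_pow(3)[OF \<phi> exp_plus_N_plus[OF step(1)] step(3)] step(4) by simp
qed

text \<open>gamma raises every exponent in the product by one, so the product with exponents 0 to n
  becomes the one with exponents 1 to n+1, whose top factor is trivial.\<close>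

lemma row_prod_fixed:
  assumes \<Gamma>: "is_bd_triple n \<Gamma>" and \<phi>: "is_bold_gamma n \<Gamma> \<phi>" and V: "V \<in> N_plus n"
  shows "row_prod n \<phi> V m \<in> N_plus n" "\<phi> (row_prod n \<phi> V n * V) = row_prod n \<phi> V n"
proof -
  note h = bold_gamma_hom[OF \<phi>] and p = bold_gamma_pow[OF \<phi>]
  show N: "row_prod n \<phi> V m \<in> N_plus n" for m
  proof (induction m)
    case (Suc m)
    have "(\<phi> ^^ Suc m) V \<in> N_plus n" by (rule p(1)[OF V])
    then show ?case using Suc N_plus_mult by simp
  qed (simp add: N_plus_one)
  have "\<phi> (row_prod n \<phi> V m * V) = row_prod n \<phi> V (Suc m)" for m
  proof (induction m)
    case 0
    then show ?case using N_plusD(1)[OF V] N_plusD(1)[OF h(1)[OF V]] by simp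
  next
    case (Suc m)
    note P = p(1)[OF V, of "Suc m"]
    have "row_prod n \<phi> V (Suc m) * V = (\<phi> ^^ Suc m) V * (row_prod n \<phi> V m * V)"
      using N_plusD(1)[OF P] N_plusD(1)[OF N] N_plusD(1)[OF V] by (simp add: mult_assoc_square[of _ n])
    then have "\<phi> (row_prod n \<phi> V (Suc m) * V) = \<phi> ((\<phi> ^^ Suc m) V) * \<phi> (row_prod n \<phi> V m * V)"
      using h(2)[OF P N_plus_mult[OF N V]] by simp
    then show ?case using Suc by simp
  qed
  from this[of n] have "\<phi> (row_prod n \<phi> V n * V) = \<phi> ((\<phi> ^^ n) V) * row_prod n \<phi> V n" by simp
  also have "\<phi> ((\<phi> ^^ n) V) = 1\<^sub>m n"
    by (simp add: bold_gamma_nilpotent[OF \<Gamma> \<phi> V] bold_gamma_one[OF \<phi>])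
  finally show "\<phi> (row_prod n \<phi> V n * V) = row_prod n \<phi> V n"
    using left_mult_one_mat[OF N_plusD(1)[OF N[of n]]] by simp
qed

text \<open>The interface between group theory and determinants. \<open>G\<close> and
  \<open>H\<close> multiply the two neighbours that share a run; transport makes them agree there,
  and block diagonality of \<open>H\<close> keeps its effect inside the rows of a block that ends
  with a run.\<close>

definition row_glue :: "nat \<Rightarrow> bd_triple \<Rightarrow> complex mat \<Rightarrow> complex mat \<Rightarrow> bool" where
  "row_glue n \<Gamma> G H \<longleftrightarrow>
     G \<in> N_plus n \<and> H \<in> N_plus n \<and> blockdiag n (Gam2 \<Gamma>) H \<and> transported n \<Gamma> G H"

text \<open>The radical factor has identity blocks along the runs of Gamma_1, also after
  \<open>dagger\<close>, so it does not affect the entries that are transported.\<close>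

theorem row_prod_glue:
  assumes \<Gamma>: "is_bd_triple n \<Gamma>" and \<phi>: "is_bold_gamma n \<Gamma> \<phi>" and V: "V \<in> N_plus n"
    and R: "radical n (Gam1 \<Gamma>) R"
  shows "row_glue n \<Gamma> (row_prod n \<phi> V n * V * R) (row_prod n \<phi> V n)"
proof -
  note D = bd_tripleD[OF \<Gamma>]
  define H where "H = row_prod n \<phi> V n"
  have HN: "H \<in> N_plus n" and HV: "\<phi> (H * V) = H"
    unfolding H_def by (rule row_prod_fixed[OF \<Gamma> \<phi> V])+
  note AN = N_plus_mult[OF HN V] and RN = radical_N_plus[OF R]
  have t: "transported n \<Gamma> (H * V) H" and b: "blockdiag n (Gam2 \<Gamma>) H"
    using bold_gamma_transported[OF \<Gamma> \<phi> AN] HV by auto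
  have "transported n \<Gamma> (H * V * R) H"
    unfolding transported_def
  proof (intro ballI allI impI)
    fix u d d' x y x' y'
    let ?c = "fi n d u" and ?v = "fi n d' (gam \<Gamma> u)" and ?J = "fl n d (Gam1 \<Gamma>)"
    assume u: "u \<in> Gam1 \<Gamma>" and d': "d' = (d \<noteq> (\<not> preserves_orientation \<Gamma> u))"
      and r: "1 \<le> x" "x \<le> n" "1 \<le> y" "y \<le> n"
      and l: "linked ?J ?c x" "linked ?J ?c y"
      and e: "x + ?v = x' + ?c" "y + ?v = y' + ?c"
    have ll: "linked ?J x y" using l by (meson linked_trans linked_sym)
    have "src d (H * V * R) $$ (x - 1, y - 1) = (src d (H * V) * src d R) $$ (x - 1, y - 1)"
      using src_mult_N_plus[OF AN RN] by simp
    also have "\<dots> = (\<Sum>k\<in>{x - 1..y - 1}. src d (H * V) $$ (x - 1, k) * src d R $$ (k, y - 1))"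
      by (rule N_plus_mult_entry) (use AN RN N_plus_src r in auto)
    also have "\<dots> = (\<Sum>k\<in>{x - 1..y - 1}. if k = y - 1 then src d (H * V) $$ (x - 1, y - 1) else 0)"
    proof (rule sum.cong)
      fix k assume k: "k \<in> {x - 1..y - 1}"
      have "linked ?J x (Suc k)" by (rule linked_between[OF ll]) (use k r in auto)
      then have "linked ?J (Suc k) (Suc (y - 1))" using ll r by (simp, meson linked_trans linked_sym)
      then have "src d R $$ (k, y - 1) = (if k = y - 1 then 1 else 0)"
        using radical_src_entry[OF D(1) R, of k "y - 1" d] k r by auto
      then show "src d (H * V) $$ (x - 1, k) * src d R $$ (k, y - 1) =
          (if k = y - 1 then src d (H * V) $$ (x - 1, y - 1) else 0)" by simp
    qed simp
    also have "\<dots> = src d (H * V) $$ (x - 1, y - 1)"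
    proof (cases "x \<le> y")
      case False
      then have "src d (H * V) $$ (x - 1, y - 1) = 0"
        using N_plusD(3)[OF N_plus_src[OF AN], of "x - 1" "y - 1" d] r by simp
      then show ?thesis by simp
    qed (use r in simp)
    also have "\<dots> = src d' H $$ (x' - 1, y' - 1)"
      using t[unfolded transported_def, rule_format, OF u d' r l e] .
    finally show "src d (H * V * R) $$ (x - 1, y - 1) = src d' H $$ (x' - 1, y' - 1)" .
  qed
  then show ?thesis using N_plus_mult[OF AN RN] HN b by (simp add: row_glue_def H_def)
qed

section \<open>Staircase matrices: blockwise operations, splitting, and alignment of runs\<close>

section \<open>Determinants of staircase matrices\<close>

text \<open>Integer coordinates allow all glued matrices to have their lower right corner at 0,
  whatever their size.\<close>

definition detI :: "int \<Rightarrow> int \<Rightarrow> (int \<Rightarrow> int \<Rightarrow> complex) \<Rightarrow> complex" where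
  "detI lo hi f = det (mat (nat (hi - lo + 1)) (nat (hi - lo + 1)) (\<lambda>(x, y). f (lo + int x) (lo + int y)))"

lemma detI_cong:
  assumes "\<And>a b. lo \<le> a \<Longrightarrow> a \<le> hi \<Longrightarrow> lo \<le> b \<Longrightarrow> b \<le> hi \<Longrightarrow> f a b = g a b"
  shows "detI lo hi f = detI lo hi g"
  unfolding detI_def by (rule arg_cong[of _ _ det], rule eq_matI) (auto intro!: assms)

lemma detI_transpose: "detI lo hi (\<lambda>a b. f b a) = detI lo hi f"
proof -
  let ?N = "nat (hi - lo + 1)"
  have "mat ?N ?N (\<lambda>(x, y). f (lo + int y) (lo + int x)) = (mat ?N ?N (\<lambda>(x, y). f (lo + int x) (lo + int y)))\<^sup>T"
    by (rule eq_matI) auto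
  then show ?thesis unfolding detI_def using det_transpose[of "mat ?N ?N (\<lambda>(x, y). f (lo + int x) (lo + int y))" ?N] by simp
qed

lemma detI_split_upper:
  assumes m: "lo \<le> m + 1" "m \<le> hi"
    and z: "\<And>a b. lo \<le> a \<Longrightarrow> a \<le> m \<Longrightarrow> m < b \<Longrightarrow> b \<le> hi \<Longrightarrow> f a b = 0"
  shows "detI lo hi f = detI lo m f * detI (m + 1) hi f"
proof -
  define p where "p = nat (m - lo + 1)"
  define q where "q = nat (hi - m)"
  have pq: "nat (hi - lo + 1) = p + q" "int p = m - lo + 1" "int q = hi - m" using m by (auto simp: p_def q_def)
  let ?A = "mat p p (\<lambda>(x, y). f (lo + int x) (lo + int y))"
  let ?C = "mat q p (\<lambda>(x, y). f (m + 1 + int x) (lo + int y))"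
  let ?D = "mat q q (\<lambda>(x, y). f (m + 1 + int x) (m + 1 + int y))"
  have "mat (p + q) (p + q) (\<lambda>(x, y). f (lo + int x) (lo + int y)) = four_block_mat ?A (0\<^sub>m p q) ?C ?D"
  proof (rule eq_matI)
    fix x y assume "x < dim_row (four_block_mat ?A (0\<^sub>m p q) ?C ?D)" "y < dim_col (four_block_mat ?A (0\<^sub>m p q) ?C ?D)"
    then have xy: "x < p + q" "y < p + q" by auto
    have lo: "lo = m + 1 - int p" using pq by simp
    have z': "f (lo + int x) (lo + int y) = 0" if "x < p" "\<not> y < p"
      using z[of "lo + int x" "lo + int y"] that pq xy by linarith
    show "mat (p + q) (p + q) (\<lambda>(x, y). f (lo + int x) (lo + int y)) $$ (x, y) =
        four_block_mat ?A (0\<^sub>m p q) ?C ?D $$ (x, y)"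
      using xy z' by (cases "x < p"; cases "y < p") (simp_all add: index_mat_four_block lo algebra_simps)
  qed auto
  then have "detI lo hi f = det ?A * det ?D"
    unfolding detI_def pq(1) using det_four_block_mat_upper_right_zero[of ?A p "0\<^sub>m p q" q ?C ?D] by simp
  moreover have "nat (hi - (m + 1) + 1) = q" by (simp add: q_def)
  ultimately show ?thesis unfolding detI_def p_def by simp
qed

lemma detI_split_lower:
  assumes m: "lo \<le> m + 1" "m \<le> hi"
    and z: "\<And>a b. lo \<le> b \<Longrightarrow> b \<le> m \<Longrightarrow> m < a \<Longrightarrow> a \<le> hi \<Longrightarrow> f a b = 0"
  shows "detI lo hi f = detI lo m f * detI (m + 1) hi f"
proof -
  have "detI lo hi (\<lambda>a b. f b a) = detI lo m (\<lambda>a b. f b a) * detI (m + 1) hi (\<lambda>a b. f b a)"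
    by (rule detI_split_upper[OF m]) (rule z)
  then show ?thesis
    by (simp only: detI_transpose[of lo hi f] detI_transpose[of lo m f] detI_transpose[of "m + 1" hi f])
qed

lemma sum_int_shift:
  fixes g :: "int \<Rightarrow> complex"
  shows "(\<Sum>a\<in>{lo..hi}. g a) = (\<Sum>k<nat (hi - lo + 1). g (lo + int k))"
  by (rule sum.reindex_bij_witness[of _ "\<lambda>k. lo + int k" "\<lambda>a. nat (a - lo)"]) auto

lemma detI_unitriangular:
  assumes R: "\<And>a. R a a = 1" "\<And>a b. b < a \<Longrightarrow> R a b = 0"
  shows "detI lo hi R = 1"
  unfolding detI_def
proof (subst det_upper)
  show "(\<Prod>a<nat (hi - lo + 1). mat (nat (hi - lo + 1)) (nat (hi - lo + 1)) (\<lambda>(x, y). R (lo + int x) (lo + int y)) $$ (a, a)) = 1"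
    by (rule prod.neutral) (simp add: R(1))
qed (auto simp: R(2))

lemma detI_product:
  assumes R: "\<And>a. R a a = 1" "\<And>a b. b < a \<Longrightarrow> R a b = 0"
    and C: "\<And>a. C a a = 1" "\<And>a b. b < a \<Longrightarrow> C a b = 0"
    and T: "\<And>a b. lo \<le> a \<Longrightarrow> a \<le> hi \<Longrightarrow> lo \<le> b \<Longrightarrow> b \<le> hi \<Longrightarrow>
      T a b = (\<Sum>a'\<in>{lo..hi}. \<Sum>b'\<in>{lo..hi}. R a a' * T' a' b' * C b b')"
  shows "detI lo hi T = detI lo hi T'"
proof -
  define N where "N = nat (hi - lo + 1)"
  define m where "m f = mat N N (\<lambda>(x, y). f (lo + int x) (lo + int y))" for f :: "int \<Rightarrow> int \<Rightarrow> complex"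
  have mc: "m f \<in> carrier_mat N N" for f by (simp add: m_def)
  have d: "detI lo hi f = det (m f)" for f by (simp add: detI_def m_def N_def)
  have "m T = m R * m T' * (m C)\<^sup>T"
  proof (rule eq_matI)
    fix x y assume "x < dim_row (m R * m T' * (m C)\<^sup>T)" "y < dim_col (m R * m T' * (m C)\<^sup>T)"
    then have xy: "x < N" "y < N" by (auto simp: m_def)
    have RT: "m R * m T' \<in> carrier_mat N N" "(m C)\<^sup>T \<in> carrier_mat N N" using mc by auto
    have "T (lo + int x) (lo + int y) =
        (\<Sum>j<N. \<Sum>k<N. R (lo + int x) (lo + int j) * T' (lo + int j) (lo + int k) * C (lo + int y) (lo + int k))"
      using T[of "lo + int x" "lo + int y"] xy unfolding sum_int_shift N_def by simp
    also have "\<dots> = (\<Sum>k<N. (\<Sum>j<N. R (lo + int x) (lo + int j) * T' (lo + int j) (lo + int k)) * C (lo + int y) (lo + int k))"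
      by (subst sum.swap) (simp add: sum_distrib_right)
    also have "\<dots> = (\<Sum>k<N. (m R * m T') $$ (x, k) * (m C)\<^sup>T $$ (k, y))"
    proof (rule sum.cong)
      fix k assume "k \<in> {..<N}"
      then have k: "k < N" by simp
      show "(\<Sum>j<N. R (lo + int x) (lo + int j) * T' (lo + int j) (lo + int k)) * C (lo + int y) (lo + int k) =
          (m R * m T') $$ (x, k) * (m C)\<^sup>T $$ (k, y)"
        unfolding mult_entry[OF mc mc xy(1) k] using xy k by (simp add: m_def)
    qed simp
    also have "\<dots> = (m R * m T' * (m C)\<^sup>T) $$ (x, y)" by (rule mult_entry[OF RT xy, symmetric])
    finally show "m T $$ (x, y) = (m R * m T' * (m C)\<^sup>T) $$ (x, y)" using xy by (simp add: m_def)
  qed (auto simp: m_def)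
  moreover have "det (m R) = 1" "det (m C) = 1"
    using detI_unitriangular[of R lo hi] detI_unitriangular[of C lo hi] R C by (auto simp: d)
  ultimately show ?thesis unfolding d using mc by (simp add: det_mult[of _ N] det_transpose[of _ N])
qed

text \<open>The rows of the blocks of a glued matrix: block \<open>l\<close> meets the main diagonal in the positions
  \<open>P (l + 1) + 1, \<dots>, P l\<close>. Blocks with \<open>up l\<close> share rows with the next block. Columns obey the same
  rules with \<open>up\<close> negated.\<close>

locale layout =
  fixes L :: nat and P :: "nat \<Rightarrow> int" and up :: "nat \<Rightarrow> bool" and lo hi :: "nat \<Rightarrow> int"
  assumes P0: "P 0 = 0" and P_dec: "P (Suc l) < P l"
    and alt: "Suc l < L \<Longrightarrow> up (Suc l) \<longleftrightarrow> \<not> up l"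
    and up_hi: "l < L \<Longrightarrow> up l \<Longrightarrow> hi l = P l" and up_lo: "l < L \<Longrightarrow> up l \<Longrightarrow> lo l \<le> P (Suc l) + 1"
    and up_lo_Suc: "Suc l < L \<Longrightarrow> up l \<Longrightarrow> lo (Suc l) \<le> lo l"
    and low_lo: "l < L \<Longrightarrow> \<not> up l \<Longrightarrow> lo l = P (Suc l) + 1" and low_hi: "l < L \<Longrightarrow> \<not> up l \<Longrightarrow> P l \<le> hi l"
    and low_hi_Suc: "Suc l < L \<Longrightarrow> \<not> up (Suc l) \<Longrightarrow> hi (Suc l) \<le> P l"
    and low_hi_0: "0 < L \<Longrightarrow> \<not> up 0 \<Longrightarrow> hi 0 \<le> 0"
begin

lemma P_mono: "l \<le> m \<Longrightarrow> P m \<le> P l"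
  by (induction m rule: dec_induct) (use P_dec in \<open>auto intro: order.trans less_imp_le\<close>)

lemma up_parity: "l \<le> m \<Longrightarrow> m < L \<Longrightarrow> up m \<longleftrightarrow> (up l \<longleftrightarrow> even (m - l))"
proof (induction m rule: dec_induct)
  case (step m)
  then show ?case using alt[of m] by (auto simp: Suc_diff_le)
qed simp

lemma low_hi_le: "l < L \<Longrightarrow> \<not> up l \<Longrightarrow> hi l \<le> P (l - 1)"
  using low_hi_Suc[of "l - 1"] low_hi_0 P0 by (cases l) auto

lemma rows_nonpos: "l < L \<Longrightarrow> hi l \<le> 0"
  using up_hi[of l] low_hi_le[of l] P_mono[of 0 l] P_mono[of 0 "l - 1"] P0 by (cases "up l") auto

lemma diag_in_rows: "l < L \<Longrightarrow> lo l \<le> P (Suc l) + 1 \<and> P l \<le> hi l"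
  using up_hi[of l] up_lo[of l] low_lo[of l] low_hi[of l] by (cases "up l") auto

text \<open>The rows of an \<open>up\<close> block reach no higher than those of its successor, and
  all blocks after the successor end above that; after a block that is not \<open>up\<close>, every
  later block already ends above its first row.\<close>

lemma overlap:
  assumes "l < m" "m < L" "lo l \<le> a" "a \<le> hi l" "lo m \<le> a" "a \<le> hi m"
  shows "m = Suc l \<and> up l"
proof (cases "up l")
  case True
  have "m = Suc l"
  proof (rule ccontr)
    assume "m \<noteq> Suc l"
    then have m: "Suc (Suc l) \<le> m" using assms by simp
    have "\<not> up (Suc l)" using alt[of l] True assms m by simp
    then have lol: "P (Suc (Suc l)) < lo l" using up_lo_Suc[of l] low_lo[of "Suc l"] True assms m by simp
    have "hi m \<le> P (Suc (Suc l))"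
    proof (cases "up m")
      case True
      then show ?thesis using up_hi[of m] P_mono[OF m] assms by simp
    next
      case False
      then have "odd (m - l)" using up_parity[of l m] \<open>up l\<close> assms by auto
      then have "m \<noteq> Suc (Suc l)" by auto
      then have "Suc (Suc l) \<le> m - 1" using m by simp
      then show ?thesis using low_hi_le[of m] False P_mono[of "Suc (Suc l)" "m - 1"] assms by simp
    qed
    then show False using lol assms by simp
  qed
  then show ?thesis using True by simp
next
  case False
  then have lol: "P (Suc l) < lo l" using low_lo[of l] assms by simp
  have "hi m \<le> P (Suc l)"
  proof (cases "up m")
    case True
    then show ?thesis using up_hi[of m] P_mono[of "Suc l" m] assms by simp
  next
    case False
    then have "m \<noteq> Suc l" using alt[of l] \<open>\<not> up l\<close> assms by auto
    then have "Suc l \<le> m - 1" using assms(1) by simp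
    then show ?thesis using low_hi_le[of m] False P_mono[of "Suc l" "m - 1"] assms by simp
  qed
  then show ?thesis using lol assms by simp
qed

end

text \<open>Row operations prescribed block by block. \<open>match\<close> makes neighbours agree on
  their common rows. By \<open>bd\<close>, the common rows are never added to the rows of the second
  block lying above them, which the first block does not reach.\<close>

locale row_ops = layout +
  fixes Rl :: "nat \<Rightarrow> int \<Rightarrow> int \<Rightarrow> complex"
  assumes tri: "l < L \<Longrightarrow> lo l \<le> a \<Longrightarrow> a \<le> hi l \<Longrightarrow> lo l \<le> a' \<Longrightarrow> a' \<le> hi l \<Longrightarrow> a' < a \<Longrightarrow> Rl l a a' = 0"
    and one: "l < L \<Longrightarrow> lo l \<le> a \<Longrightarrow> a \<le> hi l \<Longrightarrow> Rl l a a = 1"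
    and match: "Suc l < L \<Longrightarrow> up l \<Longrightarrow> lo l \<le> a \<Longrightarrow> a \<le> hi (Suc l) \<Longrightarrow> lo l \<le> a' \<Longrightarrow> a' \<le> hi (Suc l) \<Longrightarrow>
      Rl l a a' = Rl (Suc l) a a'"
    and bd: "Suc l < L \<Longrightarrow> up l \<Longrightarrow> lo (Suc l) \<le> a \<Longrightarrow> a < lo l \<Longrightarrow> lo l \<le> a' \<Longrightarrow> a' \<le> hi (Suc l) \<Longrightarrow>
      Rl (Suc l) a a' = 0"
begin

text \<open>One unitriangular matrix inducing all the prescribed operations. Where two blocks
  contain both rows, the choice of the least one is harmless by \<open>match\<close>.\<close>

definition glob :: "int \<Rightarrow> int \<Rightarrow> complex" where
  "glob a a' = (if a = a' then 1 else if a' < a then 0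
     else if \<exists>l<L. lo l \<le> a \<and> a \<le> hi l \<and> lo l \<le> a' \<and> a' \<le> hi l
     then Rl (LEAST l. l < L \<and> lo l \<le> a \<and> a \<le> hi l \<and> lo l \<le> a' \<and> a' \<le> hi l) a a' else 0)"

lemma glob_diag: "glob a a = 1" and glob_upper: "a' < a \<Longrightarrow> glob a a' = 0"
  by (simp_all add: glob_def)

lemma glob_in:
  assumes "l < L" "lo l \<le> a" "a \<le> hi l" "lo l \<le> a'" "a' \<le> hi l"
  shows "glob a a' = Rl l a a'"
proof (cases "a < a'")
  case True
  define l0 where "l0 = (LEAST l. l < L \<and> lo l \<le> a \<and> a \<le> hi l \<and> lo l \<le> a' \<and> a' \<le> hi l)"
  have l0: "l0 < L \<and> lo l0 \<le> a \<and> a \<le> hi l0 \<and> lo l0 \<le> a' \<and> a' \<le> hi l0" "l0 \<le> l"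
    unfolding l0_def by (rule LeastI[of _ l], use assms in simp) (rule Least_le, use assms in simp)
  have "\<exists>l<L. lo l \<le> a \<and> a \<le> hi l \<and> lo l \<le> a' \<and> a' \<le> hi l" using assms by blast
  then have "glob a a' = Rl l0 a a'" using True by (simp add: glob_def l0_def)
  moreover have "Rl l0 a a' = Rl l a a'"
  proof (cases "l0 = l")
    case False
    then have "l = Suc l0 \<and> up l0" using overlap[of l0 l a] l0 assms by simp
    then show ?thesis using match[of l0 a a'] l0 assms by auto
  qed simp
  ultimately show ?thesis by simp
next
  case False
  then show ?thesis using tri one assms by (cases "a = a'") (auto simp: glob_def)
qed

text \<open>Otherwise the content of block \<open>l\<close> would leak out of its footprint. The
  critical case is a row of the next block above the common rows, excluded by
  \<open>bd\<close>.\<close>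

lemma glob_out:
  assumes "l < L" "\<not> (lo l \<le> a \<and> a \<le> hi l)" "lo l \<le> a'" "a' \<le> hi l"
  shows "glob a a' = 0"
proof (cases "a < a' \<and> (\<exists>l<L. lo l \<le> a \<and> a \<le> hi l \<and> lo l \<le> a' \<and> a' \<le> hi l)")
  case True
  then obtain m where m: "m < L" "lo m \<le> a" "a \<le> hi m" "lo m \<le> a'" "a' \<le> hi m" and lt: "a < a'" by blast
  have ne: "m \<noteq> l" using m assms by auto
  have "l < m"
  proof (rule ccontr)
    assume "\<not> l < m"
    then have "m < l" using ne by simp
    then have "l = Suc m \<and> up m" using overlap[of m l a'] m assms by simp
    then show False using up_lo_Suc[of m] m assms lt by auto
  qed
  then have "m = Suc l \<and> up l" using overlap[of l m a'] m assms by simp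
  then have "Rl m a a' = 0" using bd[of l a a'] m assms lt by auto
  then show ?thesis using glob_in[OF m] by simp
next
  case False
  have "a \<noteq> a'" using assms by auto
  then show ?thesis using False by (auto simp: glob_def)
qed

end

text \<open>\<open>glob_in\<close> and \<open>glob_out\<close> let the global operations act on each
  footprint separately. Since they are upper triangular and no block extends beyond 0, they restrict
  to the window from \<open>q\<close> to 0 with determinant 1.\<close>

lemma staircase_transform:
  assumes row: "row_ops L P up rlo rhi Rl" and col: "row_ops L P (\<lambda>l. \<not> up l) clo chi Cl"
    and B: "\<And>l a b. l < L \<Longrightarrow> rlo l \<le> a \<Longrightarrow> a \<le> rhi l \<Longrightarrow> clo l \<le> b \<Longrightarrow> b \<le> chi l \<Longrightarrow>
      B l a b = (\<Sum>a'\<in>{rlo l..rhi l}. \<Sum>b'\<in>{clo l..chi l}. Rl l a a' * B' l a' b' * Cl l b b')"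
  shows "detI q 0 (\<lambda>a b. \<Sum>l<L. if rlo l \<le> a \<and> a \<le> rhi l \<and> clo l \<le> b \<and> b \<le> chi l then B l a b else 0) =
    detI q 0 (\<lambda>a b. \<Sum>l<L. if rlo l \<le> a \<and> a \<le> rhi l \<and> clo l \<le> b \<and> b \<le> chi l then B' l a b else 0)"
    (is "detI q 0 ?T = detI q 0 ?T'")
proof -
  interpret r: row_ops L P up rlo rhi Rl by (rule row)
  interpret c: row_ops L P "\<lambda>l. \<not> up l" clo chi Cl by (rule col)
  show ?thesis
  proof (rule detI_product[of r.glob c.glob])
    fix a b assume ab: "q \<le> a" "a \<le> (0::int)" "q \<le> b" "b \<le> (0::int)"
    have blk: "(if rlo l \<le> a \<and> a \<le> rhi l \<and> clo l \<le> b \<and> b \<le> chi l then B l a b else 0) =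
        (\<Sum>a'\<in>{q..0}. \<Sum>b'\<in>{q..0}. r.glob a a' *
          (if rlo l \<le> a' \<and> a' \<le> rhi l \<and> clo l \<le> b' \<and> b' \<le> chi l then B' l a' b' else 0) * c.glob b b')"
      (is "_ = ?S") if l: "l < L" for l
    proof -
      let ?X = "\<lambda>a' b'. r.glob a a' * B' l a' b' * c.glob b b'"
      have inner: "(\<Sum>b'\<in>{q..0}. if clo l \<le> b' \<and> b' \<le> chi l then ?X a' b' else 0) = (\<Sum>b'\<in>{clo l..chi l}. ?X a' b')" for a'
      proof -
        have "(\<Sum>b'\<in>{clo l..chi l}. ?X a' b') = (\<Sum>b'\<in>{q..0} \<inter> {clo l..chi l}. ?X a' b')"
        proof (rule sum.mono_neutral_right)
          show "\<forall>i\<in>{clo l..chi l} - {q..0} \<inter> {clo l..chi l}. ?X a' i = 0"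
            using c.rows_nonpos[OF l] c.glob_upper[of _ b] ab by auto
        qed auto
        also have "\<dots> = (\<Sum>b'\<in>{q..0}. if b' \<in> {clo l..chi l} then ?X a' b' else 0)"
          by (rule sum.inter_restrict) simp
        finally show ?thesis by simp
      qed
      have "?S = (\<Sum>a'\<in>{q..0}. if rlo l \<le> a' \<and> a' \<le> rhi l then
          (\<Sum>b'\<in>{q..0}. if clo l \<le> b' \<and> b' \<le> chi l then ?X a' b' else 0) else 0)"
      proof (rule sum.cong)
        fix a'
        show "(\<Sum>b'\<in>{q..0}. r.glob a a' *
          (if rlo l \<le> a' \<and> a' \<le> rhi l \<and> clo l \<le> b' \<and> b' \<le> chi l then B' l a' b' else 0) * c.glob b b') =
          (if rlo l \<le> a' \<and> a' \<le> rhi l then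
          (\<Sum>b'\<in>{q..0}. if clo l \<le> b' \<and> b' \<le> chi l then ?X a' b' else 0) else 0)"
        proof (cases "rlo l \<le> a' \<and> a' \<le> rhi l")
          case True
          then show ?thesis by (auto intro!: sum.cong)
        next
          case False
          then have F: "(rlo l \<le> a' \<and> a' \<le> rhi l \<and> clo l \<le> b' \<and> b' \<le> chi l) = False" for b' by auto
          show ?thesis by (simp only: if_not_P[OF False] F if_False mult_zero_right mult_zero_left sum.neutral_const)
        qed
      qed simp
      also have "\<dots> = (\<Sum>a'\<in>{q..0}. if a' \<in> {rlo l..rhi l} then (\<Sum>b'\<in>{clo l..chi l}. ?X a' b') else 0)"
        unfolding inner by simp
      also have "\<dots> = (\<Sum>a'\<in>{q..0} \<inter> {rlo l..rhi l}. \<Sum>b'\<in>{clo l..chi l}. ?X a' b')"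
        by (rule sum.inter_restrict[symmetric]) simp
      also have "\<dots> = (\<Sum>a'\<in>{rlo l..rhi l}. \<Sum>b'\<in>{clo l..chi l}. ?X a' b')"
      proof (rule sum.mono_neutral_left)
        show "\<forall>i\<in>{rlo l..rhi l} - {q..0} \<inter> {rlo l..rhi l}. (\<Sum>b'\<in>{clo l..chi l}. ?X i b') = 0"
          using r.rows_nonpos[OF l] r.glob_upper[of _ a] ab by (auto intro!: sum.neutral)
      qed auto
      also have "\<dots> = (if rlo l \<le> a \<and> a \<le> rhi l \<and> clo l \<le> b \<and> b \<le> chi l then B l a b else 0)"
      proof (cases "rlo l \<le> a \<and> a \<le> rhi l \<and> clo l \<le> b \<and> b \<le> chi l")
        case True
        have "(\<Sum>a'\<in>{rlo l..rhi l}. \<Sum>b'\<in>{clo l..chi l}. ?X a' b') =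
            (\<Sum>a'\<in>{rlo l..rhi l}. \<Sum>b'\<in>{clo l..chi l}. Rl l a a' * B' l a' b' * Cl l b b')"
          by (intro sum.cong refl) (use True l r.glob_in c.glob_in in simp)
        then show ?thesis using True B[OF l] by simp
      next
        case False
        have "?X a' b' = 0" if "a' \<in> {rlo l..rhi l}" "b' \<in> {clo l..chi l}" for a' b'
        proof (cases "rlo l \<le> a \<and> a \<le> rhi l")
          case True
          then have "\<not> (clo l \<le> b \<and> b \<le> chi l)" using False by blast
          then have "c.glob b b' = 0" using c.glob_out[OF l, of b b'] that by auto
          then show ?thesis by simp
        next
          case False
          then have "r.glob a a' = 0" using r.glob_out[OF l, of a a'] that by auto
          then show ?thesis by simp
        qed
        then have "(\<Sum>a'\<in>{rlo l..rhi l}. \<Sum>b'\<in>{clo l..chi l}. ?X a' b') = 0" by (intro sum.neutral ballI)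
        then show ?thesis by (simp only: if_not_P[OF False])
      qed
      finally show ?thesis ..
    qed
    have "?T a b = (\<Sum>l<L. \<Sum>a'\<in>{q..0}. \<Sum>b'\<in>{q..0}. r.glob a a' *
          (if rlo l \<le> a' \<and> a' \<le> rhi l \<and> clo l \<le> b' \<and> b' \<le> chi l then B' l a' b' else 0) * c.glob b b')"
      by (rule sum.cong) (use blk in auto)
    also have "\<dots> = (\<Sum>a'\<in>{q..0}. \<Sum>l<L. \<Sum>b'\<in>{q..0}. r.glob a a' *
          (if rlo l \<le> a' \<and> a' \<le> rhi l \<and> clo l \<le> b' \<and> b' \<le> chi l then B' l a' b' else 0) * c.glob b b')"
      by (rule sum.swap)
    also have "\<dots> = (\<Sum>a'\<in>{q..0}. \<Sum>b'\<in>{q..0}. \<Sum>l<L. r.glob a a' *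
          (if rlo l \<le> a' \<and> a' \<le> rhi l \<and> clo l \<le> b' \<and> b' \<le> chi l then B' l a' b' else 0) * c.glob b b')"
      by (intro sum.cong refl sum.swap)
    also have "\<dots> = (\<Sum>a'\<in>{q..0}. \<Sum>b'\<in>{q..0}. r.glob a a' * ?T' a' b' * c.glob b b')"
      by (simp only: sum_distrib_left sum_distrib_right)
    finally show "?T a b = (\<Sum>a'\<in>{q..0}. \<Sum>b'\<in>{q..0}. r.glob a a' * ?T' a' b' * c.glob b b')" .
  qed (rule r.glob_diag r.glob_upper c.glob_diag c.glob_upper, assumption?)+
qed

text \<open>Later blocks end to the left of these columns; earlier ones begin to the right of them
  or below row \<open>P l\<close>.\<close>

lemma staircase_single_block:
  assumes row: "layout L P up rlo rhi" and col: "layout L P (\<lambda>l. \<not> up l) clo chi"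
    and l: "l < L" "up l" and ab: "a \<le> P l" "P (Suc l) < b" "b \<le> P l"
    and m: "m < L" "rlo m \<le> a" "a \<le> rhi m" "clo m \<le> b" "b \<le> chi m"
  shows "m = l"
proof -
  interpret r: layout L P up rlo rhi by (rule row)
  interpret c: layout L P "\<lambda>l. \<not> up l" clo chi by (rule col)
  show ?thesis
  proof (rule ccontr)
    assume "m \<noteq> l"
    show False
    proof (cases "up m")
      case True
      then have lo: "P (Suc m) < b" using c.low_lo[of m] m by simp
      have "\<not> m < l" using r.P_mono[of "Suc m" l] lo ab by auto
      then have ml: "l < m" using \<open>m \<noteq> l\<close> by simp
      then have "even (m - l)" using r.up_parity[of l m] True l m by simp
      then have "m \<noteq> Suc l" by auto
      then have "Suc l \<le> m - 1" using ml by simp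
      then have "chi m \<le> P (Suc l)" 
        using c.low_hi_le[of m] True m r.P_mono[of "Suc l" "m - 1"] ml by simp
      then show False using m ab by simp
    next
      case False
      then have "chi m = P m" using c.up_hi[of m] m by simp
      then have "\<not> l < m" using r.P_mono[of "Suc l" m] m ab by auto
      then have "m < l" using \<open>m \<noteq> l\<close> by simp
      then have "P l < rlo m" using r.low_lo[of m] False m r.P_mono[of "Suc m" l] by simp
      then show False using m ab by simp
    qed
  qed
qed

text \<open>\<open>anti\<close> is antitriangularity in grid coordinates. Together with the
  isolation of block \<open>l\<close> it makes one off-diagonal corner zero, so the diagonal piece
  nearest to 0 splits off and leaves a smaller staircase of the same kind.\<close>

lemma staircase_det:
  assumes row: "layout L P up rlo rhi" and col: "layout L P (\<lambda>l. \<not> up l) clo chi"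
    and K: "K < L" and q: "P (Suc K) < q" "q \<le> P K"
    and anti: "\<And>l a b. l < L \<Longrightarrow> rlo l \<le> a \<Longrightarrow> a \<le> rhi l \<Longrightarrow> clo l \<le> b \<Longrightarrow> b \<le> chi l \<Longrightarrow>
      (if up l then a \<le> P (Suc l) \<and> b \<le> P l else a \<le> P l \<and> b \<le> P (Suc l)) \<Longrightarrow> B l a b = 0"
  shows "detI q 0 (\<lambda>a b. \<Sum>l<L. if rlo l \<le> a \<and> a \<le> rhi l \<and> clo l \<le> b \<and> b \<le> chi l then B l a b else 0) =
    detI q (P K) (B K) * (\<Prod>l<K. detI (P (Suc l) + 1) (P l) (B l))"
    (is "detI q 0 ?T = _")
proof -
  interpret r: layout L P up rlo rhi by (rule row)
  interpret c: layout L P "\<lambda>l. \<not> up l" clo chi by (rule col)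
  have sgl: "?T a b = (if rlo l \<le> a \<and> a \<le> rhi l \<and> clo l \<le> b \<and> b \<le> chi l then B l a b else 0)"
    if l: "l < L" and ab: "a \<le> P l" "b \<le> P l" "if up l then P (Suc l) < b else P (Suc l) < a" for l a b
  proof -
    have U: "m = l" if m: "m < L" "rlo m \<le> a \<and> a \<le> rhi m \<and> clo m \<le> b \<and> b \<le> chi m" for m
    proof (cases "up l")
      case True
      then show ?thesis using staircase_single_block[OF row col l True ab(1) _ ab(2), of m] m ab by simp
    next
      case False
      have row_parity: "layout L P (\<lambda>l. \<not> \<not> up l) rlo rhi" using row by simp
      show ?thesis using staircase_single_block[OF col row_parity l _ ab(2) _ ab(1), of m] m ab False by simp
    qed
    show ?thesis
    proof (rule sum_single[OF l])
      fix m assume "m < L" "m \<noteq> l"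
      then show "(if rlo m \<le> a \<and> a \<le> rhi m \<and> clo m \<le> b \<and> b \<le> chi m then B m a b else 0) = 0"
        using U by (intro if_not_P) blast
    qed
  qed
  have diag: "?T a b = B l a b" if l: "l < L" and ab: "P (Suc l) < a" "a \<le> P l" "P (Suc l) < b" "b \<le> P l" for l a b
    using sgl[OF l ab(2,4)] ab r.diag_in_rows[OF l] c.diag_in_rows[OF l] by (auto split: if_splits)
  have peel: "detI q (P l) ?T = detI q (P K) ?T * (\<Prod>m\<in>{l..<K}. detI (P (Suc m) + 1) (P m) (B m))" if "l \<le> K" for l
    using that
  proof (induction "K - l" arbitrary: l)
    case 0
    then show ?case by simp
  next
    case (Suc k)
    then have lK: "l < K" by simp
    then have lL: "l < L" using K by simp
    have qm: "q \<le> P (Suc l) + 1" "P (Suc l) \<le> P l" using r.P_mono[of "Suc l" K] r.P_dec[of l] q lK by auto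
    have "detI q (P l) ?T = detI q (P (Suc l)) ?T * detI (P (Suc l) + 1) (P l) ?T"
    proof (cases "up l")
      case True
      have "?T a b = 0" if "a \<le> P (Suc l)" "P (Suc l) < b" "b \<le> P l" for a b
        using sgl[OF lL, of a b] anti[OF lL, of a b] that qm True by auto
      then show ?thesis by (intro detI_split_upper qm) 
    next
      case False
      have "?T a b = 0" if "b \<le> P (Suc l)" "P (Suc l) < a" "a \<le> P l" for a b
        using sgl[OF lL, of a b] anti[OF lL, of a b] that qm False by auto
      then show ?thesis by (intro detI_split_lower qm)
    qed
    moreover have "detI (P (Suc l) + 1) (P l) ?T = detI (P (Suc l) + 1) (P l) (B l)"
      by (rule detI_cong) (use diag[OF lL] in simp)
    moreover have "{l..<K} = insert l {Suc l..<K}" using lK by auto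
    ultimately show ?case using Suc.hyps(1)[of "Suc l"] Suc.hyps(2) lK by simp
  qed
  have "detI q 0 ?T = detI q (P K) ?T * (\<Prod>m<K. detI (P (Suc m) + 1) (P m) (B m))"
    using peel[of 0] r.P0 by (simp add: lessThan_atLeast0)
  moreover have "detI q (P K) ?T = detI q (P K) (B K)"
    by (rule detI_cong) (use diag[OF K] q in simp)
  ultimately show ?thesis by simp
qed

section \<open>Positions of the blocks of a glued matrix\<close>

section \<open>Alignment of runs along a path\<close>

lemma run_Min_Max:
  assumes J: "J \<subseteq> {1..<n}" and k: "1 \<le> k" "k \<le> n"
  shows "linked J k y \<longleftrightarrow> Min (run n J k) \<le> y \<and> y \<le> Max (run n J k)"
    "1 \<le> Min (run n J k)" "Min (run n J k) \<le> k" "k \<le> Max (run n J k)" "Max (run n J k) \<le> n"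
    "Max (run n J k) \<notin> J"
proof -
  obtain lo hi where lh: "lo \<le> k" "k \<le> hi" "1 \<le> lo" "hi \<le> n" "{lo..<hi} \<subseteq> J" "hi \<notin> J" "lo - 1 \<notin> J"
    "\<And>y. linked J k y \<longleftrightarrow> lo \<le> y \<and> y \<le> hi"
    using run_bounds[OF J k] by blast
  have r: "run n J k = {lo..hi}" unfolding run_eq_linked lh(8) using lh(3,4) by auto
  have mn: "Min (run n J k) = lo" unfolding r by (rule Min_eqI) (use lh(1,2) in simp_all)
  have mx: "Max (run n J k) = hi" unfolding r by (rule Max_eqI) (use lh(1,2) in simp_all)
  show "linked J k y \<longleftrightarrow> Min (run n J k) \<le> y \<and> y \<le> Max (run n J k)" unfolding mn mx by (rule lh(8))
  show "1 \<le> Min (run n J k)" "Min (run n J k) \<le> k" unfolding mn by (rule lh(3), rule lh(1))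
  show "k \<le> Max (run n J k)" "Max (run n J k) \<le> n" "Max (run n J k) \<notin> J"
    unfolding mx by (rule lh(2), rule lh(4), rule lh(6))
qed

lemma run_cong: "linked J k l \<Longrightarrow> run n J k = run n J l"
  unfolding run_eq_linked by (intro Collect_cong conj_cong refl) (meson linked_trans linked_sym)

text \<open>\<open>linked_transport\<close> shows that the run around gamma(u) extends at least as
  far as that around \<open>u\<close> on either side; the inverse triple gives the converse.\<close>

lemma run_shift:
  assumes \<Gamma>: "is_bd_triple n \<Gamma>" and u: "u \<in> Gam1 \<Gamma>" and d': "d' = (d \<noteq> (\<not> preserves_orientation \<Gamma> u))"
  shows "int (Min (run n (fl n d (Gam1 \<Gamma>)) (fi n d u))) - int (fi n d u) =
      int (Min (run n (fl n d' (Gam2 \<Gamma>)) (fi n d' (gam \<Gamma> u)))) - int (fi n d' (gam \<Gamma> u))"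
    "int (Max (run n (fl n d (Gam1 \<Gamma>)) (fi n d u))) - int (fi n d u) =
      int (Max (run n (fl n d' (Gam2 \<Gamma>)) (fi n d' (gam \<Gamma> u)))) - int (fi n d' (gam \<Gamma> u))"
proof -
  have main: "int (Min (run n (fl n d' (Gam2 \<Gamma>)) (fi n d' (gam \<Gamma> u)))) - int (fi n d' (gam \<Gamma> u)) \<le>
      int (Min (run n (fl n d (Gam1 \<Gamma>)) (fi n d u))) - int (fi n d u) \<and>
      int (Max (run n (fl n d (Gam1 \<Gamma>)) (fi n d u))) - int (fi n d u) \<le>
      int (Max (run n (fl n d' (Gam2 \<Gamma>)) (fi n d' (gam \<Gamma> u)))) - int (fi n d' (gam \<Gamma> u))"
    if \<Gamma>: "is_bd_triple n \<Gamma>" and u: "u \<in> Gam1 \<Gamma>" and d': "d' = (d \<noteq> (\<not> preserves_orientation \<Gamma> u))" for \<Gamma> u d d'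
  proof -
    note D = bd_tripleD[OF \<Gamma>]
    let ?c = "fi n d u" and ?v = "fi n d' (gam \<Gamma> u)"
    have "gam \<Gamma> u \<in> {1..<n}" "u \<in> {1..<n}" using D(4)[OF u] D(1,2) u by auto
    then have c: "1 \<le> ?c" "?c \<le> n" and v: "1 \<le> ?v" "?v \<le> n"
      using fi_range[of u n d] fi_range[of "gam \<Gamma> u" n d'] by auto
    note m1 = run_Min_Max[OF fl_subset[OF D(1)] c, of d] and m2 = run_Min_Max[OF fl_subset[OF D(2)] v, of d']
    let ?mn = "Min (run n (fl n d (Gam1 \<Gamma>)) ?c)" and ?mx = "Max (run n (fl n d (Gam1 \<Gamma>)) ?c)"
    obtain x' where x': "?mn + ?v = x' + ?c" "linked (fl n d' (Gam2 \<Gamma>)) ?v x'"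
      using linked_transport[OF \<Gamma> u d', of ?mn] m1(1)[of ?mn] m1(3,4) by auto
    obtain y' where y': "?mx + ?v = y' + ?c" "linked (fl n d' (Gam2 \<Gamma>)) ?v y'"
      using linked_transport[OF \<Gamma> u d', of ?mx] m1(1)[of ?mx] m1(3,4) by auto
    show ?thesis using x' y' m2(1)[of x'] m2(1)[of y'] by linarith
  qed
  note D = bd_tripleD[OF \<Gamma>]
  have "preserves_orientation (inv_triple \<Gamma>) (gam \<Gamma> u) = preserves_orientation \<Gamma> u"
    using inv_triple_orient[OF \<Gamma> u] by (simp add: orient_def split: if_splits)
  then have d2: "d = (d' \<noteq> (\<not> preserves_orientation (inv_triple \<Gamma>) (gam \<Gamma> u)))" using d' by auto
  note a = main[OF \<Gamma> u d'] and b = main[OF inv_triple_bd[OF \<Gamma>] _ d2]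
  show "int (Min (run n (fl n d (Gam1 \<Gamma>)) (fi n d u))) - int (fi n d u) =
      int (Min (run n (fl n d' (Gam2 \<Gamma>)) (fi n d' (gam \<Gamma> u)))) - int (fi n d' (gam \<Gamma> u))"
    "int (Max (run n (fl n d (Gam1 \<Gamma>)) (fi n d u))) - int (fi n d u) =
      int (Max (run n (fl n d' (Gam2 \<Gamma>)) (fi n d' (gam \<Gamma> u)))) - int (fi n d' (gam \<Gamma> u))"
    using a b D(4)[OF u] inv_triple_gam(1)[OF \<Gamma> u] by auto
qed

text \<open>The diagonal coordinate at which block \<open>l\<close> is entered. The steps of 1 past
  the end of the path keep the sequence strictly decreasing for all \<open>l\<close>, as
  \<open>layout\<close> demands.\<close>

definition diagpos :: "nat \<Rightarrow> (nat \<Rightarrow> nat) \<Rightarrow> nat \<Rightarrow> int" where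
  "diagpos L \<tau> l = - (\<Sum>m<l. if m < L then int (\<tau> m) else 1)"

lemma diagpos_Suc: "l < L \<Longrightarrow> diagpos L \<tau> (Suc l) = diagpos L \<tau> l - int (\<tau> l)"
  by (simp add: diagpos_def)

text \<open>The data of either the rows or the columns: \<open>\<tau> l\<close> is the size of the diagonal piece of block \<open>l\<close>,
  \<open>\<delta> l\<close> tells whether the block is dual, and \<open>\<rho> l\<close> is its offset.\<close>

locale line =
  fixes n :: nat and \<Gamma> :: bd_triple and L :: nat and up :: "nat \<Rightarrow> bool"
    and \<tau> :: "nat \<Rightarrow> nat" and \<delta> :: "nat \<Rightarrow> bool" and \<rho> :: "nat \<Rightarrow> int"
  assumes triple: "is_bd_triple n \<Gamma>"
    and \<tau>_range: "l < L \<Longrightarrow> 1 \<le> \<tau> l \<and> \<tau> l < n"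
    and alternating: "Suc l < L \<Longrightarrow> up (Suc l) \<longleftrightarrow> \<not> up l"
    and link: "Suc l < L \<Longrightarrow> up l \<Longrightarrow> \<exists>u\<in>Gam1 \<Gamma>. fi n (\<delta> l) u = n - \<tau> l \<and>
      \<tau> (Suc l) = fi n (\<delta> (Suc l)) (gam \<Gamma> u) \<and> \<delta> (Suc l) = (\<delta> l \<noteq> (\<not> preserves_orientation \<Gamma> u))"
    and start: "0 < L \<Longrightarrow> \<not> up 0 \<Longrightarrow> \<tau> 0 \<notin> fl n (\<delta> 0) (Gam2 \<Gamma>)"
    and \<rho>_0: "0 < L \<Longrightarrow> \<rho> 0 = (if up 0 then - int n else - int (Max (run n (fl n (\<delta> 0) (Gam2 \<Gamma>)) (\<tau> 0))))"
    and \<rho>_up: "Suc l < L \<Longrightarrow> up l \<Longrightarrow> \<rho> (Suc l) = \<rho> l + int (Min (run n (fl n (\<delta> l) (Gam1 \<Gamma>)) (n - \<tau> l + 1))) -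
      int (Min (run n (fl n (\<delta> (Suc l)) (Gam2 \<Gamma>)) (Max (run n (fl n (\<delta> (Suc l)) (Gam2 \<Gamma>)) (\<tau> (Suc l))))))"
    and \<rho>_low: "Suc l < L \<Longrightarrow> \<not> up l \<Longrightarrow> \<rho> (Suc l) = \<rho> l - int n"
begin

abbreviation "J1 l \<equiv> fl n (\<delta> l) (Gam1 \<Gamma>)"
abbreviation "J2 l \<equiv> fl n (\<delta> l) (Gam2 \<Gamma>)"
abbreviation "P \<equiv> diagpos L \<tau>"

definition rlo :: "nat \<Rightarrow> int" where
  "rlo l = (if up l then \<rho> l + int (Min (run n (J1 l) (n - \<tau> l + 1))) else \<rho> l + 1)"

definition rhi :: "nat \<Rightarrow> int" where
  "rhi l = (if up l then \<rho> l + int n else \<rho> l + int (Max (run n (J2 l) (\<tau> l))))"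

lemma J_subset: "J1 l \<subseteq> {1..<n}" "J2 l \<subseteq> {1..<n}"
  using fl_subset bd_tripleD(1,2)[OF triple] by auto

lemma run1:
  assumes "l < L"
  shows "linked (J1 l) (n - \<tau> l + 1) y \<longleftrightarrow> Min (run n (J1 l) (n - \<tau> l + 1)) \<le> y \<and> y \<le> Max (run n (J1 l) (n - \<tau> l + 1))"
    "1 \<le> Min (run n (J1 l) (n - \<tau> l + 1))" "Min (run n (J1 l) (n - \<tau> l + 1)) \<le> n - \<tau> l + 1"
    "Max (run n (J1 l) (n - \<tau> l + 1)) \<le> n"
  using run_Min_Max[OF J_subset(1)[of l], of "n - \<tau> l + 1"] \<tau>_range[OF assms] by auto

lemma run2:
  assumes "l < L"
  shows "linked (J2 l) (\<tau> l) y \<longleftrightarrow> Min (run n (J2 l) (\<tau> l)) \<le> y \<and> y \<le> Max (run n (J2 l) (\<tau> l))"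
    "1 \<le> Min (run n (J2 l) (\<tau> l))" "Min (run n (J2 l) (\<tau> l)) \<le> \<tau> l"
    "\<tau> l \<le> Max (run n (J2 l) (\<tau> l))" "Max (run n (J2 l) (\<tau> l)) \<le> n" "Max (run n (J2 l) (\<tau> l)) \<notin> J2 l"
  using run_Min_Max[OF J_subset(2)[of l], of "\<tau> l"] \<tau>_range[OF assms] by auto

text \<open>The offsets align first elements of runs. As the runs extend equally far around
  corresponding roots, the roots themselves and the last elements are aligned too.\<close>

lemma shift:
  assumes "Suc l < L" "up l"
  obtains u where "u \<in> Gam1 \<Gamma>" "fi n (\<delta> l) u = n - \<tau> l" "\<tau> (Suc l) = fi n (\<delta> (Suc l)) (gam \<Gamma> u)"
    "\<delta> (Suc l) = (\<delta> l \<noteq> (\<not> preserves_orientation \<Gamma> u))"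
    "linked (J1 l) (n - \<tau> l) (n - \<tau> l + 1)"
    "\<rho> (Suc l) + int (\<tau> (Suc l)) = \<rho> l + int (n - \<tau> l)"
    "\<rho> (Suc l) + int (Min (run n (J2 (Suc l)) (\<tau> (Suc l)))) = \<rho> l + int (Min (run n (J1 l) (n - \<tau> l + 1)))"
    "\<rho> (Suc l) + int (Max (run n (J2 (Suc l)) (\<tau> (Suc l)))) = \<rho> l + int (Max (run n (J1 l) (n - \<tau> l + 1)))"
proof -
  obtain u where u: "u \<in> Gam1 \<Gamma>" "fi n (\<delta> l) u = n - \<tau> l" "\<tau> (Suc l) = fi n (\<delta> (Suc l)) (gam \<Gamma> u)"
    "\<delta> (Suc l) = (\<delta> l \<noteq> (\<not> preserves_orientation \<Gamma> u))"
    using link[OF assms] by blast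
  \<comment> \<open>The exit index is one more than the root of the inclined edge; both lie in one
    run because that root belongs to \<open>J1 l\<close>.\<close>
  have "n - \<tau> l \<in> J1 l" using u(1,2) unfolding fl_def by (metis imageI)
  then have lk: "linked (J1 l) (n - \<tau> l) (n - \<tau> l + 1)" using linked_Suc[of "J1 l" "n - \<tau> l"] by simp
  have r1: "run n (J1 l) (n - \<tau> l) = run n (J1 l) (n - \<tau> l + 1)" by (rule run_cong[OF lk])
  have "linked (J2 (Suc l)) (\<tau> (Suc l)) (Max (run n (J2 (Suc l)) (\<tau> (Suc l))))"
    using run2(1)[OF assms(1)] run2(3,4)[OF assms(1)] by simp
  from run_cong[OF this, of n]
  have r2: "run n (J2 (Suc l)) (Max (run n (J2 (Suc l)) (\<tau> (Suc l)))) = run n (J2 (Suc l)) (\<tau> (Suc l))" by simp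
  note s = run_shift[OF triple u(1,4), unfolded u(2) u(3)[symmetric] r1]
  show thesis
    by (rule that[OF u lk]) (use s \<rho>_up[OF assms, unfolded r2] in linarith)+
qed

text \<open>The exit point of a block is diagonally adjacent to the entrance point of the next one,
  so the diagonal runs through all of them.\<close>

lemma pos: "l < L \<Longrightarrow> (if up l then \<rho> l + int n = P l else \<rho> l + int (\<tau> l) = P l)"
proof (induction l)
  case 0
  show ?case
  proof (cases "up 0")
    case False
    \<comment> \<open>By maximality of the path at its beginning (\<open>start\<close>), the run of
      the entrance point ends there, so the lower right corner is on the diagonal.\<close>
    have "Max (run n (J2 0) (\<tau> 0)) = \<tau> 0"
    proof (rule ccontr)
      assume a: "Max (run n (J2 0) (\<tau> 0)) \<noteq> \<tau> 0"
      then have "\<tau> 0 < Max (run n (J2 0) (\<tau> 0))" using run2(4)[OF 0] by simp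
      moreover have "linked (J2 0) (\<tau> 0) (Max (run n (J2 0) (\<tau> 0)))" using run2[OF 0] by simp
      ultimately show False using linked_less start[OF 0 False] by blast
    qed
    then show ?thesis using False \<rho>_0[OF 0] by (simp add: diagpos_def)
  qed (use \<rho>_0[OF 0] in \<open>simp add: diagpos_def\<close>)
next
  case (Suc l)
  then have l: "l < L" by simp
  show ?case
  proof (cases "up l")
    case True
    obtain u where "\<rho> (Suc l) + int (\<tau> (Suc l)) = \<rho> l + int (n - \<tau> l)"
      using shift[OF Suc.prems True] by metis
    then show ?thesis using Suc.IH[OF l] True alternating[OF Suc.prems] \<tau>_range[OF l] diagpos_Suc[OF l, of \<tau>]
      by (simp add: of_nat_diff)
  next
    case False
    then show ?thesis using Suc.IH[OF l] alternating[OF Suc.prems] \<rho>_low[OF Suc.prems False] diagpos_Suc[OF l, of \<tau>] by simp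
  qed
qed

lemma layout: "layout L P up rlo rhi"
proof
  show "P 0 = 0" by (simp add: diagpos_def)
  show "P (Suc l) < P l" for l
  proof (cases "l < L")
    case True
    then show ?thesis using diagpos_Suc[OF True, of \<tau>] \<tau>_range[OF True] by simp
  qed (simp add: diagpos_def)
  show "Suc l < L \<Longrightarrow> up (Suc l) \<longleftrightarrow> \<not> up l" for l by (rule alternating)
  show "rhi l = P l" if "l < L" "up l" for l using pos[OF that(1)] that by (simp add: rhi_def)
  show "rlo l \<le> P (Suc l) + 1" if "l < L" "up l" for l
  proof -
    have "int (Min (run n (J1 l) (n - \<tau> l + 1))) \<le> int (n - \<tau> l + 1)"
      using run1(3)[OF that(1)] by (simp only: of_nat_le_iff)
    also have "\<dots> = int n - int (\<tau> l) + 1" using \<tau>_range[OF that(1)] by simp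
    finally show ?thesis
      using pos[OF that(1)] that diagpos_Suc[OF that(1), of \<tau>] by (simp add: rlo_def)
  qed
  show "rlo (Suc l) \<le> rlo l" if h: "Suc l < L" "up l" for l
  proof -
    obtain u where "\<rho> (Suc l) + int (Min (run n (J2 (Suc l)) (\<tau> (Suc l)))) = \<rho> l + int (Min (run n (J1 l) (n - \<tau> l + 1)))"
      using shift[OF h] by metis
    then show ?thesis using run2(2)[OF that(1)] that alternating[OF that(1)] by (simp add: rlo_def)
  qed
  show "rlo l = P (Suc l) + 1" if "l < L" "\<not> up l" for l
    using pos[OF that(1)] that diagpos_Suc[OF that(1), of \<tau>] by (simp add: rlo_def)
  show "P l \<le> rhi l" if "l < L" "\<not> up l" for l
    using pos[OF that(1)] that run2(4)[OF that(1)] by (simp add: rhi_def)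
  show "rhi (Suc l) \<le> P l" if h: "Suc l < L" "\<not> up (Suc l)" for l
  proof -
    have u: "up l" using that alternating by blast
    have l: "l < L" using that by simp
    obtain u where "\<rho> (Suc l) + int (Max (run n (J2 (Suc l)) (\<tau> (Suc l)))) = \<rho> l + int (Max (run n (J1 l) (n - \<tau> l + 1)))"
      using shift[OF h(1) u] by metis
    then show ?thesis using run1(4)[OF l] that pos[OF l] u by (simp add: rhi_def)
  qed
  show "rhi 0 \<le> 0" if "0 < L" "\<not> up 0" using \<rho>_0[OF that(1)] that by (simp add: rhi_def)
qed

definition Rl :: "complex mat \<Rightarrow> complex mat \<Rightarrow> nat \<Rightarrow> int \<Rightarrow> int \<Rightarrow> complex" where
  "Rl G H l a a' = src (\<delta> l) (if up l then G else H) $$ (nat (a - \<rho> l) - 1, nat (a' - \<rho> l) - 1)"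

lemma index_range:
  assumes "l < L" "rlo l \<le> a" "a \<le> rhi l"
  shows "1 \<le> a - \<rho> l" "a - \<rho> l \<le> int n"
  using assms run1(2)[OF assms(1)] run2(5)[OF assms(1)] by (auto simp: rlo_def rhi_def split: if_splits)

text \<open>\<open>match\<close> is the transport property of \<open>row_glue\<close>, and
  \<open>bd\<close> the block diagonality of \<open>H\<close>, which survives passing to the
  dual.\<close>

lemma row_ops:
  assumes g: "row_glue n \<Gamma> G H"
  shows "row_ops L P up rlo rhi (Rl G H)"
proof -
  interpret layout L P up rlo rhi by (rule layout)
  have GH: "G \<in> N_plus n" "H \<in> N_plus n" "blockdiag n (Gam2 \<Gamma>) H" and tr: "transported n \<Gamma> G H"
    using g by (auto simp: row_glue_def)
  have N: "src (\<delta> l) (if up l then G else H) \<in> N_plus n" for l using GH N_plus_src by simp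
  show ?thesis
  proof
    fix l a a' assume l: "l < L" and a: "rlo l \<le> a" "a \<le> rhi l" "rlo l \<le> a'" "a' \<le> rhi l" "a' < a"
    show "Rl G H l a a' = 0"
      unfolding Rl_def using index_range[OF l a(1,2)] index_range[OF l a(3,4)] a(5)
      by (intro N_plusD(3)[OF N]) auto
  next
    fix l a assume l: "l < L" and a: "rlo l \<le> a" "a \<le> rhi l"
    show "Rl G H l a a = 1" unfolding Rl_def using index_range[OF l a] by (intro N_plusD(4)[OF N]) auto
  next
    fix l a a' assume l: "Suc l < L" and u: "up l"
      and a: "rlo l \<le> a" "a \<le> rhi (Suc l)" "rlo l \<le> a'" "a' \<le> rhi (Suc l)"
    have l': "l < L" using l by simp
    have nu: "\<not> up (Suc l)" using alternating[OF l] u by simp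
    obtain v where v: "v \<in> Gam1 \<Gamma>" "fi n (\<delta> l) v = n - \<tau> l" "\<tau> (Suc l) = fi n (\<delta> (Suc l)) (gam \<Gamma> v)"
      "\<delta> (Suc l) = (\<delta> l \<noteq> (\<not> preserves_orientation \<Gamma> v))"
      "linked (J1 l) (n - \<tau> l) (n - \<tau> l + 1)"
      "\<rho> (Suc l) + int (\<tau> (Suc l)) = \<rho> l + int (n - \<tau> l)"
      "\<rho> (Suc l) + int (Max (run n (J2 (Suc l)) (\<tau> (Suc l)))) = \<rho> l + int (Max (run n (J1 l) (n - \<tau> l + 1)))"
      using shift[OF l u] by metis
    have hi: "rhi (Suc l) \<le> rhi l" using low_hi_Suc[OF l nu] up_hi[OF l' u] by simp
    have lo: "rlo (Suc l) \<le> rlo l" by (rule up_lo_Suc[OF l u])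
    have key: "1 \<le> nat (a - \<rho> l) \<and> nat (a - \<rho> l) \<le> n \<and> linked (J1 l) (fi n (\<delta> l) v) (nat (a - \<rho> l)) \<and>
        nat (a - \<rho> l) + fi n (\<delta> (Suc l)) (gam \<Gamma> v) = nat (a - \<rho> (Suc l)) + fi n (\<delta> l) v"
      if a: "rlo l \<le> a" "a \<le> rhi (Suc l)" for a
    proof -
      have i: "1 \<le> a - \<rho> l" "a - \<rho> l \<le> int n" using index_range[OF l' a(1)] a hi by auto
      have i': "1 \<le> a - \<rho> (Suc l)" using index_range(1)[OF l, of a] a lo by auto
      have "Min (run n (J1 l) (n - \<tau> l + 1)) \<le> nat (a - \<rho> l)" "nat (a - \<rho> l) \<le> Max (run n (J1 l) (n - \<tau> l + 1))"
        using a u nu v(7) i by (auto simp: rlo_def rhi_def)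
      then have "linked (J1 l) (n - \<tau> l + 1) (nat (a - \<rho> l))" using run1(1)[OF l'] by simp
      then have "linked (J1 l) (fi n (\<delta> l) v) (nat (a - \<rho> l))" using v(5) linked_trans v(2) by metis
      moreover have "nat (a - \<rho> l) + fi n (\<delta> (Suc l)) (gam \<Gamma> v) = nat (a - \<rho> (Suc l)) + fi n (\<delta> l) v"
        using v(6) i i' unfolding v(2) v(3)[symmetric] by linarith
      ultimately show ?thesis using i by auto
    qed
    note k1 = key[OF a(1,2)] and k2 = key[OF a(3,4)]
    show "Rl G H l a a' = Rl G H (Suc l) a a'"
      unfolding Rl_def using u nu tr[unfolded transported_def, rule_format, OF v(1,4)] k1 k2 by simp
  next
    fix l a a' assume l: "Suc l < L" and u: "up l"
      and a: "rlo (Suc l) \<le> a" "a < rlo l" "rlo l \<le> a'" "a' \<le> rhi (Suc l)"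
    have nu: "\<not> up (Suc l)" using alternating[OF l] u by simp
    obtain v where v: "\<rho> (Suc l) + int (Min (run n (J2 (Suc l)) (\<tau> (Suc l)))) = \<rho> l + int (Min (run n (J1 l) (n - \<tau> l + 1)))"
      using shift[OF l u] by metis
    have i: "1 \<le> a - \<rho> (Suc l)" "a - \<rho> (Suc l) \<le> int n" using index_range[OF l a(1)] a by auto
    have i': "1 \<le> a' - \<rho> (Suc l)" "a' - \<rho> (Suc l) \<le> int n" using index_range[OF l _ a(4)] a by auto
    have "\<not> Min (run n (J2 (Suc l)) (\<tau> (Suc l))) \<le> nat (a - \<rho> (Suc l))"
      using a(2) v u i by (auto simp: rlo_def)
    then have n1: "\<not> linked (J2 (Suc l)) (\<tau> (Suc l)) (nat (a - \<rho> (Suc l)))" using run2(1)[OF l] by simp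
    have "Min (run n (J2 (Suc l)) (\<tau> (Suc l))) \<le> nat (a' - \<rho> (Suc l))"
      "nat (a' - \<rho> (Suc l)) \<le> Max (run n (J2 (Suc l)) (\<tau> (Suc l)))"
      using a(3,4) v u nu i' by (auto simp: rlo_def rhi_def)
    then have n2: "linked (J2 (Suc l)) (\<tau> (Suc l)) (nat (a' - \<rho> (Suc l)))" using run2(1)[OF l] by simp
    have "\<not> linked (J2 (Suc l)) (nat (a - \<rho> (Suc l))) (nat (a' - \<rho> (Suc l)))"
      using n1 n2 by (meson linked_trans linked_sym)
    then show "Rl G H (Suc l) a a' = 0"
      unfolding Rl_def using nu i i' blockdiagD(2)[OF blockdiag_src[OF bd_tripleD(2)[OF triple] GH(3) N_plusD(2)[OF GH(2)]], of "nat (a - \<rho> (Suc l)) - 1" "nat (a' - \<rho> (Suc l)) - 1" "\<delta> (Suc l)"]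
      by auto
  qed
qed

text \<open>Indices outside the block drop out: those before it by triangularity, those after it
  because an \<open>up\<close> block reaches \<open>n\<close> and any other one ends with a run,
  across which \<open>H\<close> has no entries.\<close>

lemma expand:
  assumes g: "row_glue n \<Gamma> G H" and l: "l < L" and a: "rlo l \<le> a" "a \<le> rhi l"
  shows "(\<Sum>k<n. src (\<delta> l) (if up l then G else H) $$ (nat (a - \<rho> l) - 1, k) * Y k) =
    (\<Sum>a'\<in>{rlo l..rhi l}. Rl G H l a a' * Y (nat (a' - \<rho> l) - 1))"
proof -
  have GH: "G \<in> N_plus n" "H \<in> N_plus n" "blockdiag n (Gam2 \<Gamma>) H"
    using g by (auto simp: row_glue_def)
  define A where "A = src (\<delta> l) (if up l then G else H)"
  have N: "A \<in> N_plus n" unfolding A_def using GH N_plus_src by simp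
  note i = index_range[OF l a]
  let ?x = "nat (a - \<rho> l) - 1"
  define S where "S = (\<lambda>a'. nat (a' - \<rho> l) - 1) ` {rlo l..rhi l}"
  have inj: "inj_on (\<lambda>a'. nat (a' - \<rho> l) - 1) {rlo l..rhi l}"
  proof (rule inj_onI)
    fix y z assume yz: "y \<in> {rlo l..rhi l}" "z \<in> {rlo l..rhi l}" "nat (y - \<rho> l) - 1 = nat (z - \<rho> l) - 1"
    then show "y = z" using index_range[OF l, of y] index_range[OF l, of z] by auto
  qed
  have Sn: "S \<subseteq> {..<n}" 
  proof
    fix k assume "k \<in> S"
    then obtain y where "rlo l \<le> y" "y \<le> rhi l" "k = nat (y - \<rho> l) - 1" by (auto simp: S_def)
    then show "k \<in> {..<n}" using index_range[OF l, of y] by auto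
  qed
  have zero: "A $$ (?x, k) = 0" if k: "k < n" "k \<notin> S" for k
  proof -
    have out: "\<not> (rlo l \<le> \<rho> l + int k + 1 \<and> \<rho> l + int k + 1 \<le> rhi l)"
    proof
      assume "rlo l \<le> \<rho> l + int k + 1 \<and> \<rho> l + int k + 1 \<le> rhi l"
      then have "k = nat ((\<rho> l + int k + 1) - \<rho> l) - 1" "\<rho> l + int k + 1 \<in> {rlo l..rhi l}" by auto
      then show False using k(2) unfolding S_def by blast
    qed
    show ?thesis
    proof (cases "k < ?x")
      case True
      then show ?thesis using N_plusD(3)[OF N, of ?x k] i by auto
    next
      case False
      then have hi: "rhi l < \<rho> l + int k + 1" using out a i by auto
      then have nu: "\<not> up l" using k by (auto simp: rhi_def)
      have "\<not> linked (J2 l) (Suc ?x) (Suc k)"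
      proof
        assume lk: "linked (J2 l) (Suc ?x) (Suc k)"
        have "Suc ?x \<le> Max (run n (J2 l) (\<tau> l))" using a(2) i nu by (auto simp: rhi_def)
        moreover have "Max (run n (J2 l) (\<tau> l)) < Suc k" using hi nu by (auto simp: rhi_def)
        ultimately have "Max (run n (J2 l) (\<tau> l)) \<in> {min (Suc ?x) (Suc k)..<max (Suc ?x) (Suc k)}" by auto
        then have "Max (run n (J2 l) (\<tau> l)) \<in> J2 l" using lk unfolding linked_def by blast
        then show False using run2(6)[OF l] by simp
      qed
      then show ?thesis unfolding A_def
        using nu i k blockdiagD(2)[OF blockdiag_src[OF bd_tripleD(2)[OF triple] GH(3) N_plusD(2)[OF GH(2)]], of ?x k "\<delta> l"] by auto
    qed
  qed
  have "(\<Sum>k<n. A $$ (?x, k) * Y k) = (\<Sum>k\<in>S. A $$ (?x, k) * Y k)"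
    by (rule sum.mono_neutral_right) (use Sn zero in auto)
  also have "\<dots> = (\<Sum>a'\<in>{rlo l..rhi l}. A $$ (?x, nat (a' - \<rho> l) - 1) * Y (nat (a' - \<rho> l) - 1))"
    unfolding S_def by (subst sum.reindex[OF inj]) simp
  finally show ?thesis by (simp add: A_def Rl_def)
qed

end

section \<open>Corner minors, alternating paths and the minors of glued matrices\<close>

section \<open>Trailing minors\<close>

lemma pick_interval: "x < b - a \<Longrightarrow> pick {a..<b} x = a + x"
proof (induction x)
  case 0
  then show ?case by (auto intro!: Least_equality)
next
  case (Suc x)
  then have "pick {a..<b} x = a + x" by simp
  then show ?case using Suc.prems by (auto intro!: Least_equality)
qed

lemma submatrix_interval:
  assumes "a + m \<le> dim_row A" "b + k \<le> dim_col A"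
  shows "submatrix A {a..<a + m} {b..<b + k} = mat m k (\<lambda>(x, y). A $$ (a + x, b + y))"
proof -
  have "{i. i < dim_row A \<and> i \<in> {a..<a + m}} = {a..<a + m}" "{i. i < dim_col A \<and> i \<in> {b..<b + k}} = {b..<b + k}"
    using assms by auto
  then show ?thesis unfolding submatrix_def by (intro eq_matI) (auto simp: pick_interval)
qed

lemma trailing_minor_lower:
  assumes "A \<in> carrier_mat n n" "1 \<le> j" "j \<le> i" "i \<le> n"
  shows "trailing_minor n i j A = det (mat (n + 1 - i) (n + 1 - i) (\<lambda>(x, y). A $$ (i - 1 + x, j - 1 + y)))"
proof -
  have "{i - 1..<n} = {i - 1..<i - 1 + (n + 1 - i)}" "{j - 1..<j + n - i} = {j - 1..<j - 1 + (n + 1 - i)}"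
    using assms by auto
  then show ?thesis
    unfolding trailing_minor_def using assms submatrix_interval[of "i - 1" "n + 1 - i" A "j - 1" "n + 1 - i"] by simp
qed

lemma trailing_minor_upper:
  assumes "A \<in> carrier_mat n n" "1 \<le> i" "i < j" "j \<le> n"
  shows "trailing_minor n i j A = det (mat (n + 1 - j) (n + 1 - j) (\<lambda>(x, y). A $$ (i - 1 + x, j - 1 + y)))"
proof -
  have "{i - 1..<i + n - j} = {i - 1..<i - 1 + (n + 1 - j)}" "{j - 1..<n} = {j - 1..<j - 1 + (n + 1 - j)}"
    using assms by auto
  then show ?thesis
    unfolding trailing_minor_def using assms submatrix_interval[of "i - 1" "n + 1 - j" A "j - 1" "n + 1 - j"] by simp
qed

lemma trailing_minor_transpose:
  assumes A: "A \<in> carrier_mat n n" and ij: "1 \<le> j" "j < i" "i \<le> n"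
  shows "trailing_minor n j i A\<^sup>T = trailing_minor n i j A"
proof -
  let ?B = "mat (n + 1 - i) (n + 1 - i) (\<lambda>(x, y). A $$ (i - 1 + x, j - 1 + y))"
  have "mat (n + 1 - i) (n + 1 - i) (\<lambda>(x, y). A\<^sup>T $$ (j - 1 + x, i - 1 + y)) = ?B\<^sup>T"
    by (rule eq_matI) (use A ij in auto)
  then show ?thesis
    using A ij det_transpose[of ?B "n + 1 - i"] by (simp add: trailing_minor_lower trailing_minor_upper)
qed

text \<open>The rows from \<open>i\<close> to \<open>n\<close> of \<open>N * M\<close> are
  unitriangular combinations of the same rows of \<open>M\<close>.\<close>

lemma trailing_minor_N_plus_mult:
  assumes N: "N \<in> N_plus n" and M: "M \<in> carrier_mat n n" and ij: "1 \<le> j" "j \<le> i" "i \<le> n"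
  shows "trailing_minor n i j (N * M) = trailing_minor n i j M"
proof -
  note Nc = N_plusD[OF N]
  define m where "m = n + 1 - i"
  define a where "a = i - 1"
  define b where "b = j - 1"
  have am: "a + m = n" "b + m \<le> n" using ij by (auto simp: a_def b_def m_def)
  let ?N = "mat m m (\<lambda>(x, y). N $$ (a + x, a + y))" and ?M = "mat m m (\<lambda>(x, y). M $$ (a + x, b + y))"
  have "mat m m (\<lambda>(x, y). (N * M) $$ (a + x, b + y)) = ?N * ?M"
  proof (rule eq_matI)
    fix x y assume "x < dim_row (?N * ?M)" "y < dim_col (?N * ?M)"
    then have xy: "x < m" "y < m" by auto
    have "(N * M) $$ (a + x, b + y) = (\<Sum>k<n. N $$ (a + x, k) * M $$ (k, b + y))"
      by (rule mult_entry[OF Nc(1) M]) (use xy am in auto)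
    also have "\<dots> = (\<Sum>k\<in>{a..<n}. N $$ (a + x, k) * M $$ (k, b + y))"
      by (rule sum.mono_neutral_right) (use Nc(3)[of "a + x"] xy am in auto)
    also have "\<dots> = (\<Sum>k<m. N $$ (a + x, a + k) * M $$ (a + k, b + y))"
      by (rule sum.reindex_bij_witness[of _ "\<lambda>k. a + k" "\<lambda>k. k - a"]) (use am in auto)
    also have "\<dots> = (?N * ?M) $$ (x, y)"
      using xy mult_entry[of ?N m ?M x y] by simp
    finally show "mat m m (\<lambda>(x, y). (N * M) $$ (a + x, b + y)) $$ (x, y) = (?N * ?M) $$ (x, y)" using xy by simp
  qed auto
  moreover have "det ?N = 1"
  proof (subst det_upper)
    show "(\<Prod>x<m. ?N $$ (x, x)) = 1" by (rule prod.neutral) (use Nc(4) am in auto)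
  qed (use Nc(3) am in auto)
  ultimately have "det (mat m m (\<lambda>(x, y). (N * M) $$ (a + x, b + y))) = det ?M"
    using det_mult[of ?N m ?M] by simp
  then show ?thesis
    using M Nc(1) ij by (simp add: trailing_minor_lower m_def a_def b_def del: index_mult_mat)
qed

text \<open>Jacobi's complementary minor identity for the corner minors.\<close>

lemma trailing_minor_dagger:
  assumes A: "A \<in> carrier_mat n n" "det A = 1" and m: "1 \<le> m" "m < n"
  shows "trailing_minor n (m + 1) 1 (dagger A) = trailing_minor n (n - m + 1) 1 A"
proof -
  obtain B where B: "B \<in> carrier_mat n n" "A * B = 1\<^sub>m n" by (rule det_one_inverse[OF A])
  define p where "p = n - m"
  have n: "n = p + m" using m by (simp add: p_def)
  \<comment> \<open>\<open>C\<close> is the inverse \<open>B\<close> with its last \<open>m\<close>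
    columns replaced by unit vectors. Then \<open>A * C\<close> is block triangular with determinant
    that of the corner \<open>A3\<close>, while \<open>det C\<close> is \<open>det B3\<close> up to
    the sign of a block exchange.\<close>
  define C where "C = mat n n (\<lambda>(k, y). if y < p then B $$ (k, y) else if k = y - p then 1 else 0)"
  define A1 where "A1 = mat p m (\<lambda>(x, y). A $$ (x, y))"
  define A3 where "A3 = mat m m (\<lambda>(x, y). A $$ (p + x, y))"
  define B1 where "B1 = mat m p (\<lambda>(x, y). B $$ (x, y))"
  define B3 where "B3 = mat p p (\<lambda>(x, y). B $$ (m + x, y))"
  have Cc: "C \<in> carrier_mat n n" by (simp add: C_def)
  have "A * C = four_block_mat (1\<^sub>m p) A1 (0\<^sub>m m p) A3" (is "_ = ?D")
  proof (rule eq_matI)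
    fix x y assume "x < dim_row ?D" "y < dim_col ?D"
    then have xy: "x < n" "y < n" using n by (auto simp: A3_def)
    have e: "(A * C) $$ (x, y) = (\<Sum>k<n. A $$ (x, k) * C $$ (k, y))" by (rule mult_entry[OF A(1) Cc xy])
    show "(A * C) $$ (x, y) = ?D $$ (x, y)"
    proof (cases "y < p")
      case True
      then have "(A * C) $$ (x, y) = (A * B) $$ (x, y)"
        unfolding e mult_entry[OF A(1) B(1) xy] using xy by (intro sum.cong) (auto simp: C_def)
      then show ?thesis using True xy B(2) n by (auto simp: A1_def A3_def)
    next
      case False
      have "(\<Sum>k<n. A $$ (x, k) * C $$ (k, y)) = A $$ (x, y - p) * C $$ (y - p, y)"
        by (rule sum_single) (use False xy n in \<open>auto simp: C_def\<close>)
      then have "(A * C) $$ (x, y) = A $$ (x, y - p)" unfolding e using False xy n by (simp add: C_def)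
      then show ?thesis using False xy n by (auto simp: A1_def A3_def)
    qed
  qed (use n A Cc in \<open>auto simp: A3_def\<close>)
  moreover have "det ?D = det A3"
    using det_four_block_mat_lower_left_zero[of "1\<^sub>m p" p A1 m "0\<^sub>m m p" A3] by (simp add: A1_def A3_def)
  ultimately have dC: "det C = det A3" using det_mult[OF A(1) Cc] A(2) by simp
  have "det C = (- 1) ^ (p * m) * det (mat (p + m) (p + m) (\<lambda>(i, j). C $$ ((if i < p then i + m else i - p), j)))"
    by (rule det_swap_rows) (use Cc n in simp)
  also have "mat (p + m) (p + m) (\<lambda>(i, j). C $$ ((if i < p then i + m else i - p), j)) =
      four_block_mat B3 (0\<^sub>m p m) B1 (1\<^sub>m m)"
    by (rule eq_matI) (auto simp: C_def B3_def B1_def n add.commute)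
  also have "det (four_block_mat B3 (0\<^sub>m p m) B1 (1\<^sub>m m)) = det B3"
    using det_four_block_mat_upper_right_zero[of B3 p "0\<^sub>m p m" m B1 "1\<^sub>m m"] by (simp add: B1_def B3_def)
  finally have dB: "det A3 = (- 1) ^ (p * m) * det B3" using dC by simp
  \<comment> \<open>Order reversal with alternating signs, as in \<open>dagger\<close>. Its
    determinant enters squared and cancels; the remaining sign compensates that of the block
    exchange.\<close>
  define K where "K = mat p p (\<lambda>(x, z). if z = p - 1 - x then (- 1) ^ x else (0::complex))"
  have Kc: "K \<in> carrier_mat p p" "K\<^sup>T \<in> carrier_mat p p" by (auto simp: K_def)
  have Kl: "(K * Y) $$ (x, y) = (- 1) ^ x * Y $$ (p - 1 - x, y)" if "Y \<in> carrier_mat p p" "x < p" "y < p" for Y x y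
  proof -
    have "(\<Sum>k<p. K $$ (x, k) * Y $$ (k, y)) = K $$ (x, p - 1 - x) * Y $$ (p - 1 - x, y)"
      by (rule sum_single) (use that in \<open>auto simp: K_def\<close>)
    then show ?thesis unfolding mult_entry[OF Kc(1) that] using that by (simp add: K_def)
  qed
  have Kr: "(Y * K\<^sup>T) $$ (x, y) = (- 1) ^ y * Y $$ (x, p - 1 - y)" if "Y \<in> carrier_mat p p" "x < p" "y < p" for Y x y
  proof -
    have "(\<Sum>k<p. Y $$ (x, k) * K\<^sup>T $$ (k, y)) = Y $$ (x, p - 1 - y) * K\<^sup>T $$ (p - 1 - y, y)"
      by (rule sum_single) (use that in \<open>auto simp: K_def\<close>)
    then show ?thesis unfolding mult_entry[OF that(1) Kc(2) that(2,3)] using that by (simp add: K_def)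
  qed
  have "K * K\<^sup>T = 1\<^sub>m p"
  proof (rule eq_matI)
    fix x y assume "x < dim_row (1\<^sub>m p :: complex mat)" "y < dim_col (1\<^sub>m p :: complex mat)"
    then have xy: "x < p" "y < p" by auto
    show "(K * K\<^sup>T) $$ (x, y) = 1\<^sub>m p $$ (x, y)"
      unfolding Kr[OF Kc(1) xy] using xy by (auto simp: K_def power_add[symmetric] mult_2[symmetric])
  qed (use Kc in auto)
  then have dK: "det K * det K = 1"
    using det_mult[OF Kc] det_transpose[OF Kc(1)] by simp
  have E: "mat p p (\<lambda>(x, y). dagger A $$ (m + x, y)) = (- 1) ^ m \<cdot>\<^sub>m (K * (B3\<^sup>T * K\<^sup>T))" (is "?E = _")
  proof (rule eq_matI)
    have c: "B3\<^sup>T \<in> carrier_mat p p" "B3\<^sup>T * K\<^sup>T \<in> carrier_mat p p" "K * (B3\<^sup>T * K\<^sup>T) \<in> carrier_mat p p"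
      using Kc by (auto simp: B3_def)
    fix x y assume "x < dim_row ((- 1) ^ m \<cdot>\<^sub>m (K * (B3\<^sup>T * K\<^sup>T)))" "y < dim_col ((- 1) ^ m \<cdot>\<^sub>m (K * (B3\<^sup>T * K\<^sup>T)))"
    then have xy: "x < p" "y < p" using c by (auto simp: K_def)
    have "?E $$ (x, y) = (- 1) ^ (m + x + y) * B $$ (n - 1 - y, n - 1 - (m + x))"
      using dagger_entry[OF A B, of "m + x" y] xy n by simp
    also have "B $$ (n - 1 - y, n - 1 - (m + x)) = B3 $$ (p - 1 - y, p - 1 - x)"
    proof -
      have "n - 1 - y = m + (p - 1 - y)" "n - 1 - (m + x) = p - 1 - x" using xy n by auto
      then show ?thesis using xy by (simp add: B3_def)
    qed
    also have "(- 1) ^ (m + x + y) * B3 $$ (p - 1 - y, p - 1 - x) =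
        (- 1) ^ m * ((- 1) ^ x * ((- 1) ^ y * B3\<^sup>T $$ (p - 1 - x, p - 1 - y)))"
      using xy by (simp add: power_add B3_def)
    also have "\<dots> = (- 1) ^ m * (K * (B3\<^sup>T * K\<^sup>T)) $$ (x, y)"
      unfolding Kl[OF c(2) xy] using Kr[OF c(1) _ xy(2), of "p - 1 - x"] xy by simp
    finally show "?E $$ (x, y) = ((- 1) ^ m \<cdot>\<^sub>m (K * (B3\<^sup>T * K\<^sup>T))) $$ (x, y)"
      using xy c(3) Kc by (simp add: B3_def del: index_mult_mat(1))
  qed (use Kc in \<open>auto simp: B3_def\<close>)
  have c: "B3 \<in> carrier_mat p p" "B3\<^sup>T \<in> carrier_mat p p" "B3\<^sup>T * K\<^sup>T \<in> carrier_mat p p"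
    using Kc by (auto simp: B3_def)
  have "det ?E = ((- 1) ^ m) ^ p * (det K * (det B3 * det K))"
    unfolding E using Kc c by (simp add: det_mult[of _ p] det_transpose[of _ p] B3_def[symmetric])
  also have "\<dots> = ((- 1) ^ m) ^ p * ((det K * det K) * det B3)" by (simp only: ac_simps)
  also have "\<dots> = (- 1) ^ (p * m) * det B3"
    unfolding dK by (simp add: power_mult[symmetric] mult.commute[of p m])
  also have "\<dots> = det A3" using dB by simp
  finally have "det ?E = det A3" .
  moreover have "trailing_minor n (m + 1) 1 (dagger A) = det ?E"
    using trailing_minor_lower[of "dagger A" n 1 "m + 1"] A m by (simp add: p_def)
  moreover have "trailing_minor n (n - m + 1) 1 A = det A3"
  proof -
    have idx: "n + 1 - (n - m + 1) = m" "n - m + 1 - 1 = p" using m by (auto simp: p_def)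
    have "trailing_minor n (n - m + 1) 1 A =
        det (mat (n + 1 - (n - m + 1)) (n + 1 - (n - m + 1)) (\<lambda>(x, y). A $$ (n - m + 1 - 1 + x, 1 - 1 + y)))"
      by (rule trailing_minor_lower[OF A(1)]) (use m in auto)
    then show ?thesis unfolding idx by (simp add: A3_def)
  qed
  ultimately show ?thesis by simp
qed

text \<open>Hence an edge contributes the same factor whether its primal or its dual block occurs in
  the glued matrix.\<close>

lemma trailing_minor_src:
  assumes A: "A \<in> carrier_mat n n" "det A = 1" and t: "1 \<le> t" "t < n"
  shows "trailing_minor n (n - fi n d t + 1) 1 (src d A) = trailing_minor n (n - t + 1) 1 A"
  using trailing_minor_dagger[OF A t] t by (simp add: src_def fi_def)

section \<open>Maximal alternating paths\<close>

definition chain :: "'a set \<Rightarrow> ('a \<Rightarrow> 'a \<Rightarrow> bool) \<Rightarrow> 'a list \<Rightarrow> bool" where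
  "chain E R es \<longleftrightarrow> es \<noteq> [] \<and> set es \<subseteq> E \<and> successively R es"

definition maxchain :: "'a set \<Rightarrow> ('a \<Rightarrow> 'a \<Rightarrow> bool) \<Rightarrow> 'a list \<Rightarrow> bool" where
  "maxchain E R es \<longleftrightarrow> chain E R es \<and> (\<forall>e. \<not> chain E R (e # es)) \<and> (\<forall>e. \<not> chain E R (es @ [e]))"

lemma chain_nth: "chain E R es \<longleftrightarrow> es \<noteq> [] \<and> (\<forall>k<length es. es ! k \<in> E) \<and> (\<forall>k. Suc k < length es \<longrightarrow> R (es ! k) (es ! Suc k))"
  by (auto simp: chain_def successively_conv_nth set_conv_nth)

lemma chain_Cons: "chain E R (e # es) \<longleftrightarrow> e \<in> E \<and> (es = [] \<or> chain E R es \<and> R e (hd es))"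
  by (cases es) (auto simp: chain_def)

lemma chain_snoc: "chain E R (es @ [e]) \<longleftrightarrow> e \<in> E \<and> (es = [] \<or> chain E R es \<and> R (last es) e)"
  by (cases "es = []") (auto simp: chain_def successively_append_iff)

context
  fixes E :: "'a set" and R :: "'a \<Rightarrow> 'a \<Rightarrow> bool"
  assumes finE: "finite E"
    and functional: "\<And>x y z. x \<in> E \<Longrightarrow> y \<in> E \<Longrightarrow> z \<in> E \<Longrightarrow> R x y \<Longrightarrow> R x z \<Longrightarrow> y = z"
    and injective: "\<And>x y z. x \<in> E \<Longrightarrow> y \<in> E \<Longrightarrow> z \<in> E \<Longrightarrow> R x z \<Longrightarrow> R y z \<Longrightarrow> x = y"
begin

text \<open>Successors and predecessors are unique, and a maximal chain stops only where none can be
  added; so no chain that meets it can leave it in either direction.\<close>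

lemma maxchain_agree:
  assumes es: "chain E R es" "a < length es" and fs: "maxchain E R fs" "b < length fs" and e: "es ! a = fs ! b"
  shows "a + k < length es \<Longrightarrow> b + k < length fs \<and> es ! (a + k) = fs ! (b + k)"
    "k \<le> a \<Longrightarrow> k \<le> b \<and> es ! (a - k) = fs ! (b - k)"
proof -
  have fc: "chain E R fs" using fs by (simp add: maxchain_def)
  show "a + k < length es \<Longrightarrow> b + k < length fs \<and> es ! (a + k) = fs ! (b + k)"
  proof (induction k)
    case (Suc k)
    then have IH: "b + k < length fs" "es ! (a + k) = fs ! (b + k)" by auto
    have r: "R (es ! (a + k)) (es ! (a + Suc k))" "es ! (a + Suc k) \<in> E" "es ! (a + k) \<in> E"
      using es(1) Suc.prems unfolding chain_nth by auto
    have lt: "b + Suc k < length fs"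
    proof (rule ccontr)
      assume "\<not> b + Suc k < length fs"
      then have "b + k = length fs - 1" using IH by simp
      then have "last fs = es ! (a + k)" using fc IH by (simp add: last_conv_nth chain_nth)
      then have "chain E R (fs @ [es ! (a + Suc k)])" using r fc by (simp add: chain_snoc)
      then show False using fs(1) by (simp add: maxchain_def)
    qed
    then have "R (fs ! (b + k)) (fs ! (b + Suc k))" "fs ! (b + Suc k) \<in> E"
      using fc unfolding chain_nth by auto
    then show ?case using functional[OF r(3) r(2)] r(1) IH lt by auto
  qed (use assms in auto)
  show "k \<le> a \<Longrightarrow> k \<le> b \<and> es ! (a - k) = fs ! (b - k)"
  proof (induction k)
    case (Suc k)
    then have IH: "k \<le> b" "es ! (a - k) = fs ! (b - k)" by auto
    have s: "Suc (a - Suc k) = a - k" using Suc.prems by simp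
    have r: "R (es ! (a - Suc k)) (es ! (a - k))" "es ! (a - Suc k) \<in> E" "es ! (a - k) \<in> E"
      using es Suc.prems s unfolding chain_nth by (auto simp flip: s)
    have lt: "Suc k \<le> b"
    proof (rule ccontr)
      assume "\<not> Suc k \<le> b"
      then have "b - k = 0" using IH by simp
      then have "hd fs = es ! (a - k)" using fc IH by (simp add: hd_conv_nth chain_nth)
      then have "chain E R (es ! (a - Suc k) # fs)" using r fc by (simp add: chain_Cons)
      then show False using fs(1) by (simp add: maxchain_def)
    qed
    then have s': "Suc (b - Suc k) = b - k" by simp
    have "R (fs ! (b - Suc k)) (fs ! (b - k))" "fs ! (b - Suc k) \<in> E"
      using fc fs(2) lt s' unfolding chain_nth by (auto simp flip: s')
    then show ?case using injective[OF r(2) _ r(3)] r(1) IH lt by auto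
  qed (use assms in auto)
qed

lemma maxchain_unique:
  assumes "maxchain E R es" "maxchain E R fs" "e \<in> set es" "e \<in> set fs"
  shows "es = fs"
proof -
  obtain a b where ab: "a < length es" "es ! a = e" "b < length fs" "fs ! b = e"
    using assms by (auto simp: in_set_conv_nth)
  have c: "chain E R es" "chain E R fs" using assms by (auto simp: maxchain_def)
  have e: "es ! a = fs ! b" using ab by simp
  note 1 = maxchain_agree[OF c(1) ab(1) assms(2) ab(3) e] and 2 = maxchain_agree[OF c(2) ab(3) assms(1) ab(1) e[symmetric]]
  have "a = b" using 1(2)[of a] 2(2)[of b] by simp
  have "length es = length fs"
  proof -
    have "length es - 1 < length fs" using 1(1)[of "length es - 1 - a"] \<open>a = b\<close> ab by simp
    moreover have "length fs - 1 < length es" using 2(1)[of "length fs - 1 - b"] \<open>a = b\<close> ab by simp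
    ultimately show ?thesis by linarith
  qed
  moreover have "es ! k = fs ! k" if "k < length es" for k
  proof (cases "k \<le> a")
    case True
    then show ?thesis using 1(2)[of "a - k"] \<open>a = b\<close> by simp
  next
    case False
    then show ?thesis using 1(1)[of "k - a"] \<open>a = b\<close> that by simp
  qed
  ultimately show ?thesis by (rule nth_equalityI)
qed

lemma maxchain_exists:
  assumes d: "\<And>es. chain E R es \<Longrightarrow> distinct es" and e: "e \<in> E"
  shows "\<exists>es. maxchain E R es \<and> e \<in> set es"
proof -
  let ?P = "\<lambda>es. chain E R es \<and> e \<in> set es"
  have P: "?P [e]" using e by (simp add: chain_def)
  have b: "\<forall>es. ?P es \<longrightarrow> length es < Suc (card E)"
  proof (intro allI impI)
    fix es assume "?P es"
    then have "distinct es" "set es \<subseteq> E" using d by (auto simp: chain_def)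
    then show "length es < Suc (card E)" using card_mono[OF finE, of "set es"] by (simp add: distinct_card)
  qed
  obtain es where es: "?P es" "\<forall>fs. ?P fs \<longrightarrow> length fs \<le> length es"
    using ex_has_greatest_nat[of ?P "[e]" length "Suc (card E)"] P b by blast
  have "maxchain E R es" unfolding maxchain_def
  proof (intro conjI allI notI)
    fix x assume "chain E R (x # es)"
    then show False using es(2)[rule_format, of "x # es"] es(1) by simp
  next
    fix x assume "chain E R (es @ [x])"
    then show False using es(2)[rule_format, of "es @ [x]"] es(1) by simp
  qed (use es in blast)
  then show ?thesis using es by blast
qed

end

lemma filter_alternating:
  assumes "successively (\<lambda>e e'. S e e' \<and> (P e \<longleftrightarrow> \<not> P e')) es" "Suc l < length (filter P es)"
  shows "\<exists>i\<in>set es. \<not> P i \<and> S (filter P es ! l) i \<and> S i (filter P es ! Suc l)"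
  using assms
proof (induction es arbitrary: l rule: induct_list012)
  case (3 x y zs)
  have s: "S x y" "P x \<longleftrightarrow> \<not> P y" "successively (\<lambda>e e'. S e e' \<and> (P e \<longleftrightarrow> \<not> P e')) (y # zs)"
    using "3.prems" by auto
  then have sz: "successively (\<lambda>e e'. S e e' \<and> (P e \<longleftrightarrow> \<not> P e')) zs" by (cases zs) auto
  show ?case
  proof (cases "P x")
    case False
    then have "filter P (x # y # zs) = filter P (y # zs)" by simp
    then show ?thesis using "3.IH"(2)[OF s(3), of l] "3.prems"(2) by auto
  next
    case True
    then have f: "filter P (x # y # zs) = x # filter P zs" using s by simp
    show ?thesis
    proof (cases l)
      case 0
      then have "filter P zs \<noteq> []" using "3.prems"(2) f by auto
      then obtain z zs' where z: "zs = z # zs'" by (cases zs) auto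
      then have "P z" "S y z" using s True by auto
      then show ?thesis using f 0 z s True by auto
    next
      case (Suc l')
      then show ?thesis using "3.IH"(1)[OF sz, of l'] "3.prems"(2) f by auto
    qed
  qed
qed auto

definition next_edge :: "nat \<Rightarrow> bd_triple \<Rightarrow> bd_triple \<Rightarrow> vertex \<Rightarrow> vertex \<Rightarrow> bool" where
  "next_edge n \<Gamma>r \<Gamma>c v w \<longleftrightarrow> (case v of
     (Upper, i) \<Rightarrow> n - i \<in> Gam1 \<Gamma>r \<and> w = (Lower, gam \<Gamma>r (n - i))
   | (Lower, i) \<Rightarrow> \<exists>u\<in>Gam1 \<Gamma>c. gam \<Gamma>c u = n - i \<and> w = (Upper, u))"

text \<open>The description in \<open>path_edges\<close> is definite because edges compose
  deterministically in both directions, and aperiodicity bounds the length: a stretch between two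
  occurrences of an edge would be an alternating cycle.\<close>

theorem path_edges_properties:
  fixes p :: part
  assumes \<Gamma>: "is_bd_triple n \<Gamma>r" "is_bd_triple n \<Gamma>c" and ap: "aperiodic n \<Gamma>r \<Gamma>c"
    and i: "i \<in> {1..<n}"
  defines "hs \<equiv> path_edges n \<Gamma>r \<Gamma>c (p, i)"
  shows "(p, i) \<in> set hs" "distinct hs" "\<forall>v\<in>set hs. snd v \<in> {1..<n}"
    "\<forall>l. Suc l < length hs \<longrightarrow> next_edge n \<Gamma>r \<Gamma>c (hs ! l) (hs ! Suc l)"
    "fst (hs ! 0) = Upper \<Longrightarrow> snd (hs ! 0) \<notin> Gam1 \<Gamma>c"
    "fst (hs ! 0) = Lower \<Longrightarrow> snd (hs ! 0) \<notin> Gam2 \<Gamma>r"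
proof -
  note Dr = bd_tripleD[OF \<Gamma>(1)] and Dc = bd_tripleD[OF \<Gamma>(2)]
  define H where "H = horizontal_edges n"
  define I where "I = inclined_edges \<Gamma>r \<Gamma>c"
  define E where "E = H \<union> I"
  define R where "R e e' \<longleftrightarrow> snd e = fst e' \<and> (e \<in> H \<longleftrightarrow> e' \<notin> H)" for e e' :: edge
  have Hi: "e \<in> H \<longleftrightarrow> (\<exists>p i. e = ((p, i), (p, n - i)) \<and> 1 \<le> i \<and> i < n)" for e
    by (auto simp: H_def horizontal_edges_def)
  have Ii: "e \<in> I \<longleftrightarrow> (\<exists>i\<in>Gam1 \<Gamma>r. e = ((Upper, i), (Lower, gam \<Gamma>r i))) \<or> (\<exists>i\<in>Gam1 \<Gamma>c. e = ((Lower, gam \<Gamma>c i), (Upper, i)))" for e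
    by (auto simp: I_def inclined_edges_def)
  have fin: "finite E"
  proof -
    have "E \<subseteq> ({Upper, Lower} \<times> {..n}) \<times> ({Upper, Lower} \<times> {..n})"
    proof
      fix e assume "e \<in> E"
      moreover have "p \<in> {Upper, Lower}" for p by (cases p) auto
      ultimately show "e \<in> ({Upper, Lower} \<times> {..n}) \<times> ({Upper, Lower} \<times> {..n})"
        using Dr(1,2) Dr(4) Dc(1,2) Dc(4) unfolding E_def Un_iff Hi Ii by fastforce
    qed
    then show ?thesis by (rule finite_subset) simp
  qed
  have fn: "y = z" if "x \<in> E" "y \<in> E" "z \<in> E" "R x y" "R x z" for x y z
  proof (cases "x \<in> H")
    case True
    then have "y \<in> I" "z \<in> I" "fst y = fst z" using that by (auto simp: R_def E_def)
    then show ?thesis using Dc(5) unfolding Ii by auto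
  next
    case False
    then have "y \<in> H" "z \<in> H" "fst y = fst z" using that by (auto simp: R_def)
    then show ?thesis unfolding Hi by auto
  qed
  have inj: "x = y" if "x \<in> E" "y \<in> E" "z \<in> E" "R x z" "R y z" for x y z
  proof (cases "z \<in> H")
    case True
    then have "x \<in> I" "y \<in> I" "snd x = snd y" using that by (auto simp: R_def E_def)
    then show ?thesis using Dr(5) unfolding Ii by auto
  next
    case False
    then have "x \<in> H" "y \<in> H" "snd x = snd y" using that by (auto simp: R_def)
    then show ?thesis unfolding Hi by auto
  qed
  have ch: "alternating_path n \<Gamma>r \<Gamma>c es \<longleftrightarrow> chain E R es" for es
    by (simp add: chain_def alternating_path_def E_def H_def I_def R_def[abs_def])
  have mx: "maximal_alternating_path n \<Gamma>r \<Gamma>c es \<longleftrightarrow> maxchain E R es" for es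
    by (simp add: maxchain_def maximal_alternating_path_def ch)
  have dist: "distinct es" if c: "chain E R es" for es
  proof (rule ccontr)
    assume "\<not> distinct es"
    then obtain a b where ab: "a < b" "b < length es" "es ! a = es ! b"
      by (metis distinct_conv_nth linorder_neqE_nat)
    have cn: "\<And>k. k < length es \<Longrightarrow> es ! k \<in> E" "\<And>k. Suc k < length es \<Longrightarrow> R (es ! k) (es ! Suc k)"
      using c chain_nth[of E R es] by auto
    define fs where "fs = take (b - a) (drop a es)"
    have lf: "length fs = b - a" using ab by (simp add: fs_def)
    have fk: "fs ! k = es ! (a + k)" if "k < b - a" for k using that ab by (simp add: fs_def)
    have ne: "fs \<noteq> []" using lf ab by auto
    have "chain E R fs" unfolding chain_nth
    proof (intro conjI allI impI)
      fix k assume "k < length fs"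
      then show "fs ! k \<in> E" using fk lf cn(1)[of "a + k"] ab by simp
    next
      fix k assume "Suc k < length fs"
      then show "R (fs ! k) (fs ! Suc k)" using fk[of k] fk[of "Suc k"] lf cn(2)[of "a + k"] ab by simp
    qed (use ne in simp)
    moreover have "fst (hd fs) = snd (last fs)"
    proof -
      have "hd fs = es ! a" using fk[of 0] ab ne by (simp add: hd_conv_nth)
      moreover have "last fs = es ! (b - 1)" using fk[of "b - a - 1"] lf ab ne by (simp add: last_conv_nth)
      moreover have "R (es ! (b - 1)) (es ! b)" using cn(2)[of "b - 1"] ab by simp
      ultimately show ?thesis using ab by (simp add: R_def)
    qed
    \<comment> \<open>Horizontal and inclined edges alternate, and the stretch leads from an edge to
      the same edge.\<close>
    moreover have "even (length fs)"
    proof -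
      have "a + k < length es \<Longrightarrow> (es ! (a + k) \<in> H) = (es ! a \<in> H) \<longleftrightarrow> even k" for k
      proof (induction k)
        case (Suc k)
        then show ?case using cn(2)[of "a + k"] by (auto simp: R_def)
      qed simp
      from this[of "b - a"] show ?thesis using ab lf by simp
    qed
    ultimately have "alternating_cycle n \<Gamma>r \<Gamma>c fs" by (simp add: alternating_cycle_def ch)
    then show False using ap by (auto simp: aperiodic_def)
  qed
  define e where "e = ((p, i), (p, n - i))"
  have eH: "e \<in> H" using i by (auto simp: Hi e_def)
  define es where "es = (THE es. maxchain E R es \<and> e \<in> set es)"
  have "\<exists>!es. maxchain E R es \<and> e \<in> set es"
  proof (rule ex_ex1I)
    show "\<exists>es. maxchain E R es \<and> e \<in> set es"
      by (rule maxchain_exists[OF fin]) (use fn inj dist eH in \<open>auto simp: E_def\<close>)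
  next
    fix es es' assume a: "maxchain E R es \<and> e \<in> set es" "maxchain E R es' \<and> e \<in> set es'"
    show "es = es'" by (rule maxchain_unique[OF fin, of R es es' e]) (use a fn inj in blast)+
  qed
  from theI'[OF this] have es: "maxchain E R es" "e \<in> set es" by (auto simp: es_def)
  have hs: "hs = map fst (filter (\<lambda>e. e \<in> H) es)"
    by (simp add: hs_def path_edges_def mx es_def e_def H_def)
  have c: "chain E R es" using es maxchain_def[of E R es] by auto
  note cE = c[unfolded chain_def]
  show "(p, i) \<in> set hs" using es eH unfolding hs by (auto simp: e_def intro!: image_eqI[of _ _ e])
  show "distinct hs" unfolding hs distinct_map using dist[OF c]
    by (auto simp: inj_on_def Hi)
  show "\<forall>v\<in>set hs. snd v \<in> {1..<n}" unfolding hs by (auto simp: Hi)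
  have R': "successively (\<lambda>e e'. snd e = fst e' \<and> (e \<in> H \<longleftrightarrow> e' \<notin> H)) es"
    using cE by (simp add: R_def[abs_def])
  show "\<forall>l. Suc l < length hs \<longrightarrow> next_edge n \<Gamma>r \<Gamma>c (hs ! l) (hs ! Suc l)"
  proof (intro allI impI)
    fix l assume l: "Suc l < length hs"
    let ?f = "filter (\<lambda>e. e \<in> H) es"
    have lf: "Suc l < length ?f" using l by (simp add: hs)
    obtain x where x: "x \<in> set es" "x \<notin> H" "snd (?f ! l) = fst x" "snd x = fst (?f ! Suc l)"
      using filter_alternating[OF R' lf] by blast
    have "?f ! l \<in> H" using lf nth_mem[of l ?f] by auto
    then obtain p' i' where f: "?f ! l = ((p', i'), (p', n - i'))" by (auto simp: Hi)
    have "x \<in> I" using x cE by (auto simp: E_def)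
    then show "next_edge n \<Gamma>r \<Gamma>c (hs ! l) (hs ! Suc l)"
      using x lf f unfolding Ii hs next_edge_def by (cases p') auto
  qed
  have es0: "es \<noteq> []" "\<And>x. \<not> chain E R (x # es)" using es c maxchain_def[of E R es] chain_def[of E R es] by auto
  have no: "\<not> R x (hd es)" if "x \<in> E" for x
    using es0(2)[of x] chain_Cons[of E R x es] that c by auto
  have hE: "hd es \<in> E" using cE by auto
  \<comment> \<open>An inclined first edge could be preceded by the horizontal edge that ends at its
    tail.\<close>
  have hH: "hd es \<in> H"
  proof (rule ccontr)
    assume a: "hd es \<notin> H"
    then have "hd es \<in> I" using hE by (simp add: E_def)
    then obtain p' k where k: "fst (hd es) = (p', k)" "1 \<le> k" "k < n"
      using Dr(1) Dc(2) Dc(4) unfolding Ii by fastforce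
    have "((p', n - k), (p', k)) \<in> H" unfolding Hi using k by (intro exI[of _ p'] exI[of _ "n - k"]) auto
    then have "R ((p', n - k), (p', k)) (hd es)" using k a by (simp add: R_def)
    then show False using no \<open>((p', n - k), (p', k)) \<in> H\<close> by (auto simp: E_def)
  qed
  have h0: "hs ! 0 = fst (hd es)" using es0 hH by (cases es) (auto simp: hs)
  show "snd (hs ! 0) \<notin> Gam1 \<Gamma>c" if u: "fst (hs ! 0) = Upper"
  proof
    assume a: "snd (hs ! 0) \<in> Gam1 \<Gamma>c"
    let ?x = "((Lower, gam \<Gamma>c (snd (hs ! 0))), (Upper, snd (hs ! 0)))"
    have "?x \<in> I" using a by (auto simp: Ii)
    moreover have "?x \<notin> H" by (auto simp: Hi)
    moreover have "fst (hd es) = (Upper, snd (hs ! 0))" using h0 u by (simp add: prod_eq_iff)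
    ultimately have "R ?x (hd es)" "?x \<in> E" using hH by (auto simp: R_def E_def)
    then show False using no by blast
  qed
  show "snd (hs ! 0) \<notin> Gam2 \<Gamma>r" if u: "fst (hs ! 0) = Lower"
  proof
    assume a: "snd (hs ! 0) \<in> Gam2 \<Gamma>r"
    then obtain k where k: "k \<in> Gam1 \<Gamma>r" "gam \<Gamma>r k = snd (hs ! 0)" using Dr(3) unfolding bij_betw_def by (metis imageE)
    let ?x = "((Upper, k), (Lower, snd (hs ! 0)))"
    have "?x \<in> I" using k by (auto simp: Ii)
    moreover have "?x \<notin> H" by (auto simp: Hi)
    moreover have "fst (hd es) = (Lower, snd (hs ! 0))" using h0 u by (simp add: prod_eq_iff)
    ultimately have "R ?x (hd es)" "?x \<in> E" using hH by (auto simp: R_def E_def)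
    then show False using no by blast
  qed
qed

section \<open>Glued matrices\<close>

text \<open>\<open>start_upper\<close> and \<open>start_lower\<close> are the maximality of the path
  at its beginning: no inclined edge leads into the first horizontal one.\<close>

locale glued_path =
  fixes n :: nat and \<Gamma>r \<Gamma>c :: bd_triple and hs :: "vertex list" and d :: bool
  assumes \<Gamma>r: "is_bd_triple n \<Gamma>r" and \<Gamma>c: "is_bd_triple n \<Gamma>c"
    and range: "v \<in> set hs \<Longrightarrow> snd v \<in> {1..<n}"
    and next_edge: "Suc l < length hs \<Longrightarrow> next_edge n \<Gamma>r \<Gamma>c (hs ! l) (hs ! Suc l)"
    and start_upper: "0 < length hs \<Longrightarrow> fst (hs ! 0) = Upper \<Longrightarrow> snd (hs ! 0) \<notin> Gam1 \<Gamma>c"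
    and start_lower: "0 < length hs \<Longrightarrow> fst (hs ! 0) = Lower \<Longrightarrow> snd (hs ! 0) \<notin> Gam2 \<Gamma>r"
begin

abbreviation "L \<equiv> length hs"
abbreviation "up l \<equiv> fst (hs ! l) = Upper"
abbreviation "\<delta> \<equiv> dual_at n \<Gamma>r \<Gamma>c hs d"
abbreviation "\<rho> l \<equiv> fst (offset n \<Gamma>r \<Gamma>c hs d l)"
abbreviation "\<sigma> l \<equiv> snd (offset n \<Gamma>r \<Gamma>c hs d l)"

text \<open>The position of the entrance point along its side of the block, which is also the length
  of the diagonal from the exit to the entrance point.\<close>

definition \<tau> :: "nat \<Rightarrow> nat" where
  "\<tau> l = fi n (\<delta> l) (snd (hs ! l))"

lemma snd_range: "l < L \<Longrightarrow> 1 \<le> snd (hs ! l) \<and> snd (hs ! l) < n"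
  using range[of "hs ! l"] by auto

lemma \<tau>_range: "l < L \<Longrightarrow> 1 \<le> \<tau> l \<and> \<tau> l < n"
  unfolding \<tau>_def using fi_range[of "snd (hs ! l)" n "\<delta> l"] snd_range[of l] by auto

lemma not_up: "\<not> up l \<longleftrightarrow> fst (hs ! l) = Lower"
  by (cases "fst (hs ! l)") auto

lemma alternating: "Suc l < L \<Longrightarrow> up (Suc l) \<longleftrightarrow> \<not> up l"
  using next_edge[of l] by (auto simp: next_edge_def split: prod.splits part.splits)

lemma run_of_Upper: "is_bd_triple n \<Gamma> \<Longrightarrow> 1 \<le> k \<Longrightarrow> k \<le> n \<Longrightarrow> run_of n \<Gamma> Upper e k = run n (fl n e (Gam1 \<Gamma>)) k"
  and run_of_Lower: "is_bd_triple n \<Gamma> \<Longrightarrow> 1 \<le> k \<Longrightarrow> k \<le> n \<Longrightarrow> run_of n \<Gamma> Lower e k = run n (fl n e (Gam2 \<Gamma>)) k"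
  by (simp_all add: run_of_eq)

lemma exit_upper: "i \<le> n \<Longrightarrow> exit_point n Upper e i = (n - fi n e i + 1, 1)"
  and exit_lower: "i \<le> n \<Longrightarrow> exit_point n Lower e i = (1, n - fi n e i + 1)"
  and entrance_upper: "entrance_point n Upper e i = (n, fi n e i)"
  and entrance_lower: "entrance_point n Lower e i = (fi n e i, n)"
  by (cases e; simp add: fi_def)+

lemma rows_eq:
  assumes l: "l < L"
  shows "rows_at n \<Gamma>r \<Gamma>c hs d l =
    (if up l then {Min (run n (fl n (\<delta> l) (Gam1 \<Gamma>r)) (n - \<tau> l + 1))..n}
     else {1..Max (run n (fl n (\<delta> l) (Gam2 \<Gamma>r)) (\<tau> l))})"
  using snd_range[OF l] \<tau>_range[OF l] not_up[of l]
  by (cases "up l") (auto simp: rows_at_def exit_upper entrance_lower \<tau>_def run_of_Upper[OF \<Gamma>r] run_of_Lower[OF \<Gamma>r])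

lemma cols_eq:
  assumes l: "l < L"
  shows "cols_at n \<Gamma>r \<Gamma>c hs d l =
    (if up l then {1..Max (run n (fl n (\<delta> l) (Gam1 \<Gamma>c)) (\<tau> l))}
     else {Min (run n (fl n (\<delta> l) (Gam2 \<Gamma>c)) (n - \<tau> l + 1))..n})"
  using snd_range[OF l] \<tau>_range[OF l] not_up[of l]
  by (cases "up l") (auto simp: cols_at_def exit_lower entrance_upper \<tau>_def run_of_Upper[OF \<Gamma>c] run_of_Lower[OF \<Gamma>c])

lemma run_bounds_at:
  assumes "is_bd_triple n \<Gamma>" "l < L"
  shows "1 \<le> Min (run n (fl n e (Gam1 \<Gamma>)) (n - \<tau> l + 1))" "Min (run n (fl n e (Gam1 \<Gamma>)) (n - \<tau> l + 1)) \<le> n"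
    "1 \<le> Max (run n (fl n e (Gam2 \<Gamma>)) (\<tau> l))" "Max (run n (fl n e (Gam2 \<Gamma>)) (\<tau> l)) \<le> n"
proof -
  note D = bd_tripleD[OF assms(1)]
  have r: "1 \<le> n - \<tau> l + 1" "n - \<tau> l + 1 \<le> n" "1 \<le> \<tau> l" "\<tau> l \<le> n" using \<tau>_range[OF assms(2)] by auto
  note 1 = run_Min_Max[OF fl_subset[OF D(1)] r(1,2), of e] and 2 = run_Min_Max[OF fl_subset[OF D(2)] r(3,4), of e]
  show "1 \<le> Min (run n (fl n e (Gam1 \<Gamma>)) (n - \<tau> l + 1))" "Min (run n (fl n e (Gam1 \<Gamma>)) (n - \<tau> l + 1)) \<le> n"
    "1 \<le> Max (run n (fl n e (Gam2 \<Gamma>)) (\<tau> l))" "Max (run n (fl n e (Gam2 \<Gamma>)) (\<tau> l)) \<le> n"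
    using 1(2,3) 2(4,5) r by linarith+
qed

lemma Max_interval: "a \<le> b \<Longrightarrow> Max {a..b::nat} = b" and Min_interval: "a \<le> b \<Longrightarrow> Min {a..b::nat} = a"
  by (auto intro: Max_eqI Min_eqI)

lemma rows_Min_Max:
  assumes l: "l < L"
  shows "Min (rows_at n \<Gamma>r \<Gamma>c hs d l) = (if up l then Min (run n (fl n (\<delta> l) (Gam1 \<Gamma>r)) (n - \<tau> l + 1)) else 1)"
    "Max (rows_at n \<Gamma>r \<Gamma>c hs d l) = (if up l then n else Max (run n (fl n (\<delta> l) (Gam2 \<Gamma>r)) (\<tau> l)))"
  using run_bounds_at[OF \<Gamma>r l] by (simp_all add: rows_eq[OF l] Max_interval Min_interval)

lemma cols_Min_Max:
  assumes l: "l < L"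
  shows "Min (cols_at n \<Gamma>r \<Gamma>c hs d l) = (if up l then 1 else Min (run n (fl n (\<delta> l) (Gam2 \<Gamma>c)) (n - \<tau> l + 1)))"
    "Max (cols_at n \<Gamma>r \<Gamma>c hs d l) = (if up l then Max (run n (fl n (\<delta> l) (Gam1 \<Gamma>c)) (\<tau> l)) else n)"
  using run_bounds_at[OF inv_triple_bd[OF \<Gamma>c] l] by (simp_all add: cols_eq[OF l] Max_interval Min_interval)

lemma row: "line n \<Gamma>r L up \<tau> \<delta> \<rho>"
proof
  show "is_bd_triple n \<Gamma>r" by (rule \<Gamma>r)
  show "l < L \<Longrightarrow> 1 \<le> \<tau> l \<and> \<tau> l < n" for l by (rule \<tau>_range)
  show "Suc l < L \<Longrightarrow> up (Suc l) = (\<not> up l)" for l by (rule alternating)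
  show "\<exists>u\<in>Gam1 \<Gamma>r. fi n (\<delta> l) u = n - \<tau> l \<and> \<tau> (Suc l) = fi n (\<delta> (Suc l)) (gam \<Gamma>r u) \<and>
      \<delta> (Suc l) = (\<delta> l \<noteq> (\<not> preserves_orientation \<Gamma>r u))" if l: "Suc l < L" and u: "up l" for l
  proof -
    obtain i where i: "hs ! l = (Upper, i)" using u by (cases "hs ! l") auto
    then have ne: "n - i \<in> Gam1 \<Gamma>r" "hs ! Suc l = (Lower, gam \<Gamma>r (n - i))"
      using next_edge[OF l] by (auto simp: next_edge_def)
    have ir: "1 \<le> i" "i < n" using snd_range[of l] l i by auto
    show ?thesis
      by (rule bexI[OF _ ne(1)]) (use ir i ne in \<open>auto simp: \<tau>_def fi_def reverses_after_def\<close>)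
  qed
  show "\<tau> 0 \<notin> fl n (\<delta> 0) (Gam2 \<Gamma>r)" if "0 < L" "\<not> up 0"
  proof -
    have "snd (hs ! 0) \<notin> Gam2 \<Gamma>r" using start_lower not_up that by blast
    then show ?thesis
      using fi_in_fl[OF bd_tripleD(2)[OF \<Gamma>r], of "\<tau> 0" "\<delta> 0"] \<tau>_range[OF that(1)] snd_range[OF that(1)]
      by (simp add: \<tau>_def)
  qed
  show "\<rho> 0 = (if up 0 then - int n else - int (Max (run n (fl n (\<delta> 0) (Gam2 \<Gamma>r)) (\<tau> 0))))" if "0 < L"
    using rows_Min_Max(2)[OF that] by simp
  show "\<rho> (Suc l) = \<rho> l + int (Min (run n (fl n (\<delta> l) (Gam1 \<Gamma>r)) (n - \<tau> l + 1))) -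
      int (Min (run n (fl n (\<delta> (Suc l)) (Gam2 \<Gamma>r)) (Max (run n (fl n (\<delta> (Suc l)) (Gam2 \<Gamma>r)) (\<tau> (Suc l))))))"
    if l: "Suc l < L" and u: "up l" for l
  proof -
    have lL: "l < L" and nu: "\<not> up (Suc l)" "fst (hs ! Suc l) = Lower"
      using l alternating[OF l] u not_up[of "Suc l"] by auto
    show ?thesis
      using u nu rows_Min_Max(1)[OF lL] rows_Min_Max(2)[OF l] run_bounds_at(3,4)[OF \<Gamma>r l, of "\<delta> (Suc l)"]
      by (simp add: Let_def run_of_Lower[OF \<Gamma>r] del: dual_at.simps)
  qed
  show "\<rho> (Suc l) = \<rho> l - int n" if l: "Suc l < L" and u: "\<not> up l" for l
  proof -
    have lL: "l < L" and nu: "up (Suc l)" "fst (hs ! l) = Lower"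
      using l alternating[OF l] u not_up[of l] by auto
    show ?thesis
      using u nu rows_Min_Max(1)[OF lL] rows_Min_Max(2)[OF l] by (simp add: Let_def del: dual_at.simps)
  qed
qed

text \<open>A lower block hands its leftmost columns on along the inverse of gamma^c, so for columns
  the lower blocks play the role of \<open>up\<close>.\<close>

lemma col: "line n (inv_triple \<Gamma>c) L (\<lambda>l. \<not> up l) \<tau> \<delta> \<sigma>"
proof
  note \<Gamma>i = inv_triple_bd[OF \<Gamma>c]
  show "is_bd_triple n (inv_triple \<Gamma>c)" by (rule \<Gamma>i)
  show "l < L \<Longrightarrow> 1 \<le> \<tau> l \<and> \<tau> l < n" for l by (rule \<tau>_range)
  show "Suc l < L \<Longrightarrow> (\<not> up (Suc l)) = (\<not> \<not> up l)" for l using alternating by blast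
  show "\<exists>u\<in>Gam1 (inv_triple \<Gamma>c). fi n (\<delta> l) u = n - \<tau> l \<and> \<tau> (Suc l) = fi n (\<delta> (Suc l)) (gam (inv_triple \<Gamma>c) u) \<and>
      \<delta> (Suc l) = (\<delta> l \<noteq> (\<not> preserves_orientation (inv_triple \<Gamma>c) u))" if l: "Suc l < L" and u: "\<not> up l" for l
  proof -
    obtain i where i: "hs ! l = (Lower, i)" using u not_up[of l] by (cases "hs ! l") auto
    then obtain v where v: "v \<in> Gam1 \<Gamma>c" "gam \<Gamma>c v = n - i" "hs ! Suc l = (Upper, v)"
      using next_edge[OF l] by (auto simp: next_edge_def)
    have ir: "1 \<le> i" "i < n" using snd_range[of l] l i by auto
    have m: "n - i \<in> Gam1 (inv_triple \<Gamma>c)" using bd_tripleD(4)[OF \<Gamma>c v(1)] v(2) by simp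
    have "preserves_orientation (inv_triple \<Gamma>c) (n - i) = preserves_orientation \<Gamma>c v"
      using inv_triple_orient[OF \<Gamma>c v(1)] v(2) by (simp add: orient_def split: if_splits)
    moreover have "gam (inv_triple \<Gamma>c) (n - i) = v" using inv_triple_gam(1)[OF \<Gamma>c v(1)] v(2) by simp
    ultimately show ?thesis
      by (intro bexI[OF _ m]) (use ir i v in \<open>auto simp: \<tau>_def fi_def reverses_after_def\<close>)
  qed
  show "\<tau> 0 \<notin> fl n (\<delta> 0) (Gam2 (inv_triple \<Gamma>c))" if "0 < L" "\<not> \<not> up 0"
  proof -
    have "snd (hs ! 0) \<notin> Gam1 \<Gamma>c" using start_upper that by blast
    then show ?thesis
      using fi_in_fl[OF bd_tripleD(1)[OF \<Gamma>c], of "\<tau> 0" "\<delta> 0"] \<tau>_range[OF that(1)] snd_range[OF that(1)]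
      by (simp add: \<tau>_def)
  qed
  show "\<sigma> 0 = (if \<not> up 0 then - int n else - int (Max (run n (fl n (\<delta> 0) (Gam2 (inv_triple \<Gamma>c))) (\<tau> 0))))" if "0 < L"
    using cols_Min_Max(2)[OF that] by simp
  show "\<sigma> (Suc l) = \<sigma> l + int (Min (run n (fl n (\<delta> l) (Gam1 (inv_triple \<Gamma>c))) (n - \<tau> l + 1))) -
      int (Min (run n (fl n (\<delta> (Suc l)) (Gam2 (inv_triple \<Gamma>c))) (Max (run n (fl n (\<delta> (Suc l)) (Gam2 (inv_triple \<Gamma>c))) (\<tau> (Suc l))))))"
    if l: "Suc l < L" and u: "\<not> up l" for l
  proof -
    have lL: "l < L" and nu: "up (Suc l)" "fst (hs ! l) = Lower"
      using l alternating[OF l] u not_up[of l] by auto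
    show ?thesis
      using u nu cols_Min_Max(1)[OF lL] cols_Min_Max(2)[OF l] run_bounds_at(3,4)[OF \<Gamma>i l, of "\<delta> (Suc l)"]
      by (simp add: Let_def run_of_Upper[OF \<Gamma>c] del: dual_at.simps)
  qed
  show "\<sigma> (Suc l) = \<sigma> l - int n" if l: "Suc l < L" and u: "\<not> \<not> up l" for l
  proof -
    have lL: "l < L" and nu: "\<not> up (Suc l)" using l alternating[OF l] u by auto
    show ?thesis
      using u nu cols_Min_Max(1)[OF lL] cols_Min_Max(2)[OF l] by (simp add: Let_def del: dual_at.simps)
  qed
qed

sublocale r: line n \<Gamma>r L up \<tau> \<delta> \<rho> by (rule row)
sublocale c: line n "inv_triple \<Gamma>c" L "\<lambda>l. \<not> up l" \<tau> \<delta> \<sigma> by (rule col)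

definition block :: "complex mat \<Rightarrow> complex mat \<Rightarrow> nat \<Rightarrow> int \<Rightarrow> int \<Rightarrow> complex" where
  "block X Y l a b = src (\<delta> l) (if up l then X else Y) $$ (nat (a - \<rho> l) - 1, nat (b - \<sigma> l) - 1)"

lemma cell_eq:
  "cell n \<Gamma>r \<Gamma>c hs d X Y a b =
    (\<Sum>l<L. if r.rlo l \<le> a \<and> a \<le> r.rhi l \<and> c.rlo l \<le> b \<and> b \<le> c.rhi l then block X Y l a b else 0)"
  unfolding cell_def
proof (rule sum.cong)
  fix l assume "l \<in> {..<L}"
  then have l: "l < L" by simp
  have i: "x \<in> int ` {m..k} \<longleftrightarrow> int m \<le> x \<and> x \<le> int k" for x m k
    by (auto simp: image_int_atLeastAtMost)
  have 1: "a - \<rho> l \<in> int ` rows_at n \<Gamma>r \<Gamma>c hs d l \<longleftrightarrow> r.rlo l \<le> a \<and> a \<le> r.rhi l"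
    unfolding rows_eq[OF l] by (cases "up l") (auto simp only: i r.rlo_def r.rhi_def if_True if_False simp_thms of_nat_1)
  have 2: "b - \<sigma> l \<in> int ` cols_at n \<Gamma>r \<Gamma>c hs d l \<longleftrightarrow> c.rlo l \<le> b \<and> b \<le> c.rhi l"
    unfolding cols_eq[OF l] by (cases "up l") (auto simp only: i c.rlo_def c.rhi_def if_True if_False simp_thms of_nat_1 inv_triple_simps)
  have 3: "source_mat (fst (hs ! l)) (\<delta> l) X Y = src (\<delta> l) (if up l then X else Y)"
    using not_up[of l] by (cases "fst (hs ! l)") (auto simp: source_mat_def src_def Let_def)
  show "(let x = a - \<rho> l; y = b - \<sigma> l
      in if x \<in> int ` rows_at n \<Gamma>r \<Gamma>c hs d l \<and> y \<in> int ` cols_at n \<Gamma>r \<Gamma>c hs d l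
         then source_mat (fst (hs ! l)) (\<delta> l) X Y $$ (nat x - 1, nat y - 1) else 0) =
      (if r.rlo l \<le> a \<and> a \<le> r.rhi l \<and> c.rlo l \<le> b \<and> b \<le> c.rhi l then block X Y l a b else 0)"
    unfolding Let_def 1 2 3 block_def by auto
qed simp

lemma triple_entry:
  fixes A :: "complex mat"
  assumes "A \<in> carrier_mat n n" "M \<in> carrier_mat n n" "B \<in> carrier_mat n n" "x < n" "y < n"
  shows "(A * M * B\<^sup>T) $$ (x, y) = (\<Sum>k<n. A $$ (x, k) * (\<Sum>j<n. B $$ (y, j) * M $$ (k, j)))"
proof -
  have "(A * M * B\<^sup>T) $$ (x, y) = (\<Sum>j<n. (\<Sum>k<n. A $$ (x, k) * M $$ (k, j)) * B $$ (y, j))"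
  proof -
    have "(A * M * B\<^sup>T) $$ (x, y) = (\<Sum>j<n. (A * M) $$ (x, j) * B\<^sup>T $$ (j, y))"
      by (rule mult_entry) (use assms in auto)
    also have "\<dots> = (\<Sum>j<n. (\<Sum>k<n. A $$ (x, k) * M $$ (k, j)) * B $$ (y, j))"
    proof (rule sum.cong)
      fix j assume "j \<in> {..<n}"
      then show "(A * M) $$ (x, j) * B\<^sup>T $$ (j, y) = (\<Sum>k<n. A $$ (x, k) * M $$ (k, j)) * B $$ (y, j)"
        using mult_entry[OF assms(1,2,4), of j] assms by simp
    qed simp
    finally show ?thesis .
  qed
  also have "\<dots> = (\<Sum>k<n. \<Sum>j<n. A $$ (x, k) * (B $$ (y, j) * M $$ (k, j)))"
  proof -
    have e: "a * m * b = a * (b * m)" for a m b :: complex by simp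
    show ?thesis unfolding sum_distrib_right e by (rule sum.swap)
  qed
  finally show ?thesis by (simp add: sum_distrib_left)
qed

theorem glued_minor:
  assumes gr: "row_glue n \<Gamma>r G H" and gc: "row_glue n (inv_triple \<Gamma>c) G' H'"
    and M: "antilower n M" "det M = 1" and M': "antilower n M'" "det M' = 1"
    and Z: "Z = G * M * H'\<^sup>T" "Z = H * M' * G'\<^sup>T"
    and K: "K < L" and q: "r.P (Suc K) < q" "q \<le> r.P K"
  shows "detI q 0 (cell n \<Gamma>r \<Gamma>c hs d Z Z) =
    detI q (r.P K) (block M M' K) * (\<Prod>l<K. detI (r.P (Suc l) + 1) (r.P l) (block M M' l))"
proof -
  \<comment> \<open>Each block takes the factorization of \<open>Z\<close> that belongs to its part,
    so that neighbours meet with \<open>G\<close> and \<open>H\<close> along shared rows and with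
    \<open>G'\<close> and \<open>H'\<close> along shared columns.\<close>
  define A where "A l = (if up l then G else H)" for l
  define B where "B l = (if \<not> up l then G' else H')" for l
  define N where "N l = (if up l then M else M')" for l
  have AN: "A l \<in> N_plus n" and BN: "B l \<in> N_plus n" for l
    using gr gc by (auto simp: row_glue_def A_def B_def)
  have Nc: "N l \<in> carrier_mat n n" "det (N l) = 1" "antilower n (N l)" for l
    using M M' by (auto simp: N_def antilower_def)
  have ZA: "Z = A l * N l * (B l)\<^sup>T" for l using Z by (auto simp: A_def B_def N_def)
  have bl: "block Z Z l a b = (\<Sum>a'\<in>{r.rlo l..r.rhi l}. \<Sum>b'\<in>{c.rlo l..c.rhi l}.
      r.Rl G H l a a' * block M M' l a' b' * c.Rl G' H' l b b')"
    if l: "l < L" and a: "r.rlo l \<le> a" "a \<le> r.rhi l" and b: "c.rlo l \<le> b" "b \<le> c.rhi l" for l a b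
  proof -
    note ia = r.index_range[OF l a] and ib = c.index_range[OF l b]
    let ?x = "nat (a - \<rho> l) - 1" and ?y = "nat (b - \<sigma> l) - 1"
    have BT: "(B l)\<^sup>T \<in> carrier_mat n n" "det (B l)\<^sup>T = 1"
      using N_plusD(1,2)[OF BN[of l]] det_transpose[of "B l" n] by auto
    have ANl: "A l * N l \<in> carrier_mat n n" "det (A l * N l) = 1"
      using N_plusD(1,2)[OF AN[of l]] Nc[of l] by (auto simp: det_mult[of _ n])
    have "src (\<delta> l) Z = src (\<delta> l) (A l) * src (\<delta> l) (N l) * (src (\<delta> l) (B l))\<^sup>T"
      unfolding ZA[of l] using src_mult[OF ANl BT] src_mult[OF N_plusD(1,2)[OF AN[of l]] Nc(1,2)[of l]]
        src_transpose[OF N_plusD(1)[OF BN[of l]]] by simp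
    then have "block Z Z l a b = (src (\<delta> l) (A l) * src (\<delta> l) (N l) * (src (\<delta> l) (B l))\<^sup>T) $$ (?x, ?y)"
      by (simp add: block_def)
    also have "\<dots> = (\<Sum>k<n. src (\<delta> l) (A l) $$ (?x, k) *
        (\<Sum>j<n. src (\<delta> l) (B l) $$ (?y, j) * src (\<delta> l) (N l) $$ (k, j)))"
      by (rule triple_entry) (use N_plusD(1)[OF AN[of l]] N_plusD(1)[OF BN[of l]] Nc(1)[of l] ia ib in auto)
    also have "\<dots> = (\<Sum>a'\<in>{r.rlo l..r.rhi l}. r.Rl G H l a a' *
        (\<Sum>j<n. src (\<delta> l) (B l) $$ (?y, j) * src (\<delta> l) (N l) $$ (nat (a' - \<rho> l) - 1, j)))"
      unfolding A_def by (rule r.expand[OF gr l a])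
    also have "\<dots> = (\<Sum>a'\<in>{r.rlo l..r.rhi l}. r.Rl G H l a a' *
        (\<Sum>b'\<in>{c.rlo l..c.rhi l}. c.Rl G' H' l b b' * src (\<delta> l) (N l) $$ (nat (a' - \<rho> l) - 1, nat (b' - \<sigma> l) - 1)))"
      unfolding B_def by (subst c.expand[OF gc l b]) (rule refl)
    also have "\<dots> = (\<Sum>a'\<in>{r.rlo l..r.rhi l}. \<Sum>b'\<in>{c.rlo l..c.rhi l}.
        r.Rl G H l a a' * block M M' l a' b' * c.Rl G' H' l b b')"
      by (simp add: sum_distrib_left block_def N_def ac_simps)
    finally show ?thesis .
  qed
  have anti: "block M M' l a b = 0"
    if l: "l < L" and a: "r.rlo l \<le> a" "a \<le> r.rhi l" and b: "c.rlo l \<le> b" "b \<le> c.rhi l"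
      and h: "if up l then a \<le> r.P (Suc l) \<and> b \<le> r.P l else a \<le> r.P l \<and> b \<le> r.P (Suc l)" for l a b
  proof -
    note ia = r.index_range[OF l a] and ib = c.index_range[OF l b]
    have S: "antilower n (src (\<delta> l) (N l))" by (rule antilower_src[OF Nc(3,2)])
    \<comment> \<open>Two 1-based indices with sum at most \<open>n\<close> lie strictly above the
      antidiagonal.\<close>
    have "nat (a - \<rho> l) + nat (b - \<sigma> l) \<le> n"
      using h r.pos[OF l] c.pos[OF l] diagpos_Suc[OF l, of \<tau>] \<tau>_range[OF l] ia ib by (cases "up l") auto
    then show ?thesis
      using S ia ib unfolding antilower_def block_def N_def by auto
  qed
  have "detI q 0 (cell n \<Gamma>r \<Gamma>c hs d Z Z) = detI q 0 (\<lambda>a b. \<Sum>l<L.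
      if r.rlo l \<le> a \<and> a \<le> r.rhi l \<and> c.rlo l \<le> b \<and> b \<le> c.rhi l then block Z Z l a b else 0)"
    by (rule detI_cong) (rule cell_eq)
  also have "\<dots> = detI q 0 (\<lambda>a b. \<Sum>l<L.
      if r.rlo l \<le> a \<and> a \<le> r.rhi l \<and> c.rlo l \<le> b \<and> b \<le> c.rhi l then block M M' l a b else 0)"
    by (rule staircase_transform[OF r.row_ops[OF gr] c.row_ops[OF gc] bl])
  also have "\<dots> = detI q (r.P K) (block M M' K) * (\<Prod>l<K. detI (r.P (Suc l) + 1) (r.P l) (block M M' l))"
    by (rule staircase_det[OF r.layout c.layout K q anti])
  finally show ?thesis .
qed

lemma detI_block_diag:
  assumes l: "l < L" and M: "M \<in> carrier_mat n n" "det M = 1" and M': "M' \<in> carrier_mat n n" "det M' = 1"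
  shows "detI (r.P (Suc l) + 1) (r.P l) (block M M' l) =
    (if up l then trailing_minor n (n - snd (hs ! l) + 1) 1 M else trailing_minor n 1 (n - snd (hs ! l) + 1) M')"
proof -
  note t = snd_range[OF l] and tr = \<tau>_range[OF l]
  have P: "r.P (Suc l) = r.P l - int (\<tau> l)" by (rule diagpos_Suc[OF l])
  have sz: "nat (r.P l - (r.P (Suc l) + 1) + 1) = \<tau> l" using P by simp
  show ?thesis
  proof (cases "up l")
    case True
    have p: "\<rho> l + int n = r.P l" "\<sigma> l + int (\<tau> l) = r.P l" using r.pos[OF l] c.pos[OF l] True by auto
    have "detI (r.P (Suc l) + 1) (r.P l) (block M M' l) =
        det (mat (\<tau> l) (\<tau> l) (\<lambda>(x, y). src (\<delta> l) M $$ (n - \<tau> l + x, y)))"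
      unfolding detI_def sz
    proof (rule arg_cong[of _ _ det], rule eq_matI)
      fix x y assume "x < dim_row (mat (\<tau> l) (\<tau> l) (\<lambda>(x, y). src (\<delta> l) M $$ (n - \<tau> l + x, y)))"
        "y < dim_col (mat (\<tau> l) (\<tau> l) (\<lambda>(x, y). src (\<delta> l) M $$ (n - \<tau> l + x, y)))"
      then have xy: "x < \<tau> l" "y < \<tau> l" by auto
      have "nat (r.P (Suc l) + 1 + int x - \<rho> l) - 1 = n - \<tau> l + x" "nat (r.P (Suc l) + 1 + int y - \<sigma> l) - 1 = y"
        using p P tr by auto
      then show "mat (\<tau> l) (\<tau> l) (\<lambda>(x, y). block M M' l (r.P (Suc l) + 1 + int x) (r.P (Suc l) + 1 + int y)) $$ (x, y) =
          mat (\<tau> l) (\<tau> l) (\<lambda>(x, y). src (\<delta> l) M $$ (n - \<tau> l + x, y)) $$ (x, y)"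
        using xy True by (simp add: block_def)
    qed auto
    also have "\<dots> = trailing_minor n (n - \<tau> l + 1) 1 (src (\<delta> l) M)"
    proof -
      have e: "n + 1 - (n - \<tau> l + 1) = \<tau> l" "n - \<tau> l + 1 - 1 = n - \<tau> l" using tr by auto
      have "trailing_minor n (n - \<tau> l + 1) 1 (src (\<delta> l) M) = det (mat (n + 1 - (n - \<tau> l + 1)) (n + 1 - (n - \<tau> l + 1))
          (\<lambda>(x, y). src (\<delta> l) M $$ (n - \<tau> l + 1 - 1 + x, 1 - 1 + y)))"
        by (rule trailing_minor_lower) (use M tr in auto)
      then show ?thesis unfolding e by simp
    qed
    also have "\<dots> = trailing_minor n (n - snd (hs ! l) + 1) 1 M"
      unfolding \<tau>_def by (rule trailing_minor_src[OF M]) (use t in auto)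
    finally show ?thesis using True by simp
  next
    case False
    have p: "\<rho> l + int (\<tau> l) = r.P l" "\<sigma> l + int n = r.P l" using r.pos[OF l] c.pos[OF l] False by auto
    have "detI (r.P (Suc l) + 1) (r.P l) (block M M' l) =
        det (mat (\<tau> l) (\<tau> l) (\<lambda>(x, y). src (\<delta> l) M' $$ (x, n - \<tau> l + y)))"
      unfolding detI_def sz
    proof (rule arg_cong[of _ _ det], rule eq_matI)
      fix x y assume "x < dim_row (mat (\<tau> l) (\<tau> l) (\<lambda>(x, y). src (\<delta> l) M' $$ (x, n - \<tau> l + y)))"
        "y < dim_col (mat (\<tau> l) (\<tau> l) (\<lambda>(x, y). src (\<delta> l) M' $$ (x, n - \<tau> l + y)))"
      then have xy: "x < \<tau> l" "y < \<tau> l" by auto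
      have "nat (r.P (Suc l) + 1 + int y - \<sigma> l) - 1 = n - \<tau> l + y" "nat (r.P (Suc l) + 1 + int x - \<rho> l) - 1 = x"
        using p P tr by auto
      then show "mat (\<tau> l) (\<tau> l) (\<lambda>(x, y). block M M' l (r.P (Suc l) + 1 + int x) (r.P (Suc l) + 1 + int y)) $$ (x, y) =
          mat (\<tau> l) (\<tau> l) (\<lambda>(x, y). src (\<delta> l) M' $$ (x, n - \<tau> l + y)) $$ (x, y)"
        using xy False by (simp add: block_def)
    qed auto
    also have "\<dots> = trailing_minor n 1 (n - \<tau> l + 1) (src (\<delta> l) M')"
    proof -
      have e: "n + 1 - (n - \<tau> l + 1) = \<tau> l" "n - \<tau> l + 1 - 1 = n - \<tau> l" using tr by auto
      have "trailing_minor n 1 (n - \<tau> l + 1) (src (\<delta> l) M') = det (mat (n + 1 - (n - \<tau> l + 1)) (n + 1 - (n - \<tau> l + 1))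
          (\<lambda>(x, y). src (\<delta> l) M' $$ (1 - 1 + x, n - \<tau> l + 1 - 1 + y)))"
        by (rule trailing_minor_upper) (use M' tr in auto)
      then show ?thesis unfolding e by simp
    qed
    \<comment> \<open>The upper right corner of a lower block is transposed into a lower left one,
      the position for which the complementary minor identity is stated.\<close>
    also have "\<dots> = trailing_minor n (n - \<tau> l + 1) 1 (src (\<delta> l) M'\<^sup>T)"
    proof -
      have "trailing_minor n 1 (n - \<tau> l + 1) (src (\<delta> l) M'\<^sup>T)\<^sup>T = trailing_minor n (n - \<tau> l + 1) 1 (src (\<delta> l) M'\<^sup>T)"
        by (rule trailing_minor_transpose) (use M' tr in auto)
      then show ?thesis using src_transpose[OF M'(1)] by simp
    qed
    also have "\<dots> = trailing_minor n (n - snd (hs ! l) + 1) 1 M'\<^sup>T"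
      unfolding \<tau>_def by (rule trailing_minor_src) (use t M' det_transpose[of M' n] in auto)
    also have "\<dots> = trailing_minor n 1 (n - snd (hs ! l) + 1) M'"
    proof -
      have "trailing_minor n 1 (n - snd (hs ! l) + 1) M'\<^sup>T\<^sup>T = trailing_minor n (n - snd (hs ! l) + 1) 1 M'\<^sup>T"
        by (rule trailing_minor_transpose) (use M' t in auto)
      then show ?thesis by simp
    qed
    finally show ?thesis using False by simp
  qed
qed

lemma detI_block_top:
  assumes K: "K < L" "\<not> \<delta> K" and M: "M \<in> carrier_mat n n" and M': "M' \<in> carrier_mat n n"
    and ij: "1 \<le> i" "i \<le> n" "1 \<le> j" "j \<le> n" "i \<noteq> j" "hs ! K = e_ij n i j"
  shows "detI (\<rho> K + int i) (r.P K) (block M M' K) = trailing_minor n i j (if up K then M else M')"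
    "r.P (Suc K) < \<rho> K + int i" "\<rho> K + int i \<le> r.P K" "up K \<longleftrightarrow> i > j"
proof -
  have P: "r.P (Suc K) = r.P K - int (\<tau> K)" by (rule diagpos_Suc[OF K(1)])
  have tK: "\<tau> K = snd (hs ! K)" using K(2) by (simp add: \<tau>_def fi_def)
  show u: "up K \<longleftrightarrow> i > j" using ij(6) by (auto simp: e_ij_def)
  have p: "if up K then \<rho> K + int n = r.P K \<and> \<sigma> K + int (\<tau> K) = r.P K else \<rho> K + int (\<tau> K) = r.P K \<and> \<sigma> K + int n = r.P K"
    using r.pos[OF K(1)] c.pos[OF K(1)] by auto
  have t: "\<tau> K = (if i > j then n + j - i else n + i - j)" using ij(6) tK by (auto simp: e_ij_def)
  show "r.P (Suc K) < \<rho> K + int i" "\<rho> K + int i \<le> r.P K"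
    using P p t ij u by (auto split: if_splits)
  have q: "\<rho> K + int i = \<sigma> K + int j" using p t ij u by (auto split: if_splits)
  define m where "m = (if i > j then n + 1 - i else n + 1 - j)"
  have sz: "nat (r.P K - (\<rho> K + int i) + 1) = m" using p t ij u by (auto simp: m_def split: if_splits)
  have "detI (\<rho> K + int i) (r.P K) (block M M' K) =
      det (mat m m (\<lambda>(x, y). (if up K then M else M') $$ (i - 1 + x, j - 1 + y)))"
    unfolding detI_def sz
  proof (rule arg_cong[of _ _ det], rule eq_matI)
    fix x y assume "x < dim_row (mat m m (\<lambda>(x, y). (if up K then M else M') $$ (i - 1 + x, j - 1 + y)))"
      "y < dim_col (mat m m (\<lambda>(x, y). (if up K then M else M') $$ (i - 1 + x, j - 1 + y)))"
    then have xy: "x < m" "y < m" by auto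
    have "nat (\<rho> K + int i + int x - \<rho> K) - 1 = i - 1 + x" using ij by auto
    moreover have "nat (\<rho> K + int i + int y - \<sigma> K) - 1 = j - 1 + y" unfolding q using ij by auto
    ultimately show "mat m m (\<lambda>(x, y). block M M' K (\<rho> K + int i + int x) (\<rho> K + int i + int y)) $$ (x, y) =
        mat m m (\<lambda>(x, y). (if up K then M else M') $$ (i - 1 + x, j - 1 + y)) $$ (x, y)"
      using xy K(2) by (simp add: block_def src_def)
  qed auto
  also have "\<dots> = trailing_minor n i j (if up K then M else M')"
  proof (cases "i > j")
    case True
    then show ?thesis using trailing_minor_lower[of "if up K then M else M'" n j i] M M' ij by (simp add: m_def)
  next
    case False
    then show ?thesis using trailing_minor_upper[of "if up K then M else M'" n i j] M M' ij by (simp add: m_def)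
  qed
  finally show "detI (\<rho> K + int i) (r.P K) (block M M' K) = trailing_minor n i j (if up K then M else M')" .
qed

lemma glued_submatrix:
  assumes K: "K < L" and q: "r.P (Suc K) < q" "q \<le> r.P K"
  defines "N \<equiv> glued_dim n \<Gamma>r \<Gamma>c hs d"
  shows "det (submatrix (glued_mat n \<Gamma>r \<Gamma>c hs d X Y) {nat (q + int N - 1)..<N} {nat (q + int N - 1)..<N}) =
    detI q 0 (cell n \<Gamma>r \<Gamma>c hs d X Y)"
proof -
  interpret lr: layout L r.P up r.rlo r.rhi by (rule r.layout)
  have L1: "L - 1 < L" using K by simp
  have rl: "\<rho> (L - 1) + int (Min (rows_at n \<Gamma>r \<Gamma>c hs d (L - 1))) = r.rlo (L - 1)"
    unfolding rows_Min_Max(1)[OF L1] r.rlo_def by simp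
  \<comment> \<open>The glued matrix begins with the first row of its last block; this row is not
    below \<open>q\<close>, so the conversion of \<open>q\<close> to a natural index loses
    nothing.\<close>
  have "r.rlo (L - 1) \<le> r.P (Suc (L - 1)) + 1" using lr.diag_in_rows[OF L1] by simp
  also have "\<dots> \<le> r.P (Suc K) + 1" using lr.P_mono[of "Suc K" "Suc (L - 1)"] K by simp
  also have "\<dots> \<le> q" using q by simp
  finally have lq: "r.rlo (L - 1) \<le> q" .
  have q0: "q \<le> 0" using q lr.P_mono[of 0 K] lr.P0 by simp
  have N: "int N = 1 - r.rlo (L - 1)" using lq q0 rl by (simp add: N_def glued_dim_def Let_def)
  define s where "s = nat (q + int N - 1)"
  have s: "int s = q + int N - 1" using N lq by (simp add: s_def)
  define m where "m = N - s"
  have sm: "s + m = N" "int m = 1 - q" using s N q0 by (auto simp: m_def)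
  have sz: "nat (0 - q + 1) = m" using sm(2) by simp
  have G: "glued_mat n \<Gamma>r \<Gamma>c hs d X Y = mat N N (\<lambda>(a, b). cell n \<Gamma>r \<Gamma>c hs d X Y (int a + 1 - int N) (int b + 1 - int N))"
    by (simp add: glued_mat_def N_def Let_def)
  have "submatrix (glued_mat n \<Gamma>r \<Gamma>c hs d X Y) {s..<s + m} {s..<s + m} =
      mat m m (\<lambda>(x, y). glued_mat n \<Gamma>r \<Gamma>c hs d X Y $$ (s + x, s + y))"
    by (rule submatrix_interval) (simp_all add: G sm)
  also have "\<dots> = mat m m (\<lambda>(x, y). cell n \<Gamma>r \<Gamma>c hs d X Y (q + int x) (q + int y))"
  proof (rule eq_matI)
    fix x y assume "x < dim_row (mat m m (\<lambda>(x, y). cell n \<Gamma>r \<Gamma>c hs d X Y (q + int x) (q + int y)))"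
      "y < dim_col (mat m m (\<lambda>(x, y). cell n \<Gamma>r \<Gamma>c hs d X Y (q + int x) (q + int y)))"
    then have xy: "x < m" "y < m" by auto
    then have lt: "s + x < N" "s + y < N" using sm by auto
    have e: "int (s + x) + 1 - int N = q + int x" "int (s + y) + 1 - int N = q + int y" using s by auto
    show "mat m m (\<lambda>(x, y). glued_mat n \<Gamma>r \<Gamma>c hs d X Y $$ (s + x, s + y)) $$ (x, y) =
        mat m m (\<lambda>(x, y). cell n \<Gamma>r \<Gamma>c hs d X Y (q + int x) (q + int y)) $$ (x, y)"
      unfolding G using xy lt by (simp add: e del: of_nat_add)
  qed auto
  finally show ?thesis unfolding detI_def s_def[symmetric] sm(1) sz by simp
qed

end

text \<open>Therefore exactly one type of the first block makes the block of e(i,j) primal, as the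
  \<open>THE\<close> in \<open>start_ij\<close> presupposes.\<close>

lemma dual_at_flip: "dual_at n \<Gamma>r \<Gamma>c hs (\<not> d) l \<longleftrightarrow> \<not> dual_at n \<Gamma>r \<Gamma>c hs d l"
  by (induction l) auto

context glued_path
begin

lemma exit_position:
  assumes l: "l < L"
  shows "\<rho> l + int (fst (exit_point n (fst (hs ! l)) (\<delta> l) (snd (hs ! l)))) = r.P (Suc l) + 1"
    "\<sigma> l + int (snd (exit_point n (fst (hs ! l)) (\<delta> l) (snd (hs ! l)))) = r.P (Suc l) + 1"
proof -
  have le: "snd (hs ! l) \<le> n" using snd_range[OF l] by simp
  note P = diagpos_Suc[OF l, of \<tau>] and t = \<tau>_range[OF l]
  have "\<rho> l + int (fst (exit_point n (fst (hs ! l)) (\<delta> l) (snd (hs ! l)))) = r.P (Suc l) + 1 \<and>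
    \<sigma> l + int (snd (exit_point n (fst (hs ! l)) (\<delta> l) (snd (hs ! l)))) = r.P (Suc l) + 1"
  proof (cases "up l")
    case True
    then have "exit_point n (fst (hs ! l)) (\<delta> l) (snd (hs ! l)) = (n - \<tau> l + 1, 1)"
      using exit_upper[OF le] by (simp add: \<tau>_def)
    then show ?thesis using r.pos[OF l] c.pos[OF l] True P t by simp
  next
    case False
    then have "exit_point n (fst (hs ! l)) (\<delta> l) (snd (hs ! l)) = (1, n - \<tau> l + 1)"
      using exit_lower[OF le] not_up[of l] by (simp add: \<tau>_def)
    then show ?thesis using r.pos[OF l] c.pos[OF l] False P t by simp
  qed
  then show "\<rho> l + int (fst (exit_point n (fst (hs ! l)) (\<delta> l) (snd (hs ! l)))) = r.P (Suc l) + 1"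
    "\<sigma> l + int (snd (exit_point n (fst (hs ! l)) (\<delta> l) (snd (hs ! l)))) = r.P (Suc l) + 1" by blast+
qed

text \<open>An upper block may extend beyond the diagonal to the right, a lower one downwards, so
  the diagonal leaves the block at the smaller of its two ends. Being below or to the right of the
  block therefore means, for a point of the diagonal, being past this end.\<close>

lemma corner_position:
  assumes K: "K < L"
  shows "r.P K = min (\<rho> K + int (Max (rows_at n \<Gamma>r \<Gamma>c hs d K))) (\<sigma> K + int (Max (cols_at n \<Gamma>r \<Gamma>c hs d K)))"
proof (cases "up K")
  case True
  have "\<tau> K \<le> Max (run n (fl n (\<delta> K) (Gam1 \<Gamma>c)) (\<tau> K))"
    using run_Min_Max(4)[OF fl_subset[OF bd_tripleD(1)[OF \<Gamma>c]], of "\<tau> K" "\<delta> K"] \<tau>_range[OF K] by simp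
  then show ?thesis
    using r.pos[OF K] c.pos[OF K] True rows_Min_Max(2)[OF K] cols_Min_Max(2)[OF K] by simp
next
  case False
  have "\<tau> K \<le> Max (run n (fl n (\<delta> K) (Gam2 \<Gamma>r)) (\<tau> K))"
    using run_Min_Max(4)[OF fl_subset[OF bd_tripleD(2)[OF \<Gamma>r]], of "\<tau> K" "\<delta> K"] \<tau>_range[OF K] by simp
  then show ?thesis
    using r.pos[OF K] c.pos[OF K] False rows_Min_Max(2)[OF K] cols_Min_Max(2)[OF K] by simp
qed

lemma subordinate_iff:
  assumes K: "K < L" and l: "l < L"
  shows "(r.P (Suc l) + 1 > \<rho> K + int (Max (rows_at n \<Gamma>r \<Gamma>c hs d K)) \<or>
    r.P (Suc l) + 1 > \<sigma> K + int (Max (cols_at n \<Gamma>r \<Gamma>c hs d K))) \<longleftrightarrow> l < K"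
proof -
  interpret lr: layout L r.P up r.rlo r.rhi by (rule r.layout)
  have "l < K \<longleftrightarrow> r.P K \<le> r.P (Suc l)"
  proof
    assume "l < K" then show "r.P K \<le> r.P (Suc l)" using lr.P_mono[of "Suc l" K] K by simp
  next
    assume h: "r.P K \<le> r.P (Suc l)"
    show "l < K"
    proof (rule ccontr)
      assume "\<not> l < K"
      then have "r.P l \<le> r.P K" using lr.P_mono[of K l] l by simp
      then show False using h diagpos_Suc[OF l, of \<tau>] \<tau>_range[OF l] by simp
    qed
  qed
  then show ?thesis unfolding corner_position[OF K] min_le_iff_disj by linarith
qed

end

lemma ij_path:
  assumes \<Gamma>: "is_bd_triple n \<Gamma>r" "is_bd_triple n \<Gamma>c" and ap: "aperiodic n \<Gamma>r \<Gamma>c"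
    and ij: "1 \<le> i" "i \<le> n" "1 \<le> j" "j \<le> n" "i \<noteq> j"
  defines "hs \<equiv> hs_ij n \<Gamma>r \<Gamma>c i j" and "K \<equiv> pos_ij n \<Gamma>r \<Gamma>c i j" and "d \<equiv> start_ij n \<Gamma>r \<Gamma>c i j"
  shows "glued_path n \<Gamma>r \<Gamma>c hs" "K < length hs" "hs ! K = e_ij n i j"
    "\<not> dual_at n \<Gamma>r \<Gamma>c hs d K" "distinct hs"
proof -
  define p where "p = fst (e_ij n i j)"
  define i0 where "i0 = snd (e_ij n i j)"
  have e: "e_ij n i j = (p, i0)" by (simp add: p_def i0_def)
  have i0: "i0 \<in> {1..<n}" using ij by (auto simp: i0_def e_ij_def)
  have hs: "hs = path_edges n \<Gamma>r \<Gamma>c (p, i0)" by (simp add: hs_def hs_ij_def e)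
  note props = path_edges_properties[OF \<Gamma> ap i0, of p, folded hs]
  obtain K0 where K0: "K0 < length hs" "hs ! K0 = e_ij n i j"
    using props(1) e by (metis in_set_conv_nth)
  have "K = K0"
    unfolding K_def pos_ij_def hs_def[symmetric]
  proof (rule the_equality)
    show "K0 < length hs \<and> hs ! K0 = e_ij n i j" using K0 by simp
    show "l = K0" if "l < length hs \<and> hs ! l = e_ij n i j" for l
      using nth_eq_iff_index_eq[OF props(2), of l K0] K0 that by simp
  qed
  then show K: "K < length hs" "hs ! K = e_ij n i j" using K0 by auto
  show "\<not> dual_at n \<Gamma>r \<Gamma>c hs d K"
  proof -
    have "\<exists>!e. \<not> dual_at n \<Gamma>r \<Gamma>c hs e K"
    proof (cases "dual_at n \<Gamma>r \<Gamma>c hs False K")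
      case True
      have "e = True" if "\<not> dual_at n \<Gamma>r \<Gamma>c hs e K" for e using True that by (cases e) auto
      moreover have "\<not> dual_at n \<Gamma>r \<Gamma>c hs True K" using True dual_at_flip[of n \<Gamma>r \<Gamma>c hs False K] by simp
      ultimately show ?thesis by blast
    next
      case False
      have "dual_at n \<Gamma>r \<Gamma>c hs True K" using False dual_at_flip[of n \<Gamma>r \<Gamma>c hs False K] by simp
      then have "e = False" if "\<not> dual_at n \<Gamma>r \<Gamma>c hs e K" for e using that by (cases e) auto
      then show ?thesis using False by blast
    qed
    then show ?thesis unfolding d_def start_ij_def hs_def[symmetric] K_def[symmetric] by (rule theI')
  qed
  show "glued_path n \<Gamma>r \<Gamma>c hs"
    by unfold_locales (use \<Gamma> props in auto)
  show "distinct hs" by (rule props(2))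
qed

theorem f_ij_factor:
  assumes \<Gamma>: "is_bd_triple n \<Gamma>r" "is_bd_triple n \<Gamma>c" and ap: "aperiodic n \<Gamma>r \<Gamma>c"
    and ij: "1 \<le> i" "i \<le> n" "1 \<le> j" "j \<le> n" "i \<noteq> j"
    and gr: "row_glue n \<Gamma>r G H" and gc: "row_glue n (inv_triple \<Gamma>c) G' H'"
    and M: "antilower n M" "det M = 1" and M': "antilower n M'" "det M' = 1"
    and Z: "Z = G * M * H'\<^sup>T" "Z = H * M' * G'\<^sup>T"
  shows "f_ij n \<Gamma>r \<Gamma>c i j Z = trailing_minor n i j (if i > j then M else M') *
    (\<Prod>k\<in>subordinate_X n \<Gamma>r \<Gamma>c i j. trailing_minor n k 1 M) *
    (\<Prod>m\<in>subordinate_Y n \<Gamma>r \<Gamma>c i j. trailing_minor n 1 m M')"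
proof -
  have Mc: "M \<in> carrier_mat n n" "M' \<in> carrier_mat n n" using M M' by (auto simp: antilower_def)
  define hs where "hs = hs_ij n \<Gamma>r \<Gamma>c i j"
  define K where "K = pos_ij n \<Gamma>r \<Gamma>c i j"
  define d where "d = start_ij n \<Gamma>r \<Gamma>c i j"
  note path = ij_path[OF \<Gamma> ap ij, folded hs_def K_def d_def]
  note K = path(2,3) and d = path(4)
  interpret glued_path n \<Gamma>r \<Gamma>c hs d by (rule path(1))
  note top = detI_block_top[OF K(1) d Mc ij(1-4) ij(5) K(2)]
  have sub: "subordinate_edge n \<Gamma>r \<Gamma>c i j l \<longleftrightarrow> l < K" for l
  proof (cases "l < length hs")
    case True
    show ?thesis
      unfolding subordinate_edge_def Let_def hs_def[symmetric] K_def[symmetric] d_def[symmetric]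
        exit_position[OF True] subordinate_iff[OF K(1) True, symmetric]
      using True by simp
  next
    case False
    then show ?thesis unfolding subordinate_edge_def Let_def hs_def[symmetric] using K(1) by auto
  qed
  \<comment> \<open>Different edges of one part have different exit points, so the products over
    sets of exit points count every preceding edge exactly once.\<close>
  have inj: "l = l'" if "l < K" "l' < K" "fst (hs ! l) = fst (hs ! l')" "n - snd (hs ! l) + 1 = n - snd (hs ! l') + 1" for l l'
  proof -
    have "snd (hs ! l) = snd (hs ! l')" using that(4) snd_range[of l] snd_range[of l'] that(1,2) K(1) by linarith
    then have "hs ! l = hs ! l'" using that(3) by (simp add: prod_eq_iff)
    then show ?thesis using nth_eq_iff_index_eq[OF path(5), of l l'] that(1,2) K(1) by simp
  qed
  have X: "subordinate_X n \<Gamma>r \<Gamma>c i j = (\<lambda>l. n - snd (hs ! l) + 1) ` {l\<in>{..<K}. up l}"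
  proof (rule Set.set_eqI)
    fix k
    have "k \<in> subordinate_X n \<Gamma>r \<Gamma>c i j \<longleftrightarrow> (\<exists>l u. l < K \<and> hs ! l = (Upper, u) \<and> k = n - u + 1)"
      unfolding subordinate_X_def sub hs_def[symmetric] by auto
    also have "\<dots> \<longleftrightarrow> (\<exists>l<K. fst (hs ! l) = Upper \<and> k = n - snd (hs ! l) + 1)"
      by (simp only: prod_eq_iff fst_conv snd_conv) blast
    finally show "k \<in> subordinate_X n \<Gamma>r \<Gamma>c i j \<longleftrightarrow> k \<in> (\<lambda>l. n - snd (hs ! l) + 1) ` {l\<in>{..<K}. up l}"
      by blast
  qed
  have Y: "subordinate_Y n \<Gamma>r \<Gamma>c i j = (\<lambda>l. n - snd (hs ! l) + 1) ` {l\<in>{..<K}. \<not> up l}"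
  proof (rule Set.set_eqI)
    fix k
    have "k \<in> subordinate_Y n \<Gamma>r \<Gamma>c i j \<longleftrightarrow> (\<exists>l u. l < K \<and> hs ! l = (Lower, u) \<and> k = n - u + 1)"
      unfolding subordinate_Y_def sub hs_def[symmetric] by auto
    also have "\<dots> \<longleftrightarrow> (\<exists>l<K. fst (hs ! l) = Lower \<and> k = n - snd (hs ! l) + 1)"
      by (simp only: prod_eq_iff fst_conv snd_conv) blast
    finally show "k \<in> subordinate_Y n \<Gamma>r \<Gamma>c i j \<longleftrightarrow> k \<in> (\<lambda>l. n - snd (hs ! l) + 1) ` {l\<in>{..<K}. \<not> up l}"
      unfolding not_up by blast
  qed
  have "f_ij n \<Gamma>r \<Gamma>c i j Z = detI (\<rho> K + int i) 0 (cell n \<Gamma>r \<Gamma>c hs d Z Z)"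
    unfolding f_ij_def f_XY_def L_mat_def hs_def[symmetric] d_def[symmetric] K_def[symmetric] Let_def
    using glued_submatrix[OF K(1) top(2,3), of Z Z]
    by (simp add: glued_mat_def Let_def)
  also have "\<dots> = detI (\<rho> K + int i) (r.P K) (block M M' K) *
      (\<Prod>l<K. detI (r.P (Suc l) + 1) (r.P l) (block M M' l))"
    by (rule glued_minor[OF gr gc M M' Z K(1) top(2,3)])
  also have "detI (\<rho> K + int i) (r.P K) (block M M' K) = trailing_minor n i j (if i > j then M else M')"
    using top(1,4) by simp
  also have "(\<Prod>l<K. detI (r.P (Suc l) + 1) (r.P l) (block M M' l)) =
      (\<Prod>l<K. if up l then trailing_minor n (n - snd (hs ! l) + 1) 1 M
        else trailing_minor n 1 (n - snd (hs ! l) + 1) M')"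
    by (rule prod.cong[OF refl], rule detI_block_diag, use K(1) in simp, (rule Mc M(2) M'(2))+)
  also have "\<dots> = (\<Prod>l\<in>{l\<in>{..<K}. up l}. trailing_minor n (n - snd (hs ! l) + 1) 1 M) *
      (\<Prod>l\<in>{l\<in>{..<K}. \<not> up l}. trailing_minor n 1 (n - snd (hs ! l) + 1) M')"
    by (subst prod.If_cases) (simp_all add: Int_def)
  also have "(\<Prod>l\<in>{l\<in>{..<K}. up l}. trailing_minor n (n - snd (hs ! l) + 1) 1 M) =
      (\<Prod>k\<in>subordinate_X n \<Gamma>r \<Gamma>c i j. trailing_minor n k 1 M)"
  proof -
    have "inj_on (\<lambda>l. n - snd (hs ! l) + 1) {l\<in>{..<K}. up l}"
      by (rule inj_onI) (rule inj, simp_all)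
    then show ?thesis unfolding X by (simp add: prod.reindex)
  qed
  also have "(\<Prod>l\<in>{l\<in>{..<K}. \<not> up l}. trailing_minor n 1 (n - snd (hs ! l) + 1) M') =
      (\<Prod>m\<in>subordinate_Y n \<Gamma>r \<Gamma>c i j. trailing_minor n 1 m M')"
  proof -
    have "inj_on (\<lambda>l. n - snd (hs ! l) + 1) {l\<in>{..<K}. \<not> up l}"
      by (rule inj_onI) (rule inj, simp_all add: not_up)
    then show ?thesis unfolding Y by (simp add: prod.reindex)
  qed
  finally show ?thesis by (simp add: mult.assoc)
qed

section \<open>The column side by transposition, passage to the limit, and conclusion\<close>

section \<open>The column construction by transposition\<close>

lemma prod_minus_append:
  "length w1 = length t1 \<Longrightarrow> prod_minus n (w1 @ w2) (t1 @ t2) = prod_minus n w1 t1 * prod_minus n w2 t2"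
proof (induction w1 t1 rule: list_induct2)
  case Nil
  then show ?case by (simp add: prod_minus_Nil left_mult_one_mat[of _ n n])
next
  case (Cons i w t ts)
  then show ?case by (simp add: prod_minus_Cons mult_assoc_square[of _ n])
qed

lemma prod_minus_single: "prod_minus n [i] [t] = exp_minus n i t"
  by (simp add: prod_minus_Cons prod_minus_Nil)

lemma prod_plus_transpose:
  "length w = length ts \<Longrightarrow> (prod_plus n w ts)\<^sup>T = prod_minus n (rev w) (rev ts)"
proof (induction w ts rule: list_induct2)
  case Nil
  then show ?case by (simp add: prod_plus_def prod_minus_Nil)
next
  case (Cons i w t ts)
  have 1: "prod_plus n (i # w) (t # ts) = exp_plus n i t * prod_plus n w ts"
    by (simp add: prod_plus_def)
  have c: "(prod_plus n w ts)\<^sup>T \<in> carrier_mat n n" unfolding Cons.IH by (rule prod_minus_carrier)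
  then have "prod_plus n w ts \<in> carrier_mat n n" by (metis transpose_carrier_mat transpose_transpose)
  then have "(prod_plus n (i # w) (t # ts))\<^sup>T = (prod_plus n w ts)\<^sup>T * (exp_plus n i t)\<^sup>T"
    unfolding 1 by (intro transpose_mult[of _ n n _ n] exp_carrier)
  also have "\<dots> = prod_minus n (rev w) (rev ts) * prod_minus n [i] [t]"
    unfolding Cons.IH exp_plus_transpose prod_minus_single ..
  also have "\<dots> = prod_minus n (rev (i # w)) (rev (t # ts))"
    using Cons.hyps by (simp add: prod_minus_append)
  finally show ?case .
qed

text \<open>Transposition reverses words, so the distinguished final subword becomes an initial
  one.\<close>

lemma V_col_transpose:
  assumes "V_col n J Up V"
  shows "V_row n J Up\<^sup>T V\<^sup>T"
proof -
  obtain w1 w2 t1 t2 where h: "longest_word n {1..<n} (w1 @ w2)" "longest_word n J w2"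
    "length t1 = length w1" "length t2 = length w2"
    "Up = prod_plus n (w1 @ w2) (t1 @ t2)" "V = prod_plus n w2 t2"
    using assms unfolding V_col_def by blast
  have "longest_word n {1..<n} (rev w2 @ rev w1)" using longest_word_rev[OF h(1)] by simp
  moreover have "Up\<^sup>T = prod_minus n (rev w2 @ rev w1) (rev t2 @ rev t1)"
    unfolding h(5) using h(3,4) prod_plus_transpose[of "w1 @ w2" "t1 @ t2" n] by simp
  moreover have "V\<^sup>T = prod_minus n (rev w2) (rev t2)"
    unfolding h(6) using h(4) by (simp add: prod_plus_transpose)
  ultimately show ?thesis
    unfolding V_row_def using longest_word_rev[OF h(2)] h(3,4)
    by (intro exI[of _ "rev w2"] exI[of _ "rev w1"] exI[of _ "rev t2"] exI[of _ "rev t1"]) simp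
qed

lemma SL_transpose: "A \<in> carrier (SL n) \<Longrightarrow> A\<^sup>T \<in> carrier (SL n)"
  by (auto simp: SL_carrier_iff det_transpose)

lemma transpose_mult_square:
  fixes A :: "complex mat"
  shows "A \<in> carrier_mat n n \<Longrightarrow> B \<in> carrier_mat n n \<Longrightarrow> (A * B)\<^sup>T = B\<^sup>T * A\<^sup>T"
  by (rule transpose_mult)

lemma SL_inv_transpose:
  assumes "A \<in> carrier (SL n)"
  shows "inv\<^bsub>SL n\<^esub> A\<^sup>T = (inv\<^bsub>SL n\<^esub> A)\<^sup>T"
proof -
  note i = SL_inv[OF assms] and iT = SL_inv[OF SL_transpose[OF assms]]
  have A: "A \<in> carrier_mat n n" using assms by (simp add: SL_carrier_iff)
  have "A\<^sup>T * (inv\<^bsub>SL n\<^esub> A)\<^sup>T = 1\<^sub>m n"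
    using transpose_mult_square[OF i(1) A] i(3) by simp
  then show ?thesis
    using inverse_unique[of "A\<^sup>T" n "inv\<^bsub>SL n\<^esub> A\<^sup>T" "(inv\<^bsub>SL n\<^esub> A)\<^sup>T"] A i(1) iT(1,2) by simp
qed

lemma G_sub_transpose:
  assumes J: "J \<subseteq> {1..<n}" and A: "A \<in> G_sub n J"
  shows "A\<^sup>T \<in> G_sub n J"
proof -
  let ?S = "{exp_plus n i t | i t. i \<in> J} \<union> {exp_minus n i t | i t. i \<in> J}"
  have gens: "h\<^sup>T \<in> ?S" if "h \<in> ?S" for h
    using that by (auto simp: exp_plus_transpose exp_minus_transpose) (metis exp_plus_transpose exp_minus_transpose)+
  show ?thesis
    using A unfolding G_sub_def
  proof (induction rule: generate.induct)
    case one
    then show ?case using generate.one[of "SL n"] by (simp add: SL_def)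
  next
    case (incl h)
    then show ?case by (intro generate.incl gens)
  next
    case (inv h)
    have "1 \<le> i" if "i \<in> J" for i using J that by auto
    then have "h \<in> carrier (SL n)" using inv exp_SL by blast
    then have e: "(inv\<^bsub>SL n\<^esub> h)\<^sup>T = inv\<^bsub>SL n\<^esub> h\<^sup>T" by (simp add: SL_inv_transpose)
    show ?case unfolding e
      by (rule generate.inv) (rule gens[OF inv])
  next
    case (eng h1 h2)
    have "h1 \<in> carrier_mat n n" "h2 \<in> carrier_mat n n"
      using eng(1,2) G_sub_blockdiag(1)[OF J] by (auto simp: G_sub_def SL_carrier_iff)
    then have "(h1 \<otimes>\<^bsub>SL n\<^esub> h2)\<^sup>T = h2\<^sup>T \<otimes>\<^bsub>SL n\<^esub> h1\<^sup>T" by (simp add: SL_def transpose_mult_square)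
    then show ?case using generate.eng[OF eng(4,3)] by simp
  qed
qed

lemma B_minus_transpose: "A\<^sup>T \<in> B_plus n \<longleftrightarrow> A \<in> B_minus n"
  and B_plus_transpose: "A\<^sup>T \<in> B_minus n \<longleftrightarrow> A \<in> B_plus n"
  using SL_transpose[of A n] SL_transpose[of "A\<^sup>T" n] by (auto simp: B_plus_def B_minus_def)

lemma B_G_sub_transpose:
  assumes J: "J \<subseteq> {1..<n}"
  shows "A\<^sup>T \<in> B_plus n \<inter> G_sub n J \<longleftrightarrow> A \<in> B_minus n \<inter> G_sub n J"
    "A\<^sup>T \<in> B_minus n \<inter> G_sub n J \<longleftrightarrow> A \<in> B_plus n \<inter> G_sub n J"
  using G_sub_transpose[OF J, of A] G_sub_transpose[OF J, of "A\<^sup>T"]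
  by (auto simp: B_plus_transpose B_minus_transpose)

text \<open>Transposition exchanges B_+ and B_- and also reverses the direction of the conjugation:
  A' = W B' W^-1 for transposes A', B' says that W^T A W^-T = B. The two effects cancel, and W^T
  satisfies the condition of the row construction.\<close>

lemma Vbar_col_transpose:
  assumes J: "J \<subseteq> {1..<n}" and V: "V \<in> carrier_mat n n" and Vb: "Vbar_col n J V Vb"
  shows "Vbar_row n J V\<^sup>T Vb\<^sup>T"
proof -
  obtain W b where W: "W \<in> G_sub n J" "conjugates n W (B_minus n \<inter> G_sub n J) (B_plus n \<inter> G_sub n J)"
    "Vb \<in> N_minus n" "b \<in> B_plus n" "W * V = b * Vb"
    using Vb unfolding Vbar_col_def by blast
  have Ws: "W \<in> carrier (SL n)" using G_sub_blockdiag(1)[OF J W(1)] .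
  then have Wc: "W \<in> carrier_mat n n" by (simp add: SL_carrier_iff)
  note Wi = SL_inv[OF Ws]
  let ?W = "W\<^sup>T" and ?I = "(inv\<^bsub>SL n\<^esub> W)\<^sup>T"
  have I: "inv\<^bsub>SL n\<^esub> ?W = ?I" by (rule SL_inv_transpose[OF Ws])
  have c: "A \<in> carrier_mat n n" if "A \<in> B_minus n \<inter> G_sub n J \<or> A \<in> B_plus n \<inter> G_sub n J" for A
    using that by (auto simp: B_minus_def B_plus_def SL_carrier_iff)
  have img: "(\<lambda>A. W * A * inv\<^bsub>SL n\<^esub> W) ` (B_minus n \<inter> G_sub n J) = B_plus n \<inter> G_sub n J"
    using W(2) by (simp add: conjugates_def)
  \<comment> \<open>Both inclusions of the image equality below come from this identity, with the
    roles of given and constructed matrix exchanged.\<close>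
  have flip: "?W * A * ?I = B" if "A \<in> carrier_mat n n" "B \<in> carrier_mat n n" "W * B\<^sup>T * inv\<^bsub>SL n\<^esub> W = A\<^sup>T" for A B
  proof -
    have "A = (W * B\<^sup>T * inv\<^bsub>SL n\<^esub> W)\<^sup>T" using that(3) by (metis transpose_transpose)
    also have "\<dots> = ?I * (B * ?W)"
      using that(2) Wc Wi(1) by (simp add: transpose_mult_square[of _ n])
    finally have A: "A = ?I * (B * ?W)" .
    have 1: "?W * ?I = 1\<^sub>m n" "?I * ?W = 1\<^sub>m n"
      unfolding transpose_mult_square[OF Wi(1) Wc, symmetric] transpose_mult_square[OF Wc Wi(1), symmetric] Wi(2,3)
      by simp_all
    have "?W * A * ?I = (?W * ?I) * (B * (?W * ?I))"
      unfolding A using that(2) Wc Wi(1) by (simp add: mult_assoc_square[of _ n])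
    then show ?thesis unfolding 1 using that(2) by simp
  qed
  have "(\<lambda>A. ?W * A * inv\<^bsub>SL n\<^esub> ?W) ` (B_minus n \<inter> G_sub n J) = B_plus n \<inter> G_sub n J"
    unfolding I
  proof (rule Set.set_eqI, rule iffI)
    fix X assume "X \<in> (\<lambda>A. ?W * A * ?I) ` (B_minus n \<inter> G_sub n J)"
    then obtain A where A: "A \<in> B_minus n \<inter> G_sub n J" "X = ?W * A * ?I" by blast
    then have "A\<^sup>T \<in> B_plus n \<inter> G_sub n J" using B_G_sub_transpose[OF J] by blast
    then obtain B where B: "B \<in> B_minus n \<inter> G_sub n J" "A\<^sup>T = W * B * inv\<^bsub>SL n\<^esub> W"
      using img by blast
    have "X = B\<^sup>T" unfolding A(2) by (rule flip) (use A B c[of A] c[of B] in simp_all)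
    then show "X \<in> B_plus n \<inter> G_sub n J" using B(1) B_G_sub_transpose(1)[OF J] by blast
  next
    fix X assume X: "X \<in> B_plus n \<inter> G_sub n J"
    then have XT: "X\<^sup>T \<in> B_minus n \<inter> G_sub n J" using B_G_sub_transpose[OF J] by blast
    then have "W * X\<^sup>T * inv\<^bsub>SL n\<^esub> W \<in> B_plus n \<inter> G_sub n J" using img by blast
    then have A: "(W * X\<^sup>T * inv\<^bsub>SL n\<^esub> W)\<^sup>T \<in> B_minus n \<inter> G_sub n J" using B_G_sub_transpose(2)[OF J] by blast
    have "X = ?W * (W * X\<^sup>T * inv\<^bsub>SL n\<^esub> W)\<^sup>T * ?I"
      by (rule flip[symmetric]) (use X A c[of X] c[OF disjI1, OF A] in simp_all)
    then show "X \<in> (\<lambda>A. ?W * A * ?I) ` (B_minus n \<inter> G_sub n J)" using A by blast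
  qed
  moreover have "V\<^sup>T * ?W = Vb\<^sup>T * b\<^sup>T"
  proof -
    have "b \<in> carrier_mat n n" "Vb \<in> carrier_mat n n"
      using W(3,4) by (auto simp: N_minus_def B_minus_def B_plus_def SL_carrier_iff)
    then show ?thesis
      using transpose_mult_square[OF Wc V] transpose_mult_square[of b n Vb] W(5) by simp
  qed
  moreover have "b\<^sup>T \<in> B_minus n" using W(4) by (simp add: B_plus_transpose)
  ultimately show ?thesis
    unfolding Vbar_row_def conjugates_def using G_sub_transpose[OF J W(1)] W(3)
    by (intro bexI[of _ ?W] conjI bexI[of _ "b\<^sup>T"]) (simp_all only: N_minus_transpose)
qed

text \<open>The dual homomorphism sends the generator for gamma(i) to that for i, which is the
  action of the inverse triple.\<close>

lemma bold_gamma_star_transpose: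
  assumes \<Gamma>: "is_bd_triple n \<Gamma>" and \<phi>: "is_bold_gamma_star n \<Gamma> \<phi>"
  shows "is_bold_gamma n (inv_triple \<Gamma>) (\<lambda>A. (\<phi> A\<^sup>T)\<^sup>T)"
proof -
  have hom: "\<phi> \<in> hom ((SL n)\<lparr>carrier := N_minus n\<rparr>) ((SL n)\<lparr>carrier := N_minus n\<rparr>)"
    using \<phi> by (simp add: is_bold_gamma_star_def)
  have N: "\<phi> A \<in> N_minus n" if "A \<in> N_minus n" for A using hom that by (auto simp: hom_def)
  have m: "\<phi> (A * B) = \<phi> A * \<phi> B" if "A \<in> N_minus n" "B \<in> N_minus n" for A B
    using hom that by (auto simp: hom_def SL_def)
  have T: "A\<^sup>T \<in> N_minus n" if "A \<in> N_plus n" for A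
    using that N_minus_transpose[of "A\<^sup>T" n] by simp
  have D: "has_deriv_at_0 n (\<lambda>t. (\<phi> (exp_plus n j t)\<^sup>T)\<^sup>T) D\<^sup>T"
    if "has_deriv_at_0 n (\<lambda>t. \<phi> (exp_minus n j t)) D" "1 \<le> j" "D \<in> carrier_mat n n" for j D
  proof -
    have "\<phi> (exp_minus n j t) \<in> carrier_mat n n" for t
      using N[OF exp_minus_N_minus[OF that(2)]] by (simp add: N_minus_def B_minus_def SL_carrier_iff)
    then have "dim_row (\<phi> (exp_minus n j t)) = n \<and> dim_col (\<phi> (exp_minus n j t)) = n" for t by blast
    then show ?thesis using that(1,3) unfolding has_deriv_at_0_def exp_plus_transpose by simp
  qed
  show ?thesis
    unfolding is_bold_gamma_def
  proof (intro conjI ballI)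
    show "(\<lambda>A. (\<phi> A\<^sup>T)\<^sup>T) \<in> hom ((SL n)\<lparr>carrier := N_plus n\<rparr>) ((SL n)\<lparr>carrier := N_plus n\<rparr>)"
    proof (rule homI)
      show "(\<phi> A\<^sup>T)\<^sup>T \<in> carrier ((SL n)\<lparr>carrier := N_plus n\<rparr>)"
        if "A \<in> carrier ((SL n)\<lparr>carrier := N_plus n\<rparr>)" for A
        using N[OF T] that by (simp add: N_minus_transpose)
    next
      fix A B assume "A \<in> carrier ((SL n)\<lparr>carrier := N_plus n\<rparr>)" "B \<in> carrier ((SL n)\<lparr>carrier := N_plus n\<rparr>)"
      then have AB: "A \<in> N_plus n" "B \<in> N_plus n" by auto
      have "\<phi> A\<^sup>T \<in> carrier_mat n n" "\<phi> B\<^sup>T \<in> carrier_mat n n"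
        using N[OF T[OF AB(1)]] N[OF T[OF AB(2)]] by (auto simp: N_minus_def B_minus_def SL_carrier_iff)
      then have "(\<phi> (A * B)\<^sup>T)\<^sup>T = (\<phi> A\<^sup>T)\<^sup>T * (\<phi> B\<^sup>T)\<^sup>T"
        using transpose_mult_square[OF N_plusD(1)[OF AB(1)] N_plusD(1)[OF AB(2)]] m[OF T[OF AB(2)] T[OF AB(1)]]
        by (simp add: transpose_mult_square[of _ n])
      then show "(\<phi> (A \<otimes>\<^bsub>(SL n)\<lparr>carrier := N_plus n\<rparr>\<^esub> B)\<^sup>T)\<^sup>T =
          (\<phi> A\<^sup>T)\<^sup>T \<otimes>\<^bsub>(SL n)\<lparr>carrier := N_plus n\<rparr>\<^esub> (\<phi> B\<^sup>T)\<^sup>T"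
        by (simp add: SL_def)
    qed
  next
    fix j assume "j \<in> Gam1 (inv_triple \<Gamma>)"
    then have j: "j \<in> Gam2 \<Gamma>" by simp
    let ?i = "gam (inv_triple \<Gamma>) j"
    have "?i \<in> Gam1 \<Gamma>" "gam \<Gamma> ?i = j" using inv_triple_gam(2,3)[OF \<Gamma> j] .
    then have "has_deriv_at_0 n (\<lambda>t. \<phi> (exp_minus n j t)) (e_minus n ?i)"
      using \<phi> unfolding is_bold_gamma_star_def by metis
    moreover have "1 \<le> j" using j bd_tripleD(2)[OF \<Gamma>] by auto
    ultimately show "has_deriv_at_0 n (\<lambda>t. (\<phi> (exp_plus n j t)\<^sup>T)\<^sup>T) (e_plus n ?i)"
      using D[of j "e_minus n ?i"] by (simp add: e_minus_def e_plus_def)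
  next
    fix j assume j: "j \<in> {1..<n} - Gam1 (inv_triple \<Gamma>)"
    then have "has_deriv_at_0 n (\<lambda>t. \<phi> (exp_minus n j t)) (0\<^sub>m n n)"
      using \<phi> unfolding is_bold_gamma_star_def by simp
    then show "has_deriv_at_0 n (\<lambda>t. (\<phi> (exp_plus n j t)\<^sup>T)\<^sup>T) (0\<^sub>m n n)"
      using D[of j "0\<^sub>m n n"] j by simp
  qed
qed

lemma col_prod_transpose:
  assumes \<phi>: "\<And>A. A \<in> N_minus n \<Longrightarrow> \<phi> A \<in> N_minus n" and V: "V \<in> N_minus n"
  shows "(col_prod n \<phi> V m)\<^sup>T = row_prod n (\<lambda>A. (\<phi> A\<^sup>T)\<^sup>T) V\<^sup>T m"
proof -
  have N: "(\<phi> ^^ k) V \<in> N_minus n" for k by (induction k) (use \<phi> V in auto)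
  have p: "((\<lambda>A. (\<phi> A\<^sup>T)\<^sup>T) ^^ k) V\<^sup>T = ((\<phi> ^^ k) V)\<^sup>T" for k by (induction k) auto
  have c: "A \<in> carrier_mat n n" if "A \<in> N_minus n" for A
    using that by (simp add: N_minus_def B_minus_def SL_carrier_iff)
  have cc: "col_prod n \<phi> V m \<in> carrier_mat n n" for m
    by (induction m) (use c[OF N[of "Suc k" for k]] in \<open>simp_all del: funpow.simps\<close>)
  show ?thesis
  proof (induction m)
    case (Suc m)
    show ?case
      using transpose_mult_square[OF cc[of m] c[OF N[of "Suc m"]]] Suc.IH p[of "Suc m"]
      by (simp del: funpow.simps)
  qed simp
qed

section \<open>Continuity\<close>

definition continuous_mat :: "nat \<Rightarrow> (complex \<Rightarrow> complex mat) \<Rightarrow> bool" where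
  "continuous_mat n A \<longleftrightarrow> (\<forall>t. A t \<in> carrier_mat n n) \<and>
     (\<forall>a<n. \<forall>b<n. continuous_on UNIV (\<lambda>t. A t $$ (a, b)))"

lemma continuous_matD:
  assumes "continuous_mat n A"
  shows "A t \<in> carrier_mat n n" "a < n \<Longrightarrow> b < n \<Longrightarrow> continuous_on UNIV (\<lambda>t. A t $$ (a, b))"
  using assms by (auto simp: continuous_mat_def)

lemma continuous_mat_const: "A \<in> carrier_mat n n \<Longrightarrow> continuous_mat n (\<lambda>t. A)"
  by (simp add: continuous_mat_def)

lemma continuous_mat_transpose:
  assumes "continuous_mat n A"
  shows "continuous_mat n (\<lambda>t. (A t)\<^sup>T)"
  unfolding continuous_mat_def
proof (intro conjI allI impI)
  note D = continuous_matD[OF assms]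
  show "(A t)\<^sup>T \<in> carrier_mat n n" for t using D(1) by simp
  fix a b assume ab: "a < n" "b < n"
  have "(\<lambda>t. (A t)\<^sup>T $$ (a, b)) = (\<lambda>t. A t $$ (b, a))"
    using ab carrier_matD[OF D(1)] by simp
  then show "continuous_on UNIV (\<lambda>t. (A t)\<^sup>T $$ (a, b))" using D(2)[OF ab(2,1)] by (simp only:)
qed

lemma continuous_mat_mult:
  assumes A: "continuous_mat n A" and B: "continuous_mat n B"
  shows "continuous_mat n (\<lambda>t. A t * B t)"
  unfolding continuous_mat_def
proof (intro conjI allI impI)
  note DA = continuous_matD[OF A] and DB = continuous_matD[OF B]
  show "A t * B t \<in> carrier_mat n n" for t using DA(1) DB(1) by simp
  fix a b assume ab: "a < n" "b < n"
  have "(\<lambda>t. (A t * B t) $$ (a, b)) = (\<lambda>t. \<Sum>k<n. A t $$ (a, k) * B t $$ (k, b))"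
    by (rule ext, rule mult_entry[OF DA(1) DB(1) ab])
  moreover have "continuous_on UNIV (\<lambda>t. \<Sum>k<n. A t $$ (a, k) * B t $$ (k, b))"
    by (intro continuous_intros DA(2) DB(2)) (use ab in auto)
  ultimately show "continuous_on UNIV (\<lambda>t. (A t * B t) $$ (a, b))" by (simp only:)
qed

lemma continuous_mat_exp_minus:
  assumes "continuous_on UNIV f"
  shows "continuous_mat n (\<lambda>t. exp_minus n i (f t))"
  unfolding continuous_mat_def
proof (intro conjI allI impI)
  fix a b assume ab: "a < n" "b < n"
  show "continuous_on UNIV (\<lambda>t. exp_minus n i (f t) $$ (a, b))"
    unfolding exp_minus_entry[OF ab] by (cases "a = i \<and> b = i - 1") (auto intro!: continuous_intros assms)
qed (rule exp_carrier)

lemma continuous_mat_prod_minus: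
  "length w = length ts \<Longrightarrow> continuous_mat n (\<lambda>s. prod_minus n w (map (\<lambda>t. t + s) ts))"
proof (induction w ts rule: list_induct2)
  case Nil
  then show ?case by (simp add: prod_minus_Nil continuous_mat_const)
next
  case (Cons i w t ts)
  then show ?case
    by (simp add: prod_minus_Cons) (intro continuous_mat_mult continuous_mat_exp_minus continuous_intros)
qed

lemma continuous_det:
  assumes "\<And>x y. x < r \<Longrightarrow> y < r \<Longrightarrow> continuous_on UNIV (\<lambda>t. f t (x, y))"
  shows "continuous_on UNIV (\<lambda>t::complex. det (mat r c (f t)) :: complex)"
proof (cases "r = c")
  case True
  have "continuous_on UNIV (\<lambda>t. \<Sum>p\<in>{p. p permutes {0..<r}}. signof p * (\<Prod>i = 0..<r. f t (i, p i)))"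
    by (intro continuous_intros assms) (auto simp: permutes_in_image)
  moreover have "det (mat r c (f t)) = (\<Sum>p\<in>{p. p permutes {0..<r}}. signof p * (\<Prod>i = 0..<r. f t (i, p i)))" for t
    unfolding det_def using True by (auto intro!: sum.cong prod.cong simp: permutes_in_image)
  ultimately show ?thesis by simp
next
  case False
  then show ?thesis by (simp add: det_def)
qed

lemma continuous_submatrix:
  assumes "continuous_mat n A"
  shows "continuous_on UNIV (\<lambda>t. det (submatrix (A t) I J))"
proof -
  note D = continuous_matD[OF assms]
  have "submatrix (A t) I J = mat (card {i. i < n \<and> i \<in> I}) (card {j. j < n \<and> j \<in> J})
      (\<lambda>(i, j). A t $$ (pick I i, pick J j))" for t
    using carrier_matD[OF D(1)[of t]] by (simp add: submatrix_def)
  moreover have "continuous_on UNIV (\<lambda>t. det (mat (card {i. i < n \<and> i \<in> I}) (card {j. j < n \<and> j \<in> J})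
      (\<lambda>(i, j). A t $$ (pick I i, pick J j))))"
  proof (cases "card {i. i < n \<and> i \<in> I} = card {j. j < n \<and> j \<in> J}")
    case True
    show ?thesis
    proof (rule continuous_det)
      fix x y assume "x < card {i. i < n \<and> i \<in> I}" "y < card {i. i < n \<and> i \<in> I}"
      then have "pick I x < n" "pick J y < n" using True by (auto intro!: pick_le)
      then show "continuous_on UNIV (\<lambda>t. case (x, y) of (i, j) \<Rightarrow> A t $$ (pick I i, pick J j))"
        using D(2) by simp
    qed
  qed (simp add: det_def)
  ultimately show ?thesis by simp
qed

lemma continuous_trailing_minor:
  "continuous_mat n A \<Longrightarrow> continuous_on UNIV (\<lambda>t. trailing_minor n i j (A t))"
  unfolding trailing_minor_def by (cases "i \<ge> j") (simp_all add: continuous_submatrix)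

lemma continuous_mat_src:
  assumes "continuous_mat n A"
  shows "continuous_mat n (\<lambda>t. src d (A t))"
proof (cases d)
  case True
  note D = continuous_matD[OF assms]
  have dm: "dim_row (A t) = n" "dim_col (A t) = n" for t using D(1)[of t] by auto
  have "continuous_on UNIV (\<lambda>t. dagger (A t) $$ (a, b))" if ab: "a < n" "b < n" for a b
  proof -
    have "dagger (A t) $$ (a, b) = det (mat (n - 1) (n - 1) (\<lambda>(i, j).
        A t $$ (if i < n - 1 - a then i else Suc i, if j < n - 1 - b then j else Suc j)))" for t
      using ab by (simp add: dagger_def mat_delete_def dm)
    moreover have "continuous_on UNIV (\<lambda>t. det (mat (n - 1) (n - 1) (\<lambda>(i, j).
        A t $$ (if i < n - 1 - a then i else Suc i, if j < n - 1 - b then j else Suc j))))"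
      by (rule continuous_det) (auto intro!: D(2))
    ultimately show ?thesis by simp
  qed
  then show ?thesis using True by (auto simp: continuous_mat_def src_def dagger_def dm)
qed (use assms in \<open>simp add: src_def\<close>)

lemma (in glued_path) continuous_cell:
  assumes "continuous_mat n Z"
  shows "continuous_on UNIV (\<lambda>t. cell n \<Gamma>r \<Gamma>c hs d (Z t) (Z t) a b)"
  unfolding cell_eq
proof (rule continuous_on_sum)
  fix l assume "l \<in> {..<L}"
  then have l: "l < L" by simp
  show "continuous_on UNIV (\<lambda>t. if r.rlo l \<le> a \<and> a \<le> r.rhi l \<and> c.rlo l \<le> b \<and> b \<le> c.rhi l
      then block (Z t) (Z t) l a b else 0)"
  proof (cases "r.rlo l \<le> a \<and> a \<le> r.rhi l \<and> c.rlo l \<le> b \<and> b \<le> c.rhi l")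
    case True
    then have "nat (a - \<rho> l) - 1 < n" "nat (b - \<sigma> l) - 1 < n"
      using r.index_range[OF l, of a] c.index_range[OF l, of b] by auto
    then show ?thesis
      unfolding if_P[OF True] block_def using continuous_matD(2)[OF continuous_mat_src[OF assms]] by simp
  next
    case False
    show ?thesis unfolding if_not_P[OF False] by simp
  qed
qed

lemma (in glued_path) continuous_glued_mat:
  assumes "continuous_mat n Z"
  shows "continuous_mat (glued_dim n \<Gamma>r \<Gamma>c hs d) (\<lambda>t. glued_mat n \<Gamma>r \<Gamma>c hs d (Z t) (Z t))"
  by (simp add: continuous_mat_def glued_mat_def Let_def continuous_cell[OF assms])

text \<open>Dimension, offsets and window depend only on the path, so the varying matrix enters
  through the entries alone.\<close>

lemma continuous_f_ij:
  assumes \<Gamma>: "is_bd_triple n \<Gamma>r" "is_bd_triple n \<Gamma>c" and ap: "aperiodic n \<Gamma>r \<Gamma>c"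
    and ij: "1 \<le> i" "i \<le> n" "1 \<le> j" "j \<le> n" "i \<noteq> j" and Z: "continuous_mat n Z"
  shows "continuous_on UNIV (\<lambda>t. f_ij n \<Gamma>r \<Gamma>c i j (Z t))"
proof -
  interpret glued_path n \<Gamma>r \<Gamma>c "hs_ij n \<Gamma>r \<Gamma>c i j" "start_ij n \<Gamma>r \<Gamma>c i j"
    by (rule ij_path(1)[OF \<Gamma> ap ij])
  show ?thesis
    unfolding f_ij_def f_XY_def L_mat_def Let_def
    using continuous_submatrix[OF continuous_glued_mat[OF Z]] by (simp add: glued_mat_def Let_def)
qed

lemma continuous_eq_at_0:
  fixes f g :: "complex \<Rightarrow> complex"
  assumes f: "continuous_on UNIV f" and g: "continuous_on UNIV g" and F: "finite F"
    and e: "\<And>t. t \<notin> F \<Longrightarrow> t \<noteq> 0 \<Longrightarrow> f t = g t"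
  shows "f 0 = g 0"
proof -
  have "open (- (F - {0}))" using F by (intro open_Compl finite_imp_closed) auto
  then have ev: "eventually (\<lambda>t. f t = g t) (at 0)"
    unfolding eventually_at_topological using e by (intro exI[of _ "- (F - {0})"]) auto
  have "f \<midarrow>0\<rightarrow> f 0" "g \<midarrow>0\<rightarrow> g 0"
    using f g by (auto simp: continuous_on_eq_continuous_at isCont_def)
  moreover have "f \<midarrow>0\<rightarrow> g 0" by (rule Lim_transform_eventually[OF \<open>g \<midarrow>0\<rightarrow> g 0\<close>]) (use ev in \<open>auto elim: eventually_mono\<close>)
  ultimately show ?thesis by (intro tendsto_unique[OF at_neq_bot])
qed

section \<open>The generic case and the perturbation\<close>

lemma upper_mult:
  fixes A B :: "complex mat"
  assumes A: "A \<in> carrier_mat n n" "\<And>a b. a < n \<Longrightarrow> b < a \<Longrightarrow> A $$ (a, b) = 0"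
    and B: "B \<in> carrier_mat n n" "\<And>a b. a < n \<Longrightarrow> b < a \<Longrightarrow> B $$ (a, b) = 0"
    and ab: "a < n" "b < a"
  shows "(A * B) $$ (a, b) = 0"
proof -
  have "A $$ (a, k) * B $$ (k, b) = 0" if "k < n" for k
    using A(2)[OF ab(1), of k] B(2)[OF that, of b] ab by (cases "k < a") auto
  then show ?thesis unfolding mult_entry[OF A(1) B(1) ab(1) less_trans[OF ab(2,1)]] by (intro sum.neutral) auto
qed

lemma prod_minus_N_minus: "set w \<subseteq> {1..<n} \<Longrightarrow> length w = length ts \<Longrightarrow> (prod_minus n w ts)\<^sup>T \<in> N_plus n"
proof (induction w arbitrary: ts)
  case Nil
  then show ?case using N_plus_one[of n] by (simp add: prod_minus_Nil)
next
  case (Cons i w)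
  then obtain t ts' where ts: "ts = t # ts'" "length w = length ts'" by (cases ts) auto
  have "(prod_minus n (i # w) ts)\<^sup>T = (prod_minus n w ts')\<^sup>T * exp_plus n i t"
    unfolding ts prod_minus_Cons transpose_mult_square[OF exp_carrier(2) prod_minus_carrier] exp_minus_transpose ..
  then show ?case using Cons ts by (simp add: N_plus_mult exp_plus_N_plus)
qed

lemma row_factor:
  assumes \<Gamma>: "is_bd_triple n \<Gamma>" and \<phi>: "is_bold_gamma n \<Gamma> \<phi>"
    and Vb: "Vbar_row n (Gam1 \<Gamma>) (prod_minus n w1 t1) Vb"
    and w: "longest_word n {1..<n} (w1 @ w2)" "longest_word n (Gam1 \<Gamma>) w1"
    and t: "length t2 = length w2" "\<forall>t\<in>set t2. t \<noteq> 0"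
    and B: "B \<in> carrier_mat n n" "\<And>a b. a < n \<Longrightarrow> b < a \<Longrightarrow> B $$ (a, b) = 0"
  defines "H \<equiv> row_prod n \<phi> Vb n"
  obtains N M where "N \<in> N_plus n" "antilower n M" "row_glue n \<Gamma> (H * N) H"
    "prod_minus n w1 t1 * prod_minus n w2 t2 * B = N * M"
proof -
  have V: "Vb \<in> N_plus n" using Vb by (auto simp: Vbar_row_def)
  obtain R M where RM: "radical n (Gam1 \<Gamma>) R" "antilower n M"
    "prod_minus n w1 t1 * prod_minus n w2 t2 * B = Vb * R * M"
    using Vbar_row_factor[OF bd_tripleD(1)[OF \<Gamma>] Vb w t refl B] by blast
  have R: "R \<in> N_plus n" by (rule radical_N_plus[OF RM(1)])
  have "row_glue n \<Gamma> (H * (Vb * R)) H"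
    using row_prod_glue[OF \<Gamma> \<phi> V RM(1)]
      mult_assoc_square[OF N_plusD(1)[OF row_prod_fixed(1)[OF \<Gamma> \<phi> V]] N_plusD(1)[OF V] N_plusD(1)[OF R], of n]
    by (simp add: H_def)
  then show thesis using that N_plus_mult[OF V R] RM(2,3) by blast
qed

lemma subordinate_range:
  assumes \<Gamma>: "is_bd_triple n \<Gamma>r" "is_bd_triple n \<Gamma>c" and ap: "aperiodic n \<Gamma>r \<Gamma>c"
    and ij: "1 \<le> i" "i \<le> n" "1 \<le> j" "j \<le> n" "i \<noteq> j"
  shows "k \<in> subordinate_X n \<Gamma>r \<Gamma>c i j \<Longrightarrow> 1 < k \<and> k \<le> n"
    "k \<in> subordinate_Y n \<Gamma>r \<Gamma>c i j \<Longrightarrow> 1 < k \<and> k \<le> n"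
proof -
  interpret glued_path n \<Gamma>r \<Gamma>c "hs_ij n \<Gamma>r \<Gamma>c i j" "start_ij n \<Gamma>r \<Gamma>c i j"
    by (rule ij_path(1)[OF \<Gamma> ap ij])
  have r: "1 < n - u + 1 \<and> n - u + 1 \<le> n" if "subordinate_edge n \<Gamma>r \<Gamma>c i j l" "hs_ij n \<Gamma>r \<Gamma>c i j ! l = (p, u)" for l p u
  proof -
    have "l < L" using that(1) by (simp add: subordinate_edge_def Let_def)
    then show ?thesis using snd_range[of l] that(2) by auto
  qed
  show "k \<in> subordinate_X n \<Gamma>r \<Gamma>c i j \<Longrightarrow> 1 < k \<and> k \<le> n"
    "k \<in> subordinate_Y n \<Gamma>r \<Gamma>c i j \<Longrightarrow> 1 < k \<and> k \<le> n"
    using r unfolding subordinate_X_def subordinate_Y_def by fastforce+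
qed

lemma f_ij_generic:
  assumes \<Gamma>: "is_bd_triple n \<Gamma>r" "is_bd_triple n \<Gamma>c" and ap: "aperiodic n \<Gamma>r \<Gamma>c"
    and ij: "1 \<le> i" "i \<le> n" "1 \<le> j" "j \<le> n" "i \<noteq> j"
    and U: "U \<in> carrier_mat n n" "det U = 1"
    and r: "N \<in> N_plus n" "antilower n M" "row_glue n \<Gamma>r (H * N) H" "U = N * M"
    and c: "N' \<in> N_plus n" "antilower n M'" "row_glue n (inv_triple \<Gamma>c) (H' * N') H'" "U\<^sup>T = N' * M'"
  shows "f_ij n \<Gamma>r \<Gamma>c i j (H * U * H'\<^sup>T) = trailing_minor n i j U *
    (\<Prod>k\<in>subordinate_X n \<Gamma>r \<Gamma>c i j. trailing_minor n k 1 U) *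
    (\<Prod>m\<in>subordinate_Y n \<Gamma>r \<Gamma>c i j. trailing_minor n 1 m U)"
proof -
  have H: "H \<in> carrier_mat n n" "H' \<in> carrier_mat n n"
    using r(3) c(3) N_plusD(1) by (auto simp: row_glue_def)
  have Mc: "M \<in> carrier_mat n n" "M' \<in> carrier_mat n n" using r(2) c(2) by (auto simp: antilower_def)
  have Nc: "N \<in> carrier_mat n n" "N' \<in> carrier_mat n n" using r(1) c(1) N_plusD(1) by auto
  have dM: "det M = 1" using det_mult[OF Nc(1) Mc(1)] U(2) r(4) N_plusD(2)[OF r(1)] by simp
  have dM': "det M'\<^sup>T = 1"
    using det_mult[OF Nc(2) Mc(2)] U det_transpose[OF U(1)] det_transpose[OF Mc(2)] c(4) N_plusD(2)[OF c(1)] by simp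
  have UT: "U = M'\<^sup>T * N'\<^sup>T" using c(4) transpose_mult_square[OF Nc(2) Mc(2)] by (metis transpose_transpose)
  have Z1: "H * U * H'\<^sup>T = H * N * M * H'\<^sup>T"
    using r(4) H Nc Mc by (simp add: mult_assoc_square[of _ n])
  have Z2: "H * U * H'\<^sup>T = H * M'\<^sup>T * (H' * N')\<^sup>T"
    unfolding transpose_mult_square[OF H(2) Nc(2)] using UT H Nc Mc by (simp add: mult_assoc_square[of _ n])
  \<comment> \<open>Minors on or below the diagonal see only \<open>M\<close>, by the factorization
    of \<open>U\<close>; those above it see only \<open>M'\<close>, by the factorization of the
    transpose.\<close>
  have lower: "trailing_minor n k l U = trailing_minor n k l M" if "1 \<le> l" "l \<le> k" "k \<le> n" for k l
    unfolding r(4) by (rule trailing_minor_N_plus_mult[OF r(1) Mc(1) that])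
  have upper: "trailing_minor n k l U = trailing_minor n k l M'\<^sup>T" if "1 \<le> k" "k < l" "l \<le> n" for k l
  proof -
    have "trailing_minor n k l U = trailing_minor n l k U\<^sup>T"
      using trailing_minor_transpose[of "U\<^sup>T" n k l] U(1) that by simp
    also have "\<dots> = trailing_minor n l k M'"
      unfolding c(4) by (rule trailing_minor_N_plus_mult[OF c(1) Mc(2)]) (use that in auto)
    also have "\<dots> = trailing_minor n k l M'\<^sup>T" by (rule trailing_minor_transpose[OF Mc(2) that, symmetric])
    finally show ?thesis .
  qed
  note range = subordinate_range[OF \<Gamma> ap ij]
  have "trailing_minor n i j (if i > j then M else M'\<^sup>T) = trailing_minor n i j U"
    using lower[of j i] upper[of i j] ij by auto
  moreover have "(\<Prod>k\<in>subordinate_X n \<Gamma>r \<Gamma>c i j. trailing_minor n k 1 M) =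
      (\<Prod>k\<in>subordinate_X n \<Gamma>r \<Gamma>c i j. trailing_minor n k 1 U)"
    by (rule prod.cong[OF refl]) (use range(1) lower[of 1] in force)
  moreover have "(\<Prod>m\<in>subordinate_Y n \<Gamma>r \<Gamma>c i j. trailing_minor n 1 m M'\<^sup>T) =
      (\<Prod>m\<in>subordinate_Y n \<Gamma>r \<Gamma>c i j. trailing_minor n 1 m U)"
    by (rule prod.cong[OF refl]) (use range(2) upper[of 1] in force)
  ultimately show ?thesis
    using f_ij_factor[OF \<Gamma> ap ij r(3) c(3) r(2) dM antilower_transpose[OF c(2)] dM' Z1 Z2] by simp
qed

lemma f_ij_row_prod:
  assumes \<Gamma>: "is_bd_triple n \<Gamma>r" "is_bd_triple n \<Gamma>c" and ap: "aperiodic n \<Gamma>r \<Gamma>c"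
    and ij: "1 \<le> i" "i \<le> n" "1 \<le> j" "j \<le> n" "i \<noteq> j"
    and \<phi>: "is_bold_gamma n \<Gamma>r \<phi>" and \<phi>': "is_bold_gamma n (inv_triple \<Gamma>c) \<phi>'"
    and V: "V_row n (Gam1 \<Gamma>r) S V" "Vbar_row n (Gam1 \<Gamma>r) V Vb"
    and V': "V_row n (Gam2 \<Gamma>c) S' V'" "Vbar_row n (Gam2 \<Gamma>c) V' Vb'"
    and U: "U \<in> carrier_mat n n" "det U = 1"
    and B: "B \<in> carrier_mat n n" "\<And>a b. a < n \<Longrightarrow> b < a \<Longrightarrow> B $$ (a, b) = 0" "U = S * B"
    and B': "B' \<in> carrier_mat n n" "\<And>a b. a < n \<Longrightarrow> b < a \<Longrightarrow> B' $$ (a, b) = 0" "U\<^sup>T = S' * B'"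
  defines "H \<equiv> row_prod n \<phi> Vb n" and "H' \<equiv> row_prod n \<phi>' Vb' n"
  shows "f_ij n \<Gamma>r \<Gamma>c i j (H * U * H'\<^sup>T) = trailing_minor n i j U *
    (\<Prod>k\<in>subordinate_X n \<Gamma>r \<Gamma>c i j. trailing_minor n k 1 U) *
    (\<Prod>m\<in>subordinate_Y n \<Gamma>r \<Gamma>c i j. trailing_minor n 1 m U)"
proof -
  note \<Gamma>i = inv_triple_bd[OF \<Gamma>(2)]
  obtain w1 w2 t1 t2 where w: "longest_word n {1..<n} (w1 @ w2)" "longest_word n (Gam1 \<Gamma>r) w1"
    "length t1 = length w1" "length t2 = length w2" "S = prod_minus n (w1 @ w2) (t1 @ t2)" "V = prod_minus n w1 t1"
    using V(1) unfolding V_row_def by blast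
  obtain w1' w2' t1' t2' where w': "longest_word n {1..<n} (w1' @ w2')" "longest_word n (Gam2 \<Gamma>c) w1'"
    "length t1' = length w1'" "length t2' = length w2'" "S' = prod_minus n (w1' @ w2') (t1' @ t2')" "V' = prod_minus n w1' t1'"
    using V'(1) unfolding V_row_def by blast
  \<comment> \<open>Only the parameters after the initial subword are shifted. \<open>V\<close> and
    \<open>V'\<close>, and with them \<open>H\<close> and \<open>H'\<close>, stay the same along the
    whole family.\<close>
  define T where "T s = V * prod_minus n w2 (map (\<lambda>t. t + s) t2)" for s
  define T' where "T' s = V' * prod_minus n w2' (map (\<lambda>t. t + s) t2')" for s
  have T: "T s = prod_minus n (w1 @ w2) (t1 @ map (\<lambda>t. t + s) t2)" for s
    unfolding T_def w(6) using w(3) by (simp add: prod_minus_append)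
  have T': "T' s = prod_minus n (w1' @ w2') (t1' @ map (\<lambda>t. t + s) t2')" for s
    unfolding T'_def w'(6) using w'(3) by (simp add: prod_minus_append)
  have set: "set (w1 @ w2) \<subseteq> {1..<n}" "set (w1' @ w2') \<subseteq> {1..<n}"
    using w(1) w'(1) unfolding longest_word_def by blast+
  have TN: "(T s)\<^sup>T \<in> N_plus n" for s unfolding T by (rule prod_minus_N_minus[OF set(1)]) (simp add: w(3,4))
  have TN': "(T' s)\<^sup>T \<in> N_plus n" for s unfolding T' by (rule prod_minus_N_minus[OF set(2)]) (simp add: w'(3,4))
  have Tc: "T s \<in> carrier_mat n n" "T' s \<in> carrier_mat n n" for s by (simp_all only: T T' prod_minus_carrier)
  have T0: "T 0 = S" "T' 0 = S'" by (simp_all add: T T' w(5) w'(5))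
  obtain Q where Q: "Q \<in> N_plus n" "S\<^sup>T * Q = 1\<^sub>m n" "Q * S\<^sup>T = 1\<^sub>m n"
    using N_plus_obtain_inverse[OF TN[of 0, unfolded T0]] .
  obtain Q' where Q': "Q' \<in> N_plus n" "S'\<^sup>T * Q' = 1\<^sub>m n" "Q' * S'\<^sup>T = 1\<^sub>m n"
    using N_plus_obtain_inverse[OF TN'[of 0, unfolded T0]] .
  note Sc = Tc(1)[of 0, unfolded T0] Tc(2)[of 0, unfolded T0]
  note Qc = N_plusD(1)[OF Q(1)] N_plusD(1)[OF Q'(1)]
  have "Q\<^sup>T * S = (S\<^sup>T * Q)\<^sup>T" "S * Q\<^sup>T = (Q * S\<^sup>T)\<^sup>T" "Q'\<^sup>T * S' = (S'\<^sup>T * Q')\<^sup>T"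
    using Sc Qc by (simp_all add: transpose_mult_square[of _ n])
  then have iS: "Q\<^sup>T * S = 1\<^sub>m n" "S * Q\<^sup>T = 1\<^sub>m n" and iS': "Q'\<^sup>T * S' = 1\<^sub>m n"
    unfolding Q(2,3) Q'(2) by simp_all
  \<comment> \<open>The middle factor of \<open>U\<close> between \<open>S\<close> and the transpose
    of \<open>S'\<close>. It is upper triangular because of \<open>U = S * B\<close>, and its
    transpose is because of the factorization of \<open>U\<^sup>T\<close>, so a perturbation of both
    outer factors keeps both triangular forms.\<close>
  define C where "C = Q\<^sup>T * U * Q'"
  have Cc: "C \<in> carrier_mat n n" using U(1) Qc by (simp add: C_def)
  have dC: "det C = 1"
    using U Qc det_transpose[OF Qc(1)] N_plusD(2)[OF Q(1)] N_plusD(2)[OF Q'(1)]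
    by (simp add: C_def det_mult[of _ n])
  have "C = (Q\<^sup>T * S) * B * Q'"
    unfolding C_def B(3) using Sc Qc B(1) by (simp add: mult_assoc_square[of _ n])
  then have C: "C = B * Q'" unfolding iS using B(1) by simp
  have "C\<^sup>T = Q'\<^sup>T * (U\<^sup>T * Q)"
    unfolding C_def using U(1) Qc by (simp add: transpose_mult_square[of _ n])
  also have "\<dots> = (Q'\<^sup>T * S') * B' * Q"
    unfolding B'(3) using Sc Qc B'(1) by (simp add: mult_assoc_square[of _ n])
  finally have CT: "C\<^sup>T = B' * Q" unfolding iS' using B'(1) by simp
  have Cu: "C $$ (a, b) = 0" if "a < n" "b < a" for a b
    unfolding C by (rule upper_mult[OF B(1,2) Qc(2) N_plusD(3)[OF Q'(1)] that])
  have CTu: "C\<^sup>T $$ (a, b) = 0" if "a < n" "b < a" for a b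
    unfolding CT by (rule upper_mult[OF B'(1,2) Qc(1) N_plusD(3)[OF Q(1)] that])
  define W where "W s = T s * (C * (T' s)\<^sup>T)" for s
  have Wc: "W s \<in> carrier_mat n n" for s using Tc Cc by (simp add: W_def)
  have dW: "det (W s) = 1" for s
    using Tc[of s] Cc dC N_plusD(2)[OF TN[of s]] N_plusD(2)[OF TN'[of s]] det_transpose[OF Tc(1)[of s]]
    by (simp add: W_def det_mult[of _ n])
  have WT: "(W s)\<^sup>T = T' s * (C\<^sup>T * (T s)\<^sup>T)" for s
    using Tc Cc by (simp add: W_def transpose_mult_square[of _ n] mult_assoc_square[of _ n])
  have W0: "W 0 = U"
  proof -
    have "W 0 = (S * Q\<^sup>T) * U * (Q' * S'\<^sup>T)"
      unfolding W_def T0 C_def using Sc Qc U(1) by (simp add: mult_assoc_square[of _ n])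
    then show ?thesis unfolding iS Q' using U(1) by simp
  qed
  have "Vb \<in> N_plus n" "Vb' \<in> N_plus n" using V(2) V'(2) by (auto simp: Vbar_row_def)
  then have Hc: "H \<in> carrier_mat n n" "H' \<in> carrier_mat n n"
    using N_plusD(1)[OF row_prod_fixed(1)[OF \<Gamma>(1) \<phi>]] N_plusD(1)[OF row_prod_fixed(1)[OF \<Gamma>i \<phi>']]
    by (auto simp: H_def H'_def)
  have Wcont: "continuous_mat n W"
  proof -
    have Vc: "V \<in> carrier_mat n n" "V' \<in> carrier_mat n n" by (simp_all add: w(6) w'(6))
    show ?thesis
      unfolding W_def[abs_def] T_def T'_def
      by (intro continuous_mat_mult continuous_mat_transpose continuous_mat_const continuous_mat_prod_minus Vc Cc)
        (simp_all add: w(4) w'(4))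
  qed
  \<comment> \<open>The finitely many shifts at which some parameter vanishes; 0 may be among
    them.\<close>
  define F where "F = uminus ` (set t2 \<union> set t2')"
  define f where "f s = f_ij n \<Gamma>r \<Gamma>c i j (H * W s * H'\<^sup>T)" for s
  define g where "g s = trailing_minor n i j (W s) *
    (\<Prod>k\<in>subordinate_X n \<Gamma>r \<Gamma>c i j. trailing_minor n k 1 (W s)) *
    (\<Prod>m\<in>subordinate_Y n \<Gamma>r \<Gamma>c i j. trailing_minor n 1 m (W s))" for s
  have "f 0 = g 0"
  proof (rule continuous_eq_at_0[where F = F])
    show "continuous_on UNIV f"
      unfolding f_def
      by (intro continuous_f_ij[OF \<Gamma> ap ij] continuous_mat_mult Wcont continuous_mat_const) (use Hc in simp_all)
    show "continuous_on UNIV g"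
      unfolding g_def by (intro continuous_intros continuous_trailing_minor Wcont)
    show "finite F" by (simp add: F_def)
    fix s assume s: "s \<notin> F"
    have nz: "\<forall>t\<in>set (map (\<lambda>t. t + s) t2). t \<noteq> 0" "\<forall>t\<in>set (map (\<lambda>t. t + s) t2'). t \<noteq> 0"
      using s by (auto simp: F_def add_eq_0_iff)
    have b: "C * (T' s)\<^sup>T \<in> carrier_mat n n" "C\<^sup>T * (T s)\<^sup>T \<in> carrier_mat n n" using Cc Tc by simp_all
    have len: "length (map (\<lambda>t. t + s) t2) = length w2" "length (map (\<lambda>t. t + s) t2') = length w2'"
      by (simp_all add: w(4) w'(4))
    have u: "(C * (T' s)\<^sup>T) $$ (a, b) = 0" if "a < n" "b < a" for a b
      by (rule upper_mult[OF Cc Cu N_plusD(1)[OF TN'] N_plusD(3)[OF TN'] that])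
    have CTc: "C\<^sup>T \<in> carrier_mat n n" using Cc by simp
    have u': "(C\<^sup>T * (T s)\<^sup>T) $$ (a, b) = 0" if "a < n" "b < a" for a b
      by (rule upper_mult[OF CTc CTu N_plusD(1)[OF TN] N_plusD(3)[OF TN] that])
    obtain N M where NM: "N \<in> N_plus n" "antilower n M" "row_glue n \<Gamma>r (H * N) H" "W s = N * M"
      by (rule row_factor[OF \<Gamma>(1) \<phi> V(2)[unfolded w(6)] w(1,2) len(1) nz(1) b(1) u,
        folded w(6), folded T_def, folded W_def H_def])
    have V'i: "Vbar_row n (Gam1 (inv_triple \<Gamma>c)) (prod_minus n w1' t1') Vb'"
      "longest_word n (Gam1 (inv_triple \<Gamma>c)) w1'"
      using V'(2) w'(2) by (simp_all add: w'(6))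
    obtain N' M' where NM': "N' \<in> N_plus n" "antilower n M'"
      "row_glue n (inv_triple \<Gamma>c) (H' * N') H'" "(W s)\<^sup>T = N' * M'"
      by (rule row_factor[OF \<Gamma>i \<phi>' V'i(1) w'(1) V'i(2) len(2) nz(2) b(2) u',
        folded w'(6), folded T'_def, folded WT H'_def])
    show "f s = g s"
      unfolding f_def g_def by (rule f_ij_generic[OF \<Gamma> ap ij Wc dW NM NM'])
  qed
  then show ?thesis unfolding f_def g_def W0 .
qed

theorem theorem4p4:
  fixes n i j :: nat and \<Gamma>r \<Gamma>c :: bd_triple and U Z :: "complex mat"
  assumes "is_bd_triple n \<Gamma>r" and "is_bd_triple n \<Gamma>c"
    and "aperiodic n \<Gamma>r \<Gamma>c"
    and "i \<in> {1..n}" and "j \<in> {1..n}" and "i \<noteq> j"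
    and "U \<in> carrier (SL n)"
    and "h_value n \<Gamma>r \<Gamma>c U Z"
  shows "f_ij n \<Gamma>r \<Gamma>c i j Z =
           trailing_minor n i j U *
           (\<Prod>k\<in>subordinate_X n \<Gamma>r \<Gamma>c i j. trailing_minor n k 1 U) *
           (\<Prod>m\<in>subordinate_Y n \<Gamma>r \<Gamma>c i j. trailing_minor n 1 m U)"
proof -
  obtain Hr Hc where Z: "Z = Hr * U * Hc" and "H_row_value n \<Gamma>r U Hr" "H_col_value n \<Gamma>c U Hc"
    using assms(8) unfolding h_value_def by blast
  then obtain \<phi> Um U0 Up V Vb \<psi> Um' U0' Up' V' Vb' where
    r: "is_bold_gamma n \<Gamma>r \<phi>" "gauss n U Um U0 Up" "V_row n (Gam1 \<Gamma>r) Um V"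
      "Vbar_row n (Gam1 \<Gamma>r) V Vb" "Hr = row_prod n \<phi> Vb n" and
    c: "is_bold_gamma_star n \<Gamma>c \<psi>" "gauss n U Um' U0' Up'" "V_col n (Gam2 \<Gamma>c) Up' V'"
      "Vbar_col n (Gam2 \<Gamma>c) V' Vb'" "Hc = col_prod n \<psi> Vb' n"
    unfolding H_row_value_def H_col_value_def by blast
  have U: "U \<in> carrier_mat n n" "det U = 1" using assms(7) by (auto simp: SL_carrier_iff)
  have J: "Gam2 \<Gamma>c \<subseteq> {1..<n}" by (rule bd_tripleD(2)[OF assms(2)])
  have gr: "U0 \<in> carrier_mat n n" "diagonal_mat U0" "Up \<in> N_plus n" "Um\<^sup>T \<in> N_plus n" "U = Um * U0 * Up"
    using r(2) by (auto simp: gauss_def SL_carrier_iff N_minus_transpose)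
  have gc: "U0' \<in> carrier_mat n n" "diagonal_mat U0'" "Up' \<in> N_plus n" "Um'\<^sup>T \<in> N_plus n" "U = Um' * U0' * Up'"
    using c(2) by (auto simp: gauss_def SL_carrier_iff N_minus_transpose)
  have cr: "Um \<in> carrier_mat n n" "Up \<in> carrier_mat n n" "Um' \<in> carrier_mat n n" "Up' \<in> carrier_mat n n"
    using N_plusD(1)[OF gr(4)] N_plusD(1)[OF gr(3)] N_plusD(1)[OF gc(4)] N_plusD(1)[OF gc(3)] by simp_all
  \<comment> \<open>The row and the column construction bring their own Gauss decompositions. One
    presents \<open>U\<close>, the other its transpose, as a lower unipotent matrix times an upper
    triangular one.\<close>
  have B: "U0 * Up \<in> carrier_mat n n" "U = Um * (U0 * Up)"
    using cr gr by (simp_all add: mult_assoc_square[of _ n])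
  have Bu: "(U0 * Up) $$ (a, b) = 0" if "a < n" "b < a" for a b
    by (rule upper_mult[OF gr(1) _ cr(2) N_plusD(3)[OF gr(3)] that]) (use gr(1,2) in \<open>auto simp: diagonal_mat_def\<close>)
  have B': "U0'\<^sup>T * Um'\<^sup>T \<in> carrier_mat n n" "U\<^sup>T = Up'\<^sup>T * (U0'\<^sup>T * Um'\<^sup>T)"
    using cr gc by (simp_all add: transpose_mult_square[of _ n])
  have Bu': "(U0'\<^sup>T * Um'\<^sup>T) $$ (a, b) = 0" if "a < n" "b < a" for a b
    by (rule upper_mult[OF _ _ _ N_plusD(3)[OF gc(4)] that]) (use gc(1,2) cr(3) in \<open>auto simp: diagonal_mat_def\<close>)
  have V'c: "V' \<in> carrier_mat n n"
  proof -
    obtain w t where "length t = length w" "V' = prod_plus n w t" using c(3) unfolding V_col_def by blast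
    then show ?thesis using prod_plus_transpose[of w t n] prod_minus_carrier[of n "rev w" "rev t"]
      by (metis transpose_carrier_mat)
  qed
  have Vb': "Vb' \<in> N_minus n" using c(4) by (auto simp: Vbar_col_def)
  have N: "\<psi> A \<in> N_minus n" if "A \<in> N_minus n" for A
    using c(1) that by (auto simp: is_bold_gamma_star_def hom_def)
  have K: "Hc = (row_prod n (\<lambda>A. (\<psi> A\<^sup>T)\<^sup>T) Vb'\<^sup>T n)\<^sup>T"
    unfolding c(5) using col_prod_transpose[where \<phi> = \<psi>, OF N Vb', of n] by (metis transpose_transpose)
  have ij: "1 \<le> i" "i \<le> n" "1 \<le> j" "j \<le> n" using assms(4,5) by auto
  show ?thesis
    unfolding Z K r(5)
    by (rule f_ij_row_prod[OF assms(1-3) ij assms(6) r(1) bold_gamma_star_transpose[OF assms(2) c(1)] r(3,4)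
      V_col_transpose[OF c(3)] Vbar_col_transpose[OF J V'c c(4)] U B(1) Bu B(2) B'(1) Bu' B'(2)])
qed

end
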